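(* Let $1\le p,q,r<\infty$, $\beta,\beta_0\in\mathbb{R}$, and let $p',q',r'$ be the conjugate exponents. Under the pairing $(f,h)_{\beta_0}=\iint_{\mathbb{R}^{n+1}_+}f(y,t)h(y,t)t^{-\beta_0-1}\,dy\,dt$, the dual of $T^{p,r}_{q,\beta}$ is $T^{p',r'}_{q',\beta_0-\beta}$: for every $h\in T^{p',r'}_{q',\beta_0-\beta}$, $f\mapsto(f,h)_{\beta_0}$ is a bounded linear functional on $T^{p,r}_{q,\beta}$, every bounded linear functional on $T^{p,r}_{q,\beta}$ is of this form for a unique such $h$, and the functional norm is equivalent to $\|h\|_{T^{p',r'}_{q',\beta_0-\beta}}$.
   Context: Let $\mathbb{R}^{n+1}_+=\mathbb{R}^n\times(0,\infty)$; functions are complex-valued measurable, identified a.e. $B(y,t)=\{z:|z-y|<t\}$, $\Gamma(x)=\{(y,t):|y-x|<t\}$, $\widehat{B}=\{(y,t):B(y,t)\subset B\}$ for an open ball $B\subset\mathbb{R}^n$. Fix Whitney parameters $0<\alpha_1<\alpha_2^{-1}<1$, $W(y,t)=\{(z,s):|z-y|<\alpha_1t,\ \alpha_2^{-1}t<s<\alpha_2t\}$, $\mathcal{W}_r(f)(y,t)=|W(y,t)|^{-1/r}\|f\|_{L^r(W(y,t))}$ ($r<\infty$), $\mathcal{W}_\infty(f)(y,t)=\operatorname{ess\,sup}_{W(y,t)}|f|$. Tent spaces $T^p_q$: (A) $p,q<\infty$: $\|g\|=\|(\iint_{\Gamma(x)}|g|^q\,dy\,dt/t^{n+1})^{1/q}\|_{L^p(dx)}$;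 (B) $q<p=\infty$: $\|g\|=\sup_x\sup_{B\ni x}|B|^{-1/q}(\iint_{\widehat B}|g|^q\,dy\,dt/t)^{1/q}$; (C) $p<q=\infty$: $\|g\|=\|\sup_{(y,t)\in\Gamma(x)}|g(y,t)|\|_{L^p(dx)}$; (D) $T^\infty_\infty=L^\infty$. $T^{p,r}_{q,\beta}$ is the space of $f$ with $\|f\|_{T^{p,r}_{q,\beta}}=\|\mathcal{W}_r(f(z,s)s^{-\beta})\|_{T^p_q}<\infty$. *)

theory Defs
  imports "HOL-Analysis.Analysis"
begin

text \<open>Points of the upper half space are pairs (y,t) :: 'a \<times> real, 'a a Euclidean
  space of dimension n = DIM('a). Measure: Lebesgue measure on 'a \<times> real.\<close>

definition upper_half :: "('a::euclidean_space \<times> real) set" where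
  "upper_half = {z. snd z > 0}"

text \<open>Power of a nonnegative extended real, with \<infinity>^a = \<infinity> (used with a > 0).\<close>
definition epow :: "ennreal \<Rightarrow> real \<Rightarrow> ennreal" where
  "epow x a = (if x = top then top else ennreal (enn2real x powr a))"

definition cone :: "'a::euclidean_space \<Rightarrow> ('a \<times> real) set" where
  "cone x = {(y, t). t > 0 \<and> dist y x < t}"

definition tent :: "'a::euclidean_space set \<Rightarrow> ('a \<times> real) set" where
  "tent B = {(y, t). t > 0 \<and> ball y t \<subseteq> B}"

definition whitney :: "real \<Rightarrow> real \<Rightarrow> 'a::euclidean_space \<times> real \<Rightarrow> ('a \<times> real) set" where
  "whitney \<alpha>1 \<alpha>2 yt = {(z, s). dist z (fst yt) < \<alpha>1 * snd yt \<and>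
       snd yt / \<alpha>2 < s \<and> s < \<alpha>2 * snd yt}"

definition esssup_on :: "('a::euclidean_space) set \<Rightarrow> ('a \<Rightarrow> ennreal) \<Rightarrow> ennreal" where
  "esssup_on A g = Inf {C. AE z in lebesgue. z \<in> A \<longrightarrow> g z \<le> C}"

definition whitney_avg ::
  "real \<Rightarrow> real \<Rightarrow> ereal \<Rightarrow> ('a::euclidean_space \<times> real \<Rightarrow> complex) \<Rightarrow> 'a \<times> real \<Rightarrow> ennreal" where
  "whitney_avg \<alpha>1 \<alpha>2 r f yt =
     (if r = \<infinity> then esssup_on (whitney \<alpha>1 \<alpha>2 yt) (\<lambda>z. ennreal (cmod (f z)))
      else epow ((\<integral>\<^sup>+ z\<in>whitney \<alpha>1 \<alpha>2 yt. ennreal (cmod (f z) powr real_of_ereal r) \<partial>lebesgue)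
                   / emeasure lebesgue (whitney \<alpha>1 \<alpha>2 yt)) (1 / real_of_ereal r))"

definition tent_norm :: "ereal \<Rightarrow> ereal \<Rightarrow> ('a::euclidean_space \<times> real \<Rightarrow> ennreal) \<Rightarrow> ennreal" where
  "tent_norm p q g =
    (if p \<noteq> \<infinity> \<and> q \<noteq> \<infinity> then
       epow (\<integral>\<^sup>+ x. epow (\<integral>\<^sup>+ z\<in>cone x. epow (g z) (real_of_ereal q)
                * ennreal (1 / snd z ^ (DIM('a) + 1)) \<partial>lebesgue)
              (real_of_ereal p / real_of_ereal q) \<partial>lebesgue) (1 / real_of_ereal p)
     else if p = \<infinity> \<and> q \<noteq> \<infinity> then
       (SUP x. SUP B \<in> {ball c R | c R. R > 0 \<and> x \<in> ball c R}.
          epow ((\<integral>\<^sup>+ z\<in>tent B. epow (g z) (real_of_ereal q) * ennreal (1 / snd z) \<partial>lebesgue)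
                / emeasure lebesgue B) (1 / real_of_ereal q))
     else if p \<noteq> \<infinity> \<and> q = \<infinity> then
       epow (\<integral>\<^sup>+ x. epow (SUP z\<in>cone x. g z) (real_of_ereal p) \<partial>lebesgue) (1 / real_of_ereal p)
     else esssup_on upper_half g)"

definition wtent_norm ::
  "real \<Rightarrow> real \<Rightarrow> ereal \<Rightarrow> ereal \<Rightarrow> ereal \<Rightarrow> real \<Rightarrow> ('a::euclidean_space \<times> real \<Rightarrow> complex) \<Rightarrow> ennreal" where
  "wtent_norm \<alpha>1 \<alpha>2 p q r \<beta> f =
     tent_norm p q (whitney_avg \<alpha>1 \<alpha>2 r (\<lambda>z. f z * complex_of_real (snd z powr (- \<beta>))))"

definition wtent_space ::
  "real \<Rightarrow> real \<Rightarrow> ereal \<Rightarrow> ereal \<Rightarrow> ereal \<Rightarrow> real \<Rightarrow> ('a::euclidean_space \<times> real \<Rightarrow> complex) set" where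
  "wtent_space \<alpha>1 \<alpha>2 p q r \<beta> =
     {f. f \<in> borel_measurable lebesgue \<and> wtent_norm \<alpha>1 \<alpha>2 p q r \<beta> f < top}"

definition conj_exp :: "real \<Rightarrow> ereal" where
  "conj_exp p = (if p = 1 then \<infinity> else ereal (p / (p - 1)))"

definition pairing :: "real \<Rightarrow> ('a::euclidean_space \<times> real \<Rightarrow> complex) \<Rightarrow> ('a \<times> real \<Rightarrow> complex) \<Rightarrow> complex" where
  "pairing \<beta>0 f h = (LINT z:upper_half|lebesgue. f z * h z * complex_of_real (snd z powr (- \<beta>0 - 1)))"

definition pairing_integrable :: "real \<Rightarrow> ('a::euclidean_space \<times> real \<Rightarrow> complex) \<Rightarrow> ('a \<times> real \<Rightarrow> complex) \<Rightarrow> bool" where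
  "pairing_integrable \<beta>0 f h = set_integrable lebesgue upper_half
      (\<lambda>z. f z * h z * complex_of_real (snd z powr (- \<beta>0 - 1)))"

end

(*
  After absorbing the weights, the pairing is the integral of F G ds dz / s over the upper half space,
  and Hoelder's inequality on Whitney boxes reduces the upper bound to the duality inequality for tent
  spaces; for p = 1 this is the stopping-time argument of Coifman, Meyer and Stein.

  For the lower bound, G is replaced by the sequence of its L^r'-averages over a fixed partition into
  Whitney cells. By the one-third trick each cell sits deep inside a cube of one of 2^n nested grids.
  On a nested family of cubes an almost extremal dual sequence is explicit: its coefficients are the
  increments, divided by the data, of a power of the partial sums taken from the coarse cubes down to
  the fine ones. These partial sums are constant on cubes, so no maximal function is needed.

  A bounded functional L is represented by applying the Radon-Nikodym theorem to E |-> L(w 1_E), for a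
  strictly positive w in the space. The norm is order continuous, which extends the representation
  from bounded multiples of w to the whole space; the lower bound then shows that the density lies in
  the dual space.
*)

theory Submission
  imports Defs
begin

section \<open>Powers of extended nonnegative reals and Hoelder's inequality\<close>

text \<open>The lower bound tests G with functions built from G itself. This yields V \<le> D
  V^(1/p) X, where V is a power of the norm in question and X the supremum of the normalized
  pairings, and V^(1/p) has to be divided out. But the norm of G is not known to be finite: the
  density delivered by Radon-Nikodym is merely measurable. Hence every test uses finitely many
  cells, with coefficients that are finite and strictly below the local averages of G, and monotone
  convergence removes the cutoffs at the end. Strictness is forced because an essential supremum or
  an infinite average has no extremal local test function; the price is a factor 2.

  A function on one cell is felt in the cones of all vertices in an enlarged ball around the cell.
  It is this ball, not the cell, that must fit into a grid cube: comparing balls with cells would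
  otherwise call for a maximal function.

  For p = 1 the dual exponent is infinite and the nested construction does not apply. One cell at a
  time settles q = 1, and Hoelder's inequality on one ball at a time settles q > 1.\<close>

lemma epow_ennreal: "0 \<le> x \<Longrightarrow> epow (ennreal x) a = ennreal (x powr a)"
  by (simp add: epow_def)

lemma epow_top [simp]: "epow top a = top"
  by (simp add: epow_def)

lemma epow_0 [simp]: "epow 0 a = 0"
  by (simp add: epow_def)

lemma epow_1 [simp]: "epow 1 a = 1"
  using epow_ennreal[of 1 a] by simp

lemma epow_one [simp]: "epow x 1 = x"
  by (cases x) (auto simp: epow_ennreal)

text \<open>Holds for exponents of any sign because \<open>0 powr a\<close> is 0 for every
  \<open>a\<close>, even a = 0, and \<open>epow\<close> fixes \<open>top\<close>: both extreme
  values survive every exponent.\<close>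

lemma epow_epow: "epow (epow x a) b = epow x (a * b)"
  by (cases x) (auto simp: epow_ennreal powr_powr)

lemma epow_inv [simp]: "a > 0 \<Longrightarrow> epow (epow x a) (1 / a) = x" "a > 0 \<Longrightarrow> epow (epow x (1 / a)) a = x"
  by (simp_all add: epow_epow)

lemma epow_mono: "0 \<le> a \<Longrightarrow> x \<le> y \<Longrightarrow> epow x a \<le> epow y a"
  by (cases x; cases y) (auto simp: epow_ennreal powr_mono2 ennreal_leI top_unique)

lemma epow_le_iff: "0 < a \<Longrightarrow> epow x a \<le> y \<longleftrightarrow> x \<le> epow y (1 / a)"
  using epow_mono[of "1/a" "epow x a" y] epow_mono[of a x "epow y (1/a)"] by auto

lemma le_epow_iff: "0 < a \<Longrightarrow> y \<le> epow x a \<longleftrightarrow> epow y (1 / a) \<le> x"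
  using epow_mono[of "1/a" y "epow x a"] epow_mono[of a "epow y (1/a)" x] by auto

lemma epow_less_top_iff [simp]: "epow x a < top \<longleftrightarrow> x < top"
  by (cases x) (auto simp: epow_ennreal)

lemma epow_eq_top_iff [simp]: "epow x a = top \<longleftrightarrow> x = top"
  by (cases x) (auto simp: epow_ennreal)

lemma epow_eq_0_iff [simp]: "epow x a = 0 \<longleftrightarrow> x = 0"
  by (cases x) (auto simp: epow_ennreal ennreal_eq_0_iff)

lemma epow_mult: "epow (x * y) a = epow x a * epow y a"
proof (cases "x = top \<or> y = top")
  case True
  then show ?thesis
    by (auto simp: ennreal_top_mult ennreal_mult_top)
next
  case False
  then obtain u v where "x = ennreal u" "y = ennreal v" "u \<ge> 0" "v \<ge> 0"
    by (metis ennreal_cases)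
  then show ?thesis
    by (simp add: epow_ennreal powr_mult flip: ennreal_mult)
qed

lemma epow_divide: "0 \<le> a \<Longrightarrow> 0 < v \<Longrightarrow> epow (x / ennreal v) a = epow x a / ennreal (v powr a)"
proof -
  assume "0 \<le> a" "0 < v"
  have "x / ennreal v = x * ennreal (1 / v)"
    using \<open>0 < v\<close> by (simp add: divide_ennreal_def inverse_ennreal inverse_eq_divide)
  moreover have "epow x a / ennreal (v powr a) = epow x a * ennreal (1 / (v powr a))"
    using \<open>0 < v\<close> by (simp add: divide_ennreal_def inverse_ennreal inverse_eq_divide)
  ultimately show ?thesis
    using \<open>0 < v\<close> by (simp add: epow_mult epow_ennreal powr_divide)
qed

lemma epow_SUP:
  assumes "a > 0" "I \<noteq> {}"
  shows "epow (SUP i\<in>I. f i) a = (SUP i\<in>I. epow (f i) a)"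
proof (rule antisym)
  show "epow (SUP i\<in>I. f i) a \<le> (SUP i\<in>I. epow (f i) a)"
    using assms by (simp add: epow_le_iff SUP_le_iff) (metis SUP_upper epow_le_iff)
  show "(SUP i\<in>I. epow (f i) a) \<le> epow (SUP i\<in>I. f i) a"
    using assms by (intro SUP_least epow_mono SUP_upper) auto
qed

text \<open>Comparison with the maximum: the sum is at most \<open>card I\<close> times its largest
  term. The constant is crude, but the bound covers exponents on both sides of 1; it is applied with
  p' and with 1/q'.\<close>

lemma epow_sum_le:
  assumes "finite I" "0 < a"
  shows "epow (\<Sum>i\<in>I. f i) a \<le> ennreal (real (card I) powr a) * (\<Sum>i\<in>I. epow (f i) a)"
proof (cases "I = {}")
  case False
  define M where "M = (MAX i\<in>I. f i)"
  have M: "M \<in> f ` I" unfolding M_def using assms False by (intro Max_in) auto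
  then obtain j where j: "j \<in> I" "M = f j" by auto
  have "(\<Sum>i\<in>I. f i) \<le> of_nat (card I) * M"
    using assms by (intro sum_bounded_above) (auto simp: M_def)
  then have "epow (\<Sum>i\<in>I. f i) a \<le> epow (of_nat (card I) * M) a"
    using assms by (intro epow_mono) auto
  also have "\<dots> = ennreal (real (card I) powr a) * epow (f j) a"
    by (simp add: epow_mult j epow_ennreal flip: ennreal_of_nat_eq_real_of_nat)
       (simp add: epow_ennreal ennreal_of_nat_eq_real_of_nat)
  also have "\<dots> \<le> ennreal (real (card I) powr a) * (\<Sum>i\<in>I. epow (f i) a)"
    using assms j by (intro mult_left_mono member_le_sum) auto
  finally show ?thesis .
qed simp

lemma borel_measurable_epow [measurable (raw)]:
  assumes [measurable]: "f \<in> borel_measurable M"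
  shows "(\<lambda>x. epow (f x) a) \<in> borel_measurable M"
  unfolding epow_def by measurable

lemma tendsto_epow_0:
  assumes "(f \<longlongrightarrow> 0) F" "a > 0"
  shows "((\<lambda>x. epow (f x) a) \<longlongrightarrow> 0) F"
  unfolding order_tendsto_iff
proof (intro conjI allI impI)
  fix u :: ennreal assume "0 < u"
  then have "0 < epow u (1/a)" using epow_eq_0_iff[of u] by (simp add: zero_less_iff_neq_zero)
  then have "eventually (\<lambda>x. f x < epow u (1/a)) F"
    using assms(1) order_tendstoD(2) by blast
  then show "eventually (\<lambda>x. epow (f x) a < u) F"
    by (rule eventually_mono) (use assms(2) in \<open>simp add: le_epow_iff[symmetric] not_le[symmetric]\<close>)
qed simp

lemma nn_Holder:
  assumes [measurable]: "f \<in> borel_measurable M" "g \<in> borel_measurable M"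
    and p: "p > 1"
  shows "(\<integral>\<^sup>+x. f x * g x \<partial>M) \<le> epow (\<integral>\<^sup>+x. epow (f x) p \<partial>M) (1 / p)
    * epow (\<integral>\<^sup>+x. epow (g x) (p / (p - 1)) \<partial>M) (1 / (p / (p - 1)))"
proof -
  define q where "q = p / (p - 1)"
  have q: "q > 1" and pq: "1 / p + 1 / q = 1" using p by (auto simp: q_def field_simps)
  define A where "A = (\<integral>\<^sup>+x. epow (f x) p \<partial>M)"
  define B where "B = (\<integral>\<^sup>+x. epow (g x) q \<partial>M)"
  have "(\<integral>\<^sup>+x. f x * g x \<partial>M) \<le> epow A (1/p) * epow B (1/q)"
  proof (cases "A = 0 \<or> B = 0")
    case True
    then have "AE x in M. f x * g x = 0"
    proof
      assume "A = 0"
      then have "AE x in M. epow (f x) p = 0" unfolding A_def by (subst (asm) nn_integral_0_iff_AE) auto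
      then show ?thesis by eventually_elim simp
    next
      assume "B = 0"
      then have "AE x in M. epow (g x) q = 0" unfolding B_def by (subst (asm) nn_integral_0_iff_AE) auto
      then show ?thesis by eventually_elim simp
    qed
    then have "(\<integral>\<^sup>+x. f x * g x \<partial>M) = 0"
      by (subst nn_integral_0_iff_AE) auto
    then show ?thesis by simp
  next
    case False
    show ?thesis
    proof (cases "A = top \<or> B = top")
      case True
      then show ?thesis using False by (auto simp: ennreal_top_mult ennreal_mult_top)
    next
      case fin: False
      obtain a where a: "A = ennreal a" "a > 0" using False fin by (cases A) (auto simp: less_le)
      obtain b where b: "B = ennreal b" "b > 0" using False fin by (cases B) (auto simp: less_le)
      \<comment> \<open>\<open>s\<close> and \<open>t\<close> are the norms of f and g. After
        normalization by them Young's inequality integrates to \<open>s * t\<close> times 1/p + 1/q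
        = 1. The values 0 and \<infinity>, which cannot be normalized, are settled
        beforehand.\<close>
      define s where "s = a powr (1/p)"
      define t where "t = b powr (1/q)"
      have st: "s > 0" "t > 0" "s powr p = a" "t powr q = b"
        using a b p q by (auto simp: s_def t_def powr_powr)
      have young: "u * v \<le> ennreal (s * t) * (ennreal (1 / (p * a)) * epow u p + ennreal (1 / (q * b)) * epow v q)"
        for u v :: ennreal
      proof (cases "u = 0 \<or> v = 0")
        case True then show ?thesis by auto
      next
        case nz: False
        show ?thesis
        proof (cases "u = top \<or> v = top")
          case True then show ?thesis using nz st a b p q
            by (auto simp: ennreal_mult_top ennreal_top_mult ennreal_mult_eq_top_iff)
        next
          case False
          obtain x where x: "u = ennreal x" "x > 0" using nz False by (cases u) (auto simp: less_le)
          obtain y where y: "v = ennreal y" "y > 0" using nz False by (cases v) (auto simp: less_le)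
          have "(x/s) * (y/t) \<le> (x/s) powr p / p + (y/t) powr q / q"
            using Youngs_inequality[OF p q pq, of "x/s" "y/t"] x y st by auto
          then have "x * y \<le> s * t * (1 / (p * a) * x powr p + 1 / (q * b) * y powr q)"
            using st x y by (simp add: powr_divide field_simps)
          then show ?thesis using x y st a b p q
            by (auto simp: epow_ennreal ennreal_leI simp flip: ennreal_mult ennreal_plus)
        qed
      qed
      have "(\<integral>\<^sup>+x. f x * g x \<partial>M) \<le> (\<integral>\<^sup>+x. ennreal (s * t) * (ennreal (1 / (p * a)) * epow (f x) p + ennreal (1 / (q * b)) * epow (g x) q) \<partial>M)"
        by (intro nn_integral_mono young)
      also have "\<dots> = ennreal (s * t) * (ennreal (1 / (p * a)) * A + ennreal (1 / (q * b)) * B)"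
        by (simp add: nn_integral_cmult nn_integral_add A_def B_def)
      also have "\<dots> = ennreal (s * t * (1 / (p * a) * a + 1 / (q * b) * b))"
        using a b st p q by (simp del: ennreal_plus flip: ennreal_mult ennreal_plus)
      also have "s * t * (1 / (p * a) * a + 1 / (q * b) * b) = s * t"
        using a b pq by simp
      also have "ennreal (s * t) = epow A (1/p) * epow B (1/q)"
        using a b st by (simp add: epow_ennreal s_def t_def ennreal_mult)
      finally show ?thesis .
    qed
  qed
  then show ?thesis unfolding A_def B_def q_def .
qed

text \<open>The infimum defining the essential supremum is attained: the bounds C + 1/(n+1) have
  countably many exceptional null sets, and their union is null.\<close>

lemma esssup_on_le_iff_AE:
  fixes A :: "'a::euclidean_space set"
  shows "esssup_on A g \<le> C \<longleftrightarrow> (AE z in lebesgue. z \<in> A \<longrightarrow> g z \<le> C)"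
proof
  assume le: "esssup_on A g \<le> C"
  show "AE z in lebesgue. z \<in> A \<longrightarrow> g z \<le> C"
  proof (cases "C = top")
    case False
    have "\<forall>n::nat. AE z in lebesgue. z \<in> A \<longrightarrow> g z \<le> C + ennreal (1 / Suc n)"
    proof
      fix n :: nat
      have "esssup_on A g < C + ennreal (1 / Suc n)"
        using le False by (auto intro!: le_less_trans[OF le] simp: ennreal_less_zero_iff less_top
            intro: ennreal_add_left_cancel_less[THEN iffD2, of C 0, simplified])
      then obtain D where "D < C + ennreal (1 / Suc n)" "AE z in lebesgue. z \<in> A \<longrightarrow> g z \<le> D"
        unfolding esssup_on_def Inf_less_iff by auto
      then show "AE z in lebesgue. z \<in> A \<longrightarrow> g z \<le> C + ennreal (1 / Suc n)"
        by (auto elim!: eventually_mono)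
    qed
    then have "AE z in lebesgue. \<forall>n::nat. z \<in> A \<longrightarrow> g z \<le> C + ennreal (1 / Suc n)"
      by (subst AE_all_countable)
    then show ?thesis
    proof eventually_elim
      case (elim z)
      have lim: "(\<lambda>n::nat. C + ennreal (1 / Suc n)) \<longlonglongrightarrow> C + ennreal 0"
        by (intro tendsto_add tendsto_const tendsto_ennrealI LIMSEQ_Suc[OF lim_1_over_n])
      show ?case
        using LIMSEQ_le_const[OF lim] elim by auto
    qed
  qed simp
next
  assume "AE z in lebesgue. z \<in> A \<longrightarrow> g z \<le> C"
  then show "esssup_on A g \<le> C"
    unfolding esssup_on_def by (intro Inf_lower) simp
qed

lemma AE_le_esssup_on: "AE z in lebesgue. z \<in> A \<longrightarrow> g z \<le> esssup_on A g"
  using esssup_on_le_iff_AE[of A g "esssup_on A g"] by simp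

section \<open>Whitney averages\<close>

text \<open>\<open>whitney_avg\<close> for a function that is already a modulus. Working with values
  in [0, \<infinity>] makes every integral meaningful, so integrability matters only at the very
  end, for the complex pairing.\<close>

definition wav :: "real \<Rightarrow> real \<Rightarrow> ereal \<Rightarrow> ('a::euclidean_space \<times> real \<Rightarrow> ennreal) \<Rightarrow> 'a \<times> real \<Rightarrow> ennreal" where
  "wav \<alpha>1 \<alpha>2 r F yt =
     (if r = \<infinity> then esssup_on (whitney \<alpha>1 \<alpha>2 yt) F
      else epow ((\<integral>\<^sup>+ z\<in>whitney \<alpha>1 \<alpha>2 yt. epow (F z) (real_of_ereal r) \<partial>lebesgue)
                   / emeasure lebesgue (whitney \<alpha>1 \<alpha>2 yt)) (1 / real_of_ereal r))"

lemma whitney_avg_eq_wav: "whitney_avg \<alpha>1 \<alpha>2 r f = wav \<alpha>1 \<alpha>2 r (\<lambda>z. ennreal (cmod (f z)))"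
  by (simp add: whitney_avg_def wav_def epow_ennreal fun_eq_iff)

lemma measurable_fst_borel [measurable]: "fst \<in> borel_measurable (borel :: ('a::euclidean_space \<times> real) measure)"
  by (intro borel_measurable_continuous_onI continuous_intros)

lemma measurable_snd_borel [measurable]: "snd \<in> borel_measurable (borel :: ('a::euclidean_space \<times> real) measure)"
  by (intro borel_measurable_continuous_onI continuous_intros)

lemma borel_measurable_lebesgueI: "f \<in> borel_measurable borel \<Longrightarrow> f \<in> borel_measurable lebesgue"
  by (rule measurable_completion) simp

lemma emeasure_lborel_Times:
  assumes "A \<in> sets borel" "B \<in> sets borel"
  shows "emeasure lborel ((A :: 'a::euclidean_space set) \<times> (B :: real set)) = emeasure lborel A * emeasure lborel B"
  using assms by (subst lborel_prod[symmetric], subst lborel.emeasure_pair_measure_Times) auto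

lemma whitney_eq: "whitney \<alpha>1 \<alpha>2 (y, t) = ball y (\<alpha>1 * t) \<times> {t / \<alpha>2 <..< \<alpha>2 * t}"
  by (auto simp: whitney_def dist_commute)

lemma whitney_sets [measurable]: "whitney \<alpha>1 \<alpha>2 (yt :: 'a::euclidean_space \<times> real) \<in> sets borel"
proof -
  have "open (whitney \<alpha>1 \<alpha>2 yt)"
    by (cases yt) (simp only: whitney_eq, intro open_Times open_ball open_greaterThanLessThan)
  then show ?thesis by simp
qed

lemma pred_whitney [measurable]:
  "Measurable.pred (borel \<Otimes>\<^sub>M borel) (\<lambda>(yt, z). (z :: 'a::euclidean_space \<times> real) \<in> whitney \<alpha>1 \<alpha>2 yt)"
  unfolding whitney_def by (simp add: split_beta') measurable

lemma upper_half_sets [measurable]: "(upper_half :: ('a::euclidean_space \<times> real) set) \<in> sets borel"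
proof -
  have "upper_half = {z :: 'a \<times> real. snd z > 0}" by (simp add: upper_half_def)
  moreover have "open {z :: 'a \<times> real. snd z > 0}"
    by (intro open_Collect_less continuous_intros)
  ultimately show ?thesis by simp
qed

lemma pred_cone [measurable]:
  "Measurable.pred (borel \<Otimes>\<^sub>M borel) (\<lambda>(x, z). (z :: 'a::euclidean_space \<times> real) \<in> cone x)"
  unfolding cone_def by (simp add: split_beta') measurable

text \<open>Tonelli's theorem and joint measurability are used on products of Borel spaces. Lebesgue
  measurable functions are therefore first replaced by Borel ones; Whitney averages do not see the
  change (\<open>wav_cong_AE\<close>).\<close>

lemma borel_version:
  fixes F :: "'a::euclidean_space \<Rightarrow> ennreal"
  assumes "F \<in> borel_measurable lebesgue"
  obtains F0 where "F0 \<in> borel_measurable borel" "AE z in lborel. F z = F0 z"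
  using completion_ex_borel_measurable[OF assms] by auto

lemma wav_cong_AE:
  assumes "AE z in lborel. F z = F0 z"
  shows "wav \<alpha>1 \<alpha>2 r F = wav \<alpha>1 \<alpha>2 r F0"
proof
  fix yt :: "'a \<times> real"
  have 2: "(AE z in lborel. z \<in> whitney \<alpha>1 \<alpha>2 yt \<longrightarrow> F z \<le> C) \<longleftrightarrow> (AE z in lborel. z \<in> whitney \<alpha>1 \<alpha>2 yt \<longrightarrow> F0 z \<le> C)" for C
  proof
    assume "AE z in lborel. z \<in> whitney \<alpha>1 \<alpha>2 yt \<longrightarrow> F z \<le> C"
    with assms show "AE z in lborel. z \<in> whitney \<alpha>1 \<alpha>2 yt \<longrightarrow> F0 z \<le> C" by eventually_elim auto
  next
    assume "AE z in lborel. z \<in> whitney \<alpha>1 \<alpha>2 yt \<longrightarrow> F0 z \<le> C"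
    with assms show "AE z in lborel. z \<in> whitney \<alpha>1 \<alpha>2 yt \<longrightarrow> F z \<le> C" by eventually_elim auto
  qed
  have 3: "(\<integral>\<^sup>+ z\<in>whitney \<alpha>1 \<alpha>2 yt. epow (F z) a \<partial>lborel) = (\<integral>\<^sup>+ z\<in>whitney \<alpha>1 \<alpha>2 yt. epow (F0 z) a \<partial>lborel)" for a
    by (rule nn_integral_cong_AE) (use assms in \<open>eventually_elim, auto simp: indicator_def\<close>)
  show "wav \<alpha>1 \<alpha>2 r F yt = wav \<alpha>1 \<alpha>2 r F0 yt"
    by (simp add: wav_def esssup_on_def AE_completion_iff nn_integral_completion 2 3)
qed

lemma wav_mono:
  assumes "AE z in lborel. z \<in> upper_half \<longrightarrow> F z \<le> F0 z" "\<alpha>2 > 0" "snd yt > 0" "r \<ge> 0"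
  shows "wav \<alpha>1 \<alpha>2 r F yt \<le> wav \<alpha>1 \<alpha>2 r F0 yt"
proof -
  have sub: "whitney \<alpha>1 \<alpha>2 yt \<subseteq> upper_half"
    using assms(2,3) by (auto simp: whitney_def upper_half_def) (meson divide_pos_pos less_trans)
  have 1: "AE z in lborel. z \<in> whitney \<alpha>1 \<alpha>2 yt \<longrightarrow> F z \<le> F0 z"
    using assms(1) by eventually_elim (use sub in auto)
  have r: "real_of_ereal r \<ge> 0" using assms(4) by (simp add: real_of_ereal_pos)
  have "(\<integral>\<^sup>+ z\<in>whitney \<alpha>1 \<alpha>2 yt. epow (F z) (real_of_ereal r) \<partial>lborel) \<le> (\<integral>\<^sup>+ z\<in>whitney \<alpha>1 \<alpha>2 yt. epow (F0 z) (real_of_ereal r) \<partial>lborel)"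
    by (rule nn_integral_mono_AE) (use 1 in \<open>eventually_elim, auto simp: indicator_def intro: epow_mono r\<close>)
  moreover have "esssup_on (whitney \<alpha>1 \<alpha>2 yt) F \<le> esssup_on (whitney \<alpha>1 \<alpha>2 yt) F0"
    using AE_le_esssup_on[of "whitney \<alpha>1 \<alpha>2 yt" F0] 1
    unfolding esssup_on_le_iff_AE AE_completion_iff by eventually_elim auto
  ultimately show ?thesis
    using r by (auto simp: wav_def nn_integral_completion intro!: epow_mono divide_right_mono_ennreal)
qed

lemma epow_indicator: "epow (x * indicator A z) a = epow x a * indicator A z"
  by (simp add: indicator_def)

text \<open>One inequality suffices: applied with the factor 1/c to the scaled function, it becomes
  the other one.\<close>

lemma esssup_on_scale:
  assumes "c > 0"
  shows "esssup_on A (\<lambda>z. ennreal c * F z) = ennreal c * esssup_on A F"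
proof -
  have le: "esssup_on A (\<lambda>z. ennreal c * F z) \<le> ennreal c * esssup_on A F" for c F
    unfolding esssup_on_le_iff_AE
    using AE_le_esssup_on[of A F] by eventually_elim (auto intro: mult_left_mono)
  have "ennreal c * esssup_on A (\<lambda>z. ennreal (1 / c) * (ennreal c * F z)) \<le> ennreal c * (ennreal (1 / c) * esssup_on A (\<lambda>z. ennreal c * F z))"
    by (intro mult_left_mono le) simp
  then have "ennreal c * esssup_on A F \<le> esssup_on A (\<lambda>z. ennreal c * F z)"
    using assms by (simp add: mult.assoc[symmetric] ennreal_mult[symmetric])
  with le[of c F] show ?thesis by (rule antisym)
qed

lemma wav_scale:
  assumes F: "F \<in> borel_measurable lebesgue" and "c > 0" "r > 0"
  shows "wav \<alpha>1 \<alpha>2 r (\<lambda>z. ennreal c * F z) yt = ennreal c * wav \<alpha>1 \<alpha>2 r F yt"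
proof (cases "r = \<infinity>")
  case True then show ?thesis using assms by (simp add: wav_def esssup_on_scale)
next
  case False
  then obtain r' where r: "r = ereal r'" "r' > 0" using assms(3) by (cases r) auto
  have m [measurable]: "(\<lambda>z. epow (F z) r' * indicator (whitney \<alpha>1 \<alpha>2 yt) z) \<in> borel_measurable lebesgue"
    using F by (intro borel_measurable_times_ennreal borel_measurable_epow borel_measurable_indicator) auto
  have "(\<integral>\<^sup>+ z\<in>whitney \<alpha>1 \<alpha>2 yt. epow (ennreal c * F z) r' \<partial>lebesgue) = epow (ennreal c) r' * (\<integral>\<^sup>+ z\<in>whitney \<alpha>1 \<alpha>2 yt. epow (F z) r' \<partial>lebesgue)"
    by (subst nn_integral_cmult[symmetric, OF m]) (simp add: epow_mult mult.assoc)
  then show ?thesis using r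
    by (simp add: wav_def epow_mult ennreal_times_divide[symmetric] epow_epow)
qed

text \<open>The sublevel set at C consists of those y for which the part of \<open>A y\<close> where
  F exceeds C has measure zero, and this measure depends measurably on y by Tonelli.\<close>

lemma esssup_on_measurable:
  fixes F :: "'b::euclidean_space \<Rightarrow> ennreal"
  assumes [measurable]: "F \<in> borel_measurable borel"
    and A [measurable]: "Measurable.pred (N \<Otimes>\<^sub>M borel) (\<lambda>(y, z). z \<in> A y)"
  shows "(\<lambda>y. esssup_on (A y) F) \<in> borel_measurable N"
proof (rule borel_measurableI_le)
  fix C
  have "{y \<in> space N. esssup_on (A y) F \<le> C} = {y \<in> space N. (\<integral>\<^sup>+z. indicator {z. z \<in> A y \<and> \<not> F z \<le> C} z \<partial>lborel) = 0}"
  proof (intro Collect_cong conj_cong refl)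
    fix y assume y: "y \<in> space N"
    have [measurable]: "Measurable.pred borel (\<lambda>z. z \<in> A y)"
      using measurable_compose[OF measurable_Pair1'[OF y] A] by simp
    have "(\<integral>\<^sup>+z. indicator {z. z \<in> A y \<and> \<not> F z \<le> C} z \<partial>lborel) = 0 \<longleftrightarrow> (AE z in lborel. indicator {z. z \<in> A y \<and> \<not> F z \<le> C} z = (0::ennreal))"
      by (subst nn_integral_0_iff_AE) auto
    also have "\<dots> \<longleftrightarrow> esssup_on (A y) F \<le> C"
      unfolding esssup_on_le_iff_AE AE_completion_iff by (intro AE_cong) (auto simp: indicator_def)
    finally show "(esssup_on (A y) F \<le> C) = ((\<integral>\<^sup>+z. indicator {z. z \<in> A y \<and> \<not> F z \<le> C} z \<partial>lborel) = 0)" by simp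
  qed
  also have "\<dots> \<in> sets N"
  proof -
    have "(\<lambda>y. \<integral>\<^sup>+z. indicator {z. z \<in> A y \<and> \<not> F z \<le> C} z \<partial>lborel) \<in> borel_measurable N"
    proof (rule lborel.borel_measurable_nn_integral)
      have "(\<lambda>(y, z). indicator {w. (snd w) \<in> A (fst w) \<and> \<not> F (snd w) \<le> C} (y,z)) \<in> borel_measurable (N \<Otimes>\<^sub>M lborel)"
        using A by (simp add: split_beta') measurable
      then show "(\<lambda>(y, z). indicator {z. z \<in> A y \<and> \<not> F z \<le> C} z :: ennreal) \<in> borel_measurable (N \<Otimes>\<^sub>M lborel)"
        by (simp add: indicator_def)
    qed
    then show ?thesis by measurable
  qed
  finally show "{y \<in> space N. esssup_on (A y) F \<le> C} \<in> sets N" .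
qed

lemma wav_measurable [measurable (raw)]:
  fixes F :: "'a::euclidean_space \<times> real \<Rightarrow> ennreal"
  assumes "F \<in> borel_measurable lebesgue"
  shows "wav \<alpha>1 \<alpha>2 r F \<in> borel_measurable borel"
proof -
  obtain F0 where F0 [measurable]: "F0 \<in> borel_measurable borel" and ae: "AE z in lborel. F z = F0 z"
    using borel_version[OF assms] .
  have [measurable]: "(\<lambda>yt. esssup_on (whitney \<alpha>1 \<alpha>2 yt) F0) \<in> borel_measurable borel"
    by (rule esssup_on_measurable) auto
  have [measurable]: "(\<lambda>yt. \<integral>\<^sup>+z. g z * indicator (whitney \<alpha>1 \<alpha>2 yt) z \<partial>lborel) \<in> borel_measurable borel"
    if [measurable]: "g \<in> borel_measurable borel" for g :: "'a \<times> real \<Rightarrow> ennreal"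
  proof (rule lborel.borel_measurable_nn_integral)
    have "(\<lambda>(yt, z). g z * indicator {w. snd w \<in> whitney \<alpha>1 \<alpha>2 (fst w)} (yt, z)) \<in> borel_measurable (borel \<Otimes>\<^sub>M lborel)"
      using pred_whitney[of \<alpha>1 \<alpha>2] by (simp add: split_beta') measurable
    then show "(\<lambda>(yt, z). g z * indicator (whitney \<alpha>1 \<alpha>2 yt) z) \<in> borel_measurable (borel \<Otimes>\<^sub>M lborel)"
      by (simp add: indicator_def)
  qed
  have em: "emeasure lebesgue (whitney \<alpha>1 \<alpha>2 yt) = (\<integral>\<^sup>+z. 1 * indicator (whitney \<alpha>1 \<alpha>2 yt) z \<partial>lborel)" for yt :: "'a \<times> real"
    by (simp add: nn_integral_indicator)
  show ?thesis unfolding wav_cong_AE[OF ae]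
    unfolding wav_def em nn_integral_completion by measurable
qed

section \<open>Volumes of balls and Whitney boxes, and integration over boxes\<close>

definition ubv :: "'a::euclidean_space itself \<Rightarrow> real" where
  "ubv _ = unit_ball_vol (real DIM('a))"

lemma ubv_pos [simp]: "ubv TYPE('a::euclidean_space) > 0"
  by (simp add: ubv_def)

lemma ubv_nonzero [simp]: "ubv TYPE('a::euclidean_space) \<noteq> 0"
  using ubv_pos[where ?'a='a] by linarith

lemma ubv_nonneg [simp]: "0 \<le> ubv TYPE('a::euclidean_space)"
  using ubv_pos[where ?'a='a] by linarith

lemma emeasure_ball_ubv:
  "r \<ge> 0 \<Longrightarrow> emeasure lborel (ball (c::'a::euclidean_space) r) = ennreal (ubv TYPE('a) * r ^ DIM('a))"
  by (simp add: ubv_def emeasure_ball)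

locale whitney_params =
  fixes \<alpha>1 \<alpha>2 :: real
  assumes \<alpha>: "0 < \<alpha>1" "\<alpha>1 < 1 / \<alpha>2" "1 / \<alpha>2 < 1"
begin

lemma \<alpha>2_gt1: "\<alpha>2 > 1"
proof -
  have "1 / \<alpha>2 > 0" using \<alpha> by linarith
  then show ?thesis using \<alpha> by (simp add: divide_less_eq)
qed

lemma \<alpha>2_pos [simp]: "\<alpha>2 > 0" using \<alpha>2_gt1 by linarith

lemma div_\<alpha>2_less: "t > 0 \<Longrightarrow> t / \<alpha>2 < \<alpha>2 * t"
proof -
  assume t: "t > 0"
  have "t / \<alpha>2 < t" using \<alpha>2_gt1 t by (simp add: divide_less_eq)
  also have "t < \<alpha>2 * t" using \<alpha>2_gt1 t by simp
  finally show ?thesis .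
qed

lemma div_\<alpha>2_le: "t > 0 \<Longrightarrow> t / \<alpha>2 \<le> \<alpha>2 * t"
  using div_\<alpha>2_less by (simp add: less_imp_le)

lemma \<alpha>1_lt1: "\<alpha>1 < 1" using \<alpha> by linarith

abbreviation "W \<equiv> whitney \<alpha>1 \<alpha>2"
abbreviation "WA \<equiv> wav \<alpha>1 \<alpha>2"

definition wvol :: "'a::euclidean_space itself \<Rightarrow> real" where
  "wvol _ = ubv TYPE('a) * \<alpha>1 ^ DIM('a) * (\<alpha>2 - 1 / \<alpha>2)"

lemma wvol_pos [simp]: "wvol TYPE('a::euclidean_space) > 0"
  unfolding wvol_def using \<alpha> div_\<alpha>2_less[of 1] by (intro mult_pos_pos) auto

lemma emeasure_whitney:
  assumes "t > 0"
  shows "emeasure lborel (W (y::'a::euclidean_space, t)) = ennreal (wvol TYPE('a) * t ^ (DIM('a) + 1))"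
proof -
  have "t / \<alpha>2 \<le> \<alpha>2 * t"
    using assms by (simp add: div_\<alpha>2_le)
  then show ?thesis
    using assms \<alpha> ubv_pos[where ?'a='a] unfolding whitney_eq
    by (simp add: emeasure_lborel_Times emeasure_ball_ubv less_imp_le wvol_def
        flip: ennreal_mult) (simp add: field_simps)
qed

lemma whitney_subset_upper_half: "W yt \<subseteq> upper_half" if "snd yt > 0"
  using that \<alpha>2_pos by (auto simp: whitney_def upper_half_def) (meson \<alpha>2_pos divide_pos_pos less_trans)

lemma wav_Holder:
  fixes F G :: "'a::euclidean_space \<times> real \<Rightarrow> ennreal"
  assumes F [measurable]: "F \<in> borel_measurable borel" and G [measurable]: "G \<in> borel_measurable borel"
    and r: "r \<ge> 1" and t: "t > 0"
  shows "(\<integral>\<^sup>+z\<in>W (y, t). F z * G z \<partial>lborel) / emeasure lborel (W (y, t))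
     \<le> WA (ereal r) F (y, t) * WA (conj_exp r) G (y, t)"
proof -
  define v where "v = wvol TYPE('a) * t ^ (DIM('a) + 1)"
  have v: "v > 0" "emeasure lborel (W (y, t)) = ennreal v"
    using t by (simp_all add: v_def emeasure_whitney)
  show ?thesis
  proof (cases "r = 1")
    case True
    define E where "E = esssup_on (W (y, t)) G"
    have "AE z in lborel. z \<in> W (y, t) \<longrightarrow> G z \<le> E"
      using AE_le_esssup_on[of "W (y, t)" G] by (simp add: AE_completion_iff E_def)
    then have "(\<integral>\<^sup>+z\<in>W (y, t). F z * G z \<partial>lborel) \<le> (\<integral>\<^sup>+z. (F z * indicator (W (y, t)) z) * E \<partial>lborel)"
      by (intro nn_integral_mono_AE, elim eventually_mono) (auto simp: indicator_def intro!: mult_left_mono)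
    also have "\<dots> = (\<integral>\<^sup>+z\<in>W (y, t). F z \<partial>lborel) * E"
      by (subst nn_integral_multc) auto
    finally have "(\<integral>\<^sup>+z\<in>W (y, t). F z * G z \<partial>lborel) / ennreal v \<le> (\<integral>\<^sup>+z\<in>W (y, t). F z \<partial>lborel) * E / ennreal v"
      by (rule divide_right_mono_ennreal)
    then show ?thesis using True v
      by (simp add: wav_def conj_exp_def nn_integral_completion E_def divide_ennreal_def mult_ac)
  next
    case False
    with r have r1: "r > 1" by simp
    define q where "q = r / (r - 1)"
    have q: "q > 1" "1 / r + 1 / q = 1" using r1 by (auto simp: q_def field_simps)
    have "(\<integral>\<^sup>+z\<in>W (y, t). F z * G z \<partial>lborel) = (\<integral>\<^sup>+z. (F z * indicator (W (y, t)) z) * (G z * indicator (W (y, t)) z) \<partial>lborel)"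
      by (intro nn_integral_cong) (auto simp: indicator_def)
    also have "\<dots> \<le> epow (\<integral>\<^sup>+z\<in>W (y, t). epow (F z) r \<partial>lborel) (1 / r) * epow (\<integral>\<^sup>+z\<in>W (y, t). epow (G z) q \<partial>lborel) (1 / q)"
      unfolding epow_indicator[symmetric] q_def by (intro nn_Holder r1) auto
    finally have "(\<integral>\<^sup>+z\<in>W (y, t). F z * G z \<partial>lborel) / ennreal v \<le>
      epow (\<integral>\<^sup>+z\<in>W (y, t). epow (F z) r \<partial>lborel) (1 / r) * epow (\<integral>\<^sup>+z\<in>W (y, t). epow (G z) q \<partial>lborel) (1 / q) / ennreal v"
      by (rule divide_right_mono_ennreal)
    also have "\<dots> = (epow (\<integral>\<^sup>+z\<in>W (y, t). epow (F z) r \<partial>lborel) (1 / r) / ennreal (v powr (1/r))) * (epow (\<integral>\<^sup>+z\<in>W (y, t). epow (G z) q \<partial>lborel) (1 / q) / ennreal (v powr (1/q)))"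
    proof -
      \<comment> \<open>The normalization splits as v^(-1/r) v^(-1/q) because 1/r + 1/q = 1; hence
        normalized averages satisfy Hoelder's inequality with constant 1.\<close>
      have "ennreal (1 / v) = ennreal (1 / v powr (1/r)) * ennreal (1 / v powr (1/q))"
        using v q by (simp add: powr_add[symmetric] flip: ennreal_mult)
      then show ?thesis using v
        by (simp add: divide_ennreal_def inverse_ennreal inverse_eq_divide mult_ac)
    qed
    also have "\<dots> = WA (ereal r) F (y, t) * WA (conj_exp r) G (y, t)"
      using False r1 q v by (simp add: wav_def conj_exp_def q_def[symmetric] nn_integral_completion epow_divide)
    finally show ?thesis using v by simp
  qed
qed

text \<open>By Tonelli the right side integrates H(z) against the total weight 1/(|W(y,t)| t) of
  those (y,t) whose box contains z, and at height s this weight is at least a constant multiple of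
  1/s.\<close>

lemma whitney_Fubini:
  fixes H :: "'a::euclidean_space \<times> real \<Rightarrow> ennreal"
  assumes H [measurable]: "H \<in> borel_measurable borel"
  shows "(\<integral>\<^sup>+z\<in>upper_half. H z * ennreal (1 / snd z) \<partial>lborel) \<le>
    ennreal ((\<alpha>2 ^ 2) ^ (DIM('a) + 1)) *
      (\<integral>\<^sup>+yt\<in>upper_half. (\<integral>\<^sup>+z\<in>W yt. H z \<partial>lborel) / emeasure lborel (W yt) * ennreal (1 / snd yt) \<partial>lborel)"
    (is "?L \<le> ?C * ?R")
proof -
  define n where "n = DIM('a)"
  define k where "k = (\<lambda>(yt :: 'a \<times> real) (z :: 'a \<times> real).
     indicator {w. snd w \<in> W (fst w) \<and> snd (fst w) > 0} (yt, z) * ennreal (1 / (wvol TYPE('a) * snd yt ^ (n + 1) * snd yt)))"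
  have k_meas [measurable]: "case_prod k \<in> borel_measurable (borel \<Otimes>\<^sub>M borel)"
    unfolding k_def using pred_whitney[of \<alpha>1 \<alpha>2] by (simp add: split_beta') measurable
  have k_meas' [measurable]: "k yt \<in> borel_measurable borel" for yt
    using measurable_compose[OF measurable_Pair1'[of yt borel borel] k_meas] by simp
  have k_meas'' [measurable]: "(\<lambda>yt. k yt z) \<in> borel_measurable borel" for z
    using measurable_compose[OF measurable_Pair2'[of z borel borel] k_meas] by simp
  have "?R = (\<integral>\<^sup>+yt. (\<integral>\<^sup>+z. k yt z * H z \<partial>lborel) \<partial>lborel)"
  proof (intro nn_integral_cong)
    fix yt :: "'a \<times> real"
    show "(\<integral>\<^sup>+z\<in>W yt. H z \<partial>lborel) / emeasure lborel (W yt) * ennreal (1 / snd yt) * indicator upper_half yt = (\<integral>\<^sup>+z. k yt z * H z \<partial>lborel)"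
    proof (cases "snd yt > 0")
      case True
      obtain y t where yt: "yt = (y, t)" by force
      define v where "v = wvol TYPE('a) * t ^ (n + 1)"
      have v: "v > 0" "emeasure lborel (W yt) = ennreal v"
        using True by (simp_all add: v_def emeasure_whitney yt n_def)
      have "(\<integral>\<^sup>+z. k yt z * H z \<partial>lborel) = (\<integral>\<^sup>+z. ennreal (1 / (v * t)) * (H z * indicator (W yt) z) \<partial>lborel)"
        using True by (intro nn_integral_cong) (auto simp: k_def yt v_def indicator_def mult_ac)
      also have "\<dots> = ennreal (1 / (v * t)) * (\<integral>\<^sup>+z\<in>W yt. H z \<partial>lborel)"
        by (subst nn_integral_cmult) auto
      also have "ennreal (1 / (v * t)) = inverse (ennreal v) * ennreal (1 / t)"
        using v True by (simp add: inverse_ennreal inverse_eq_divide yt flip: ennreal_mult)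
      finally show ?thesis using True v by (simp add: yt upper_half_def divide_ennreal_def mult_ac)
    qed (simp add: k_def upper_half_def)
  qed
  also have "\<dots> = (\<integral>\<^sup>+z. (\<integral>\<^sup>+yt. k yt z * H z \<partial>lborel) \<partial>lborel)"
    by (intro lborel_pair.Fubini'[symmetric]) measurable
  also have "\<dots> = (\<integral>\<^sup>+z. (\<integral>\<^sup>+yt. k yt z \<partial>lborel) * H z \<partial>lborel)"
    by (intro nn_integral_cong nn_integral_multc) measurable
  finally have R: "?R = (\<integral>\<^sup>+z. (\<integral>\<^sup>+yt. k yt z \<partial>lborel) * H z \<partial>lborel)" .
  have low: "ennreal (1 / snd z) \<le> ?C * (\<integral>\<^sup>+yt. k yt z \<partial>lborel)" if z: "z \<in> upper_half" for z
  proof -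
    obtain x s where xs: "z = (x, s)" "s > 0" using z by (cases z) (auto simp: upper_half_def)
    \<comment> \<open>An upper bound for |W(y,t)| t when t < \<alpha>2 s. The points whose box
      contains z = (x,s) include B(x, \<alpha>1 s/\<alpha>2) times (s/\<alpha>2, \<alpha>2 s),
      because t > s/\<alpha>2 there. The volume of this product divided by c is \<alpha>2^(-2(n+1))
      / s, which is the origin of the constant in the statement.\<close>
    define c where "c = wvol TYPE('a) * (\<alpha>2 * s) ^ (n + 1) * (\<alpha>2 * s)"
    have c: "c > 0" using xs \<alpha>2_pos by (simp add: c_def)
    have "ennreal (1 / c) * emeasure lborel (ball x (\<alpha>1 * (s / \<alpha>2)) \<times> {s / \<alpha>2 <..< \<alpha>2 * s})
        = (\<integral>\<^sup>+yt. ennreal (1 / c) * indicator (ball x (\<alpha>1 * (s / \<alpha>2)) \<times> {s / \<alpha>2 <..< \<alpha>2 * s}) yt \<partial>lborel)"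
      by (subst nn_integral_cmult_indicator) (auto simp: borel_Times)
    also have "\<dots> \<le> (\<integral>\<^sup>+yt. k yt z \<partial>lborel)"
    proof (intro nn_integral_mono)
      fix yt :: "'a \<times> real"
      obtain y t where yt: "yt = (y, t)" by force
      show "ennreal (1 / c) * indicator (ball x (\<alpha>1 * (s / \<alpha>2)) \<times> {s / \<alpha>2 <..< \<alpha>2 * s}) yt \<le> k yt z"
      proof (cases "yt \<in> ball x (\<alpha>1 * (s / \<alpha>2)) \<times> {s / \<alpha>2 <..< \<alpha>2 * s}")
        case True
        then have d: "dist x y < \<alpha>1 * (s / \<alpha>2)" "s / \<alpha>2 < t" "t < \<alpha>2 * s" by (auto simp: yt)
        have t: "t > 0" using d xs \<alpha>2_pos by (meson divide_pos_pos less_trans)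
        have "\<alpha>1 * (s / \<alpha>2) \<le> \<alpha>1 * t" using d \<alpha> by (intro mult_left_mono) auto
        then have inW: "z \<in> W yt"
          using d \<alpha>2_pos by (auto simp: whitney_def yt xs divide_less_eq mult.commute)
        have "wvol TYPE('a) * t ^ (n + 1) * t \<le> c"
          unfolding c_def using d t wvol_pos[where ?'a='a] xs \<alpha>2_pos
          by (intro mult_mono power_mono) (auto simp: less_imp_le)
        then have "1 / c \<le> 1 / (wvol TYPE('a) * t ^ (n + 1) * t)"
          using t by (intro divide_left_mono mult_pos_pos c) auto
        then show ?thesis using inW t True by (auto simp: k_def yt intro!: ennreal_leI)
      qed simp
    qed
    finally have le: "ennreal (1 / c) * emeasure lborel (ball x (\<alpha>1 * (s / \<alpha>2)) \<times> {s / \<alpha>2 <..< \<alpha>2 * s}) \<le> (\<integral>\<^sup>+yt. k yt z \<partial>lborel)" .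
    have "s / \<alpha>2 \<le> \<alpha>2 * s"
      using xs by (simp add: div_\<alpha>2_le)
    then have em: "emeasure lborel (ball x (\<alpha>1 * (s / \<alpha>2)) \<times> {s / \<alpha>2 <..< \<alpha>2 * s}) = ennreal (ubv TYPE('a) * (\<alpha>1 * (s / \<alpha>2)) ^ n * (\<alpha>2 * s - s / \<alpha>2))"
      using xs \<alpha> \<alpha>2_pos ubv_pos[where ?'a='a]
      by (simp add: emeasure_lborel_Times emeasure_ball_ubv n_def less_imp_le flip: ennreal_mult)
    have "1 / s = (\<alpha>2 ^ 2) ^ (n + 1) * (1 / c * (ubv TYPE('a) * (\<alpha>1 * (s / \<alpha>2)) ^ n * (\<alpha>2 * s - s / \<alpha>2)))"
    proof -
      define D where "D = \<alpha>2 * s - s / \<alpha>2"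
      have "D > 0" using xs div_\<alpha>2_less by (simp add: D_def)
      have cD: "c = ubv TYPE('a) * \<alpha>1 ^ n * D * (\<alpha>2 ^ n * s ^ n) * \<alpha>2 * (\<alpha>2 * s)"
        using xs by (simp add: c_def wvol_def n_def D_def algebra_simps power_mult_distrib)
      have "(\<alpha>2 ^ 2) ^ n = \<alpha>2 ^ n * \<alpha>2 ^ n"
        by (simp add: power2_eq_square power_mult_distrib)
      then show ?thesis unfolding D_def[symmetric] cD
        using xs \<alpha> \<alpha>2_pos ubv_pos[where ?'a='a] \<open>D > 0\<close>
        by (simp add: power_mult_distrib power_divide field_simps power2_eq_square)
    qed
    then have "ennreal (1 / s) = ?C * (ennreal (1 / c) * ennreal (ubv TYPE('a) * (\<alpha>1 * (s / \<alpha>2)) ^ n * (\<alpha>2 * s - s / \<alpha>2)))"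
      using \<alpha>2_pos \<alpha> xs c \<open>s / \<alpha>2 \<le> \<alpha>2 * s\<close> ubv_pos[where ?'a='a]
      by (simp add: n_def flip: ennreal_mult)
    also have "\<dots> \<le> ?C * (\<integral>\<^sup>+yt. k yt z \<partial>lborel)"
      using le[unfolded em] by (intro mult_left_mono) auto
    finally show ?thesis by (simp add: xs)
  qed
  have "?L \<le> (\<integral>\<^sup>+z. ?C * ((\<integral>\<^sup>+yt. k yt z \<partial>lborel) * H z) \<partial>lborel)"
  proof (intro nn_integral_mono)
    fix z :: "'a \<times> real"
    show "H z * ennreal (1 / snd z) * indicator upper_half z \<le> ?C * ((\<integral>\<^sup>+yt. k yt z \<partial>lborel) * H z)"
      using mult_left_mono[OF low[of z], of "H z"] by (auto simp: indicator_def mult_ac)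
  qed
  also have "\<dots> = ?C * (\<integral>\<^sup>+z. ((\<integral>\<^sup>+yt. k yt z \<partial>lborel) * H z) \<partial>lborel)"
    by (intro nn_integral_cmult borel_measurable_times lborel.borel_measurable_nn_integral) measurable
  finally show ?thesis by (simp add: R)
qed

end

section \<open>The duality inequality in tent spaces\<close>

text \<open>The q-th power of the conical area functional. The inner root is left off, so that the
  p-th power of the tent norm is the integral of \<open>area\<close> to the power p/q.\<close>

definition area :: "real \<Rightarrow> ('a::euclidean_space \<times> real \<Rightarrow> ennreal) \<Rightarrow> 'a \<Rightarrow> ennreal" where
  "area q g x = (\<integral>\<^sup>+z\<in>cone x. epow (g z) q * ennreal (1 / snd z ^ (DIM('a) + 1)) \<partial>lborel)"

lemma tent_norm_real:
  fixes g :: "'a::euclidean_space \<times> real \<Rightarrow> ennreal"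
  shows "tent_norm (ereal p) (ereal q) g = epow (\<integral>\<^sup>+x. epow (area q g x) (p / q) \<partial>lborel) (1 / p)"
  by (simp add: tent_norm_def area_def nn_integral_completion)

lemma tent_norm_Carleson:
  fixes g :: "'a::euclidean_space \<times> real \<Rightarrow> ennreal"
  shows "tent_norm \<infinity> (ereal q) g = (SUP x. SUP B \<in> {ball c R | c R. R > 0 \<and> x \<in> ball c R}.
          epow ((\<integral>\<^sup>+ z\<in>tent B. epow (g z) q * ennreal (1 / snd z) \<partial>lborel) / emeasure lborel B) (1 / q))"
proof -
  have "emeasure lebesgue B = emeasure lborel B" if "B \<in> {ball c R | c R. R > 0 \<and> x \<in> ball c R}" for x B
    using that by (auto simp: emeasure_completion)
  then show ?thesis
    unfolding tent_norm_def nn_integral_completion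
    by (simp, intro SUP_cong refl) auto
qed

lemma tent_norm_nontangential:
  fixes g :: "'a::euclidean_space \<times> real \<Rightarrow> ennreal"
  shows "tent_norm (ereal p) \<infinity> g = epow (\<integral>\<^sup>+ x. epow (SUP z\<in>cone x. g z) p \<partial>lborel) (1 / p)"
  by (simp add: tent_norm_def nn_integral_completion)

lemma tent_norm_infty: "tent_norm \<infinity> \<infinity> g = esssup_on upper_half g"
  by (simp add: tent_norm_def)

lemma borel_measurable_pair_lborel:
  "borel_measurable (N \<Otimes>\<^sub>M lborel) = borel_measurable (N \<Otimes>\<^sub>M borel)"
  by (rule measurable_cong_sets) (auto intro: sets_pair_measure_cong)

lemma pred_ball [measurable]: "Measurable.pred borel (\<lambda>x. x \<in> ball (y::'a::euclidean_space) t)"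
  unfolding mem_ball by measurable

lemma cone_sets [measurable]: "cone (x::'a::euclidean_space) \<in> sets borel"
proof -
  have "{z :: 'a \<times> real. snd z > 0 \<and> dist (fst z) x < snd z} \<in> sets borel" by measurable
  also have "{z :: 'a \<times> real. snd z > 0 \<and> dist (fst z) x < snd z} = cone x" by (auto simp: cone_def)
  finally show ?thesis .
qed

lemma tent_sets [measurable]: "tent (ball (c::'a::euclidean_space) R) \<in> sets borel"
proof -
  have "tent (ball c R) = {z. snd z > 0 \<and> dist (fst z) c + snd z \<le> R}"
    by (auto simp: tent_def ball_subset_ball_iff)
  moreover have "{z :: 'a \<times> real. snd z > 0 \<and> dist (fst z) c + snd z \<le> R} \<in> sets borel" by measurable
  ultimately show ?thesis by simp
qed

lemma cone_measurable_integral: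
  fixes K :: "'a::euclidean_space \<Rightarrow> 'a \<times> real \<Rightarrow> ennreal"
  assumes [measurable]: "(\<lambda>(x, z). K x z) \<in> borel_measurable (borel \<Otimes>\<^sub>M borel)"
  shows "(\<lambda>(x, z). K x z * indicator (cone x) z) \<in> borel_measurable (borel \<Otimes>\<^sub>M borel)"
proof -
  have "(\<lambda>(x, z). K x z * indicator {w. snd w \<in> cone (fst w)} (x, z)) \<in> borel_measurable (borel \<Otimes>\<^sub>M borel)"
    using pred_cone[where ?'a='a] assms by (simp add: split_beta') measurable
  then show ?thesis by (simp add: indicator_def)
qed

lemma area_measurable [measurable]:
  assumes [measurable]: "g \<in> borel_measurable borel"
  shows "area q g \<in> borel_measurable borel"
proof -
  have "(\<lambda>(x, z). epow (g z) q * ennreal (1 / snd z ^ (DIM('a) + 1)) * indicator (cone x) z) \<in> borel_measurable (borel \<Otimes>\<^sub>M borel)"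
    by (rule cone_measurable_integral) measurable
  then show ?thesis unfolding area_def
    by (intro lborel.borel_measurable_nn_integral) (simp only: borel_measurable_pair_lborel)
qed

text \<open>The exchange of integrals rests on a symmetry: (y,t) lies in the cone at x exactly when
  x lies in B(y,t).\<close>

lemma cone_Fubini:
  fixes K :: "'a::euclidean_space \<Rightarrow> 'a \<times> real \<Rightarrow> ennreal"
  assumes [measurable]: "(\<lambda>(x, z). K x z) \<in> borel_measurable (borel \<Otimes>\<^sub>M borel)"
  shows "(\<integral>\<^sup>+x. (\<integral>\<^sup>+z\<in>cone x. K x z \<partial>lborel) \<partial>lborel)
      = (\<integral>\<^sup>+z\<in>upper_half. (\<integral>\<^sup>+x\<in>ball (fst z) (snd z). K x z \<partial>lborel) \<partial>lborel)"
proof -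
  note [measurable] = cone_measurable_integral[OF assms]
  have "(\<integral>\<^sup>+x. (\<integral>\<^sup>+z\<in>cone x. K x z \<partial>lborel) \<partial>lborel) = (\<integral>\<^sup>+z. (\<integral>\<^sup>+x. K x z * indicator (cone x) z \<partial>lborel) \<partial>lborel)"
    by (rule lborel_pair.Fubini'[symmetric]) simp
  also have "\<dots> = (\<integral>\<^sup>+z\<in>upper_half. (\<integral>\<^sup>+x\<in>ball (fst z) (snd z). K x z \<partial>lborel) \<partial>lborel)"
    by (intro nn_integral_cong) (auto simp: cone_def upper_half_def indicator_def nn_integral_0_iff_AE intro!: nn_integral_cong)
  finally show ?thesis .
qed

text \<open>Integrating out the vertex contributes |B(y,t)| = \<open>ubv\<close> t^n and turns the
  cone weight t^(-n-1) into \<open>ubv\<close>/t. This links conical integrals with the measure dy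
  dt/t of the pairing.\<close>

lemma cone_Fubini_const:
  fixes H :: "'a::euclidean_space \<times> real \<Rightarrow> ennreal"
  assumes [measurable]: "H \<in> borel_measurable borel"
  shows "(\<integral>\<^sup>+x. (\<integral>\<^sup>+z\<in>cone x. H z * ennreal (1 / snd z ^ (DIM('a) + 1)) \<partial>lborel) \<partial>lborel)
      = ennreal (ubv TYPE('a)) * (\<integral>\<^sup>+z\<in>upper_half. H z * ennreal (1 / snd z) \<partial>lborel)"
proof -
  have "(\<integral>\<^sup>+x. (\<integral>\<^sup>+z\<in>cone x. H z * ennreal (1 / snd z ^ (DIM('a) + 1)) \<partial>lborel) \<partial>lborel)
    = (\<integral>\<^sup>+z\<in>upper_half. (\<integral>\<^sup>+x\<in>ball (fst z) (snd z). H z * ennreal (1 / snd z ^ (DIM('a) + 1)) \<partial>lborel) \<partial>lborel)"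
    by (rule cone_Fubini) measurable
  also have "\<dots> = (\<integral>\<^sup>+z. ennreal (ubv TYPE('a)) * (H z * ennreal (1 / snd z) * indicator upper_half z) \<partial>lborel)"
  proof (intro nn_integral_cong)
    fix z :: "'a \<times> real"
    show "(\<integral>\<^sup>+x\<in>ball (fst z) (snd z). H z * ennreal (1 / snd z ^ (DIM('a) + 1)) \<partial>lborel) * indicator upper_half z
      = ennreal (ubv TYPE('a)) * (H z * ennreal (1 / snd z) * indicator upper_half z)"
    proof (cases "z \<in> upper_half")
      case True
      then have t: "snd z > 0" by (simp add: upper_half_def)
      have "ennreal (1 / snd z ^ (DIM('a) + 1)) * ennreal (ubv TYPE('a) * snd z ^ DIM('a)) = ennreal (ubv TYPE('a)) * ennreal (1 / snd z)"
        using t by (simp flip: ennreal_mult)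
      then have "H z * (ennreal (1 / snd z ^ (DIM('a) + 1)) * ennreal (ubv TYPE('a) * snd z ^ DIM('a))) = H z * (ennreal (ubv TYPE('a)) * ennreal (1 / snd z))"
        by (rule arg_cong)
      moreover have "(\<integral>\<^sup>+x\<in>ball (fst z) (snd z). H z * ennreal (1 / snd z ^ (DIM('a) + 1)) \<partial>lborel)
          = H z * ennreal (1 / snd z ^ (DIM('a) + 1)) * ennreal (ubv TYPE('a) * snd z ^ DIM('a))"
        using t by (subst nn_integral_cmult_indicator) (auto simp: emeasure_ball_ubv)
      ultimately show ?thesis using True by (simp only: mult_ac)
    qed simp
  qed
  also have "\<dots> = ennreal (ubv TYPE('a)) * (\<integral>\<^sup>+z\<in>upper_half. H z * ennreal (1 / snd z) \<partial>lborel)"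
    by (rule nn_integral_cmult) measurable
  finally show ?thesis .
qed

lemma cone_Holder:
  fixes F G :: "'a::euclidean_space \<times> real \<Rightarrow> ennreal"
  assumes [measurable]: "F \<in> borel_measurable borel" "G \<in> borel_measurable borel" and q: "q > 1"
  shows "(\<integral>\<^sup>+z\<in>cone x. F z * G z * ennreal (1 / snd z ^ (DIM('a) + 1)) \<partial>lborel)
    \<le> epow (area q F x) (1 / q) * epow (area (q / (q - 1)) G x) (1 / (q / (q - 1)))"
proof -
  let ?w = "\<lambda>z. ennreal (1 / snd z ^ (DIM('a) + 1)) * indicator (cone x) z"
  let ?N = "density lborel ?w"
  have eq: "(\<integral>\<^sup>+z\<in>cone x. H z * ennreal (1 / snd z ^ (DIM('a) + 1)) \<partial>lborel) = (\<integral>\<^sup>+z. H z \<partial>?N)"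
    if [measurable]: "H \<in> borel_measurable borel" for H :: "'a \<times> real \<Rightarrow> ennreal"
    by (subst nn_integral_density) (auto simp: mult_ac)
  have FG: "(\<integral>\<^sup>+z\<in>cone x. F z * G z * ennreal (1 / snd z ^ (DIM('a) + 1)) \<partial>lborel) = (\<integral>\<^sup>+z. F z * G z \<partial>?N)"
    and F: "area q F x = (\<integral>\<^sup>+z. epow (F z) q \<partial>?N)"
    and G: "area (q / (q - 1)) G x = (\<integral>\<^sup>+z. epow (G z) (q / (q - 1)) \<partial>?N)"
    unfolding area_def by (rule eq, measurable)+
  show ?thesis unfolding FG F G by (rule nn_Holder) (use q in auto)
qed

text \<open>Superlevel sets are unions of balls B(y,t), hence open: the nontangential maximal
  function is lower semicontinuous whatever G is.\<close>

lemma SUP_cone_measurable [measurable]: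
  fixes G :: "'a::euclidean_space \<times> real \<Rightarrow> ennreal"
  shows "(\<lambda>x. SUP z\<in>cone x. G z) \<in> borel_measurable borel"
proof (rule borel_measurableI_greater)
  fix c
  have "{x \<in> space borel. c < (SUP z\<in>cone x. G z)} = (\<Union>z\<in>{z. c < G z \<and> snd z > 0}. ball (fst z) (snd z))"
    by (fastforce simp: less_SUP_iff cone_def Bex_def)
  also have "\<dots> \<in> sets borel" by (intro borel_open) auto
  finally show "{x \<in> space borel. c < (SUP z\<in>cone x. G z)} \<in> sets borel" .
qed

text \<open>Hoelder's inequality twice: with q and q' inside each cone, then with p and p' over the
  vertices. For q = 1 the inner step bounds G by its supremum over the cone.\<close>

lemma tent_duality_finite:
  fixes F G :: "'a::euclidean_space \<times> real \<Rightarrow> ennreal"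
  assumes [measurable]: "F \<in> borel_measurable borel" "G \<in> borel_measurable borel" and p: "p > 1" and q: "q \<ge> 1"
  shows "ennreal (ubv TYPE('a)) * (\<integral>\<^sup>+z\<in>upper_half. F z * G z * ennreal (1 / snd z) \<partial>lborel)
    \<le> tent_norm (ereal p) (ereal q) F * tent_norm (conj_exp p) (conj_exp q) G"
proof -
  define p' where "p' = p / (p - 1)"
  define q' where "q' = q / (q - 1)"
  define A where "A x = epow (area q F x) (1 / q)" for x
  define B where "B x = (if q = 1 then (SUP z\<in>cone x. G z) else epow (area q' G x) (1 / q'))" for x
  have [measurable]: "A \<in> borel_measurable borel" "B \<in> borel_measurable borel"
    unfolding A_def B_def by measurable
  have "(\<integral>\<^sup>+z\<in>cone x. F z * G z * ennreal (1 / snd z ^ (DIM('a) + 1)) \<partial>lborel) \<le> A x * B x" for x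
  proof (cases "q = 1")
    case True
    have "(\<integral>\<^sup>+z\<in>cone x. F z * G z * ennreal (1 / snd z ^ (DIM('a) + 1)) \<partial>lborel)
      \<le> (\<integral>\<^sup>+z. (F z * ennreal (1 / snd z ^ (DIM('a) + 1)) * indicator (cone x) z) * (SUP z\<in>cone x. G z) \<partial>lborel)"
    proof (intro nn_integral_mono)
      fix z
      show "F z * G z * ennreal (1 / snd z ^ (DIM('a) + 1)) * indicator (cone x) z
        \<le> (F z * ennreal (1 / snd z ^ (DIM('a) + 1)) * indicator (cone x) z) * (SUP z\<in>cone x. G z)"
        using mult_left_mono[OF SUP_upper[of z "cone x" G], of "F z * ennreal (1 / snd z ^ (DIM('a) + 1))"]
        by (cases "z \<in> cone x") (simp_all add: mult_ac)
    qed
    also have "\<dots> = A x * B x"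
      using True by (subst nn_integral_multc) (auto simp: A_def B_def area_def)
    finally show ?thesis .
  next
    case False
    then show ?thesis using cone_Holder[of F G q x] q by (simp add: A_def B_def q'_def)
  qed
  then have "(\<integral>\<^sup>+x. (\<integral>\<^sup>+z\<in>cone x. F z * G z * ennreal (1 / snd z ^ (DIM('a) + 1)) \<partial>lborel) \<partial>lborel) \<le> (\<integral>\<^sup>+x. A x * B x \<partial>lborel)"
    by (rule nn_integral_mono)
  also have "\<dots> \<le> epow (\<integral>\<^sup>+x. epow (A x) p \<partial>lborel) (1 / p) * epow (\<integral>\<^sup>+x. epow (B x) p' \<partial>lborel) (1 / p')"
    unfolding p'_def by (intro nn_Holder p) measurable
  also have "epow (\<integral>\<^sup>+x. epow (A x) p \<partial>lborel) (1 / p) = tent_norm (ereal p) (ereal q) F"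
    by (simp add: A_def epow_epow tent_norm_real)
  also have "epow (\<integral>\<^sup>+x. epow (B x) p' \<partial>lborel) (1 / p') = tent_norm (conj_exp p) (conj_exp q) G"
    using p by (auto simp: B_def epow_epow tent_norm_real tent_norm_nontangential conj_exp_def p'_def q'_def mult_ac)
  finally show ?thesis
    using cone_Fubini_const[of "\<lambda>z. F z * G z"] by (simp only: borel_measurable_times_ennreal assms)
qed

text \<open>By \<open>cone_Fubini_const\<close> the first norm is \<open>ubv\<close> times the L^1
  norm for dy dt/t, while the second is an essential supremum.\<close>

lemma tent_duality_11:
  fixes F G :: "'a::euclidean_space \<times> real \<Rightarrow> ennreal"
  assumes [measurable]: "F \<in> borel_measurable borel" "G \<in> borel_measurable borel"
  shows "ennreal (ubv TYPE('a)) * (\<integral>\<^sup>+z\<in>upper_half. F z * G z * ennreal (1 / snd z) \<partial>lborel)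
    \<le> tent_norm (ereal 1) (ereal 1) F * tent_norm (conj_exp 1) (conj_exp 1) G"
proof -
  define E where "E = esssup_on upper_half G"
  have "AE z in lborel. z \<in> upper_half \<longrightarrow> G z \<le> E"
    using AE_le_esssup_on[of upper_half G] by (simp add: AE_completion_iff E_def)
  then have "(\<integral>\<^sup>+z\<in>upper_half. F z * G z * ennreal (1 / snd z) \<partial>lborel) \<le> (\<integral>\<^sup>+z. (F z * ennreal (1 / snd z) * indicator upper_half z) * E \<partial>lborel)"
  proof (intro nn_integral_mono_AE, elim eventually_mono)
    fix z assume "z \<in> upper_half \<longrightarrow> G z \<le> E"
    then show "F z * G z * ennreal (1 / snd z) * indicator upper_half z \<le> F z * ennreal (1 / snd z) * indicator upper_half z * E"
      using mult_left_mono[of "G z" E "F z * ennreal (1 / snd z)"]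
      by (cases "z \<in> upper_half") (simp_all add: mult_ac)
  qed
  also have "\<dots> = (\<integral>\<^sup>+z\<in>upper_half. F z * ennreal (1 / snd z) \<partial>lborel) * E"
    by (rule nn_integral_multc) measurable
  finally have "ennreal (ubv TYPE('a)) * (\<integral>\<^sup>+z\<in>upper_half. F z * G z * ennreal (1 / snd z) \<partial>lborel)
    \<le> ennreal (ubv TYPE('a)) * ((\<integral>\<^sup>+z\<in>upper_half. F z * ennreal (1 / snd z) \<partial>lborel) * E)"
    by (rule mult_left_mono) simp
  also have "\<dots> = (\<integral>\<^sup>+x. area 1 F x \<partial>lborel) * E"
    unfolding area_def epow_one cone_Fubini_const[OF assms(1)] by (simp only: mult.assoc)
  finally show ?thesis by (simp add: tent_norm_real conj_exp_def tent_norm_infty E_def)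
qed

text \<open>Monotone convergence asks for a sequence, whereas the admissible truncation heights at a
  point form an interval with lower end 0 that may or may not contain its upper end. If there is no
  maximum, running maxima of an enumeration of the rational points exhaust it from inside.\<close>

lemma down_closed_cofinal_sequence:
  fixes T :: "real set"
  assumes "T \<noteq> {}" and down: "\<And>s t. t \<in> T \<Longrightarrow> 0 < s \<Longrightarrow> s \<le> t \<Longrightarrow> s \<in> T" and pos: "\<And>t. t \<in> T \<Longrightarrow> t > 0"
  obtains \<tau> :: "nat \<Rightarrow> real" where "incseq \<tau>" "\<And>k. \<tau> k \<in> T" "\<And>t. t \<in> T \<Longrightarrow> \<exists>k. t \<le> \<tau> k"
proof (cases "\<exists>m\<in>T. \<forall>t\<in>T. t \<le> m")
  case True
  then obtain m where "m \<in> T" "\<forall>t\<in>T. t \<le> m" by auto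
  then show ?thesis by (intro that[of "\<lambda>_. m"]) (auto simp: incseq_def)
next
  case False
  define D where "D = T \<inter> \<rat>"
  have D: "\<exists>d\<in>D. t \<le> d" if t: "t \<in> T" for t
  proof -
    obtain u where u: "u \<in> T" "t < u" using False t by (meson not_le)
    obtain d where d: "d \<in> \<rat>" "t < d" "d < u" using Rats_dense_in_real[OF u(2)] by auto
    then have "d \<in> D" using down[OF u(1), of d] pos[OF t] by (simp add: D_def)
    then show ?thesis using d by (auto intro: less_imp_le)
  qed
  have ne: "D \<noteq> {}" using D assms(1) by auto
  have cD: "countable D" unfolding D_def by (simp add: countable_rat)
  define d where "d = from_nat_into D"
  have dT: "d k \<in> T" for k using from_nat_into[OF ne] by (auto simp: d_def D_def)
  define \<tau> where "\<tau> k = Max (d ` {..k})" for k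
  have "\<tau> k \<in> d ` {..k}" for k unfolding \<tau>_def by (rule Max_in) auto
  then have "\<tau> k \<in> T" for k using dT by (metis imageE)
  moreover have "incseq \<tau>" unfolding \<tau>_def incseq_def by (auto intro!: Max_mono)
  moreover have "\<exists>k. t \<le> \<tau> k" if t: "t \<in> T" for t
  proof -
    obtain e where e: "e \<in> D" "t \<le> e" using D[OF t] by auto
    then obtain k where "d k = e" unfolding d_def by (metis cD from_nat_into_surj)
    then have "e \<le> \<tau> k" unfolding \<tau>_def by (auto intro: Max_ge)
    then show ?thesis using e by (auto intro: order_trans)
  qed
  ultimately show ?thesis by (intro that) auto
qed

text \<open>The stopping-time argument of Coifman, Meyer and Stein: by Chebyshev's inequality, for at least
  half of the points \<open>x\<close> of \<open>B(y,t)\<close> the area integral over the cone at \<open>x\<close> truncated at height \<open>t\<close>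
  is bounded by a multiple of the Carleson constant.\<close>

lemma tent_duality_Carleson:
  fixes F G :: "'a::euclidean_space \<times> real \<Rightarrow> ennreal"
  assumes [measurable]: "F \<in> borel_measurable borel" "G \<in> borel_measurable borel" and q: "q > 1"
  shows "(\<integral>\<^sup>+z\<in>upper_half. F z * G z * ennreal (1 / snd z) \<partial>lborel)
    \<le> ennreal (2 / ubv TYPE('a) * (2 * ubv TYPE('a) * 3 ^ DIM('a)) powr (1 / (q / (q - 1))))
       * tent_norm (ereal 1) (ereal q) F * tent_norm (conj_exp 1) (conj_exp q) G"
proof -
  define q' where "q' = q / (q - 1)"
  have q': "q' > 1" "conj_exp q = ereal q'" using q by (auto simp: q'_def conj_exp_def field_simps)
  define n where "n = DIM('a)"
  define w where "w z = ennreal (1 / snd z ^ (DIM('a) + 1))" for z :: "'a \<times> real"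
  have [measurable]: "w \<in> borel_measurable borel" unfolding w_def by measurable
  define K where "K = epow (tent_norm \<infinity> (ereal q') G) q'"
  \<comment> \<open>Twice the mean value bound proved in \<open>avg\<close>. The cones with vertex
    in B(y,t), truncated at height t, lie in the tent over B(y,3t), which costs 3^n; integrating out
    the vertex costs \<open>ubv\<close>.\<close>
  define \<Lambda> where "\<Lambda> = 2 * ennreal (ubv TYPE('a)) * ennreal (3 ^ n) * K"
  have K: "(\<integral>\<^sup>+z\<in>tent (ball c R). epow (G z) q' * ennreal (1 / snd z) \<partial>lborel) \<le> K * emeasure lborel (ball c R)"
    if "R > 0" for c :: 'a and R
  proof -
    have "epow ((\<integral>\<^sup>+z\<in>tent (ball c R). epow (G z) q' * ennreal (1 / snd z) \<partial>lborel) / emeasure lborel (ball c R)) (1 / q') \<le> tent_norm \<infinity> (ereal q') G"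
      unfolding tent_norm_Carleson using that
      by (intro SUP_upper2[of c] SUP_upper2[of "ball c R"] order_refl) (auto intro!: exI[of _ c] exI[of _ R])
    then have le: "(\<integral>\<^sup>+z\<in>tent (ball c R). epow (G z) q' * ennreal (1 / snd z) \<partial>lborel) / emeasure lborel (ball c R) \<le> K"
      using q' by (simp add: epow_le_iff K_def)
    have V: "emeasure lborel (ball c R) = ennreal (ubv TYPE('a) * R ^ n)" "ubv TYPE('a) * R ^ n > 0"
      using that by (auto simp: emeasure_ball_ubv n_def)
    have "X = X / ennreal v * ennreal v" if "v > 0" for X v
      using that by (simp add: ennreal_divide_times mult_divide_eq_ennreal)
    from this[OF V(2), of "\<integral>\<^sup>+z\<in>tent (ball c R). epow (G z) q' * ennreal (1 / snd z) \<partial>lborel"]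
    show ?thesis using mult_right_mono[OF le, of "emeasure lborel (ball c R)"] by (simp only: V zero_le)
  qed
  \<comment> \<open>The area integral over the cone at x truncated at height t. Joint measurability
    in (x,t) is needed because t will become the height of the integration variable.\<close>
  define A where "A x t = (\<integral>\<^sup>+z\<in>cone x. epow (G z) q' * w z * indicator {z. snd z \<le> t} z \<partial>lborel)" for x t
  have A_meas [measurable]: "(\<lambda>(x, t). A x t) \<in> borel_measurable (borel \<Otimes>\<^sub>M borel)"
  proof -
    have "(\<lambda>(xt, z). epow (G z) q' * w z * indicator {v. snd (snd v) \<le> snd (fst v)} (xt, z) * indicator {v. snd v \<in> cone (fst (fst v))} (xt, z))
        \<in> borel_measurable ((borel \<Otimes>\<^sub>M borel) \<Otimes>\<^sub>M borel)"
    proof -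
      have [measurable]: "Measurable.pred ((borel \<Otimes>\<^sub>M borel) \<Otimes>\<^sub>M borel) (\<lambda>v. snd v \<in> cone (fst (fst v) :: 'a))"
        unfolding cone_def by (simp add: split_beta') measurable
      show ?thesis by (simp add: split_beta')
    qed
    then have "(\<lambda>xt. \<integral>\<^sup>+z. epow (G z) q' * w z * indicator {v. snd (snd v) \<le> snd (fst v)} (xt, z) * indicator {v. snd v \<in> cone (fst (fst v))} (xt, z) \<partial>lborel)
        \<in> borel_measurable (borel \<Otimes>\<^sub>M borel)"
      by (intro lborel.borel_measurable_nn_integral) (simp only: borel_measurable_pair_lborel)
    then show ?thesis by (simp add: A_def split_beta' indicator_def)
  qed
  have avg: "(\<integral>\<^sup>+x\<in>ball y t. A x t \<partial>lborel) * 2 \<le> \<Lambda> * emeasure lborel (ball y t)" if t: "t > 0" for y t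
  proof -
    have "(\<integral>\<^sup>+x\<in>ball y t. A x t \<partial>lborel)
      = (\<integral>\<^sup>+x. (\<integral>\<^sup>+z\<in>cone x. (epow (G z) q' * w z * indicator {z. snd z \<le> t} z) * indicator (ball y t) x \<partial>lborel) \<partial>lborel)"
      unfolding A_def by (intro nn_integral_cong) (auto simp: indicator_def)
    also have "\<dots> = (\<integral>\<^sup>+z\<in>upper_half. (\<integral>\<^sup>+x\<in>ball (fst z) (snd z). (epow (G z) q' * w z * indicator {z. snd z \<le> t} z) * indicator (ball y t) x \<partial>lborel) \<partial>lborel)"
    proof (rule cone_Fubini)
      have [measurable]: "(\<lambda>v. indicator (ball y t) (fst v) :: ennreal) \<in> borel_measurable (borel \<Otimes>\<^sub>M (borel :: ('a \<times> real) measure))"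
        by (rule measurable_compose[OF measurable_fst]) (auto intro!: borel_measurable_indicator)
      show "(\<lambda>(x, z). epow (G z) q' * w z * indicator {z. snd z \<le> t} z * indicator (ball y t) x) \<in> borel_measurable (borel \<Otimes>\<^sub>M borel)"
        by (simp add: split_beta')
    qed
    also have "\<dots> \<le> (\<integral>\<^sup>+z. ennreal (ubv TYPE('a)) * (epow (G z) q' * ennreal (1 / snd z) * indicator (tent (ball y (3 * t))) z) \<partial>lborel)"
    proof (intro nn_integral_mono)
      fix z :: "'a \<times> real"
      show "(\<integral>\<^sup>+x\<in>ball (fst z) (snd z). (epow (G z) q' * w z * indicator {z. snd z \<le> t} z) * indicator (ball y t) x \<partial>lborel) * indicator upper_half z
        \<le> ennreal (ubv TYPE('a)) * (epow (G z) q' * ennreal (1 / snd z) * indicator (tent (ball y (3 * t))) z)"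
      proof (cases "z \<in> upper_half \<and> snd z \<le> t \<and> ball (fst z) (snd z) \<inter> ball y t \<noteq> {}")
        case True
        then have s: "snd z > 0" "snd z \<le> t" by (auto simp: upper_half_def)
        obtain x where "dist (fst z) x < snd z" "dist y x < t" using True by auto
        \<comment> \<open>A common point of the two balls puts their centers at distance below 2t;
          adding the radius \<open>snd z\<close> \<le> t stays within 3t.\<close>
        then have "dist (fst z) y < snd z + t" by (smt (verit) dist_triangle dist_commute)
        then have tent: "z \<in> tent (ball y (3 * t))"
          using s by (cases z) (auto simp: tent_def ball_subset_ball_iff)
        have "(\<integral>\<^sup>+x\<in>ball (fst z) (snd z). (epow (G z) q' * w z * indicator {z. snd z \<le> t} z) * indicator (ball y t) x \<partial>lborel)
          \<le> (\<integral>\<^sup>+x. (epow (G z) q' * w z) * indicator (ball (fst z) (snd z)) x \<partial>lborel)"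
          by (intro nn_integral_mono) (auto simp: indicator_def)
        also have "\<dots> = epow (G z) q' * w z * ennreal (ubv TYPE('a) * snd z ^ n)"
          using s by (subst nn_integral_cmult_indicator) (auto simp: emeasure_ball_ubv n_def)
        also have "\<dots> = epow (G z) q' * (w z * ennreal (ubv TYPE('a) * snd z ^ n))" by (simp add: mult.assoc)
        also have "w z * ennreal (ubv TYPE('a) * snd z ^ n) = ennreal (ubv TYPE('a)) * ennreal (1 / snd z)"
          using s by (simp add: w_def n_def flip: ennreal_mult)
        finally show ?thesis using tent True by (simp add: mult_ac)
      next
        case False
        show ?thesis
        proof (cases "z \<in> upper_half")
          case True
          with False have "(\<lambda>x. (epow (G z) q' * w z * indicator {z. snd z \<le> t} z) * indicator (ball y t) x * indicator (ball (fst z) (snd z)) x) = (\<lambda>_. 0)"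
            by (auto simp: indicator_def fun_eq_iff)
          then show ?thesis by (simp only:) simp
        qed simp
      qed
    qed
    also have "\<dots> = ennreal (ubv TYPE('a)) * (\<integral>\<^sup>+z\<in>tent (ball y (3 * t)). epow (G z) q' * ennreal (1 / snd z) \<partial>lborel)"
      by (rule nn_integral_cmult) measurable
    also have "\<dots> \<le> ennreal (ubv TYPE('a)) * (K * emeasure lborel (ball y (3 * t)))"
      using t by (intro mult_left_mono K) auto
    also have "emeasure lborel (ball y (3 * t)) = ennreal (3 ^ n) * emeasure lborel (ball y t)"
      using t by (simp add: emeasure_ball_ubv n_def power_mult_distrib mult_ac flip: ennreal_mult)
    finally have "(\<integral>\<^sup>+x\<in>ball y t. A x t \<partial>lborel) * 2 \<le> ennreal (ubv TYPE('a)) * (K * (ennreal (3 ^ n) * emeasure lborel (ball y t))) * 2"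
      by (rule mult_right_mono) simp
    then show ?thesis by (simp add: \<Lambda>_def mult_ac)
  qed
  \<comment> \<open>The extreme values of \<Lambda> are separated because Chebyshev's inequality
    divides by it: for \<Lambda> = \<infinity> every vertex is good, and for \<Lambda> = 0 the
    truncated integral vanishes almost everywhere on the ball.\<close>
  have half: "emeasure lborel (ball y t) \<le> 2 * (\<integral>\<^sup>+x\<in>ball y t. indicator {x. A x t \<le> \<Lambda>} x \<partial>lborel)" if t: "t > 0" for y t
  proof (cases "\<Lambda> = top")
    case True
    have "1 * emeasure lborel (ball y t) \<le> 2 * emeasure lborel (ball y t)" by (rule mult_right_mono) auto
    then show ?thesis using True by simp
  next
    case False
    define V where "V = emeasure lborel (ball y t)"
    have V: "V \<noteq> top" using t by (simp add: V_def emeasure_ball_ubv)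
    have [measurable]: "(\<lambda>x. A x t) \<in> borel_measurable borel"
      using measurable_compose[OF measurable_Pair2'[of t borel borel] A_meas] by simp
    define U where "U = (\<integral>\<^sup>+x\<in>ball y t. indicator {x. \<not> A x t \<le> \<Lambda>} x \<partial>lborel)"
    define L where "L = (\<integral>\<^sup>+x\<in>ball y t. indicator {x. A x t \<le> \<Lambda>} x \<partial>lborel)"
    have sum: "V = L + U"
    proof -
      have "V = (\<integral>\<^sup>+x. indicator (ball y t) x \<partial>lborel)" by (simp add: V_def)
      also have "\<dots> = (\<integral>\<^sup>+x. indicator {x. A x t \<le> \<Lambda>} x * indicator (ball y t) x + indicator {x. \<not> A x t \<le> \<Lambda>} x * indicator (ball y t) x \<partial>lborel)"
        by (intro nn_integral_cong) (auto simp: indicator_def)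
      also have "\<dots> = L + U" unfolding L_def U_def by (rule nn_integral_add) measurable
      finally show ?thesis .
    qed
    have "U * 2 \<le> V"
    proof (cases "\<Lambda> = 0")
      case True
      then have "(\<integral>\<^sup>+x\<in>ball y t. A x t \<partial>lborel) = 0" using avg[OF t, of y] by simp
      then have "AE x in lborel. A x t * indicator (ball y t) x = 0" by (subst (asm) nn_integral_0_iff_AE) auto
      then have "AE x in lborel. indicator {x. \<not> A x t \<le> \<Lambda>} x * indicator (ball y t) x = (0 :: ennreal)"
        using True by (elim eventually_mono) (auto simp: indicator_def)
      then have "U = (\<integral>\<^sup>+x. 0 \<partial>(lborel :: 'a measure))" unfolding U_def by (intro nn_integral_cong_AE)
      then show ?thesis by simp
    next
      case pos: False
      have "\<Lambda> * U = (\<integral>\<^sup>+x. \<Lambda> * (indicator {x. \<not> A x t \<le> \<Lambda>} x * indicator (ball y t) x) \<partial>lborel)"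
        unfolding U_def by (rule nn_integral_cmult[symmetric]) measurable
      also have "\<dots> \<le> (\<integral>\<^sup>+x\<in>ball y t. A x t \<partial>lborel)"
        by (intro nn_integral_mono) (auto simp: indicator_def not_le intro: less_imp_le)
      finally have "\<Lambda> * (U * 2) \<le> (\<integral>\<^sup>+x\<in>ball y t. A x t \<partial>lborel) * 2"
        unfolding mult.assoc[symmetric] by (rule mult_right_mono) simp
      also have "\<dots> \<le> \<Lambda> * V" using avg[OF t] by (simp add: V_def)
      finally show ?thesis using pos False by (simp add: ennreal_mult_le_mult_iff)
    qed
    moreover have "U \<noteq> top" "L \<noteq> top" using sum V by auto
    ultimately have "U \<le> L"
      using sum by (simp add: mult_2_right add.commute[of L] ennreal_add_left_cancel_le)
    then have "V \<le> 2 * L"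
      unfolding sum mult_2 by (rule add_left_mono)
    then show ?thesis by (simp add: V_def L_def)
  qed
  \<comment> \<open>\<open>\<eta> x z\<close> = 1 says that z is not above the stopping height of x.
    Inserting this factor costs only a factor 2 by \<open>half\<close>, and it leaves an area
    integral of G that is at most \<Lambda> at every vertex.\<close>
  define \<eta> where "\<eta> x z = (indicator {x. A x (snd z) \<le> \<Lambda>} x :: ennreal)" for x and z :: "'a \<times> real"
  have \<eta>_meas [measurable]: "(\<lambda>(x, z). \<eta> x z) \<in> borel_measurable (borel \<Otimes>\<^sub>M borel)"
  proof -
    have [measurable]: "(\<lambda>v. A (fst v) (snd (snd v))) \<in> borel_measurable (borel \<Otimes>\<^sub>M (borel :: ('a \<times> real) measure))"
      using measurable_compose[OF measurable_Pair[OF measurable_fst[of borel borel] measurable_compose[OF measurable_snd measurable_snd_borel]] A_meas]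
      by simp
    have "(\<lambda>v. indicator {v. A (fst v) (snd (snd v)) \<le> \<Lambda>} v :: ennreal) \<in> borel_measurable (borel \<Otimes>\<^sub>M (borel :: ('a \<times> real) measure))"
      by measurable
    then show ?thesis by (simp add: \<eta>_def indicator_def split_beta')
  qed
  have \<eta>_meas' [measurable]: "\<eta> x \<in> borel_measurable borel" for x
    using measurable_compose[OF measurable_Pair1'[of x borel borel] \<eta>_meas] by simp
  have \<eta>_sq: "epow (H * \<eta> x z) a = epow H a * \<eta> x z" for H x z a
    by (simp add: \<eta>_def indicator_def)
  have stop: "area q' (\<lambda>z. G z * \<eta> x z) x \<le> \<Lambda>" for x
  proof -
    \<comment> \<open>The admissible heights at x. As \<open>A x\<close> increases with t, they form
      an initial interval, and the part of the cone kept by \<eta> is exhausted by the truncations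
      along a cofinal sequence of heights.\<close>
    define T where "T = {t. t > 0 \<and> A x t \<le> \<Lambda>}"
    show ?thesis
    proof (cases "T = {}")
      case True
      then have "area q' (\<lambda>z. G z * \<eta> x z) x = (\<integral>\<^sup>+z. 0 \<partial>(lborel :: ('a \<times> real) measure))"
        unfolding area_def by (intro nn_integral_cong) (auto simp: \<eta>_def indicator_def T_def cone_def)
      then show ?thesis by simp
    next
      case False
      have Amono: "A x s \<le> A x t" if "s \<le> t" for s t
        unfolding A_def using that by (intro nn_integral_mono) (auto simp: indicator_def)
      have Tdown: "s \<in> T" if "t \<in> T" "0 < s" "s \<le> t" for s t
        using that Amono[OF that(3)] by (auto simp: T_def intro: order_trans)
      have Tpos: "t > 0" if "t \<in> T" for t using that by (simp add: T_def)
      obtain \<tau> where \<tau>: "incseq \<tau>" "\<And>k. \<tau> k \<in> T" "\<And>t. t \<in> T \<Longrightarrow> \<exists>k. t \<le> \<tau> k"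
        by (rule down_closed_cofinal_sequence[of T]; use False Tdown Tpos in blast)
      have "area q' (\<lambda>z. G z * \<eta> x z) x \<le> (\<integral>\<^sup>+z. (SUP k. epow (G z) q' * w z * indicator {z. snd z \<le> \<tau> k} z * indicator (cone x) z) \<partial>lborel)"
        unfolding area_def
      proof (intro nn_integral_mono)
        fix z :: "'a \<times> real"
        show "epow (G z * \<eta> x z) q' * ennreal (1 / snd z ^ (DIM('a) + 1)) * indicator (cone x) z
          \<le> (SUP k. epow (G z) q' * w z * indicator {z. snd z \<le> \<tau> k} z * indicator (cone x) z)"
        proof (cases "z \<in> cone x \<and> A x (snd z) \<le> \<Lambda>")
          case True
          then have "snd z \<in> T" by (auto simp: T_def cone_def)
          then obtain k where k: "snd z \<le> \<tau> k" using \<tau>(3) by auto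
          show ?thesis
            by (rule SUP_upper2[of k]) (use k True in \<open>auto simp: \<eta>_def w_def\<close>)
        qed (auto simp: \<eta>_def indicator_def)
      qed
      also have "\<dots> = (SUP k. A x (\<tau> k))"
        unfolding A_def
      proof (rule nn_integral_monotone_convergence_SUP)
        show "incseq (\<lambda>k z. epow (G z) q' * w z * indicator {z. snd z \<le> \<tau> k} z * indicator (cone x) z)"
          using \<tau>(1) by (auto simp: incseq_def le_fun_def indicator_def intro: order_trans)
      qed measurable
      also have "\<dots> \<le> \<Lambda>" using \<tau>(2) by (intro SUP_least) (auto simp: T_def)
      finally show ?thesis .
    qed
  qed
  have [measurable]: "(\<lambda>(x, z). F z * G z * \<eta> x z * w z) \<in> borel_measurable (borel \<Otimes>\<^sub>M borel)"
    using \<eta>_meas by (simp add: split_beta')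
  \<comment> \<open>\<open>ubv\<close>/t is rewritten as |B(y,t)| / t^(n+1), so that |B(y,t)| can be
    replaced by twice the measure of the good vertices in that ball.\<close>
  have "ennreal (ubv TYPE('a)) * (\<integral>\<^sup>+z\<in>upper_half. F z * G z * ennreal (1 / snd z) \<partial>lborel)
     = (\<integral>\<^sup>+z. F z * G z * w z * emeasure lborel (ball (fst z) (snd z)) * indicator upper_half z \<partial>lborel)"
  proof (subst nn_integral_cmult[symmetric], measurable, intro nn_integral_cong)
    fix z :: "'a \<times> real"
    show "ennreal (ubv TYPE('a)) * (F z * G z * ennreal (1 / snd z) * indicator upper_half z)
      = F z * G z * w z * emeasure lborel (ball (fst z) (snd z)) * indicator upper_half z"
    proof (cases "z \<in> upper_half")
      case True
      then have t: "snd z > 0" by (simp add: upper_half_def)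
      have "w z * ennreal (ubv TYPE('a) * snd z ^ DIM('a)) = ennreal (ubv TYPE('a)) * ennreal (1 / snd z)"
        using t by (simp add: w_def flip: ennreal_mult)
      then have "F z * G z * (w z * ennreal (ubv TYPE('a) * snd z ^ DIM('a))) = F z * G z * (ennreal (ubv TYPE('a)) * ennreal (1 / snd z))"
        by (rule arg_cong)
      then show ?thesis using True t
        by (simp only: mult_ac) (simp add: emeasure_ball_ubv mult_ac)
    qed simp
  qed
  also have "\<dots> \<le> (\<integral>\<^sup>+z\<in>upper_half. 2 * (\<integral>\<^sup>+x\<in>ball (fst z) (snd z). F z * G z * \<eta> x z * w z \<partial>lborel) \<partial>lborel)"
  proof (intro nn_integral_mono)
    fix z :: "'a \<times> real"
    show "F z * G z * w z * emeasure lborel (ball (fst z) (snd z)) * indicator upper_half z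
      \<le> 2 * (\<integral>\<^sup>+x\<in>ball (fst z) (snd z). F z * G z * \<eta> x z * w z \<partial>lborel) * indicator upper_half z"
    proof (cases "z \<in> upper_half")
      case True
      then have t: "snd z > 0" by (simp add: upper_half_def)
      have [measurable]: "(\<lambda>x. \<eta> x z) \<in> borel_measurable borel"
        using measurable_compose[OF measurable_Pair2'[of z borel borel] \<eta>_meas] by simp
      have "(\<integral>\<^sup>+x\<in>ball (fst z) (snd z). F z * G z * \<eta> x z * w z \<partial>lborel)
        = (\<integral>\<^sup>+x. (F z * G z * w z) * (\<eta> x z * indicator (ball (fst z) (snd z)) x) \<partial>lborel)"
        by (intro nn_integral_cong) (simp add: mult_ac)
      also have "\<dots> = (F z * G z * w z) * (\<integral>\<^sup>+x\<in>ball (fst z) (snd z). \<eta> x z \<partial>lborel)"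
        by (rule nn_integral_cmult) measurable
      finally have eq: "2 * (\<integral>\<^sup>+x\<in>ball (fst z) (snd z). F z * G z * \<eta> x z * w z \<partial>lborel)
        = (F z * G z * w z) * (2 * (\<integral>\<^sup>+x\<in>ball (fst z) (snd z). \<eta> x z \<partial>lborel))"
        by (simp add: mult_ac)
      show ?thesis unfolding eq using True half[OF t, of "fst z"]
        by (simp add: \<eta>_def mult_left_mono)
    qed simp
  qed
  also have "\<dots> = 2 * (\<integral>\<^sup>+x. (\<integral>\<^sup>+z\<in>cone x. F z * G z * \<eta> x z * w z \<partial>lborel) \<partial>lborel)"
  proof (subst cone_Fubini)
    have m: "(\<lambda>z. \<integral>\<^sup>+x\<in>ball (fst z) (snd z). F z * G z * \<eta> x z * w z \<partial>lborel) \<in> borel_measurable borel"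
    proof (rule lborel.borel_measurable_nn_integral)
      have "(\<lambda>(z, x). F z * G z * \<eta> x z * w z * indicator {v. dist (fst (fst v)) (snd v) < snd (fst v)} (z, x)) \<in> borel_measurable (borel \<Otimes>\<^sub>M borel)"
        using measurable_compose[OF measurable_Pair[OF measurable_snd measurable_fst] \<eta>_meas] by (simp add: split_beta')
      then show "(\<lambda>(z, x). F z * G z * \<eta> x z * w z * indicator (ball (fst z) (snd z)) x) \<in> borel_measurable (borel \<Otimes>\<^sub>M lborel)"
        by (simp add: indicator_def split_beta' borel_measurable_pair_lborel)
    qed
    show "(\<integral>\<^sup>+z\<in>upper_half. 2 * (\<integral>\<^sup>+x\<in>ball (fst z) (snd z). F z * G z * \<eta> x z * w z \<partial>lborel) \<partial>lborel)
      = 2 * (\<integral>\<^sup>+z\<in>upper_half. (\<integral>\<^sup>+x\<in>ball (fst z) (snd z). F z * G z * \<eta> x z * w z \<partial>lborel) \<partial>lborel)"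
      unfolding mult.assoc[of 2]
      by (intro nn_integral_cmult borel_measurable_times_ennreal) (use m in \<open>auto intro!: borel_measurable_indicator\<close>)
  qed measurable
  also have "\<dots> \<le> 2 * (\<integral>\<^sup>+x. epow (area q F x) (1 / q) * epow \<Lambda> (1 / q') \<partial>lborel)"
  proof (intro mult_left_mono nn_integral_mono)
    fix x :: 'a
    have "(\<integral>\<^sup>+z\<in>cone x. F z * G z * \<eta> x z * w z \<partial>lborel) \<le> epow (area q F x) (1 / q) * epow (area q' (\<lambda>z. G z * \<eta> x z) x) (1 / q')"
      using cone_Holder[OF _ _ q, of F "\<lambda>z. G z * \<eta> x z" x] by (simp add: q'_def w_def mult_ac)
    also have "\<dots> \<le> epow (area q F x) (1 / q) * epow \<Lambda> (1 / q')"
      using q' by (intro mult_left_mono epow_mono stop) auto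
    finally show "(\<integral>\<^sup>+z\<in>cone x. F z * G z * \<eta> x z * w z \<partial>lborel) \<le> epow (area q F x) (1 / q) * epow \<Lambda> (1 / q')" .
  qed simp
  also have "\<dots> = 2 * (tent_norm (ereal 1) (ereal q) F * epow \<Lambda> (1 / q'))"
    by (simp add: nn_integral_multc tent_norm_real)
  also have "epow \<Lambda> (1 / q') = ennreal ((2 * ubv TYPE('a) * 3 ^ n) powr (1 / q')) * tent_norm \<infinity> (ereal q') G"
  proof -
    have "\<Lambda> = ennreal (2 * ubv TYPE('a) * 3 ^ n) * K"
      by (simp add: \<Lambda>_def ennreal_mult)
    then show ?thesis using q' by (simp add: epow_mult epow_ennreal K_def)
  qed
  finally have fin: "ennreal (ubv TYPE('a)) * (\<integral>\<^sup>+z\<in>upper_half. F z * G z * ennreal (1 / snd z) \<partial>lborel)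
     \<le> 2 * (tent_norm (ereal 1) (ereal q) F * (ennreal ((2 * ubv TYPE('a) * 3 ^ n) powr (1 / q')) * tent_norm \<infinity> (ereal q') G))" .
  have "(\<integral>\<^sup>+z\<in>upper_half. F z * G z * ennreal (1 / snd z) \<partial>lborel) = ennreal (1 / ubv TYPE('a)) * (ennreal (ubv TYPE('a)) * (\<integral>\<^sup>+z\<in>upper_half. F z * G z * ennreal (1 / snd z) \<partial>lborel))"
    by (simp add: mult.assoc[symmetric] flip: ennreal_mult)
  also have "\<dots> \<le> ennreal (1 / ubv TYPE('a)) * (2 * (tent_norm (ereal 1) (ereal q) F * (ennreal ((2 * ubv TYPE('a) * 3 ^ n) powr (1 / q')) * tent_norm \<infinity> (ereal q') G)))"
    by (intro mult_left_mono fin) simp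
  also have "\<dots> = ennreal (2 / ubv TYPE('a) * (2 * ubv TYPE('a) * 3 ^ n) powr (1 / q')) * tent_norm (ereal 1) (ereal q) F * tent_norm \<infinity> (ereal q') G"
  proof -
    have "ennreal (2 / ubv TYPE('a) * (2 * ubv TYPE('a) * 3 ^ n) powr (1 / q')) = ennreal (1 / ubv TYPE('a)) * 2 * ennreal ((2 * ubv TYPE('a) * 3 ^ n) powr (1 / q'))"
      by (simp flip: ennreal_mult ennreal_numeral)
    then show ?thesis by (simp add: mult_ac)
  qed
  finally show ?thesis using q' by (simp add: conj_exp_def q'_def n_def)
qed

section \<open>Weighted tent space norms\<close>

context whitney_params
begin

text \<open>\<open>whitney_Fubini\<close> and Hoelder's inequality in each box reduce the pairing of
  F and G to the tent space pairing of their Whitney averages. Only p = 1 < q requires the Carleson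
  estimate.\<close>

theorem duality_upper_bound:
  assumes p: "p \<ge> 1" and q: "q \<ge> 1" and r: "r \<ge> 1"
  shows "\<exists>C>0. \<forall>F G :: 'a::euclidean_space \<times> real \<Rightarrow> ennreal.
    F \<in> borel_measurable lebesgue \<longrightarrow> G \<in> borel_measurable lebesgue \<longrightarrow>
    (\<integral>\<^sup>+z\<in>upper_half. F z * G z * ennreal (1 / snd z) \<partial>lborel) \<le>
      ennreal C * tent_norm (ereal p) (ereal q) (WA (ereal r) F) * tent_norm (conj_exp p) (conj_exp q) (WA (conj_exp r) G)"
proof -
  have "\<exists>C>0. \<forall>F G :: 'a \<times> real \<Rightarrow> ennreal. F \<in> borel_measurable borel \<longrightarrow> G \<in> borel_measurable borel \<longrightarrow>
    (\<integral>\<^sup>+z\<in>upper_half. F z * G z * ennreal (1 / snd z) \<partial>lborel) \<le>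
      ennreal C * tent_norm (ereal p) (ereal q) F * tent_norm (conj_exp p) (conj_exp q) G"
  proof (cases "p = 1 \<and> q > 1")
    case True
    then show ?thesis
      using tent_duality_Carleson[where ?'a='a, of _ _ q]
      by (intro exI[of _ "2 / ubv TYPE('a) * (2 * ubv TYPE('a) * 3 ^ DIM('a)) powr (1 / (q / (q - 1)))"]) auto
  next
    case False
    have "(\<integral>\<^sup>+z\<in>upper_half. F z * G z * ennreal (1 / snd z) \<partial>lborel) \<le>
      ennreal (1 / ubv TYPE('a)) * tent_norm (ereal p) (ereal q) F * tent_norm (conj_exp p) (conj_exp q) G"
      if [measurable]: "F \<in> borel_measurable borel" "G \<in> borel_measurable borel" for F G :: "'a \<times> real \<Rightarrow> ennreal"
    proof -
      have le: "ennreal (ubv TYPE('a)) * (\<integral>\<^sup>+z\<in>upper_half. F z * G z * ennreal (1 / snd z) \<partial>lborel) \<le> tent_norm (ereal p) (ereal q) F * tent_norm (conj_exp p) (conj_exp q) G"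
      proof (cases "p = 1")
        case True
        with False q have "q = 1" by simp
        with True show ?thesis using tent_duality_11[of F G] by simp
      next
        case False
        then show ?thesis using tent_duality_finite[of F G p q] p q by simp
      qed
      have "(\<integral>\<^sup>+z\<in>upper_half. F z * G z * ennreal (1 / snd z) \<partial>lborel) =
        ennreal (1 / ubv TYPE('a)) * (ennreal (ubv TYPE('a)) * (\<integral>\<^sup>+z\<in>upper_half. F z * G z * ennreal (1 / snd z) \<partial>lborel))"
        by (simp add: mult.assoc[symmetric] flip: ennreal_mult)
      also have "\<dots> \<le> ennreal (1 / ubv TYPE('a)) * (tent_norm (ereal p) (ereal q) F * tent_norm (conj_exp p) (conj_exp q) G)"
        by (intro mult_left_mono le) simp
      finally show ?thesis by (simp add: mult.assoc)
    qed
    then show ?thesis by (intro exI[of _ "1 / ubv TYPE('a)"]) auto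
  qed
  then obtain C where C: "C > 0" "\<And>F G :: 'a \<times> real \<Rightarrow> ennreal. F \<in> borel_measurable borel \<Longrightarrow> G \<in> borel_measurable borel \<Longrightarrow>
    (\<integral>\<^sup>+z\<in>upper_half. F z * G z * ennreal (1 / snd z) \<partial>lborel) \<le>
      ennreal C * tent_norm (ereal p) (ereal q) F * tent_norm (conj_exp p) (conj_exp q) G" by blast
  define D where "D = (\<alpha>2 ^ 2) ^ (DIM('a) + 1)"
  have D: "D > 0" unfolding D_def using \<alpha>2_pos by (intro zero_less_power) simp
  show ?thesis
  proof (intro exI[of _ "D * C"] conjI allI impI)
    show "0 < D * C" using D C by simp
    fix F G :: "'a \<times> real \<Rightarrow> ennreal"
    assume F: "F \<in> borel_measurable lebesgue" and G: "G \<in> borel_measurable lebesgue"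
    obtain F0 where F0 [measurable]: "F0 \<in> borel_measurable borel" and FF: "AE z in lborel. F z = F0 z"
      using borel_version[OF F] .
    obtain G0 where G0 [measurable]: "G0 \<in> borel_measurable borel" and GG: "AE z in lborel. G z = G0 z"
      using borel_version[OF G] .
    have [measurable]: "WA a F0 \<in> borel_measurable borel" "WA a G0 \<in> borel_measurable borel" for a
      by (intro wav_measurable borel_measurable_lebesgueI F0 G0)+
    have "(\<integral>\<^sup>+z\<in>upper_half. F z * G z * ennreal (1 / snd z) \<partial>lborel) = (\<integral>\<^sup>+z\<in>upper_half. (F0 z * G0 z) * ennreal (1 / snd z) \<partial>lborel)"
      by (rule nn_integral_cong_AE) (use FF GG in \<open>eventually_elim, simp\<close>)
    also have "\<dots> \<le> ennreal D * (\<integral>\<^sup>+yt\<in>upper_half. (\<integral>\<^sup>+z\<in>W yt. F0 z * G0 z \<partial>lborel) / emeasure lborel (W yt) * ennreal (1 / snd yt) \<partial>lborel)"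
      unfolding D_def by (rule whitney_Fubini) measurable
    also have "\<dots> \<le> ennreal D * (\<integral>\<^sup>+yt\<in>upper_half. WA (ereal r) F0 yt * WA (conj_exp r) G0 yt * ennreal (1 / snd yt) \<partial>lborel)"
    proof (intro mult_left_mono nn_integral_mono)
      fix yt :: "'a \<times> real"
      show "(\<integral>\<^sup>+z\<in>W yt. F0 z * G0 z \<partial>lborel) / emeasure lborel (W yt) * ennreal (1 / snd yt) * indicator upper_half yt
        \<le> WA (ereal r) F0 yt * WA (conj_exp r) G0 yt * ennreal (1 / snd yt) * indicator upper_half yt"
        using wav_Holder[OF F0 G0 r, of "snd yt" "fst yt"]
        by (cases "yt \<in> upper_half") (auto simp: upper_half_def intro!: mult_right_mono)
    qed simp
    also have "\<dots> \<le> ennreal D * (ennreal C * tent_norm (ereal p) (ereal q) (WA (ereal r) F0) * tent_norm (conj_exp p) (conj_exp q) (WA (conj_exp r) G0))"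
      by (intro mult_left_mono C) auto
    also have "\<dots> = ennreal (D * C) * tent_norm (ereal p) (ereal q) (WA (ereal r) F) * tent_norm (conj_exp p) (conj_exp q) (WA (conj_exp r) G)"
      using D C by (simp add: ennreal_mult mult.assoc wav_cong_AE[OF FF] wav_cong_AE[OF GG])
    finally show "(\<integral>\<^sup>+z\<in>upper_half. F z * G z * ennreal (1 / snd z) \<partial>lborel) \<le>
      ennreal (D * C) * tent_norm (ereal p) (ereal q) (WA (ereal r) F) * tent_norm (conj_exp p) (conj_exp q) (WA (conj_exp r) G)" .
  qed
qed

section \<open>The norm of the primal space: monotonicity, scaling, order continuity\<close>

definition TN :: "real \<Rightarrow> real \<Rightarrow> real \<Rightarrow> ('a::euclidean_space \<times> real \<Rightarrow> ennreal) \<Rightarrow> ennreal" where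
  "TN p q r F = tent_norm (ereal p) (ereal q) (WA (ereal r) F)"

lemma area_mono:
  assumes "q \<ge> 0" "\<And>z. z \<in> upper_half \<Longrightarrow> g z \<le> h z"
  shows "area q g x \<le> area q h x"
  unfolding area_def using assms
  by (intro nn_integral_mono) (auto simp: indicator_def cone_def upper_half_def intro!: mult_right_mono epow_mono)

lemma TN_mono:
  assumes "p \<ge> 1" "q \<ge> 1" "r \<ge> 1" "AE z in lborel. z \<in> upper_half \<longrightarrow> F z \<le> F0 z"
  shows "TN p q r F \<le> TN p q r F0"
  unfolding TN_def tent_norm_real using assms
  by (intro epow_mono nn_integral_mono area_mono wav_mono) (auto simp: upper_half_def)

lemma area_scale:
  fixes g :: "'a::euclidean_space \<times> real \<Rightarrow> ennreal"
  assumes [measurable]: "g \<in> borel_measurable borel" and "c > 0"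
  shows "area q (\<lambda>z. ennreal c * g z) x = epow (ennreal c) q * area q g x"
proof -
  have "area q (\<lambda>z. ennreal c * g z) x = (\<integral>\<^sup>+z. epow (ennreal c) q * (epow (g z) q * ennreal (1 / snd z ^ (DIM('a) + 1)) * indicator (cone x) z) \<partial>lborel)"
    unfolding area_def by (intro nn_integral_cong) (simp add: epow_mult mult.assoc)
  also have "\<dots> = epow (ennreal c) q * area q g x"
    unfolding area_def by (rule nn_integral_cmult) measurable
  finally show ?thesis .
qed

lemma TN_scale:
  fixes F :: "'a::euclidean_space \<times> real \<Rightarrow> ennreal"
  assumes "p \<ge> 1" "q \<ge> 1" "r \<ge> 1" and F: "F \<in> borel_measurable lebesgue" and c: "c > 0"
  shows "TN p q r (\<lambda>z. ennreal c * F z) = ennreal c * TN p q r F"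
proof -
  have [measurable]: "WA (ereal r) F \<in> borel_measurable borel" using F by (rule wav_measurable)
  have "WA (ereal r) (\<lambda>z. ennreal c * F z) = (\<lambda>yt. ennreal c * WA (ereal r) F yt)"
    using wav_scale[OF F c, of "ereal r"] assms by (auto simp: fun_eq_iff)
  then have "TN p q r (\<lambda>z. ennreal c * F z) = epow (\<integral>\<^sup>+x. epow (ennreal c) p * epow (area q (WA (ereal r) F) x) (p / q) \<partial>lborel) (1 / p)"
    using assms unfolding TN_def tent_norm_real by (simp add: area_scale epow_mult epow_epow)
  also have "(\<integral>\<^sup>+x. epow (ennreal c) p * epow (area q (WA (ereal r) F) x) (p / q) \<partial>lborel) = epow (ennreal c) p * (\<integral>\<^sup>+x. epow (area q (WA (ereal r) F) x) (p / q) \<partial>lborel)"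
    by (rule nn_integral_cmult) measurable
  finally show ?thesis using assms unfolding TN_def tent_norm_real by (simp add: epow_mult)
qed

lemma wav_order_continuous:
  fixes F :: "'a::euclidean_space \<times> real \<Rightarrow> ennreal"
  assumes r: "r \<ge> 1" and F: "F \<in> borel_measurable lebesgue" and fin: "WA (ereal r) F yt < top" and t: "snd yt > 0"
    and Fk: "\<And>k. Fk k \<in> borel_measurable lebesgue"
    and le: "\<And>k. AE z in lborel. z \<in> upper_half \<longrightarrow> Fk k z \<le> F z"
    and lim: "AE z in lborel. z \<in> upper_half \<longrightarrow> (\<lambda>k. Fk k z) \<longlonglongrightarrow> 0"
  shows "(\<lambda>k. WA (ereal r) (Fk k) yt) \<longlonglongrightarrow> 0"
proof -
  obtain y s where yt: "yt = (y, s)" "s > 0" using t by (cases yt) auto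
  define v where "v = wvol TYPE('a) * s ^ (DIM('a) + 1)"
  have v: "v > 0" "emeasure lborel (W yt) = ennreal v"
    using yt by (simp_all add: v_def emeasure_whitney)
  have m: "(\<lambda>z. epow (H z) r * indicator (W yt) z) \<in> borel_measurable lebesgue" if "H \<in> borel_measurable lebesgue" for H :: "'a \<times> real \<Rightarrow> ennreal"
    using that by (intro borel_measurable_times_ennreal borel_measurable_epow borel_measurable_indicator) auto
  have sub: "z \<in> upper_half" if "z \<in> W yt" for z using whitney_subset_upper_half[OF t] that by auto
  have "(\<lambda>k. \<integral>\<^sup>+z. epow (Fk k z) r * indicator (W yt) z \<partial>lebesgue) \<longlonglongrightarrow> (\<integral>\<^sup>+z. 0 \<partial>(lebesgue :: ('a \<times> real) measure))"
  proof (rule nn_integral_dominated_convergence[where w = "\<lambda>z. epow (F z) r * indicator (W yt) z"])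
    show "AE z in lebesgue. epow (Fk k z) r * indicator (W yt) z \<le> epow (F z) r * indicator (W yt) z" for k
      unfolding AE_completion_iff using le[of k]
      by eventually_elim (use r sub in \<open>auto simp: indicator_def intro!: epow_mono\<close>)
    show "AE z in lebesgue. (\<lambda>k. epow (Fk k z) r * indicator (W yt) z) \<longlonglongrightarrow> 0"
      unfolding AE_completion_iff using lim
      by eventually_elim (use r sub in \<open>auto simp: indicator_def intro!: tendsto_epow_0\<close>)
    have "(\<integral>\<^sup>+z. epow (F z) r * indicator (W yt) z \<partial>lborel) / ennreal v < top"
      using fin r v by (simp add: wav_def nn_integral_completion)
    then show "(\<integral>\<^sup>+z. epow (F z) r * indicator (W yt) z \<partial>lebesgue) < \<infinity>"
      using v by (simp add: nn_integral_completion less_top[symmetric] ennreal_divide_eq_top_iff)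
  qed (use m F Fk in auto)
  then have "(\<lambda>k. ennreal (1 / v) * (\<integral>\<^sup>+z. epow (Fk k z) r * indicator (W yt) z \<partial>lebesgue)) \<longlonglongrightarrow> ennreal (1 / v) * (\<integral>\<^sup>+z. 0 \<partial>(lebesgue :: ('a \<times> real) measure))"
    by (intro ennreal_tendsto_cmult) auto
  then have "(\<lambda>k. epow (ennreal (1 / v) * (\<integral>\<^sup>+z. epow (Fk k z) r * indicator (W yt) z \<partial>lebesgue)) (1 / r)) \<longlonglongrightarrow> 0"
    using r by (intro tendsto_epow_0) auto
  then show ?thesis
    using v r by (simp add: wav_def divide_ennreal_def inverse_ennreal inverse_eq_divide mult.commute)
qed

text \<open>Dominated convergence at three levels: in the Whitney box, in the cone and over the
  vertices. Finiteness of the norm of F provides, almost everywhere, a finite dominating value at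
  each inner level. It is essential that all three exponents are finite, since suprema are not order
  continuous.\<close>

lemma TN_order_continuous:
  fixes F :: "'a::euclidean_space \<times> real \<Rightarrow> ennreal"
  assumes pqr: "p \<ge> 1" "q \<ge> 1" "r \<ge> 1" and F: "F \<in> borel_measurable lebesgue" and fin: "TN p q r F < top"
    and Fk: "\<And>k. Fk k \<in> borel_measurable lebesgue"
    and le: "\<And>k. AE z in lborel. z \<in> upper_half \<longrightarrow> Fk k z \<le> F z"
    and lim: "AE z in lborel. z \<in> upper_half \<longrightarrow> (\<lambda>k. Fk k z) \<longlonglongrightarrow> 0"
  shows "(\<lambda>k. TN p q r (Fk k)) \<longlonglongrightarrow> 0"
proof -
  define g where "g = WA (ereal r) F"
  define gk where "gk k = WA (ereal r) (Fk k)" for k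
  have [measurable]: "g \<in> borel_measurable borel" "\<And>k. gk k \<in> borel_measurable borel"
    unfolding g_def gk_def using F Fk by (auto intro: wav_measurable)
  have gle: "gk k z \<le> g z" if "z \<in> upper_half" for k z
    unfolding g_def gk_def using that le[of k] pqr by (intro wav_mono) (auto simp: upper_half_def)
  have g0: "(\<lambda>k. gk k z) \<longlonglongrightarrow> 0" if "z \<in> upper_half" "g z < top" for z
    unfolding gk_def using that pqr F Fk le lim
    by (intro wav_order_continuous[of r F]) (auto simp: upper_half_def g_def)
  have a0: "(\<lambda>k. area q (gk k) x) \<longlonglongrightarrow> 0" if fx: "area q g x < top" for x
  proof -
    have "AE z in lborel. epow (g z) q * ennreal (1 / snd z ^ (DIM('a) + 1)) * indicator (cone x) z \<noteq> \<infinity>"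
      using fx unfolding area_def by (intro nn_integral_PInf_AE) auto
    then have ae: "AE z in lborel. z \<in> cone x \<longrightarrow> g z < top"
      by eventually_elim (auto simp: cone_def less_top ennreal_mult_eq_top_iff)
    have "(\<lambda>k. area q (gk k) x) \<longlonglongrightarrow> (\<integral>\<^sup>+z. 0 \<partial>(lborel :: ('a \<times> real) measure))"
      unfolding area_def
    proof (rule nn_integral_dominated_convergence[where w = "\<lambda>z. epow (g z) q * ennreal (1 / snd z ^ (DIM('a) + 1)) * indicator (cone x) z"])
      show "(\<integral>\<^sup>+z\<in>cone x. epow (g z) q * ennreal (1 / snd z ^ (DIM('a) + 1)) \<partial>lborel) < \<infinity>"
        using fx by (simp add: area_def)
      show "AE z in lborel. epow (gk k z) q * ennreal (1 / snd z ^ (DIM('a) + 1)) * indicator (cone x) z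
         \<le> epow (g z) q * ennreal (1 / snd z ^ (DIM('a) + 1)) * indicator (cone x) z" for k
        using gle pqr by (intro AE_I2) (auto simp: indicator_def cone_def upper_half_def intro!: mult_right_mono epow_mono)
      show "AE z in lborel. (\<lambda>k. epow (gk k z) q * ennreal (1 / snd z ^ (DIM('a) + 1)) * indicator (cone x) z) \<longlonglongrightarrow> 0"
        using ae
      proof eventually_elim
        case (elim z)
        show ?case
        proof (cases "z \<in> cone x")
          case True
          then have "(\<lambda>k. epow (gk k z) q) \<longlonglongrightarrow> 0"
            using elim pqr by (intro tendsto_epow_0 g0) (auto simp: cone_def upper_half_def)
          then have "(\<lambda>k. ennreal (1 / snd z ^ (DIM('a) + 1)) * epow (gk k z) q) \<longlonglongrightarrow> ennreal (1 / snd z ^ (DIM('a) + 1)) * 0"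
            by (intro ennreal_tendsto_cmult) auto
          then show ?thesis using True by (simp add: mult.commute)
        qed simp
      qed
    qed measurable
    then show ?thesis by simp
  qed
  have "(\<integral>\<^sup>+x. epow (area q g x) (p / q) \<partial>lborel) < top"
    using fin by (simp add: TN_def tent_norm_real g_def)
  then have "AE x in lborel. epow (area q g x) (p / q) \<noteq> \<infinity>"
    by (intro nn_integral_PInf_AE) auto
  then have ae: "AE x in lborel. area q g x < top"
    by eventually_elim (simp add: less_top)
  have "(\<lambda>k. \<integral>\<^sup>+x. epow (area q (gk k) x) (p / q) \<partial>lborel) \<longlonglongrightarrow> (\<integral>\<^sup>+x. 0 \<partial>(lborel :: 'a measure))"
  proof (rule nn_integral_dominated_convergence[where w = "\<lambda>x. epow (area q g x) (p / q)"])
    show "(\<integral>\<^sup>+x. epow (area q g x) (p / q) \<partial>lborel) < \<infinity>" by (simp; fact)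
    show "AE x in lborel. epow (area q (gk k) x) (p / q) \<le> epow (area q g x) (p / q)" for k
      using gle pqr by (intro AE_I2 epow_mono area_mono) auto
    show "AE x in lborel. (\<lambda>k. epow (area q (gk k) x) (p / q)) \<longlonglongrightarrow> 0"
      using ae by eventually_elim (use pqr in \<open>auto intro!: tendsto_epow_0 a0\<close>)
  qed measurable
  then show ?thesis
    unfolding TN_def tent_norm_real gk_def[symmetric] using pqr by (intro tendsto_epow_0) auto
qed

end

section \<open>Discrete duality on nested families of sets\<close>

text \<open>By homogeneity y = u x with 0 \<le> u \<le> 1, and the claim becomes 1 - u^a \<le> max 1
  (a/b) (1 - u^b). For a \<le> b powers of u decrease in the exponent; for a > b this is Bernoulli's
  inequality for v = u^b, obtained here from Young's inequality.\<close>

lemma powr_diff_le: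
  fixes a b x y :: real
  assumes ab: "a > 0" "b > 0" and xy: "0 \<le> y" "y \<le> x" "x > 0"
  shows "x powr a - y powr a \<le> max 1 (a / b) * (x powr (a - b) * (x powr b - y powr b))"
proof -
  define u where "u = y / x"
  have u: "0 \<le> u" "u \<le> 1" using xy by (auto simp: u_def)
  have "1 - u powr a \<le> max 1 (a / b) * (1 - u powr b)"
  proof (cases "a \<le> b")
    case True
    then have "u powr b \<le> u powr a" using u ab by (cases "u = 0") (auto intro: powr_mono')
    moreover have "u powr b \<le> 1" using u ab by (auto intro: powr_le1)
    then have "1 * (1 - u powr b) \<le> max 1 (a / b) * (1 - u powr b)" by (intro mult_right_mono) auto
    ultimately show ?thesis by simp
  next
    case False
    define c where "c = a / b"
    have c: "c > 1" using False ab by (simp add: c_def)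
    define v where "v = u powr b"
    have v: "0 \<le> v" "u powr a = v powr c" using ab by (auto simp: v_def c_def powr_powr)
    have "v * 1 \<le> v powr c / c + 1 powr (c / (c - 1)) / (c / (c - 1))"
      using c v by (intro Youngs_inequality) (auto simp: field_simps)
    then have "v \<le> (1 / c) * v powr c + (1 - 1 / c)" using c by (simp add: diff_divide_distrib)
    then have "c * v \<le> c * ((1 / c) * v powr c + (1 - 1 / c))" using c by (intro mult_left_mono) auto
    then have "1 - v powr c \<le> c * (1 - v)" using c by (simp add: algebra_simps)
    then show ?thesis using c v by (simp add: v_def c_def)
  qed
  then have "x powr a * (1 - u powr a) \<le> x powr a * (max 1 (a / b) * (1 - u powr b))"
    by (intro mult_left_mono) auto
  moreover have "x powr a * (1 - u powr a) = x powr a - y powr a" "x powr b * (1 - u powr b) = x powr b - y powr b"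
    using xy by (simp_all add: right_diff_distrib u_def flip: powr_mult)
  moreover have "x powr a * (max 1 (a / b) * (1 - u powr b)) = max 1 (a / b) * (x powr (a - b) * (x powr b * (1 - u powr b)))"
    using xy by (simp flip: powr_add mult.assoc)
  ultimately show ?thesis by simp
qed

text \<open>One step of an l^(q') partial sum: \<open>G\<close> is the value so far and
  \<open>b\<close> the next term. The maximum is the case q' = \<infinity>.\<close>

definition conj_comb :: "real \<Rightarrow> real \<Rightarrow> real \<Rightarrow> real" where
  "conj_comb q G b = (if q = 1 then max G b
     else (G powr (q / (q - 1)) + b powr (q / (q - 1))) powr (1 / (q / (q - 1))))"

lemma conj_comb_ge:
  assumes "q \<ge> 1" "G \<ge> 0" "b \<ge> 0"
  shows "G \<le> conj_comb q G b" "b \<le> conj_comb q G b" "b = 0 \<Longrightarrow> conj_comb q G b = G"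
proof -
  have *: "x \<le> (x powr s + y powr s) powr (1 / s)" if "s > 1" "x \<ge> 0" "y \<ge> 0" for x y s :: real
  proof -
    have "(x powr s) powr (1 / s) \<le> (x powr s + y powr s) powr (1 / s)" using that by (intro powr_mono2) auto
    then show ?thesis using that by (simp add: powr_powr)
  qed
  have q1: "q \<noteq> 1 \<Longrightarrow> q / (q - 1) > 1" using assms by (simp add: field_simps)
  show "G \<le> conj_comb q G b" using *[OF q1, of G b] assms by (auto simp: conj_comb_def)
  show "b \<le> conj_comb q G b" using *[OF q1, of b G] assms by (auto simp: conj_comb_def add.commute)
  show "b = 0 \<Longrightarrow> conj_comb q G b = G" using q1 assms by (auto simp: conj_comb_def powr_powr)
qed

text \<open>The factors stem from two uses of \<open>powr_diff_le\<close> in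
  \<open>conj_comb_step\<close>: one with exponents p' and q', raised to the power q - 1, the other
  with p' and (p' - 1) q. For q = 1 the first factor equals 1.\<close>

definition chain_const :: "real \<Rightarrow> real \<Rightarrow> real" where
  "chain_const p' q = (max 1 (p' / (q / (q - 1)))) powr (q - 1) * max 1 (p' / ((p' - 1) * q))"

text \<open>The coefficient \<open>a\<close> is a difference quotient of the p'-th power of the
  partial sum. Its increment D = a b has two bounds, one by b^q' and one by the increment of the
  power s = (p' - 1) q. In D^q = D^(q-1) D the first bound is used on D^(q-1) and the second on D;
  then the powers of x cancel and b^q divides out.\<close>

lemma conj_comb_step:
  assumes q: "q \<ge> 1" and p': "p' > 1" and G: "G \<ge> 0" and b: "b \<ge> 0"
  defines "x \<equiv> conj_comb q G b"
  defines "a \<equiv> (x powr p' - G powr p') / b"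
  shows "a \<ge> 0" "a * b = x powr p' - G powr p'"
    "a powr q \<le> chain_const p' q * (x powr ((p' - 1) * q) - G powr ((p' - 1) * q))"
proof -
  have Gx: "G \<le> x" unfolding x_def using conj_comb_ge[OF q G b] by simp
  then have D0: "x powr p' - G powr p' \<ge> 0" using G p' by (simp add: powr_mono2)
  show "a \<ge> 0" using D0 b by (simp add: a_def)
  have "b = 0 \<Longrightarrow> x = G" unfolding x_def using conj_comb_ge[OF q G b] by simp
  then show "a * b = x powr p' - G powr p'" by (auto simp: a_def)
  define s where "s = (p' - 1) * q"
  have s: "s > 0" using p' q by (simp add: s_def)
  have C0: "chain_const p' q \<ge> 0" by (simp add: chain_const_def)
  show "a powr q \<le> chain_const p' q * (x powr ((p' - 1) * q) - G powr ((p' - 1) * q))"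
    unfolding s_def[symmetric]
  proof (cases "b = 0 \<or> x = G")
    case True
    then have "a powr q = 0" by (auto simp: a_def)
    then show "a powr q \<le> chain_const p' q * (x powr s - G powr s)"
      using C0 Gx G s by (auto intro!: mult_nonneg_nonneg powr_mono2)
  next
    case False
    then have bp: "b > 0" and x: "x > G" "x > 0" using b Gx G by auto
    define D where "D = x powr p' - G powr p'"
    have Dp: "D > 0" unfolding D_def using x G p' by (simp add: powr_less_mono2)
    define C2 where "C2 = max 1 (p' / s)"
    have D2: "D \<le> C2 * (x powr (p' - s) * (x powr s - G powr s))"
      unfolding D_def C2_def using p' s x G by (intro powr_diff_le) auto
    show "a powr q \<le> chain_const p' q * (x powr s - G powr s)"
    proof (cases "q = 1")
      case True
      \<comment> \<open>For q = 1 the combination is a maximum, so a value above G can only be b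
        itself. Dividing by b is then dividing by x, and the second bound alone suffices.\<close>
      then have xb: "x = b" using x by (auto simp: x_def conj_comb_def max_def split: if_splits)
      have "D / x \<le> C2 * (x powr (p' - s) * (x powr s - G powr s)) / x"
        using D2 x by (intro divide_right_mono) auto
      also have "x powr (p' - s) = x" using True x by (simp add: s_def)
      finally have "a \<le> C2 * (x powr s - G powr s)" using x by (simp add: a_def D_def xb[symmetric])
      then show ?thesis using \<open>a \<ge> 0\<close> True by (simp add: chain_const_def C2_def s_def)
    next
      case False
      define q' where "q' = q / (q - 1)"
      have q': "q' > 1" "q' * (q - 1) = q" using False q by (auto simp: q'_def field_simps)
      have xq: "x powr q' = G powr q' + b powr q'"
        using False q' by (simp add: x_def conj_comb_def q'_def[symmetric] powr_powr)
      define C1 where "C1 = max 1 (p' / q')"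
      have D1: "D \<le> C1 * (x powr (p' - q') * b powr q')"
        using powr_diff_le[of p' q' G x] p' q' x G by (simp add: D_def C1_def xq)
      have "D powr q = D powr (q - 1) * D" using Dp by (simp add: powr_mult_base mult.commute)
      also have "\<dots> \<le> (C1 * (x powr (p' - q') * b powr q')) powr (q - 1) * (C2 * (x powr (p' - s) * (x powr s - G powr s)))"
        using D1 D2 Dp q by (intro mult_mono powr_mono2) auto
      also have "(C1 * (x powr (p' - q') * b powr q')) powr (q - 1) = C1 powr (q - 1) * x powr ((p' - q') * (q - 1)) * b powr q"
        using q' by (simp add: powr_mult powr_powr C1_def)
      also have "C1 powr (q - 1) * x powr ((p' - q') * (q - 1)) * b powr q * (C2 * (x powr (p' - s) * (x powr s - G powr s)))
         = (C1 powr (q - 1) * C2) * (x powr ((p' - q') * (q - 1)) * x powr (p' - s)) * b powr q * (x powr s - G powr s)"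
        by (simp add: mult_ac)
      also have "x powr ((p' - q') * (q - 1)) * x powr (p' - s) = 1"
      proof -
        have "(p' - q') * (q - 1) + (p' - s) = 0"
          using q'(2) by (simp add: s_def algebra_simps)
        then show ?thesis using x by (simp flip: powr_add)
      qed
      also have "C1 powr (q - 1) * C2 = chain_const p' q"
        by (simp add: chain_const_def C1_def C2_def s_def q'_def)
      finally have "D powr q \<le> chain_const p' q * (x powr s - G powr s) * b powr q" by (simp add: mult_ac)
      moreover have "a powr q = D powr q / b powr q"
        using Dp bp by (simp add: a_def D_def[symmetric] powr_divide)
      ultimately show ?thesis using bp by (simp add: divide_le_eq)
    qed
  qed
qed

text \<open>Partial sums at x in the order of the indices. In the application the indices run from
  coarse sets to fine ones, so that on \<open>Q i\<close> the value before step i depends only on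
  the sets that contain \<open>Q i\<close>.\<close>

primrec chain_sum :: "real \<Rightarrow> (nat \<Rightarrow> 'a set) \<Rightarrow> (nat \<Rightarrow> real) \<Rightarrow> 'a \<Rightarrow> nat \<Rightarrow> real" where
  "chain_sum q Q b x 0 = 0"
| "chain_sum q Q b x (Suc i) = (if x \<in> Q i then conj_comb q (chain_sum q Q b x i) (b i) else chain_sum q Q b x i)"

lemma chain_sum_nonneg: "q \<ge> 1 \<Longrightarrow> (\<And>i. b i \<ge> 0) \<Longrightarrow> chain_sum q Q b x i \<ge> 0"
  by (induction i) (auto intro: order_trans[OF _ conj_comb_ge(1)])

lemma chain_sum_eq:
  assumes "\<And>j. j < i \<Longrightarrow> x \<in> Q j \<longleftrightarrow> y \<in> Q j"
  shows "chain_sum q Q b x i = chain_sum q Q b y i"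
  using assms by (induction i) auto

lemma chain_sum_powr:
  assumes "q > 1" "\<And>i. b i \<ge> 0"
  shows "chain_sum q Q b x N powr (q / (q - 1)) = (\<Sum>i<N. b i powr (q / (q - 1)) * indicator (Q i) x)"
proof (induction N)
  case (Suc N)
  have "q / (q - 1) > 0" using assms by simp
  then show ?case using Suc assms by (auto simp: conj_comb_def powr_powr add_nonneg_nonneg sum_nonneg)
qed (use assms in auto)

lemma chain_sum_ge:
  assumes "q \<ge> 1" "\<And>i. b i \<ge> 0" "i < N" "x \<in> Q i"
  shows "b i \<le> chain_sum q Q b x N"
  using assms(3)
proof (induction N)
  case (Suc N)
  have c: "chain_sum q Q b x N \<ge> 0" using assms by (intro chain_sum_nonneg)
  note ge = conj_comb_ge[OF assms(1) c assms(2)[of N]]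
  show ?case
  proof (cases "i = N")
    case True then show ?thesis using ge assms(4) by simp
  next
    case False
    then have "b i \<le> chain_sum q Q b x N" using Suc by simp
    then show ?thesis using ge by auto
  qed
qed simp

text \<open>Before step i the partial sum is constant on \<open>Q i\<close>, because each earlier
  set contains \<open>Q i\<close> or misses it. The quotient of \<open>conj_comb_step\<close> is
  therefore one number per set, and both sums over the sets through x telescope, the second as an
  inequality.\<close>

lemma chain_sum_duality:
  assumes q: "q \<ge> 1" and p': "p' > 1" and b: "\<And>i. b i \<ge> 0"
    and nest: "\<And>i j. j < i \<Longrightarrow> i < N \<Longrightarrow> Q i \<subseteq> Q j \<or> Q i \<inter> Q j = {}"
  shows "\<exists>a. (\<forall>i. a i \<ge> 0) \<and>
    (\<forall>x. (\<Sum>i<N. a i * b i * indicator (Q i) x) = chain_sum q Q b x N powr p') \<and>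
    (\<forall>x. (\<Sum>i<N. a i powr q * indicator (Q i) x) \<le> chain_const p' q * chain_sum q Q b x N powr ((p' - 1) * q))"
proof -
  let ?S = "chain_sum q Q b"
  \<comment> \<open>Any point of \<open>Q i\<close> would do. For an empty \<open>Q i\<close> the
    choice is arbitrary, and the indicators never see the coefficient.\<close>
  define \<xi> where "\<xi> i = (SOME x. x \<in> Q i)" for i
  define a where "a i = (conj_comb q (?S (\<xi> i) i) (b i) powr p' - ?S (\<xi> i) i powr p') / b i" for i
  have S0: "?S x i \<ge> 0" for x i using q b by (intro chain_sum_nonneg)
  note step = conj_comb_step[OF q p' S0 b]
  have a: "a i = (?S x (Suc i) powr p' - ?S x i powr p') / b i" if "x \<in> Q i" "i < N" for x i
  proof -
    have "\<xi> i \<in> Q i" unfolding \<xi>_def using that by (intro someI)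
    then have "?S (\<xi> i) i = ?S x i" using nest that by (intro chain_sum_eq) blast
    then show ?thesis using that by (simp add: a_def)
  qed
  have "(\<Sum>i<M. a i * b i * indicator (Q i) x) = ?S x M powr p' \<and>
     (\<Sum>i<M. a i powr q * indicator (Q i) x) \<le> chain_const p' q * ?S x M powr ((p' - 1) * q)" if "M \<le> N" for M x
    using that
  proof (induction M)
    case (Suc M)
    show ?case
    proof (cases "x \<in> Q M")
      case True
      then show ?thesis using Suc step(2,3)[of x M M] a[OF True] by (auto simp: algebra_simps)
    next
      case False
      then show ?thesis using Suc by simp
    qed
  qed (use p' in auto)
  moreover have "a i \<ge> 0" for i unfolding a_def using step(1) .
  ultimately show ?thesis by blast
qed

definition disc_fun :: "real \<Rightarrow> (nat \<Rightarrow> 'a set) \<Rightarrow> (nat \<Rightarrow> ennreal) \<Rightarrow> 'a \<Rightarrow> ennreal" where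
  "disc_fun q Q b x = (if q = 1 then SUP i. b i * indicator (Q i) x
     else epow (\<Sum>i. epow (b i) (q / (q - 1)) * indicator (Q i) x) (1 / (q / (q - 1))))"

lemma disc_fun_measurable [measurable]:
  assumes [measurable]: "\<And>i. Q i \<in> sets M"
  shows "disc_fun q Q b \<in> borel_measurable M"
  unfolding disc_fun_def by measurable

text \<open>V is the integral of the p'-th power of the complete chain sum. The same number is the
  pairing of a with b and, as (p' - 1) p = p', it controls the p-th power of the norm of a. It is
  finite because only finitely many sets of finite measure occur.\<close>

lemma discrete_duality_sorted:
  fixes Q :: "nat \<Rightarrow> 'a set"
  assumes q: "q \<ge> 1" and p: "p > 1" and b: "\<And>i. b i \<ge> 0"
    and Q [measurable]: "\<And>i. Q i \<in> sets M" and fin: "\<And>i. emeasure M (Q i) < top"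
    and nest: "\<And>i j. j < i \<Longrightarrow> i < N \<Longrightarrow> Q i \<subseteq> Q j \<or> Q i \<inter> Q j = {}"
  defines "p' \<equiv> p / (p - 1)"
  shows "\<exists>a V. (\<forall>i. a i \<ge> 0) \<and> V < top \<and>
    (\<integral>\<^sup>+x. epow (disc_fun q Q (\<lambda>i. if i < N then ennreal (b i) else 0) x) p' \<partial>M) \<le> V \<and>
    (\<Sum>i<N. ennreal (a i * b i) * emeasure M (Q i)) = V \<and>
    (\<integral>\<^sup>+x. epow (\<Sum>i<N. ennreal (a i powr q) * indicator (Q i) x) (p / q) \<partial>M) \<le> ennreal (chain_const p' q powr (p / q)) * V"
proof -
  have p': "p' > 1" "(p' - 1) * p = p'" using p by (auto simp: p'_def field_simps)
  let ?S = "\<lambda>x. chain_sum q Q b x N"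
  have "\<exists>a. (\<forall>i. a i \<ge> 0) \<and> (\<forall>x. (\<Sum>i<N. a i * b i * indicator (Q i) x) = ?S x powr p') \<and>
    (\<forall>x. (\<Sum>i<N. a i powr q * indicator (Q i) x) \<le> chain_const p' q * ?S x powr ((p' - 1) * q))"
    by (rule chain_sum_duality) (fact q, fact p'(1), fact b, fact nest)
  then obtain a where a: "\<And>i. a i \<ge> 0" "\<And>x. (\<Sum>i<N. a i * b i * indicator (Q i) x) = ?S x powr p'"
    "\<And>x. (\<Sum>i<N. a i powr q * indicator (Q i) x) \<le> chain_const p' q * ?S x powr ((p' - 1) * q)"
    by blast
  have S0: "?S x \<ge> 0" for x using q b by (intro chain_sum_nonneg)
  have sum1: "(\<Sum>i<N. ennreal (a i * b i) * indicator (Q i) x) = ennreal (?S x powr p')" for x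
  proof -
    have "(\<Sum>i<N. ennreal (a i * b i) * indicator (Q i) x) = (\<Sum>i<N. ennreal (a i * b i * indicator (Q i) x))"
      using a b by (intro sum.cong) (auto simp: indicator_def)
    also have "\<dots> = ennreal (\<Sum>i<N. a i * b i * indicator (Q i) x)"
      using a b by (intro sum_ennreal) auto
    finally show ?thesis by (simp add: a)
  qed
  define V where "V = (\<Sum>i<N. ennreal (a i * b i) * emeasure M (Q i))"
  have "V < top" unfolding V_def using fin by (auto simp: ennreal_mult_less_top)
  have V: "V = (\<integral>\<^sup>+x. ennreal (?S x powr p') \<partial>M)"
    unfolding V_def sum1[symmetric] by (subst nn_integral_sum) (auto simp: nn_integral_cmult_indicator)
  have "disc_fun q Q (\<lambda>i. if i < N then ennreal (b i) else 0) x \<le> ennreal (?S x)" for x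
  proof (cases "q = 1")
    case True
    have "(if i < N then ennreal (b i) else 0) * indicator (Q i) x \<le> ennreal (?S x)" for i
    proof (cases "i < N \<and> x \<in> Q i")
      case True
      then show ?thesis using ennreal_leI[OF chain_sum_ge[OF q b, of i N x Q]] by simp
    qed auto
    then show ?thesis using True by (simp add: disc_fun_def SUP_least)
  next
    case False
    define q' where "q' = q / (q - 1)"
    have q': "q' > 1" using False q by (auto simp: q'_def field_simps)
    have "(\<Sum>i. epow (if i < N then ennreal (b i) else 0) q' * indicator (Q i) x) = (\<Sum>i<N. epow (ennreal (b i)) q' * indicator (Q i) x)"
      by (subst suminf_finite[of "{..<N}"]) auto
    also have "\<dots> = (\<Sum>i<N. ennreal (b i powr q' * indicator (Q i) x))"
      using b by (intro sum.cong) (auto simp: indicator_def epow_ennreal)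
    also have "\<dots> = ennreal (?S x powr q')"
      using chain_sum_powr[of q b Q x N] b False q by (subst sum_ennreal) (auto simp: q'_def)
    finally show ?thesis
      using False q' S0[of x] by (simp add: disc_fun_def q'_def[symmetric] epow_ennreal powr_powr)
  qed
  then have "(\<integral>\<^sup>+x. epow (disc_fun q Q (\<lambda>i. if i < N then ennreal (b i) else 0) x) p' \<partial>M) \<le> (\<integral>\<^sup>+x. epow (ennreal (?S x)) p' \<partial>M)"
    using p' by (intro nn_integral_mono epow_mono) auto
  then have 1: "(\<integral>\<^sup>+x. epow (disc_fun q Q (\<lambda>i. if i < N then ennreal (b i) else 0) x) p' \<partial>M) \<le> V"
    unfolding V using S0 by (simp add: epow_ennreal)
  have C0: "chain_const p' q \<ge> 0" by (simp add: chain_const_def)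
  have "(\<integral>\<^sup>+x. epow (\<Sum>i<N. ennreal (a i powr q) * indicator (Q i) x) (p / q) \<partial>M)
     \<le> (\<integral>\<^sup>+x. ennreal (chain_const p' q powr (p / q)) * ennreal (?S x powr p') \<partial>M)"
  proof (intro nn_integral_mono)
    fix x
    have "(\<Sum>i<N. ennreal (a i powr q) * indicator (Q i) x) = (\<Sum>i<N. ennreal (a i powr q * indicator (Q i) x))"
      by (intro sum.cong) (auto simp: indicator_def)
    also have "\<dots> = ennreal (\<Sum>i<N. a i powr q * indicator (Q i) x)"
      by (intro sum_ennreal) auto
    also have "\<dots> \<le> ennreal (chain_const p' q * ?S x powr ((p' - 1) * q))"
      by (intro ennreal_leI a)
    finally have "epow (\<Sum>i<N. ennreal (a i powr q) * indicator (Q i) x) (p / q) \<le> epow (ennreal (chain_const p' q * ?S x powr ((p' - 1) * q))) (p / q)"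
      using p q by (intro epow_mono) auto
    also have "\<dots> = ennreal (chain_const p' q powr (p / q)) * ennreal (?S x powr p')"
    proof -
      have "(p' - 1) * q * (p / q) = p'" using q p'(2) by simp
      then have "(chain_const p' q * ?S x powr ((p' - 1) * q)) powr (p / q) = chain_const p' q powr (p / q) * ?S x powr p'"
        using C0 by (simp add: powr_mult powr_powr)
      moreover have "0 \<le> chain_const p' q * ?S x powr ((p' - 1) * q)" using C0 by simp
      ultimately show ?thesis by (simp only: epow_ennreal ennreal_mult[OF powr_ge_zero powr_ge_zero])
    qed
    finally show "epow (\<Sum>i<N. ennreal (a i powr q) * indicator (Q i) x) (p / q) \<le> ennreal (chain_const p' q powr (p / q)) * ennreal (?S x powr p')" .
  qed
  also have "\<dots> = ennreal (chain_const p' q powr (p / q)) * V"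
    unfolding V
  proof (rule nn_integral_cmult)
    show "(\<lambda>x. ennreal (?S x powr p')) \<in> borel_measurable M"
      unfolding sum1[symmetric] by measurable
  qed
  finally show ?thesis using a(1) \<open>V < top\<close> 1 V_def by blast
qed

text \<open>Sorting by decreasing level puts coarse sets first and so produces the order that the
  chain sums require; all quantities involved are invariant under the permutation.\<close>

lemma discrete_duality:
  fixes Q :: "nat \<Rightarrow> 'a set" and level :: "nat \<Rightarrow> int"
  assumes q: "q \<ge> 1" and p: "p > 1" and b: "\<And>i. b i \<ge> 0"
    and Q [measurable]: "\<And>i. Q i \<in> sets M" and fin: "\<And>i. emeasure M (Q i) < top"
    and nest: "\<And>i j. level i \<le> level j \<Longrightarrow> Q i \<subseteq> Q j \<or> Q i \<inter> Q j = {}"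
  defines "p' \<equiv> p / (p - 1)"
  shows "\<exists>a V. (\<forall>i. a i \<ge> 0) \<and> V < top \<and>
    (\<integral>\<^sup>+x. epow (disc_fun q Q (\<lambda>i. if i < N then ennreal (b i) else 0) x) p' \<partial>M) \<le> V \<and>
    (\<Sum>i<N. ennreal (a i * b i) * emeasure M (Q i)) = V \<and>
    (\<integral>\<^sup>+x. epow (\<Sum>i<N. ennreal (a i powr q) * indicator (Q i) x) (p / q) \<partial>M) \<le> ennreal (chain_const p' q powr (p / q)) * V"
proof -
  define xs where "xs = sort_key (\<lambda>i. - level i) [0..<N]"
  define \<sigma> where "\<sigma> i = (if i < N then xs ! i else i)" for i
  have len: "length xs = N" by (simp add: xs_def)
  have bij: "bij_betw \<sigma> {..<N} {..<N}"
  proof -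
    have "bij_betw ((!) xs) {..<length xs} (set xs)" by (rule bij_betw_nth) (auto simp: xs_def)
    then have "bij_betw ((!) xs) {..<N} {..<N}" by (simp add: len) (simp add: xs_def atLeast0LessThan)
    then show ?thesis by (rule bij_betw_cong[THEN iffD1, rotated]) (simp add: \<sigma>_def)
  qed
  have level: "level (\<sigma> i) \<le> level (\<sigma> j)" if "j < i" "i < N" for i j
  proof -
    have "sorted (map (\<lambda>i. - level i) xs)" unfolding xs_def by simp
    from sorted_nth_mono[OF this, of j i] that show ?thesis by (simp add: len \<sigma>_def)
  qed
  have reindex: "(\<Sum>i<N. g (\<sigma> i)) = (\<Sum>i<N. g i)" for g :: "nat \<Rightarrow> ennreal"
    using sum.reindex_bij_betw[OF bij, of g] .
  have "disc_fun q (\<lambda>i. Q (\<sigma> i)) (\<lambda>i. if i < N then ennreal (b (\<sigma> i)) else 0) x = disc_fun q Q (\<lambda>i. if i < N then ennreal (b i) else 0) x" for x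
  proof (cases "q = 1")
    case True
    have bnd: "(SUP i. (if i < N then g i else 0)) = (SUP i\<in>{..<N}. g i)" for g :: "nat \<Rightarrow> ennreal"
    proof (intro antisym SUP_least)
      show "(if i < N then g i else 0) \<le> (SUP i\<in>{..<N}. g i)" for i by (auto intro: SUP_upper)
      show "g i \<le> (SUP i. (if i < N then g i else 0))" if "i \<in> {..<N}" for i
        by (rule SUP_upper2[of i]) (use that in auto)
    qed
    have im: "(\<lambda>i. g (\<sigma> i)) ` {..<N} = g ` {..<N}" for g :: "nat \<Rightarrow> ennreal"
      using bij by (metis bij_betw_imp_surj_on image_image)
    have "(SUP i. (if i < N then ennreal (b (\<sigma> i)) else 0) * indicator (Q (\<sigma> i)) x)
      = (SUP i. (if i < N then ennreal (b (\<sigma> i)) * indicator (Q (\<sigma> i)) x else 0))"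
      by (intro SUP_cong) auto
    also have "\<dots> = (SUP i. (if i < N then ennreal (b i) * indicator (Q i) x else 0))"
      unfolding bnd im[of "\<lambda>i. ennreal (b i) * indicator (Q i) x"] ..
    also have "\<dots> = (SUP i. (if i < N then ennreal (b i) else 0) * indicator (Q i) x)"
      by (intro SUP_cong) auto
    finally show ?thesis using True by (simp add: disc_fun_def)
  next
    case False
    define q' where "q' = q / (q - 1)"
    have "(\<Sum>i. epow (if i < N then ennreal (b (\<sigma> i)) else 0) q' * indicator (Q (\<sigma> i)) x) = (\<Sum>i<N. epow (ennreal (b (\<sigma> i))) q' * indicator (Q (\<sigma> i)) x)"
      by (subst suminf_finite[of "{..<N}"]) auto
    also have "\<dots> = (\<Sum>i<N. epow (ennreal (b i)) q' * indicator (Q i) x)"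
      by (rule reindex)
    also have "\<dots> = (\<Sum>i. epow (if i < N then ennreal (b i) else 0) q' * indicator (Q i) x)"
      by (subst suminf_finite[of "{..<N}"]) auto
    finally show ?thesis using False by (simp add: disc_fun_def q'_def)
  qed
  note disc_eq = this
  have nest': "Q (\<sigma> i) \<subseteq> Q (\<sigma> j) \<or> Q (\<sigma> i) \<inter> Q (\<sigma> j) = {}" if "j < i" "i < N" for i j
    using nest[OF level[OF that]] .
  have "\<exists>a V. (\<forall>i. a i \<ge> 0) \<and> V < top \<and>
    (\<integral>\<^sup>+x. epow (disc_fun q (\<lambda>i. Q (\<sigma> i)) (\<lambda>i. if i < N then ennreal (b (\<sigma> i)) else 0) x) p' \<partial>M) \<le> V \<and>
    (\<Sum>i<N. ennreal (a i * b (\<sigma> i)) * emeasure M (Q (\<sigma> i))) = V \<and>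
    (\<integral>\<^sup>+x. epow (\<Sum>i<N. ennreal (a i powr q) * indicator (Q (\<sigma> i)) x) (p / q) \<partial>M) \<le> ennreal (chain_const p' q powr (p / q)) * V"
    unfolding p'_def
    by (rule discrete_duality_sorted) (fact q, fact p, fact b, fact Q, fact fin, fact nest')
  then obtain a V where aV: "\<And>i. a i \<ge> 0" "V < top"
    "(\<integral>\<^sup>+x. epow (disc_fun q Q (\<lambda>i. if i < N then ennreal (b i) else 0) x) p' \<partial>M) \<le> V"
    "(\<Sum>i<N. ennreal (a i * b (\<sigma> i)) * emeasure M (Q (\<sigma> i))) = V"
    "(\<integral>\<^sup>+x. epow (\<Sum>i<N. ennreal (a i powr q) * indicator (Q (\<sigma> i)) x) (p / q) \<partial>M) \<le> ennreal (chain_const p' q powr (p / q)) * V"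
    unfolding disc_eq by blast
  define \<tau> where "\<tau> = inv_into {..<N} \<sigma>"
  have \<tau>: "\<tau> (\<sigma> i) = i" if "i < N" for i
    unfolding \<tau>_def using bij that by (intro inv_into_f_f) (auto simp: bij_betw_def)
  have "(\<Sum>i<N. ennreal (a (\<tau> i) * b i) * emeasure M (Q i)) = V"
    unfolding aV(4)[symmetric] by (subst reindex[symmetric], intro sum.cong) (auto simp: \<tau>)
  moreover have "(\<Sum>i<N. ennreal (a (\<tau> i) powr q) * indicator (Q i) x) = (\<Sum>i<N. ennreal (a i powr q) * indicator (Q (\<sigma> i)) x)" for x
    by (subst reindex[symmetric], intro sum.cong) (auto simp: \<tau>)
  ultimately show ?thesis using aV by (intro exI[of _ "\<lambda>i. a (\<tau> i)"] exI[of _ V]) simp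
qed

section \<open>Local averages and their duality\<close>

definition local_avg :: "ereal \<Rightarrow> 'a::euclidean_space set \<Rightarrow> ('a \<Rightarrow> ennreal) \<Rightarrow> ennreal" where
  "local_avg r P F = (if r = \<infinity> then esssup_on P F
      else epow ((\<integral>\<^sup>+ z\<in>P. epow (F z) (real_of_ereal r) \<partial>lborel) / emeasure lborel P) (1 / real_of_ereal r))"

lemma ennreal_divide_le_iff: "0 < v \<Longrightarrow> x / ennreal v \<le> y \<longleftrightarrow> x \<le> y * ennreal v"
proof -
  assume v: "0 < v"
  have e: "x = x / ennreal v * ennreal v" using v by (simp add: ennreal_divide_times mult_divide_eq_ennreal)
  show ?thesis
  proof
    assume "x / ennreal v \<le> y"
    then show "x \<le> y * ennreal v" by (subst e) (rule mult_right_mono, auto)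
  next
    assume "x \<le> y * ennreal v"
    then have "x / ennreal v \<le> y * ennreal v / ennreal v" by (rule divide_right_mono_ennreal)
    then show "x / ennreal v \<le> y" using v by (simp add: mult_divide_eq_ennreal)
  qed
qed

text \<open>An almost extremal function for the duality of normalized L^r and L^r' on P. The number
  \<beta> stays strictly below the average of h because for r = 1 the essential supremum need not be
  attained, and for r > 1 the average may be infinite.\<close>

lemma local_duality:
  fixes h :: "'a::euclidean_space \<Rightarrow> ennreal"
  assumes [measurable]: "P \<in> sets borel" "h \<in> borel_measurable borel" and v: "emeasure lborel P = ennreal v" "v > 0"
    and r: "r \<ge> 1" and \<beta>: "\<beta> \<ge> 0" "\<beta> = 0 \<or> ennreal \<beta> < local_avg (conj_exp r) P h"
  shows "\<exists>\<phi>::'a \<Rightarrow> real. \<phi> \<in> borel_measurable borel \<and> (\<forall>z. 0 \<le> \<phi> z) \<and> (\<forall>z. z \<notin> P \<longrightarrow> \<phi> z = 0) \<and>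
     (\<integral>\<^sup>+z\<in>P. epow (ennreal (\<phi> z)) r \<partial>lborel) \<le> ennreal v \<and>
     ennreal (\<beta> * v) \<le> (\<integral>\<^sup>+z\<in>P. ennreal (\<phi> z) * h z \<partial>lborel)"
proof (cases "\<beta> = 0")
  case True
  then show ?thesis by (intro exI[of _ "\<lambda>_. 0"]) auto
next
  case False
  then have \<beta>p: "\<beta> > 0" and lt: "ennreal \<beta> < local_avg (conj_exp r) P h" using \<beta> by auto
  show ?thesis
  proof (cases "r = 1")
    case True
    define E where "E = {z. z \<in> P \<and> ennreal \<beta> < h z}"
    have [measurable]: "E \<in> sets borel"
    proof -
      have "E = P \<inter> {z. ennreal \<beta> < h z}" by (auto simp: E_def)
      moreover have "{z. ennreal \<beta> < h z} \<in> sets borel" by measurable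
      ultimately show ?thesis by simp
    qed
    have "\<not> (AE z in lborel. z \<notin> E)"
    proof
      assume "AE z in lborel. z \<notin> E"
      then have "AE z in lborel. z \<in> P \<longrightarrow> h z \<le> ennreal \<beta>" by eventually_elim (auto simp: E_def)
      then have "esssup_on P h \<le> ennreal \<beta>" by (simp add: esssup_on_le_iff_AE AE_completion_iff)
      then show False using lt True by (simp add: local_avg_def conj_exp_def)
    qed
    then have "emeasure lborel E \<noteq> 0" by (subst (asm) AE_iff_measurable[of E]) auto
    moreover have "emeasure lborel E \<le> ennreal v" unfolding v(1)[symmetric] by (intro emeasure_mono) (auto simp: E_def)
    ultimately obtain e where e: "emeasure lborel E = ennreal e" "e > 0" "e \<le> v"
      using v by (cases "emeasure lborel E") (auto simp: top_unique)
    \<comment> \<open>The normalized indicator of the set where h exceeds \<beta>: its mean over P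
      is 1, and its integral against h is at least \<beta> v.\<close>
    define \<phi> where "\<phi> z = (v / e) * indicator E z" for z :: 'a
    have \<phi>: "ennreal (\<phi> z) = ennreal (v / e) * indicator E z" for z by (auto simp: \<phi>_def indicator_def)
    have "(\<integral>\<^sup>+z\<in>P. epow (ennreal (\<phi> z)) r \<partial>lborel) = (\<integral>\<^sup>+z. ennreal (v / e) * indicator E z \<partial>lborel)"
      unfolding \<phi> by (intro nn_integral_cong) (auto simp: True E_def indicator_def)
    also have "\<dots> = ennreal v" using e v by (simp add: nn_integral_cmult_indicator flip: ennreal_mult)
    finally have 1: "(\<integral>\<^sup>+z\<in>P. epow (ennreal (\<phi> z)) r \<partial>lborel) \<le> ennreal v" by simp
    have "ennreal (\<beta> * v) = (\<integral>\<^sup>+z. ennreal (v / e * \<beta>) * indicator E z \<partial>lborel)"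
      using e v \<beta> by (subst nn_integral_cmult_indicator) (auto simp: mult.commute simp flip: ennreal_mult)
    also have "\<dots> \<le> (\<integral>\<^sup>+z\<in>P. ennreal (\<phi> z) * h z \<partial>lborel)"
    proof (intro nn_integral_mono)
      fix z
      show "ennreal (v / e * \<beta>) * indicator E z \<le> ennreal (\<phi> z) * h z * indicator P z"
      proof (cases "z \<in> E")
        case True
        have "ennreal (v / e * \<beta>) = ennreal (v / e) * ennreal \<beta>"
          using v e \<beta> by (intro ennreal_mult) auto
        also have "\<dots> \<le> ennreal (v / e) * h z"
          using True by (intro mult_left_mono) (auto simp: E_def intro: less_imp_le)
        finally show ?thesis using True by (simp add: \<phi>) (simp add: E_def)
      qed simp
    qed
    finally have 2: "ennreal (\<beta> * v) \<le> (\<integral>\<^sup>+z\<in>P. ennreal (\<phi> z) * h z \<partial>lborel)" .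
    have "\<phi> \<in> borel_measurable borel" unfolding \<phi>_def by measurable
    moreover have "\<phi> z \<ge> 0" "z \<notin> P \<Longrightarrow> \<phi> z = 0" for z
      using v e by (auto simp: \<phi>_def E_def)
    ultimately show ?thesis using 1 2 by blast
  next
    case False
    with r have r1: "r > 1" by simp
    define r' where "r' = r / (r - 1)"
    have r': "r' > 1" "conj_exp r = ereal r'" "(r' - 1) * r = r'" using r1 by (auto simp: r'_def conj_exp_def field_simps)
    \<comment> \<open>Truncation makes the r'-th power integrable, so that the normalization by d
      below is possible; by monotone convergence the integral still exceeds \<beta>^r' v for some
      k.\<close>
    define hk where "hk k z = min (h z) (of_nat k)" for k :: nat and z
    have [measurable]: "hk k \<in> borel_measurable borel" for k unfolding hk_def by measurable
    define A where "A k = (\<integral>\<^sup>+z\<in>P. epow (hk k z) r' \<partial>lborel)" for k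
    have hk_SUP: "(SUP k. hk k z) = h z" for z
    proof -
      have "(SUP k. hk k z) = min (h z) (SUP k. of_nat k)"
        unfolding hk_def by (simp add: inf_min[symmetric] inf_SUP)
      then show ?thesis by (simp add: ennreal_SUP_of_nat_eq_top)
    qed
    have "(SUP k. A k) = (\<integral>\<^sup>+z. (SUP k. epow (hk k z) r' * indicator P z) \<partial>lborel)"
      unfolding A_def
    proof (rule nn_integral_monotone_convergence_SUP[symmetric])
      show "incseq (\<lambda>k z. epow (hk k z) r' * indicator P z)"
        using r' unfolding incseq_def le_fun_def hk_def
        by (auto intro!: mult_right_mono epow_mono min.mono simp: of_nat_mono)
    qed measurable
    also have "\<dots> = (\<integral>\<^sup>+z\<in>P. epow (h z) r' \<partial>lborel)"
      using r' by (intro nn_integral_cong) (simp add: SUP_mult_right_ennreal[symmetric] epow_SUP[symmetric] hk_SUP)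
    finally have SUPA: "(SUP k. A k) = (\<integral>\<^sup>+z\<in>P. epow (h z) r' \<partial>lborel)" .
    have "\<not> local_avg (conj_exp r) P h \<le> ennreal \<beta>" using lt by simp
    then have "\<not> (\<integral>\<^sup>+z\<in>P. epow (h z) r' \<partial>lborel) \<le> ennreal (\<beta> powr r' * v)"
      using r' v \<beta> by (simp add: local_avg_def epow_le_iff epow_ennreal ennreal_divide_le_iff ennreal_mult)
    then obtain k where k: "ennreal (\<beta> powr r' * v) < A k"
      unfolding SUPA[symmetric] not_le less_SUP_iff by auto
    have "A k \<le> (\<integral>\<^sup>+z. ennreal (real k powr r') * indicator P z \<partial>lborel)"
      unfolding A_def using r'
      by (intro nn_integral_mono mult_right_mono)
         (auto simp: epow_le_iff epow_ennreal powr_powr hk_def ennreal_of_nat_eq_real_of_nat)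
    also have "\<dots> < top" using v by (simp add: nn_integral_cmult_indicator ennreal_mult_less_top)
    finally obtain A' where A': "A k = ennreal A'" "A' > 0"
      using le_less_trans[OF zero_le k] by (cases "A k") auto
    \<comment> \<open>The r'-average of the truncated function. The extremal function (H/d)^(r'-1)
      has r-average 1 because (r' - 1) r = r'.\<close>
    define d where "d = (A' / v) powr (1 / r')"
    have d: "d > 0" "d powr r' = A' / v" using A' v r' by (auto simp: d_def powr_powr)
    have "\<beta> powr r' * v < A'" using k A' v by (subst ennreal_less_iff[symmetric]) auto
    then have "\<beta> powr r' < d powr r'" using v d by (simp add: pos_less_divide_eq)
    then have \<beta>d: "\<beta> < d" using \<beta> r' d by (smt (verit) powr_mono2)
    define H where "H z = enn2real (hk k z)" for z
    have [measurable]: "H \<in> borel_measurable borel" unfolding H_def by measurable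
    have "hk k z < top" for z unfolding hk_def by (simp add: min_less_iff_disj ennreal_of_nat_eq_real_of_nat)
    then have H: "hk k z = ennreal (H z)" "H z \<ge> 0" for z unfolding H_def by (simp_all add: less_top)
    define \<phi> where "\<phi> z = (H z / d) powr (r' - 1) * indicator P z" for z
    have A_H: "(\<integral>\<^sup>+z. ennreal (H z powr r') * indicator P z \<partial>lborel) = ennreal A'"
      using A'(1) H by (simp add: A_def epow_ennreal)
    have "(\<integral>\<^sup>+z\<in>P. epow (ennreal (\<phi> z)) r \<partial>lborel) = (\<integral>\<^sup>+z. ennreal (1 / (d powr r')) * (ennreal (H z powr r') * indicator P z) \<partial>lborel)"
    proof (intro nn_integral_cong)
      fix z
      show "epow (ennreal (\<phi> z)) r * indicator P z = ennreal (1 / (d powr r')) * (ennreal (H z powr r') * indicator P z)"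
        using H(2)[of z] d r' A' v by (auto simp: mult.commute \<phi>_def indicator_def epow_ennreal powr_powr powr_divide simp flip: ennreal_mult)
    qed
    also have "\<dots> = ennreal (1 / (d powr r')) * ennreal A'"
      unfolding A_H[symmetric] by (rule nn_integral_cmult) measurable
    also have "\<dots> = ennreal v" using A' v d by (simp flip: ennreal_mult)
    finally have 1: "(\<integral>\<^sup>+z\<in>P. epow (ennreal (\<phi> z)) r \<partial>lborel) \<le> ennreal v" by simp
    have "ennreal (\<beta> * v) \<le> ennreal (d * v)" using \<beta>d v by (intro ennreal_leI mult_right_mono) auto
    also have "d * v = 1 / (d powr (r' - 1)) * A'"
    proof -
      have "A' = d powr r' * v" using d v by simp
      also have "d powr r' = d powr (r' - 1) * d" using d by (simp add: powr_mult_base mult.commute)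
      finally show ?thesis using d by simp
    qed
    also have "ennreal (1 / (d powr (r' - 1)) * A') = ennreal (1 / (d powr (r' - 1))) * ennreal A'"
      using A' by (intro ennreal_mult) auto
    also have "\<dots> = (\<integral>\<^sup>+z. ennreal (1 / (d powr (r' - 1))) * (ennreal (H z powr r') * indicator P z) \<partial>lborel)"
      unfolding A_H[symmetric] by (rule nn_integral_cmult[symmetric]) measurable
    also have "\<dots> \<le> (\<integral>\<^sup>+z\<in>P. ennreal (\<phi> z) * h z \<partial>lborel)"
    proof (intro nn_integral_mono)
      fix z
      have "H z powr r' = H z powr (r' - 1) * H z"
        using H(2)[of z] r' by (cases "H z = 0") (auto simp: powr_mult_base mult.commute)
      then have "ennreal (1 / (d powr (r' - 1))) * ennreal (H z powr r') = ennreal ((H z / d) powr (r' - 1)) * ennreal (H z)"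
        using d H(2)[of z] by (simp add: powr_divide flip: ennreal_mult)
      also have "\<dots> \<le> ennreal ((H z / d) powr (r' - 1)) * h z"
        unfolding H(1)[symmetric] by (intro mult_left_mono) (auto simp: hk_def)
      finally show "ennreal (1 / (d powr (r' - 1))) * (ennreal (H z powr r') * indicator P z) \<le> ennreal (\<phi> z) * h z * indicator P z"
        by (auto simp: \<phi>_def indicator_def)
    qed
    finally have 2: "ennreal (\<beta> * v) \<le> (\<integral>\<^sup>+z\<in>P. ennreal (\<phi> z) * h z \<partial>lborel)" .
    have "\<phi> \<in> borel_measurable borel" unfolding \<phi>_def by measurable
    moreover have "\<phi> z \<ge> 0" "z \<notin> P \<Longrightarrow> \<phi> z = 0" for z
      by (auto simp: \<phi>_def)
    ultimately show ?thesis using 1 2 by blast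
  qed
qed

section \<open>Whitney cells and adjacent dyadic grids\<close>

definition pow4 :: "int \<Rightarrow> real" where
  "pow4 k = 4 powr real_of_int k"

lemma pow4_pos [simp]: "pow4 k > 0" by (simp add: pow4_def)

lemma pow4_nonneg [simp]: "0 \<le> pow4 k" using pow4_pos[of k] by linarith

lemma pow4_neq_0 [simp]: "pow4 k \<noteq> 0" using pow4_pos[of k] by linarith

lemma pow4_add: "pow4 (k + int j) = 4 ^ j * pow4 k"
  by (simp add: pow4_def powr_add powr_realpow mult.commute)

lemma pow4_Suc: "pow4 (k + 1) = 4 * pow4 k"
  using pow4_add[of k 1] by simp

lemma pow4_floor: "s > 0 \<Longrightarrow> pow4 k \<le> s \<and> s < pow4 (k + 1) \<longleftrightarrow> k = \<lfloor>log 4 s\<rfloor>"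
  using floor_eq_iff[of "log 4 s" k] by (simp add: pow4_def le_log_iff log_less_iff eq_commute[of k])

definition lattice :: "'a::euclidean_space set" where
  "lattice = {m. \<forall>b\<in>Basis. m \<bullet> b \<in> \<int>}"

lemma countable_lattice: "countable (lattice :: 'a::euclidean_space set)"
proof -
  have "lattice \<subseteq> (\<lambda>f. \<Sum>b\<in>Basis. f b *\<^sub>R b) ` (Pi\<^sub>E (Basis :: 'a set) (\<lambda>_. \<int>))"
  proof
    fix m :: 'a assume m: "m \<in> lattice"
    have "m = (\<Sum>b\<in>Basis. (restrict (\<lambda>b. m \<bullet> b) Basis) b *\<^sub>R b)"
      by (simp add: euclidean_representation)
    moreover have "restrict (\<lambda>b. m \<bullet> b) Basis \<in> Pi\<^sub>E Basis (\<lambda>_. \<int>)"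
      using m by (auto simp: lattice_def)
    ultimately show "m \<in> (\<lambda>f. \<Sum>b\<in>Basis. f b *\<^sub>R b) ` (Pi\<^sub>E (Basis :: 'a set) (\<lambda>_. \<int>))" by blast
  qed
  moreover have "countable (Pi\<^sub>E (Basis :: 'a set) (\<lambda>_. \<int> :: real set))"
    by (intro countable_PiE) (auto simp: countable_int)
  ultimately show ?thesis by (meson countable_image countable_subset)
qed

text \<open>A single enumeration of all pairs of scale and lattice point, so that sums over cells
  are series over the natural numbers and finite sections are initial segments.\<close>

definition cell_index :: "nat \<Rightarrow> int \<times> 'a::euclidean_space" where
  "cell_index = from_nat_into (UNIV \<times> lattice)"

lemma bij_cell_index: "bij_betw cell_index UNIV (UNIV \<times> (lattice :: 'a::euclidean_space set))"
proof -
  have "(0::'a) \<in> lattice" by (simp add: lattice_def)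
  then have "infinite ((UNIV :: int set) \<times> (lattice :: 'a set))"
    by (auto simp: finite_cartesian_product_iff)
  then show ?thesis unfolding cell_index_def
    by (intro bij_betw_from_nat_into countable_SIGMA) (auto simp: countable_lattice)
qed

definition level :: "'a::euclidean_space itself \<Rightarrow> nat \<Rightarrow> int" where
  "level _ i = fst (cell_index i :: int \<times> 'a)"

definition csize :: "'a::euclidean_space itself \<Rightarrow> nat \<Rightarrow> real" where
  "csize T i = pow4 (level T i)"

definition corner :: "nat \<Rightarrow> 'a::euclidean_space" where
  "corner i = csize TYPE('a) i *\<^sub>R snd (cell_index i)"

definition base :: "nat \<Rightarrow> 'a::euclidean_space set" where
  "base i = {z. \<forall>b\<in>Basis. corner i \<bullet> b \<le> z \<bullet> b \<and> z \<bullet> b < corner i \<bullet> b + csize TYPE('a) i}"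

definition cell :: "nat \<Rightarrow> ('a::euclidean_space \<times> real) set" where
  "cell i = base i \<times> {csize TYPE('a) i ..< 4 * csize TYPE('a) i}"

lemma csize_pos [simp]: "csize T i > 0" by (simp add: csize_def)

lemma csize_nonzero [simp]: "csize T i \<noteq> 0" by (simp add: csize_def)

lemma csize_nonneg [simp]: "0 \<le> csize T i" by (simp add: csize_def)

lemma base_sets [measurable]: "base i \<in> sets borel"
  unfolding base_def by measurable

lemma cell_sets [measurable]: "cell i \<in> sets borel"
  unfolding cell_def by (intro borel_Times) auto

lemma emeasure_base: "emeasure lborel (base i :: 'a::euclidean_space set) = ennreal (csize TYPE('a) i ^ DIM('a))"
proof -
  let ?t = "csize TYPE('a) i"
  let ?a = "corner i :: 'a" and ?b = "corner i + ?t *\<^sub>R One :: 'a"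
  have le: "?a \<bullet> b \<le> ?b \<bullet> b" if "b \<in> Basis" for b using that by (simp add: inner_add_left)
  have pr: "(\<Prod>b\<in>Basis. (?b - ?a) \<bullet> b) = ?t ^ DIM('a)" by simp
  have "box ?a ?b \<subseteq> base i" "base i \<subseteq> cbox ?a ?b"
    by (auto simp: base_def mem_box inner_add_left less_imp_le)
  then have "emeasure lborel (box ?a ?b) \<le> emeasure lborel (base i :: 'a set)" "emeasure lborel (base i :: 'a set) \<le> emeasure lborel (cbox ?a ?b)"
    by (auto intro!: emeasure_mono)
  moreover have "emeasure lborel (box ?a ?b) = ennreal (?t ^ DIM('a))" "emeasure lborel (cbox ?a ?b) = ennreal (?t ^ DIM('a))"
    using le pr by (auto simp: emeasure_lborel_box emeasure_lborel_cbox)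
  ultimately show ?thesis by simp
qed

lemma emeasure_cell: "emeasure lborel (cell i :: ('a::euclidean_space \<times> real) set) = ennreal (3 * csize TYPE('a) i ^ (DIM('a) + 1))"
  unfolding cell_def by (subst emeasure_lborel_Times) (auto simp: emeasure_base algebra_simps simp flip: ennreal_mult)

text \<open>The height fixes the scale as the floor of its logarithm to base 4, and then floors fix
  the lattice point coordinate by coordinate. Half-open cubes and half-open height intervals leave
  no ambiguity.\<close>

lemma cell_ex1:
  fixes z :: "'a::euclidean_space \<times> real"
  assumes "z \<in> upper_half"
  shows "\<exists>!i. z \<in> cell i"
proof -
  obtain x s where z: "z = (x, s)" "s > 0" using assms by (cases z) (auto simp: upper_half_def)
  define k where "k = \<lfloor>log 4 s\<rfloor>"
  define m :: 'a where "m = (\<Sum>b\<in>Basis. of_int \<lfloor>x \<bullet> b / pow4 k\<rfloor> *\<^sub>R b)"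
  have mb: "m \<bullet> b = of_int \<lfloor>x \<bullet> b / pow4 k\<rfloor>" if "b \<in> Basis" for b
    using that by (simp add: m_def)
  have "m \<in> lattice" using mb by (simp add: lattice_def)
  have char: "z \<in> cell i \<longleftrightarrow> cell_index i = (k, m)" for i
  proof -
    obtain l u where lu: "cell_index i = (l, u :: 'a)" by force
    have ul: "u \<in> lattice" using bij_cell_index[where ?'a='a] lu unfolding bij_betw_def by (metis UNIV_I imageI mem_Sigma_iff)
    have cs: "csize TYPE('a) i = pow4 l" "corner i = pow4 l *\<^sub>R u" by (auto simp: csize_def level_def corner_def lu)
    have "z \<in> cell i \<longleftrightarrow> l = k \<and> (\<forall>b\<in>Basis. pow4 l * (u \<bullet> b) \<le> x \<bullet> b \<and> x \<bullet> b < pow4 l * (u \<bullet> b) + pow4 l)"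
      using pow4_floor[OF z(2), of l] by (auto simp: cell_def base_def z(1) cs k_def pow4_Suc)
    also have "\<dots> \<longleftrightarrow> l = k \<and> (\<forall>b\<in>Basis. u \<bullet> b \<le> x \<bullet> b / pow4 k \<and> x \<bullet> b / pow4 k < u \<bullet> b + 1)"
      by (auto simp: le_divide_eq divide_less_eq algebra_simps)
    also have "\<dots> \<longleftrightarrow> l = k \<and> (\<forall>b\<in>Basis. u \<bullet> b = m \<bullet> b)"
    proof (intro conj_cong refl ball_cong)
      fix b :: 'a assume b: "b \<in> Basis"
      then have "u \<bullet> b \<in> \<int>" using ul by (simp add: lattice_def)
      then obtain j where j: "u \<bullet> b = of_int j" by (auto elim: Ints_cases)
      show "(u \<bullet> b \<le> x \<bullet> b / pow4 k \<and> x \<bullet> b / pow4 k < u \<bullet> b + 1) = (u \<bullet> b = m \<bullet> b)"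
        unfolding mb[OF b] j by (auto simp: floor_eq_iff eq_commute[of j])
    qed
    also have "\<dots> \<longleftrightarrow> cell_index i = (k, m)"
      unfolding lu by (auto intro: euclidean_eqI)
    finally show ?thesis .
  qed
  have "\<exists>!i. cell_index i = (k, m)"
  proof -
    have "(k, m) \<in> range cell_index"
      using bij_cell_index[where ?'a='a] \<open>m \<in> lattice\<close> by (simp add: bij_betw_def)
    then obtain i where i: "cell_index i = (k, m)" by (metis rangeE)
    show ?thesis
    proof (rule ex1I[of _ i])
      fix j assume "cell_index j = (k, m)"
      with i have "cell_index j = (cell_index i :: int \<times> 'a)" by simp
      then show "j = i" using bij_cell_index[where ?'a='a] by (auto simp: bij_betw_def dest: injD)
    qed (fact i)
  qed
  then show ?thesis by (simp add: char)
qed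

lemma cell_subset_upper_half: "cell i \<subseteq> (upper_half :: ('a::euclidean_space \<times> real) set)"
  using csize_pos[of "TYPE('a)" i] by (auto simp: cell_def upper_half_def)

lemma cell_unique: "z \<in> cell i \<Longrightarrow> z \<in> cell j \<Longrightarrow> i = j"
  using cell_ex1[of z] cell_subset_upper_half[of i] by auto

lemma cell_disjoint: "i \<noteq> j \<Longrightarrow> cell i \<inter> cell j = {}"
  by (auto dest: cell_unique)

lemma UN_cell: "(\<Union>i. cell i) = upper_half"
proof
  show "(\<Union>i. cell i) \<subseteq> upper_half" using cell_subset_upper_half by (rule UN_least)
  show "upper_half \<subseteq> (\<Union>i. cell i)"
  proof
    fix z assume "z \<in> upper_half"
    from ex1_implies_ex[OF cell_ex1[OF this]] show "z \<in> (\<Union>i. cell i)" by simp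
  qed
qed

lemma dist_corner:
  assumes "z \<in> base i"
  shows "dist z (corner i :: 'a::euclidean_space) \<le> real DIM('a) * csize TYPE('a) i"
proof -
  have "norm (z - corner i) \<le> (\<Sum>b\<in>Basis. \<bar>(z - corner i) \<bullet> b\<bar>)" by (rule norm_le_l1)
  also have "\<dots> \<le> (\<Sum>b\<in>(Basis :: 'a set). csize TYPE('a) i)"
  proof (rule sum_mono)
    fix b :: 'a assume "b \<in> Basis"
    then have "corner i \<bullet> b \<le> z \<bullet> b" "z \<bullet> b < corner i \<bullet> b + csize TYPE('a) i"
      using assms by (auto simp: base_def)
    then show "\<bar>(z - corner i) \<bullet> b\<bar> \<le> csize TYPE('a) i" by (simp add: inner_diff_left)
  qed
  finally show ?thesis by (simp add: dist_norm)
qed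

text \<open>With ratio 4 and shifts \<open>0\<close> and \<open>1/3\<close> in each coordinate, all shifted grids are nested, and a
  ball whose radius is at most one sixth of the grid size lies in a cube of one of these \<open>2\<^sup>n\<close> grids.\<close>

definition shift :: "'a set \<Rightarrow> 'a \<Rightarrow> real" where
  "shift J b = (if b \<in> J then 1 / 3 else 0)"

definition gcube :: "'a set \<Rightarrow> int \<Rightarrow> 'a::euclidean_space \<Rightarrow> 'a set" where
  "gcube J k y = {x. \<forall>b\<in>Basis. \<lfloor>x \<bullet> b / pow4 k - shift J b\<rfloor> = \<lfloor>y \<bullet> b / pow4 k - shift J b\<rfloor>}"

lemma gcube_sets [measurable]: "gcube J k y \<in> sets borel"
  unfolding gcube_def by measurable

text \<open>Four times 1/3 is 1/3 + 1: passing to the next scale changes a shift by an integer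
  number of cubes, so the coarser grid is a union of cubes of the finer one. With ratio 2 the shift
  1/3 would turn into 2/3.\<close>

lemma gcube_Suc:
  assumes "x \<in> gcube J k y"
  shows "x \<in> gcube J (k + 1) y"
  unfolding gcube_def
proof (intro CollectI ballI)
  fix b :: 'a assume b: "b \<in> Basis"
  define j :: int where "j = (if b \<in> J then 1 else 0)"
  have "\<lfloor>z \<bullet> b / pow4 (k + 1) - shift J b\<rfloor> = (\<lfloor>z \<bullet> b / pow4 k - shift J b\<rfloor> - j) div 4" for z
  proof -
    have "z \<bullet> b / pow4 (k + 1) - shift J b = (z \<bullet> b / pow4 k - shift J b - of_int j) / real_of_int 4"
      unfolding pow4_Suc by (simp add: shift_def j_def diff_divide_distrib)
    then have "\<lfloor>z \<bullet> b / pow4 (k + 1) - shift J b\<rfloor> = \<lfloor>z \<bullet> b / pow4 k - shift J b - of_int j\<rfloor> div 4"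
      by (simp only: floor_divide_real_eq_div)
    then show ?thesis by (simp only: floor_diff_of_int)
  qed
  then show "\<lfloor>x \<bullet> b / pow4 (k + 1) - shift J b\<rfloor> = \<lfloor>y \<bullet> b / pow4 (k + 1) - shift J b\<rfloor>"
    using assms b by (simp add: gcube_def)
qed

lemma gcube_mono: "k \<le> l \<Longrightarrow> x \<in> gcube J k y \<Longrightarrow> x \<in> gcube J l y"
  by (induction l rule: int_ge_induct) (auto intro: gcube_Suc)

lemma gcube_nested:
  assumes "k \<le> l"
  shows "gcube J k y \<subseteq> gcube J l y' \<or> gcube J k y \<inter> gcube J l y' = {}"
proof (cases "gcube J k y \<inter> gcube J l y' = {}")
  case False
  then obtain x0 where x0: "x0 \<in> gcube J k y" "x0 \<in> gcube J l y'" by blast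
  have "x \<in> gcube J l y'" if "x \<in> gcube J k y" for x
  proof -
    have "x \<in> gcube J k x0" using that x0 by (simp add: gcube_def)
    then have "x \<in> gcube J l x0" by (rule gcube_mono[OF assms])
    then show ?thesis using x0 by (simp add: gcube_def)
  qed
  then show ?thesis by blast
qed simp

lemma emeasure_gcube: "emeasure lborel (gcube J k (y::'a::euclidean_space)) \<le> ennreal (pow4 k ^ DIM('a))"
proof -
  define a :: 'a where "a = (\<Sum>b\<in>Basis. ((of_int \<lfloor>y \<bullet> b / pow4 k - shift J b\<rfloor> + shift J b) * pow4 k) *\<^sub>R b)"
  have ab: "a \<bullet> b = (of_int \<lfloor>y \<bullet> b / pow4 k - shift J b\<rfloor> + shift J b) * pow4 k" if "b \<in> Basis" for b
    using that by (simp add: a_def)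
  have "gcube J k y \<subseteq> cbox a (a + pow4 k *\<^sub>R One)"
  proof
    fix x assume x: "x \<in> gcube J k y"
    show "x \<in> cbox a (a + pow4 k *\<^sub>R One)"
      unfolding mem_box
    proof (intro ballI)
      fix b :: 'a assume b: "b \<in> Basis"
      then have "\<lfloor>x \<bullet> b / pow4 k - shift J b\<rfloor> = \<lfloor>y \<bullet> b / pow4 k - shift J b\<rfloor>" using x by (simp add: gcube_def)
      then have "of_int \<lfloor>y \<bullet> b / pow4 k - shift J b\<rfloor> + shift J b \<le> x \<bullet> b / pow4 k" "x \<bullet> b / pow4 k \<le> of_int \<lfloor>y \<bullet> b / pow4 k - shift J b\<rfloor> + shift J b + 1"
        by linarith+
      then show "a \<bullet> b \<le> x \<bullet> b \<and> x \<bullet> b \<le> (a + pow4 k *\<^sub>R One) \<bullet> b"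
        using b by (simp add: inner_add_left ab le_divide_eq divide_le_eq algebra_simps)
    qed
  qed
  then have "emeasure lborel (gcube J k y) \<le> emeasure lborel (cbox a (a + pow4 k *\<^sub>R One))"
    by (intro emeasure_mono) auto
  also have "\<dots> = ennreal (pow4 k ^ DIM('a))"
    by (subst emeasure_lborel_cbox) (auto simp: inner_add_left)
  finally show ?thesis .
qed

text \<open>If u has distance at least 1/6 from the integers, the shift 0 works. Otherwise u lies
  within 1/6 of an integer, and u - 1/3 has distance more than 1/6 from all integers.\<close>

lemma floor_shift_exists:
  fixes u :: real
  shows "\<exists>\<delta>\<in>{0, 1/3}. \<forall>v. \<bar>v - u\<bar> < 1 / 6 \<longrightarrow> \<lfloor>v - \<delta>\<rfloor> = \<lfloor>u - \<delta>\<rfloor>"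
proof -
  define f where "f = \<lfloor>u\<rfloor>"
  have f: "of_int f \<le> u" "u < of_int f + 1" unfolding f_def by linarith+
  consider "of_int f + 1/6 \<le> u \<and> u \<le> of_int f + 5/6" | "u < of_int f + 1/6" | "u > of_int f + 5/6" by linarith
  then show ?thesis
  proof cases
    case 1
    have "\<lfloor>v - 0\<rfloor> = f" if "\<bar>v - u\<bar> < 1 / 6" for v
    proof -
      have "of_int (f) \<le> v - 0" "v - 0 < of_int (f) + 1" using 1 that by linarith+
      then show ?thesis by (simp only: floor_eq_iff)
    qed
    then show ?thesis by (intro bexI[of _ 0]) auto
  next
    case 2
    have "\<lfloor>v - 1/3\<rfloor> = f - 1" if "\<bar>v - u\<bar> < 1 / 6" for v
    proof -
      have "of_int (f - 1) \<le> v - 1/3" "v - 1/3 < of_int (f - 1) + 1" using 2 f that by linarith+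
      then show ?thesis by (simp only: floor_eq_iff)
    qed
    then show ?thesis by (intro bexI[of _ "1/3"]) auto
  next
    case 3
    have "\<lfloor>v - 1/3\<rfloor> = f" if "\<bar>v - u\<bar> < 1 / 6" for v
    proof -
      have "of_int (f) \<le> v - 1/3" "v - 1/3 < of_int (f) + 1" using 3 f that by linarith+
      then show ?thesis by (simp only: floor_eq_iff)
    qed
    then show ?thesis by (intro bexI[of _ "1/3"]) auto
  qed
qed

text \<open>The shift is chosen separately in each coordinate; the set J of shifted coordinates
  names one of the 2^n grids.\<close>

lemma ball_subset_gcube_exists:
  fixes y :: "'a::euclidean_space"
  assumes "\<rho> \<le> pow4 k / 6"
  shows "\<exists>J\<subseteq>Basis. ball y \<rho> \<subseteq> gcube J k y"
proof -
  have "\<forall>b. \<exists>\<delta>\<in>{0, 1/3}. \<forall>v. \<bar>v - y \<bullet> b / pow4 k\<bar> < 1 / 6 \<longrightarrow> \<lfloor>v - \<delta>\<rfloor> = \<lfloor>y \<bullet> b / pow4 k - \<delta>\<rfloor>"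
    using floor_shift_exists by blast
  then obtain d where d: "\<And>b. d b \<in> {0, 1/3}" "\<And>b v. \<bar>v - y \<bullet> b / pow4 k\<bar> < 1 / 6 \<Longrightarrow> \<lfloor>v - d b\<rfloor> = \<lfloor>y \<bullet> b / pow4 k - d b\<rfloor>"
    by metis
  define J where "J = {b\<in>Basis. d b = 1/3}"
  have s: "shift J b = d b" if "b \<in> Basis" for b using d(1)[of b] that by (auto simp: shift_def J_def)
  have "ball y \<rho> \<subseteq> gcube J k y"
  proof
    fix x assume x: "x \<in> ball y \<rho>"
    show "x \<in> gcube J k y"
      unfolding gcube_def
    proof (intro CollectI ballI)
      fix b :: 'a assume b: "b \<in> Basis"
      have "\<bar>(x - y) \<bullet> b\<bar> \<le> norm (x - y)" by (rule Basis_le_norm[OF b])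
      also have "\<dots> < pow4 k / 6" using x assms by (simp add: dist_norm norm_minus_commute)
      finally have "\<bar>x \<bullet> b / pow4 k - y \<bullet> b / pow4 k\<bar> < 1 / 6"
        by (simp add: inner_diff_left diff_divide_distrib[symmetric] divide_less_eq)
      then show "\<lfloor>x \<bullet> b / pow4 k - shift J b\<rfloor> = \<lfloor>y \<bullet> b / pow4 k - shift J b\<rfloor>"
        unfolding s[OF b] by (rule d(2))
    qed
  qed
  moreover have "J \<subseteq> Basis" by (auto simp: J_def)
  ultimately show ?thesis by auto
qed

section \<open>Comparison of Whitney averages with cell averages\<close>

context whitney_params
begin

lemma \<alpha>2_nonneg [simp]: "0 \<le> \<alpha>2" using \<alpha>2_pos by linarith

lemma wvol_nonzero [simp]: "wvol TYPE('a::euclidean_space) \<noteq> 0"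
  using wvol_pos[where ?'a='a] by linarith

text \<open>In units of the cell size: 4 \<alpha>2 + n bounds the distance from the corner of a cell
  to the y of any (y,t) whose Whitney box meets the cell, and a further 4 \<alpha>2 bounds t, hence
  the distance from y to the vertices of the cones through (y,t).\<close>

definition ball_factor :: "'a::euclidean_space itself \<Rightarrow> real" where
  "ball_factor _ = 8 * \<alpha>2 + real DIM('a)"

definition cell_ball :: "nat \<Rightarrow> 'a::euclidean_space set" where
  "cell_ball i = ball (corner i) (ball_factor TYPE('a) * csize TYPE('a) i)"

definition touch :: "'a::euclidean_space \<times> real \<Rightarrow> nat set" where
  "touch yt = {i. W yt \<inter> cell i \<noteq> {}}"

lemma ball_factor_pos [simp]: "ball_factor T > 0" unfolding ball_factor_def using \<alpha>2_pos by (intro add_pos_nonneg) auto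

lemma cell_ball_sets [measurable]: "cell_ball i \<in> sets borel" by (simp add: cell_ball_def)

text \<open>A common point of box and cell has a height between c and 4c, with c the cell size, and
  also between t/\<alpha>2 and \<alpha>2 t, so the two scales are comparable. The horizontal
  distance uses \<alpha>1 < 1.\<close>

lemma touch_size:
  fixes yt :: "'a::euclidean_space \<times> real"
  assumes "i \<in> touch yt"
  shows "csize TYPE('a) i < \<alpha>2 * snd yt" "snd yt < 4 * \<alpha>2 * csize TYPE('a) i" "0 < snd yt"
    "dist (fst yt) (corner i) < (4 * \<alpha>2 + real DIM('a)) * csize TYPE('a) i"
proof -
  obtain y t where yt: "yt = (y, t)" by force
  obtain z s where zs: "dist z y < \<alpha>1 * t" "t / \<alpha>2 < s" "s < \<alpha>2 * t" "z \<in> base i" "csize TYPE('a) i \<le> s" "s < 4 * csize TYPE('a) i"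
    using assms by (auto simp: touch_def whitney_def yt cell_def)
  show 1: "csize TYPE('a) i < \<alpha>2 * snd yt" using zs by (simp add: yt)
  have "t < \<alpha>2 * s" using zs by (simp add: divide_less_eq mult.commute)
  also have "\<dots> < \<alpha>2 * (4 * csize TYPE('a) i)" using zs by (intro mult_strict_left_mono) auto
  finally show 2: "snd yt < 4 * \<alpha>2 * csize TYPE('a) i" by (simp add: yt)
  have "0 < \<alpha>2 * t" using 1 csize_pos[of "TYPE('a)" i] by (simp add: yt del: csize_pos)
  then show t: "0 < snd yt" using \<alpha>2_pos by (simp add: yt zero_less_mult_iff)
  have "\<alpha>1 * t < 1 * t" using t \<alpha>1_lt1 by (intro mult_strict_right_mono) (auto simp: yt)
  moreover have "dist y (corner i) \<le> dist z y + dist z (corner i)" by (metis dist_commute dist_triangle)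
  ultimately show "dist (fst yt) (corner i) < (4 * \<alpha>2 + real DIM('a)) * csize TYPE('a) i"
    using dist_corner[OF zs(4)] zs(1) 2 by (simp add: yt algebra_simps)
qed

lemma touch_cone:
  assumes "i \<in> touch yt" "yt \<in> cone x"
  shows "x \<in> cell_ball i"
proof -
  have "dist (corner i) x \<le> dist (fst yt) (corner i) + dist (fst yt) x" by (metis dist_commute dist_triangle)
  also have "dist (fst yt) x < snd yt" using assms(2) by (auto simp: cone_def)
  finally show ?thesis using touch_size[OF assms(1)] by (simp add: cell_ball_def ball_factor_def algebra_simps)
qed

text \<open>A product set that contains every (y,t) whose Whitney box meets the cell. Its volume is
  a fixed multiple of c^(n+1), with c the cell size, and integrals of powers of the height over it
  are easy to bound.\<close>

definition influence :: "nat \<Rightarrow> ('a::euclidean_space \<times> real) set" where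
  "influence i = cell_ball i \<times> {csize TYPE('a) i / \<alpha>2 <..< 4 * \<alpha>2 * csize TYPE('a) i}"

lemma influence_sets [measurable]: "influence i \<in> sets borel"
  unfolding influence_def by (intro borel_Times) auto

lemma touch_influence: "i \<in> touch yt \<Longrightarrow> yt \<in> influence i"
proof -
  assume i: "i \<in> touch yt"
  have "(4 * \<alpha>2 + real DIM('a)) * csize TYPE('a) i \<le> ball_factor TYPE('a) * csize TYPE('a) i"
    using \<alpha>2_pos by (intro mult_right_mono) (auto simp: ball_factor_def)
  then have "dist (fst yt) (corner i) < ball_factor TYPE('a) * csize TYPE('a) i" using touch_size(4)[OF i] by linarith
  moreover have "csize TYPE('a) i / \<alpha>2 < snd yt" using touch_size(1)[OF i] by (simp add: divide_less_eq mult.commute)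
  ultimately show ?thesis using touch_size(2)[OF i]
    by (cases yt) (auto simp: influence_def cell_ball_def dist_commute)
qed

definition ivol :: "'a::euclidean_space itself \<Rightarrow> real" where
  "ivol T = ubv TYPE('a) * ball_factor T ^ DIM('a) * (4 * \<alpha>2 - 1 / \<alpha>2)"

lemma emeasure_cell_ball: "emeasure lborel (cell_ball i :: 'a::euclidean_space set) = ennreal (ubv TYPE('a) * ball_factor TYPE('a) ^ DIM('a) * csize TYPE('a) i ^ DIM('a))"
  unfolding cell_ball_def by (subst emeasure_ball_ubv) (auto simp: less_imp_le power_mult_distrib mult_ac)

lemma \<alpha>2_diff: "4 * \<alpha>2 - 1 / \<alpha>2 > 0"
  using div_\<alpha>2_less[of 1] \<alpha>2_pos by linarith

lemma ivol_pos [simp]: "ivol TYPE('a::euclidean_space) > 0"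
  unfolding ivol_def using \<alpha>2_diff by (intro mult_pos_pos) auto

lemma emeasure_influence: "emeasure lborel (influence i :: ('a::euclidean_space \<times> real) set) = ennreal (ivol TYPE('a) * csize TYPE('a) i ^ (DIM('a) + 1))"
proof -
  let ?t = "csize TYPE('a) i"
  have "0 < (4 * \<alpha>2 - 1 / \<alpha>2) * ?t" using \<alpha>2_diff by simp
  then have le: "?t / \<alpha>2 \<le> 4 * \<alpha>2 * ?t" by (simp add: algebra_simps)
  have "4 * \<alpha>2 * ?t - ?t / \<alpha>2 = (4 * \<alpha>2 - 1 / \<alpha>2) * ?t" by (simp add: algebra_simps)
  then show ?thesis unfolding influence_def using le \<alpha>2_diff
    by (subst emeasure_lborel_Times) (auto simp: emeasure_cell_ball ivol_def less_imp_le mult_ac simp flip: ennreal_mult)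
qed

definition touch_bound :: "'a::euclidean_space itself \<Rightarrow> real" where
  "touch_bound T = ubv TYPE('a) * (2 * real DIM('a) * \<alpha>2 + 1) ^ DIM('a) * (4 * \<alpha>2) * (4 * \<alpha>2) ^ (DIM('a) + 1)"

text \<open>Volume counting: the touched cells are disjoint, lie in a cylinder of size comparable to
  t, and each has volume at least a multiple of t^(n+1). Finite subsets come first because
  finiteness of the whole set is part of the claim.\<close>

lemma touch_card:
  fixes yt :: "'a::euclidean_space \<times> real"
  shows "finite (touch yt) \<and> real (card (touch yt)) \<le> touch_bound TYPE('a)"
proof -
  have bound: "real (card F) \<le> touch_bound TYPE('a)" if F: "finite F" "F \<subseteq> touch yt" for F
  proof (cases "F = {}")
    case True
    have "touch_bound TYPE('a) \<ge> 0" unfolding touch_bound_def using \<alpha>2_pos by (intro mult_nonneg_nonneg zero_le_power) auto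
    with True show ?thesis by simp
  next
    case False
    obtain y t where yt: "yt = (y, t)" by force
    have t: "t > 0" using False F touch_size(3)[of _ yt] by (auto simp: yt)
    \<comment> \<open>Two points of a cell have horizontal distance at most 2 n c with c < \<alpha>2
      t, and a further \<alpha>1 t < t leads to y; heights in the cell stay below 4c.\<close>
    define R where "R = ball y ((2 * real DIM('a) * \<alpha>2 + 1) * t) \<times> {0 <..< 4 * \<alpha>2 * t}"
    have R [measurable]: "R \<in> sets borel" unfolding R_def by (intro borel_Times) auto
    have rpos: "2 * real DIM('a) * \<alpha>2 + 1 > 0" using \<alpha>2_pos by (intro add_nonneg_pos mult_nonneg_nonneg) auto
    have eR: "emeasure lborel R = ennreal (ubv TYPE('a) * ((2 * real DIM('a) * \<alpha>2 + 1) * t) ^ DIM('a) * (4 * \<alpha>2 * t))"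
      unfolding R_def using t rpos \<alpha>2_pos
      by (subst emeasure_lborel_Times) (auto simp: emeasure_ball_ubv less_imp_le simp flip: ennreal_mult)
    have sub: "cell i \<subseteq> R" if i: "i \<in> touch yt" for i
    proof
      fix w :: "'a \<times> real" assume "w \<in> cell i"
      then obtain x s where w: "w = (x, s)" "x \<in> base i" "csize TYPE('a) i \<le> s" "s < 4 * csize TYPE('a) i" by (auto simp: cell_def)
      obtain z s' where zs: "dist z y < \<alpha>1 * t" "z \<in> base i"
        using i by (auto simp: touch_def whitney_def yt cell_def)
      have "dist y x \<le> dist z y + dist z (corner i) + dist x (corner i)"
        by (smt (verit) dist_commute dist_triangle)
      also have "\<dots> < \<alpha>1 * t + 2 * real DIM('a) * csize TYPE('a) i"
        using zs dist_corner[OF zs(2)] dist_corner[OF w(2)] by linarith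
      also have "\<dots> \<le> 1 * t + 2 * real DIM('a) * (\<alpha>2 * t)"
        using touch_size(1)[OF i] \<alpha>1_lt1 t by (intro add_mono mult_mono) (auto simp: yt)
      finally have "x \<in> ball y ((2 * real DIM('a) * \<alpha>2 + 1) * t)" by (simp add: algebra_simps)
      moreover have "0 < s" using w csize_pos[of "TYPE('a)" i] by linarith
      moreover have "s < 4 * \<alpha>2 * t" using w touch_size(1)[OF i] by (simp add: yt)
      ultimately show "w \<in> R" by (simp add: R_def w)
    qed
    have "ennreal (real (card F) * (3 * (t / (4 * \<alpha>2)) ^ (DIM('a) + 1))) = (\<Sum>i\<in>F. ennreal (3 * (t / (4 * \<alpha>2)) ^ (DIM('a) + 1)))"
      using t by (subst ennreal_mult) (auto simp: ennreal_of_nat_eq_real_of_nat)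
    also have "\<dots> \<le> (\<Sum>i\<in>F. emeasure lborel (cell i :: ('a \<times> real) set))"
    proof (rule sum_mono)
      fix i assume "i \<in> F"
      then have "t / (4 * \<alpha>2) < csize TYPE('a) i" using touch_size(2)[of i yt] F \<alpha>2_pos by (auto simp: yt divide_less_eq mult_ac)
      then show "ennreal (3 * (t / (4 * \<alpha>2)) ^ (DIM('a) + 1)) \<le> emeasure lborel (cell i :: ('a \<times> real) set)"
        unfolding emeasure_cell using t by (intro ennreal_leI mult_left_mono power_mono) auto
    qed
    also have "\<dots> = emeasure lborel (\<Union>i\<in>F. cell i :: ('a \<times> real) set)"
      using F by (intro sum_emeasure) (auto simp: disjoint_family_on_def cell_disjoint)
    also have "\<dots> \<le> emeasure lborel R" using sub F by (intro emeasure_mono) auto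
    finally have "real (card F) * (3 * (t / (4 * \<alpha>2)) ^ (DIM('a) + 1)) \<le> ubv TYPE('a) * ((2 * real DIM('a) * \<alpha>2 + 1) * t) ^ DIM('a) * (4 * \<alpha>2 * t)"
      unfolding eR using t rpos \<alpha>2_pos by (subst (asm) ennreal_le_iff) (auto simp: less_imp_le)
    moreover have "real (card F) * ((t / (4 * \<alpha>2)) ^ (DIM('a) + 1)) \<le> real (card F) * (3 * (t / (4 * \<alpha>2)) ^ (DIM('a) + 1))"
    proof (intro mult_left_mono)
      have "0 \<le> (t / (4 * \<alpha>2)) ^ (DIM('a) + 1)" using t by (intro zero_le_power) simp
      then show "(t / (4 * \<alpha>2)) ^ (DIM('a) + 1) \<le> 3 * (t / (4 * \<alpha>2)) ^ (DIM('a) + 1)" by linarith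
    qed simp
    ultimately have "real (card F) * ((t / (4 * \<alpha>2)) ^ (DIM('a) + 1)) \<le> ubv TYPE('a) * ((2 * real DIM('a) * \<alpha>2 + 1) * t) ^ DIM('a) * (4 * \<alpha>2 * t)" by linarith
    also have "\<dots> = (ubv TYPE('a) * (2 * real DIM('a) * \<alpha>2 + 1) ^ DIM('a) * (4 * \<alpha>2)) * t ^ (DIM('a) + 1)"
      by (simp add: power_mult_distrib mult_ac)
    finally have "real (card F) * t ^ (DIM('a) + 1) / (4 * \<alpha>2) ^ (DIM('a) + 1) \<le> (ubv TYPE('a) * (2 * real DIM('a) * \<alpha>2 + 1) ^ DIM('a) * (4 * \<alpha>2)) * t ^ (DIM('a) + 1)"
      by (simp only: power_divide times_divide_eq_right)
    then have "real (card F) * t ^ (DIM('a) + 1) \<le> (ubv TYPE('a) * (2 * real DIM('a) * \<alpha>2 + 1) ^ DIM('a) * (4 * \<alpha>2)) * t ^ (DIM('a) + 1) * (4 * \<alpha>2) ^ (DIM('a) + 1)"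
      using \<alpha>2_pos by (subst (asm) pos_divide_le_eq) auto
    also have "\<dots> = touch_bound TYPE('a) * t ^ (DIM('a) + 1)" by (simp add: touch_bound_def mult_ac)
    finally show ?thesis using t by (subst (asm) mult_le_cancel_right) auto
  qed
  have fin: "finite (touch yt)"
  proof (rule ccontr)
    assume "infinite (touch yt)"
    then obtain F where "finite F" "F \<subseteq> touch yt" "card F = Suc (nat \<lceil>touch_bound TYPE('a)\<rceil>)"
      by (meson infinite_arbitrarily_large)
    with bound[of F] show False by linarith
  qed
  with bound[of "touch yt"] show ?thesis by simp
qed

lemma whitney_subset_cells: "snd yt > 0 \<Longrightarrow> W yt \<subseteq> (\<Union>i\<in>touch yt. cell i)"
  using whitney_subset_upper_half[of yt] UN_cell by (fastforce simp: touch_def)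

text \<open>The number of touched cells times the largest possible cell volume, divided by the
  volume of the box. The maximum with 1 keeps the constant valid after taking an r-th root and for r
  = \<infinity>.\<close>

definition wav_const :: "'a::euclidean_space itself \<Rightarrow> real" where
  "wav_const T = max 1 (touch_bound T * (3 * \<alpha>2 ^ (DIM('a) + 1)) / wvol TYPE('a))"

lemma wav_const_ge1: "wav_const T \<ge> 1" by (simp add: wav_const_def)

lemma local_avg_cell_power:
  fixes F :: "'a::euclidean_space \<times> real \<Rightarrow> ennreal"
  assumes "r \<ge> 1"
  shows "(\<integral>\<^sup>+z\<in>cell i. epow (F z) r \<partial>lborel) = emeasure lborel (cell i :: ('a \<times> real) set) * epow (local_avg (ereal r) (cell i) F) r"
proof -
  define v where "v = 3 * csize TYPE('a) i ^ (DIM('a) + 1)"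
  have "v > 0" by (simp add: v_def)
  then have "x / ennreal v * ennreal v = x" for x
    by (simp add: ennreal_divide_times mult_divide_eq_ennreal)
  then show ?thesis using assms
    by (simp add: local_avg_def emeasure_cell[of i, where ?'a='a, folded v_def] mult.commute)
qed

lemma wav_le_local_avg:
  fixes F :: "'a::euclidean_space \<times> real \<Rightarrow> ennreal"
  assumes F [measurable]: "F \<in> borel_measurable borel" and r: "r \<ge> 1" and t: "snd yt > 0"
  shows "WA r F yt \<le> ennreal (wav_const TYPE('a)) * (SUP i\<in>touch yt. local_avg r (cell i) F)"
proof -
  define S where "S = (SUP i\<in>touch yt. local_avg r (cell i) F)"
  have S: "local_avg r (cell i) F \<le> S" if "i \<in> touch yt" for i unfolding S_def using that by (rule SUP_upper)
  note sub = whitney_subset_cells[OF t]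
  have fin: "finite (touch yt)" using touch_card by blast
  show ?thesis
  proof (cases "r = \<infinity>")
    case True
    have "AE z in lborel. \<forall>i. z \<in> cell i \<longrightarrow> F z \<le> esssup_on (cell i) F"
      unfolding AE_all_countable using AE_le_esssup_on[of "cell _" F] by (simp add: AE_completion_iff)
    then have "AE z in lborel. z \<in> W yt \<longrightarrow> F z \<le> S"
      by eventually_elim (use sub S True in \<open>force simp: local_avg_def\<close>)
    then have "WA r F yt \<le> 1 * S" using True by (simp add: wav_def esssup_on_le_iff_AE AE_completion_iff)
    also have "\<dots> \<le> ennreal (wav_const TYPE('a)) * S" using wav_const_ge1 by (intro mult_right_mono) (auto simp: ennreal_1[symmetric] simp del: ennreal_1 intro: ennreal_leI)
    finally show ?thesis by (simp add: S_def)
  next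
    case False
    then obtain r' where r': "r = ereal r'" "r' \<ge> 1" using r by (cases r) auto
    obtain y s where yt: "yt = (y, s)" "s > 0" using t by (cases yt) auto
    define v where "v = wvol TYPE('a) * s ^ (DIM('a) + 1)"
    have v: "v > 0" "emeasure lborel (W yt) = ennreal v"
      using yt by (simp_all add: v_def emeasure_whitney)
    have cellm: "emeasure lborel (cell i :: ('a \<times> real) set) \<le> ennreal (3 * (\<alpha>2 * s) ^ (DIM('a) + 1))" if "i \<in> touch yt" for i
      unfolding emeasure_cell using touch_size(1)[OF that] yt by (intro ennreal_leI mult_left_mono power_mono) auto
    have "(\<integral>\<^sup>+z\<in>W yt. epow (F z) r' \<partial>lborel) \<le> (\<integral>\<^sup>+z. (\<Sum>i\<in>touch yt. epow (F z) r' * indicator (cell i) z) \<partial>lborel)"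
    proof (intro nn_integral_mono)
      fix z
      show "epow (F z) r' * indicator (W yt) z \<le> (\<Sum>i\<in>touch yt. epow (F z) r' * indicator (cell i) z)"
      proof (cases "z \<in> W yt")
        case True
        then obtain i where i: "i \<in> touch yt" "z \<in> cell i" using sub by auto
        have "epow (F z) r' * indicator (cell i) z \<le> (\<Sum>i\<in>touch yt. epow (F z) r' * indicator (cell i) z)"
          using fin i by (intro member_le_sum) auto
        then show ?thesis using True i by simp
      qed simp
    qed
    also have "\<dots> = (\<Sum>i\<in>touch yt. (\<integral>\<^sup>+z\<in>cell i. epow (F z) r' \<partial>lborel))"
      by (rule nn_integral_sum) measurable
    also have "\<dots> = (\<Sum>i\<in>touch yt. emeasure lborel (cell i :: ('a \<times> real) set) * epow (local_avg (ereal r') (cell i) F) r')"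
      using r' by (simp add: local_avg_cell_power)
    also have "\<dots> \<le> (\<Sum>i\<in>touch yt. ennreal (3 * (\<alpha>2 * s) ^ (DIM('a) + 1)) * epow S r')"
      using S r' by (intro sum_mono mult_mono cellm epow_mono) auto
    also have "\<dots> = of_nat (card (touch yt)) * (ennreal (3 * (\<alpha>2 * s) ^ (DIM('a) + 1)) * epow S r')" by simp
    also have "\<dots> \<le> ennreal (touch_bound TYPE('a)) * (ennreal (3 * (\<alpha>2 * s) ^ (DIM('a) + 1)) * epow S r')"
      using touch_card[of yt] unfolding ennreal_of_nat_eq_real_of_nat by (intro mult_right_mono ennreal_leI) auto
    finally have "(\<integral>\<^sup>+z\<in>W yt. epow (F z) r' \<partial>lborel) / ennreal v \<le> ennreal (touch_bound TYPE('a)) * (ennreal (3 * (\<alpha>2 * s) ^ (DIM('a) + 1)) * epow S r') / ennreal v"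
      by (rule divide_right_mono_ennreal)
    also have "\<dots> \<le> ennreal (wav_const TYPE('a)) * epow S r'"
    proof -
      have N0: "touch_bound TYPE('a) \<ge> 0" using touch_card[of yt] by (meson of_nat_0_le_iff order_trans)
      have "touch_bound TYPE('a) * (3 * (\<alpha>2 * s) ^ (DIM('a) + 1)) = touch_bound TYPE('a) * (3 * \<alpha>2 ^ (DIM('a) + 1)) / wvol TYPE('a) * v"
        using wvol_pos[where ?'a='a] by (simp add: v_def power_mult_distrib) 
      also have "\<dots> \<le> wav_const TYPE('a) * v" unfolding wav_const_def using v by (intro mult_right_mono) auto
      finally have "ennreal (touch_bound TYPE('a) * (3 * (\<alpha>2 * s) ^ (DIM('a) + 1))) \<le> ennreal (wav_const TYPE('a) * v)" by (rule ennreal_leI)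
      then have "ennreal (touch_bound TYPE('a)) * ennreal (3 * (\<alpha>2 * s) ^ (DIM('a) + 1)) \<le> ennreal (wav_const TYPE('a)) * ennreal v"
        using N0 yt \<alpha>2_pos v wav_const_ge1[of "TYPE('a)"] by (simp only: ennreal_mult'[symmetric] ennreal_mult[symmetric])
      then have "ennreal (touch_bound TYPE('a)) * ennreal (3 * (\<alpha>2 * s) ^ (DIM('a) + 1)) * epow S r' \<le> ennreal (wav_const TYPE('a)) * ennreal v * epow S r'"
        by (rule mult_right_mono) simp
      then show ?thesis using v by (subst ennreal_divide_le_iff) (auto simp: mult_ac)
    qed
    finally have "WA r F yt \<le> epow (ennreal (wav_const TYPE('a)) * epow S r') (1 / r')"
      using r' v by (simp add: wav_def nn_integral_completion epow_mono)
    also have "\<dots> = ennreal (wav_const TYPE('a) powr (1 / r')) * S"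
      using r' wav_const_ge1[of "TYPE('a)"] by (simp add: epow_mult epow_ennreal)
    also have "\<dots> \<le> ennreal (wav_const TYPE('a)) * S"
    proof (intro mult_right_mono ennreal_leI)
      have "wav_const TYPE('a) powr (1 / r') \<le> wav_const TYPE('a) powr 1"
        using r' wav_const_ge1[of "TYPE('a)"] by (intro powr_mono) auto
      then show "wav_const TYPE('a) powr (1 / r') \<le> wav_const TYPE('a)" using wav_const_ge1[of "TYPE('a)"] by simp
    qed simp
    finally show ?thesis by (simp add: S_def)
  qed
qed

text \<open>The supremum over the touched cells is weakened to a series over all cells with a 0-1
  factor, which can be integrated term by term.\<close>

lemma epow_wav_le:
  fixes F :: "'a::euclidean_space \<times> real \<Rightarrow> ennreal"
  assumes F: "F \<in> borel_measurable borel" and r: "r \<ge> 1" and t: "snd yt > 0" and q: "q > 0"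
  shows "epow (WA r F yt) q \<le> ennreal (wav_const TYPE('a) powr q) * (\<Sum>i. epow (local_avg r (cell i) F) q * of_bool (i \<in> touch yt))"
proof -
  have le: "epow (SUP i\<in>touch yt. local_avg r (cell i) F) q \<le> (\<Sum>i. epow (local_avg r (cell i) F) q * of_bool (i \<in> touch yt))"
  proof (cases "touch yt = {}")
    case False
    have "epow (local_avg r (cell j) F) q \<le> (\<Sum>i. epow (local_avg r (cell i) F) q * of_bool (i \<in> touch yt))" if "j \<in> touch yt" for j
      using sum_le_suminf[of "\<lambda>i. epow (local_avg r (cell i) F) q * of_bool (i \<in> touch yt)" "{j}"] that by simp
    then show ?thesis using False q by (simp add: epow_SUP SUP_least)
  qed (simp add: bot_ennreal)
  have "epow (WA r F yt) q \<le> epow (ennreal (wav_const TYPE('a)) * (SUP i\<in>touch yt. local_avg r (cell i) F)) q"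
    using q by (intro epow_mono wav_le_local_avg F r t) auto
  also have "\<dots> = ennreal (wav_const TYPE('a) powr q) * epow (SUP i\<in>touch yt. local_avg r (cell i) F) q"
    using wav_const_ge1[of "TYPE('a)"] by (simp add: epow_mult epow_ennreal)
  also have "\<dots> \<le> ennreal (wav_const TYPE('a) powr q) * (\<Sum>i. epow (local_avg r (cell i) F) q * of_bool (i \<in> touch yt))"
    by (intro mult_left_mono le) simp
  finally show ?thesis .
qed

text \<open>Used with d = n + 1 for conical integrals, where the bound no longer depends on the
  cell, and with d = 1 for Carleson boxes, where it is a multiple of the volume of the base.\<close>

lemma influence_integral:
  assumes "d \<le> DIM('a) + 1"
  shows "(\<integral>\<^sup>+z\<in>(influence i :: ('a::euclidean_space \<times> real) set). ennreal (1 / snd z ^ d) \<partial>lborel) \<le> ennreal (ivol TYPE('a) * \<alpha>2 ^ d * csize TYPE('a) i ^ (DIM('a) + 1 - d))"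
proof -
  let ?t = "csize TYPE('a) i"
  have "(\<integral>\<^sup>+z\<in>(influence i :: ('a \<times> real) set). ennreal (1 / snd z ^ d) \<partial>lborel) \<le> (\<integral>\<^sup>+z. ennreal ((\<alpha>2 / ?t) ^ d) * indicator (influence i :: ('a \<times> real) set) z \<partial>lborel)"
  proof (intro nn_integral_mono)
    fix z :: "'a \<times> real"
    show "ennreal (1 / snd z ^ d) * indicator (influence i) z \<le> ennreal ((\<alpha>2 / ?t) ^ d) * indicator (influence i) z"
    proof (cases "z \<in> influence i")
      case True
      then have lt: "?t / \<alpha>2 < snd z" by (auto simp: influence_def)
      have "0 < ?t / \<alpha>2" by simp
      then have z0: "0 < snd z" using lt by linarith
      have "1 / snd z \<le> \<alpha>2 / ?t" using lt z0 by (simp add: field_simps)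
      then have "(1 / snd z) ^ d \<le> (\<alpha>2 / ?t) ^ d" using z0 by (intro power_mono) auto
      then show ?thesis using True by (auto simp: power_one_over intro!: ennreal_leI)
    qed simp
  qed
  also have "\<dots> = ennreal ((\<alpha>2 / ?t) ^ d) * ennreal (ivol TYPE('a) * ?t ^ (DIM('a) + 1))"
    by (subst nn_integral_cmult_indicator) (auto simp: emeasure_influence)
  also have "\<dots> = ennreal ((\<alpha>2 / ?t) ^ d * (ivol TYPE('a) * ?t ^ (DIM('a) + 1)))"
    using ivol_pos[where ?'a='a] by (intro ennreal_mult[symmetric]) (auto simp: less_imp_le)
  also have "(\<alpha>2 / ?t) ^ d * (ivol TYPE('a) * ?t ^ (DIM('a) + 1)) = ivol TYPE('a) * \<alpha>2 ^ d * ?t ^ (DIM('a) + 1 - d)"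
  proof -
    have "?t ^ (DIM('a) + 1) = ?t ^ d * ?t ^ (DIM('a) + 1 - d)" using assms by (simp flip: power_add)
    then show ?thesis by (simp add: power_divide del: power_Suc)
  qed
  finally show ?thesis .
qed

text \<open>If a point of the cone at x has a box touching cell i, then x lies in
  \<open>cell_ball i\<close> by \<open>touch_cone\<close>. The remaining integral over the influence
  of the cell is scale invariant and contributes only a constant.\<close>

lemma area_wav_le:
  fixes F :: "'a::euclidean_space \<times> real \<Rightarrow> ennreal"
  assumes F: "F \<in> borel_measurable borel" and r: "r \<ge> 1" and q: "q \<ge> 1"
  shows "area q (WA r F) x \<le> ennreal (wav_const TYPE('a) powr q * (ivol TYPE('a) * \<alpha>2 ^ (DIM('a) + 1)))
    * (\<Sum>i. epow (local_avg r (cell i) F) q * indicator (cell_ball i) x)"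
proof -
  define b where "b i = epow (local_avg r (cell i) F) q" for i
  define w where "w z = ennreal (1 / snd z ^ (DIM('a) + 1))" for z :: "'a \<times> real"
  have [measurable]: "w \<in> borel_measurable borel" unfolding w_def by measurable
  have "area q (WA r F) x \<le> (\<integral>\<^sup>+z. ennreal (wav_const TYPE('a) powr q) * (\<Sum>i. b i * indicator (cell_ball i) x * (w z * indicator (influence i) z)) \<partial>lborel)"
    unfolding area_def w_def[symmetric]
  proof (intro nn_integral_mono)
    fix z :: "'a \<times> real"
    show "epow (WA r F z) q * w z * indicator (cone x) z \<le> ennreal (wav_const TYPE('a) powr q) * (\<Sum>i. b i * indicator (cell_ball i) x * (w z * indicator (influence i) z))"
    proof (cases "z \<in> cone x")
      case True
      then have t: "snd z > 0" by (auto simp: cone_def)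
      have "epow (WA r F z) q * w z \<le> ennreal (wav_const TYPE('a) powr q) * (\<Sum>i. b i * of_bool (i \<in> touch z)) * w z"
        unfolding b_def using q by (intro mult_right_mono epow_wav_le F r t) auto
      also have "\<dots> = ennreal (wav_const TYPE('a) powr q) * (\<Sum>i. b i * of_bool (i \<in> touch z) * w z)"
        unfolding ennreal_suminf_multc by (rule mult.assoc)
      also have "\<dots> \<le> ennreal (wav_const TYPE('a) powr q) * (\<Sum>i. b i * indicator (cell_ball i) x * (w z * indicator (influence i) z))"
      proof (intro mult_left_mono suminf_le)
        fix i
        show "b i * of_bool (i \<in> touch z) * w z \<le> b i * indicator (cell_ball i) x * (w z * indicator (influence i) z)"
          using touch_cone[OF _ True, of i] touch_influence[of i z] by (cases "i \<in> touch z") auto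
      qed auto
      finally show ?thesis using True by simp
    qed simp
  qed
  also have "\<dots> = ennreal (wav_const TYPE('a) powr q) * (\<Sum>i. b i * indicator (cell_ball i) x * (\<integral>\<^sup>+z\<in>influence i. w z \<partial>lborel))"
    by (simp add: nn_integral_cmult nn_integral_suminf)
  also have "\<dots> \<le> ennreal (wav_const TYPE('a) powr q) * (\<Sum>i. b i * indicator (cell_ball i) x * ennreal (ivol TYPE('a) * \<alpha>2 ^ (DIM('a) + 1)))"
    using influence_integral[of "DIM('a) + 1", where ?'a='a]
    by (intro mult_left_mono suminf_le) (auto simp: w_def)
  also have "\<dots> = ennreal (wav_const TYPE('a) powr q * (ivol TYPE('a) * \<alpha>2 ^ (DIM('a) + 1))) * (\<Sum>i. b i * indicator (cell_ball i) x)"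
    unfolding ennreal_suminf_multc using ivol_pos[where ?'a='a]
    by (subst ennreal_mult) (simp_all add: less_imp_le mult_ac del: power_Suc)
  finally show ?thesis by (simp add: b_def)
qed

lemma SUP_cone_wav_le:
  fixes F :: "'a::euclidean_space \<times> real \<Rightarrow> ennreal"
  assumes F: "F \<in> borel_measurable borel" and r: "r \<ge> 1"
  shows "(SUP z\<in>cone x. WA r F z) \<le> ennreal (wav_const TYPE('a)) * (SUP i. local_avg r (cell i) F * indicator (cell_ball i) x)"
proof (rule SUP_least)
  fix z assume z: "z \<in> cone x"
  then have t: "snd z > 0" by (auto simp: cone_def)
  have "WA r F z \<le> ennreal (wav_const TYPE('a)) * (SUP i\<in>touch z. local_avg r (cell i) F)" by (intro wav_le_local_avg F r t)
  also have "\<dots> \<le> ennreal (wav_const TYPE('a)) * (SUP i. local_avg r (cell i) F * indicator (cell_ball i) x)"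
  proof (intro mult_left_mono SUP_least)
    fix i assume "i \<in> touch z"
    then show "local_avg r (cell i) F \<le> (SUP i. local_avg r (cell i) F * indicator (cell_ball i) x)"
      using touch_cone[OF _ z] by (intro SUP_upper2[of i]) auto
  qed simp
  finally show "WA r F z \<le> ennreal (wav_const TYPE('a)) * (SUP i. local_avg r (cell i) F * indicator (cell_ball i) x)" .
qed

text \<open>A cell touched from the tent over B(c,R) has size at most \<alpha>2 R, and its enlarged
  ball extends beyond B(c,R) by at most two of its own radii.\<close>

definition tent_factor :: "'a::euclidean_space itself \<Rightarrow> real" where
  "tent_factor T = 1 + 2 * ball_factor T * \<alpha>2"

lemma touch_tent:
  fixes c :: "'a::euclidean_space"
  assumes "i \<in> touch z" "z \<in> tent (ball c R)"
  shows "cell_ball i \<subseteq> ball c (tent_factor TYPE('a) * R)"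
proof -
  note ts = touch_size[OF assms(1)]
  have tent: "dist (fst z) c + snd z \<le> R" using assms(2) ts(3) by (auto simp: tent_def ball_subset_ball_iff)
  have "csize TYPE('a) i \<le> \<alpha>2 * R"
  proof -
    have "snd z \<le> R" using tent zero_le_dist[of "fst z" c] by linarith
    then have "\<alpha>2 * snd z \<le> \<alpha>2 * R" by (intro mult_left_mono) auto
    then show ?thesis using ts(1) by linarith
  qed
  then have "ball_factor TYPE('a) * csize TYPE('a) i \<le> ball_factor TYPE('a) * (\<alpha>2 * R)" by (intro mult_left_mono) (auto simp: less_imp_le)
  moreover have "dist (fst z) (corner i) \<le> ball_factor TYPE('a) * csize TYPE('a) i"
    using touch_influence[OF assms(1)] by (auto simp: influence_def cell_ball_def dist_commute)
  moreover have "dist (corner i) c \<le> dist (fst z) (corner i) + dist (fst z) c" by (metis dist_commute dist_triangle)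
  moreover have "tent_factor TYPE('a) * R = R + 2 * (ball_factor TYPE('a) * (\<alpha>2 * R))" by (simp add: tent_factor_def algebra_simps)
  ultimately have "dist (corner i) c + ball_factor TYPE('a) * csize TYPE('a) i \<le> tent_factor TYPE('a) * R"
    using tent ts(3) by linarith
  then show ?thesis unfolding cell_ball_def by (simp add: ball_subset_ball_iff)
qed

lemma tent_wav_le:
  fixes F :: "'a::euclidean_space \<times> real \<Rightarrow> ennreal"
  assumes F: "F \<in> borel_measurable borel" and r: "r \<ge> 1" and q: "q \<ge> 1"
  shows "(\<integral>\<^sup>+z\<in>tent (ball c R). epow (WA r F z) q * ennreal (1 / snd z) \<partial>lborel) \<le>
    ennreal (wav_const TYPE('a) powr q * (ivol TYPE('a) * \<alpha>2)) *
      (\<Sum>i. epow (local_avg r (cell i) F) q * of_bool (cell_ball i \<subseteq> ball c (tent_factor TYPE('a) * R)) * ennreal (csize TYPE('a) i ^ DIM('a)))"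
proof -
  define b where "b i = epow (local_avg r (cell i) F) q" for i
  define w where "w z = ennreal (1 / snd z)" for z :: "'a \<times> real"
  have [measurable]: "w \<in> borel_measurable borel" unfolding w_def by measurable
  have "(\<integral>\<^sup>+z\<in>tent (ball c R). epow (WA r F z) q * w z \<partial>lborel) \<le> (\<integral>\<^sup>+z. ennreal (wav_const TYPE('a) powr q) * (\<Sum>i. b i * of_bool (cell_ball i \<subseteq> ball c (tent_factor TYPE('a) * R)) * (w z * indicator (influence i) z)) \<partial>lborel)"
  proof (intro nn_integral_mono)
    fix z :: "'a \<times> real"
    show "epow (WA r F z) q * w z * indicator (tent (ball c R)) z \<le> ennreal (wav_const TYPE('a) powr q) * (\<Sum>i. b i * of_bool (cell_ball i \<subseteq> ball c (tent_factor TYPE('a) * R)) * (w z * indicator (influence i) z))"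
    proof (cases "z \<in> tent (ball c R)")
      case True
      then have t: "snd z > 0" by (auto simp: tent_def)
      have "epow (WA r F z) q * w z \<le> ennreal (wav_const TYPE('a) powr q) * (\<Sum>i. b i * of_bool (i \<in> touch z)) * w z"
        unfolding b_def using q by (intro mult_right_mono epow_wav_le F r t) auto
      also have "\<dots> = ennreal (wav_const TYPE('a) powr q) * (\<Sum>i. b i * of_bool (i \<in> touch z) * w z)"
        unfolding ennreal_suminf_multc by (rule mult.assoc)
      also have "\<dots> \<le> ennreal (wav_const TYPE('a) powr q) * (\<Sum>i. b i * of_bool (cell_ball i \<subseteq> ball c (tent_factor TYPE('a) * R)) * (w z * indicator (influence i) z))"
      proof (intro mult_left_mono suminf_le)
        fix i
        show "b i * of_bool (i \<in> touch z) * w z \<le> b i * of_bool (cell_ball i \<subseteq> ball c (tent_factor TYPE('a) * R)) * (w z * indicator (influence i) z)"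
          using touch_tent[OF _ True, of i] touch_influence[of i z] by (cases "i \<in> touch z") auto
      qed auto
      finally show ?thesis using True by simp
    qed simp
  qed
  also have "\<dots> = ennreal (wav_const TYPE('a) powr q) * (\<Sum>i. b i * of_bool (cell_ball i \<subseteq> ball c (tent_factor TYPE('a) * R)) * (\<integral>\<^sup>+z\<in>influence i. w z \<partial>lborel))"
    by (simp add: nn_integral_cmult nn_integral_suminf)
  also have "\<dots> \<le> ennreal (wav_const TYPE('a) powr q) * (\<Sum>i. b i * of_bool (cell_ball i \<subseteq> ball c (tent_factor TYPE('a) * R)) * (ennreal (ivol TYPE('a) * \<alpha>2) * ennreal (csize TYPE('a) i ^ DIM('a))))"
    using influence_integral[of 1, where ?'a='a] ivol_pos[where ?'a='a]
    by (intro mult_left_mono suminf_le) (auto simp: w_def ennreal_mult less_imp_le)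
  also have "\<dots> = ennreal (wav_const TYPE('a) powr q * (ivol TYPE('a) * \<alpha>2)) * (\<Sum>i. b i * of_bool (cell_ball i \<subseteq> ball c (tent_factor TYPE('a) * R)) * ennreal (csize TYPE('a) i ^ DIM('a)))"
  proof -
    have "(\<Sum>i. b i * of_bool (cell_ball i \<subseteq> ball c (tent_factor TYPE('a) * R)) * (ennreal (ivol TYPE('a) * \<alpha>2) * ennreal (csize TYPE('a) i ^ DIM('a))))
       = ennreal (ivol TYPE('a) * \<alpha>2) * (\<Sum>i. b i * of_bool (cell_ball i \<subseteq> ball c (tent_factor TYPE('a) * R)) * ennreal (csize TYPE('a) i ^ DIM('a)))"
      by (subst ennreal_suminf_cmult[symmetric]) (simp add: mult_ac)
    then show ?thesis using ivol_pos[where ?'a='a] by (simp add: ennreal_mult less_imp_le mult.assoc)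
  qed
  finally show ?thesis by (simp add: b_def w_def)
qed

end

section \<open>The lower bound\<close>

text \<open>Finite, increasing in N to b/2, and strictly below b unless zero: coefficients of the
  kind that \<open>local_duality\<close> accepts, also when b is infinite.\<close>

definition half_trunc :: "ennreal \<Rightarrow> nat \<Rightarrow> ennreal" where
  "half_trunc b N = min (b * ennreal (1 / 2)) (of_nat N)"

lemma half_trunc_less_top: "half_trunc b N < top"
  by (simp add: half_trunc_def min_less_iff_disj ennreal_of_nat_eq_real_of_nat)

lemma half_trunc_mono: "M \<le> N \<Longrightarrow> half_trunc b M \<le> half_trunc b N"
  unfolding half_trunc_def by (intro min.mono) (auto simp: of_nat_mono)

lemma half_trunc_less: "half_trunc b N = 0 \<or> half_trunc b N < b"
proof (cases b)
  case (real x)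
  show ?thesis
  proof (cases "x = 0")
    case False
    have "b * ennreal (1 / 2) = ennreal (x * (1 / 2))"
      unfolding real(2) using real(1) by (intro ennreal_mult[symmetric]) auto
    also have "\<dots> < b" using False real by (simp only: ennreal_less_iff)
    finally have "b * ennreal (1 / 2) < b" .
    then show ?thesis by (simp add: half_trunc_def min_less_iff_disj)
  qed (use real in \<open>simp add: half_trunc_def\<close>)
qed (use half_trunc_less_top in auto)

lemma SUP_half_trunc: "(SUP N. half_trunc b N) = b * ennreal (1 / 2)"
proof -
  have "(SUP N. half_trunc b N) = min (b * ennreal (1 / 2)) (SUP N. of_nat N)"
    unfolding half_trunc_def by (simp add: inf_min[symmetric] inf_SUP)
  then show ?thesis by (simp add: ennreal_SUP_of_nat_eq_top)
qed

lemma SUP_half_trunc_index: "(SUP N. if i < N then half_trunc b N else 0) = b * ennreal (1 / 2)"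
proof -
  have "half_trunc b N \<le> (SUP N. if i < N then half_trunc b N else 0)" for N
    by (rule SUP_upper2[of "N + Suc i"]) (auto intro: half_trunc_mono)
  moreover have "(if i < N then half_trunc b N else 0) \<le> (SUP N. half_trunc b N)" for N
    by (auto intro: SUP_upper)
  ultimately have "(SUP N. if i < N then half_trunc b N else 0) = (SUP N. half_trunc b N)"
    by (intro antisym SUP_least) auto
  then show ?thesis by (simp add: SUP_half_trunc)
qed

lemma ennreal_half_mult [simp]: "2 * (b * ennreal (1 / 2)) = (b :: ennreal)"
proof -
  have "2 * (b * ennreal (1 / 2)) = b * (ennreal 2 * ennreal (1 / 2))" by (simp add: mult_ac)
  also have "ennreal 2 * ennreal (1 / 2) = 1" by (subst ennreal_mult[symmetric]) auto
  finally show ?thesis by simp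
qed

text \<open>Finiteness of V permits division by V^(1/p). What remains is V to the power 1 - 1/p, the
  reciprocal of p/(p - 1). The finite sections in the lower bound exist to make V finite.\<close>

lemma ennreal_power_absorb:
  assumes V: "V < top" and p: "p > 1" and D: "D > 0" and le: "V \<le> ennreal D * epow V (1 / p) * X"
  shows "V \<le> epow (ennreal D * X) (p / (p - 1))"
proof -
  obtain v where v: "V = ennreal v" "v \<ge> 0" using V by (cases V) auto
  show ?thesis
  proof (cases "v = 0 \<or> X = top")
    case True
    then show ?thesis using v D by (auto simp: ennreal_mult_top)
  next
    case False
    then obtain x where x: "X = ennreal x" "x \<ge> 0" by (cases X) auto
    have v0: "v > 0" using v False by simp
    have "v \<le> D * v powr (1 / p) * x"
      using le D v0 x by (simp add: v epow_ennreal flip: ennreal_mult)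
    then have "v * v powr (- (1 / p)) \<le> (D * v powr (1 / p) * x) * v powr (- (1 / p))"
      by (intro mult_right_mono) auto
    also have "\<dots> = D * x" using v0 by (simp add: powr_minus field_simps)
    finally have "v powr (1 - 1 / p) \<le> D * x" using v0 by (simp add: powr_diff powr_minus field_simps)
    then have "(v powr (1 - 1 / p)) powr (p / (p - 1)) \<le> (D * x) powr (p / (p - 1))"
      using p by (intro powr_mono2) auto
    moreover have "(1 - 1 / p) * (p / (p - 1)) = 1" using p by (simp add: field_simps)
    ultimately have "v \<le> (D * x) powr (p / (p - 1))" using v0 by (simp only: powr_powr powr_one)
    then show ?thesis using D x v by (simp add: epow_ennreal ennreal_leI flip: ennreal_mult)
  qed
qed

lemma epow_of_indicator: "epow (indicator A z) a = indicator A z"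
  by (simp add: indicator_def)

text \<open>Removes the cutoffs: an exchange of two suprema for q = 1, and monotone convergence of
  series for q > 1.\<close>

lemma disc_fun_SUP:
  fixes b :: "nat \<Rightarrow> nat \<Rightarrow> ennreal"
  assumes q: "q \<ge> 1" and mono: "\<And>i. incseq (\<lambda>N. b N i)"
  shows "disc_fun q Q (\<lambda>i. SUP N. b N i) x = (SUP N. disc_fun q Q (b N) x)"
proof (cases "q = 1")
  case True
  have "(SUP i. (SUP N. b N i) * indicator (Q i) x) = (SUP i. SUP N. b N i * indicator (Q i) x)"
    by (simp add: SUP_mult_right_ennreal)
  also have "\<dots> = (SUP N. SUP i. b N i * indicator (Q i) x)" by (rule SUP_commute)
  finally show ?thesis using True by (simp add: disc_fun_def)
next
  case False
  define q' where "q' = q / (q - 1)"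
  have q': "q' > 1" using False q by (auto simp: q'_def field_simps)
  have "(\<Sum>i. epow (SUP N. b N i) q' * indicator (Q i) x) = (\<Sum>i. SUP N. epow (b N i) q' * indicator (Q i) x)"
    using q' by (simp add: epow_SUP SUP_mult_right_ennreal)
  also have "\<dots> = (SUP N. \<Sum>i. epow (b N i) q' * indicator (Q i) x)"
    using mono q' by (intro ennreal_suminf_SUP_eq) (auto simp: incseq_def intro!: mult_right_mono epow_mono)
  finally show ?thesis using False q' by (simp add: disc_fun_def q'_def[symmetric] epow_SUP)
qed

lemma disc_fun_mono:
  assumes q: "q \<ge> 1" and "\<And>i. b i \<le> b' i"
  shows "disc_fun q Q b x \<le> disc_fun q Q b' x"
proof (cases "q = 1")
  case True
  then show ?thesis using assms by (auto simp: disc_fun_def intro!: SUP_mono' mult_right_mono)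
next
  case False
  define q' where "q' = q / (q - 1)"
  have q': "q' > 1" using False q by (auto simp: q'_def field_simps)
  have "epow (\<Sum>i. epow (b i) q' * indicator (Q i) x) (1 / q') \<le> epow (\<Sum>i. epow (b' i) q' * indicator (Q i) x) (1 / q')"
    using q' assms by (intro epow_mono suminf_le mult_right_mono) auto
  then show ?thesis using False by (simp add: disc_fun_def q'_def)
qed

text \<open>Different indices may be covered by different members of S, so each term is bounded by a
  sum over all of S before the inner norm is taken.\<close>

lemma disc_fun_le_sum:
  assumes q: "q \<ge> 1" and S: "finite S" and c: "c > 0"
    and cover: "\<And>i. \<exists>J\<in>S. b i * indicator (Q i) x \<le> ennreal c * (bJ J i * indicator (QJ J i) x)"
  shows "disc_fun q Q b x \<le> ennreal (c * real (card S)) * (\<Sum>J\<in>S. disc_fun q (QJ J) (bJ J) x)"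
proof -
  have S0: "card S \<ge> 1" using cover[of 0] S by (metis One_nat_def Suc_leI card_gt_0_iff empty_iff)
  show ?thesis
  proof (cases "q = 1")
    case True
    have "b i * indicator (Q i) x \<le> ennreal (c * real (card S)) * (\<Sum>J\<in>S. disc_fun q (QJ J) (bJ J) x)" for i
    proof -
      obtain J where J: "J \<in> S" "b i * indicator (Q i) x \<le> ennreal c * (bJ J i * indicator (QJ J i) x)"
        using cover by blast
      have "bJ J i * indicator (QJ J i) x \<le> disc_fun q (QJ J) (bJ J) x"
        using True by (auto simp: disc_fun_def intro: SUP_upper)
      also have "\<dots> \<le> (\<Sum>J\<in>S. disc_fun q (QJ J) (bJ J) x)" using J S by (intro member_le_sum) auto
      finally have "ennreal c * (bJ J i * indicator (QJ J i) x) \<le> ennreal (c * real (card S)) * (\<Sum>J\<in>S. disc_fun q (QJ J) (bJ J) x)"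
        using S0 c by (intro mult_mono ennreal_leI) auto
      then show ?thesis using J(2) by (rule order_trans[rotated])
    qed
    then have "(SUP i. b i * indicator (Q i) x) \<le> ennreal (c * real (card S)) * (\<Sum>J\<in>S. disc_fun q (QJ J) (bJ J) x)"
      by (rule SUP_least)
    then show ?thesis by (subst disc_fun_def) (simp add: True)
  next
    case False
    define q' where "q' = q / (q - 1)"
    have q': "q' > 1" using False q by (auto simp: q'_def field_simps)
    have "epow (b i) q' * indicator (Q i) x \<le> ennreal (c powr q') * (\<Sum>J\<in>S. epow (bJ J i) q' * indicator (QJ J i) x)" for i
    proof -
      obtain J where J: "J \<in> S" "b i * indicator (Q i) x \<le> ennreal c * (bJ J i * indicator (QJ J i) x)"
        using cover by blast
      have "epow (b i * indicator (Q i) x) q' \<le> epow (ennreal c * (bJ J i * indicator (QJ J i) x)) q'"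
        using q' J by (intro epow_mono) auto
      then have "epow (b i) q' * indicator (Q i) x \<le> ennreal (c powr q') * (epow (bJ J i) q' * indicator (QJ J i) x)"
        using c by (simp add: epow_mult epow_ennreal epow_of_indicator)
      also have "\<dots> \<le> ennreal (c powr q') * (\<Sum>J\<in>S. epow (bJ J i) q' * indicator (QJ J i) x)"
        using J S by (intro mult_left_mono member_le_sum) auto
      finally show ?thesis .
    qed
    then have "(\<Sum>i. epow (b i) q' * indicator (Q i) x) \<le> (\<Sum>i. ennreal (c powr q') * (\<Sum>J\<in>S. epow (bJ J i) q' * indicator (QJ J i) x))"
      by (intro suminf_le) auto
    also have "\<dots> = ennreal (c powr q') * (\<Sum>J\<in>S. \<Sum>i. epow (bJ J i) q' * indicator (QJ J i) x)"
      by (simp add: ennreal_suminf_cmult suminf_sum)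
    finally have "epow (\<Sum>i. epow (b i) q' * indicator (Q i) x) (1 / q') \<le> epow (ennreal (c powr q') * (\<Sum>J\<in>S. \<Sum>i. epow (bJ J i) q' * indicator (QJ J i) x)) (1 / q')"
      using q' by (intro epow_mono) auto
    also have "\<dots> = ennreal c * epow (\<Sum>J\<in>S. \<Sum>i. epow (bJ J i) q' * indicator (QJ J i) x) (1 / q')"
      using c q' by (simp add: epow_mult epow_ennreal powr_powr)
    also have "\<dots> \<le> ennreal c * (ennreal (real (card S) powr (1 / q')) * (\<Sum>J\<in>S. epow (\<Sum>i. epow (bJ J i) q' * indicator (QJ J i) x) (1 / q')))"
      using S q' by (intro mult_left_mono epow_sum_le) auto
    also have "\<dots> \<le> ennreal c * (ennreal (real (card S)) * (\<Sum>J\<in>S. epow (\<Sum>i. epow (bJ J i) q' * indicator (QJ J i) x) (1 / q')))"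
    proof (intro mult_left_mono mult_right_mono ennreal_leI)
      have "real (card S) powr (1 / q') \<le> real (card S) powr 1" using S0 q' by (intro powr_mono) auto
      then show "real (card S) powr (1 / q') \<le> real (card S)" by simp
    qed auto
    also have "\<dots> = ennreal (c * real (card S)) * (\<Sum>J\<in>S. epow (\<Sum>i. epow (bJ J i) q' * indicator (QJ J i) x) (1 / q'))"
      using c by (simp add: ennreal_mult mult.assoc)
    finally show ?thesis using False by (simp add: disc_fun_def q'_def)
  qed
qed

context whitney_params
begin

text \<open>The supremum involves only nonnegative test functions and the measure dy dt/t. Complex
  phases and powers of t are put back by \<open>aligned\<close>, so this quantity is the norm of the
  functional in disguise.\<close>

definition dual_sup :: "real \<Rightarrow> real \<Rightarrow> real \<Rightarrow> ('a::euclidean_space \<times> real \<Rightarrow> ennreal) \<Rightarrow> ennreal" where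
  "dual_sup p q r G = (SUP F\<in>{F :: 'a \<times> real \<Rightarrow> real. F \<in> borel_measurable borel \<and> (\<forall>z. 0 \<le> F z) \<and> TN p q r (\<lambda>z. ennreal (F z)) \<le> 1}.
     (\<integral>\<^sup>+z\<in>upper_half. ennreal (F z) * G z * ennreal (1 / snd z) \<partial>lborel))"

lemma dual_sup_le:
  fixes F :: "'a::euclidean_space \<times> real \<Rightarrow> real"
  assumes pqr: "p \<ge> 1" "q \<ge> 1" "r \<ge> 1" and [measurable]: "F \<in> borel_measurable borel" "G \<in> borel_measurable borel" and F0: "\<And>z. F z \<ge> 0"
    and A: "A > 0" "TN p q r (\<lambda>z. ennreal (F z)) \<le> ennreal A"
  shows "(\<integral>\<^sup>+z\<in>upper_half. ennreal (F z) * G z * ennreal (1 / snd z) \<partial>lborel) \<le> ennreal A * dual_sup p q r G"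
proof -
  have "(\<lambda>z. ennreal (F z)) \<in> borel_measurable lebesgue" by (intro borel_measurable_lebesgueI) measurable
  then have "TN p q r (\<lambda>z. ennreal (1 / A) * ennreal (F z)) = ennreal (1 / A) * TN p q r (\<lambda>z. ennreal (F z))"
    using A by (intro TN_scale pqr) auto
  also have "\<dots> \<le> ennreal (1 / A) * ennreal A" by (intro mult_left_mono A) auto
  also have "\<dots> = 1" using A by (simp flip: ennreal_mult)
  also have "(\<lambda>z. ennreal (1 / A) * ennreal (F z)) = (\<lambda>z. ennreal (1 / A * F z))"
    using A F0 by (intro ext ennreal_mult[symmetric]) auto
  finally have "TN p q r (\<lambda>z. ennreal (1 / A * F z)) \<le> 1" .
  then have "(\<integral>\<^sup>+z\<in>upper_half. ennreal (1 / A * F z) * G z * ennreal (1 / snd z) \<partial>lborel) \<le> dual_sup p q r G"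
    unfolding dual_sup_def using A F0 by (intro SUP_upper2[of "\<lambda>z. 1 / A * F z"]) auto
  then have "ennreal A * (\<integral>\<^sup>+z\<in>upper_half. ennreal (1 / A * F z) * G z * ennreal (1 / snd z) \<partial>lborel) \<le> ennreal A * dual_sup p q r G"
    by (rule mult_left_mono) simp
  also have "ennreal A * (\<integral>\<^sup>+z\<in>upper_half. ennreal (1 / A * F z) * G z * ennreal (1 / snd z) \<partial>lborel)
     = (\<integral>\<^sup>+z. ennreal A * (ennreal (1 / A * F z) * G z * ennreal (1 / snd z) * indicator upper_half z) \<partial>lborel)"
    by (rule nn_integral_cmult[symmetric]) measurable
  also have "\<dots> = (\<integral>\<^sup>+z\<in>upper_half. ennreal (F z) * G z * ennreal (1 / snd z) \<partial>lborel)"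
  proof (intro nn_integral_cong)
    fix z
    have "ennreal A * ennreal (1 / A * F z) = ennreal (F z)" using A F0[of z] by (simp flip: ennreal_mult)
    then show "ennreal A * (ennreal (1 / A * F z) * G z * ennreal (1 / snd z) * indicator upper_half z) = ennreal (F z) * G z * ennreal (1 / snd z) * indicator upper_half z"
      by (simp only: mult.assoc[symmetric])
  qed
  finally show ?thesis .
qed

definition TN_const :: "'a::euclidean_space itself \<Rightarrow> real \<Rightarrow> real" where
  "TN_const T q = (wav_const T powr q * (ivol T * \<alpha>2 ^ (DIM('a) + 1))) powr (1 / q)"

lemma TN_const_pos [simp]: "TN_const TYPE('a::euclidean_space) q > 0"
proof -
  have "wav_const TYPE('a) > 0" using wav_const_ge1[of "TYPE('a)"] by linarith
  moreover have "ivol TYPE('a) \<noteq> 0" "\<alpha>2 \<noteq> 0" using ivol_pos[where ?'a='a] \<alpha>2_pos by linarith+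
  ultimately show ?thesis by (simp add: TN_const_def)
qed

text \<open>After this bound the norm of a test function depends only on its cell averages and the
  enlarged balls, so functions prescribed cell by cell can be estimated without returning to cones
  or Whitney boxes.\<close>

lemma TN_le_cells:
  fixes F :: "'a::euclidean_space \<times> real \<Rightarrow> ennreal"
  assumes pqr: "p \<ge> 1" "q \<ge> 1" "r \<ge> 1" and F: "F \<in> borel_measurable borel"
  shows "TN p q r F \<le> ennreal (TN_const TYPE('a) q) * epow (\<integral>\<^sup>+x. epow (\<Sum>i. epow (local_avg (ereal r) (cell i) F) q * indicator (cell_ball i :: 'a set) x) (p / q) \<partial>lborel) (1 / p)"
proof -
  define K where "K = wav_const TYPE('a) powr q * (ivol TYPE('a) * \<alpha>2 ^ (DIM('a) + 1))"
  have K0: "K \<ge> 0" unfolding K_def using ivol_pos[where ?'a='a] by (intro mult_nonneg_nonneg) (auto simp: less_imp_le)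
  define S where "S x = (\<Sum>i. epow (local_avg (ereal r) (cell i) F) q * indicator (cell_ball i) x)" for x :: 'a
  have [measurable]: "S \<in> borel_measurable borel" unfolding S_def by measurable
  have "(\<integral>\<^sup>+x. epow (area q (WA (ereal r) F) x) (p / q) \<partial>lborel) \<le> (\<integral>\<^sup>+x. ennreal (K powr (p / q)) * epow (S x) (p / q) \<partial>lborel)"
  proof (intro nn_integral_mono)
    fix x
    have "epow (area q (WA (ereal r) F) x) (p / q) \<le> epow (ennreal K * S x) (p / q)"
      unfolding K_def S_def using pqr by (intro epow_mono area_wav_le F) auto
    then show "epow (area q (WA (ereal r) F) x) (p / q) \<le> ennreal (K powr (p / q)) * epow (S x) (p / q)"
      using K0 by (simp add: epow_mult epow_ennreal)
  qed
  also have "\<dots> = ennreal (K powr (p / q)) * (\<integral>\<^sup>+x. epow (S x) (p / q) \<partial>lborel)"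
    by (rule nn_integral_cmult) measurable
  finally have "TN p q r F \<le> epow (ennreal (K powr (p / q)) * (\<integral>\<^sup>+x. epow (S x) (p / q) \<partial>lborel)) (1 / p)"
    unfolding TN_def tent_norm_real using pqr by (intro epow_mono) auto
  also have "\<dots> = ennreal (TN_const TYPE('a) q) * epow (\<integral>\<^sup>+x. epow (S x) (p / q) \<partial>lborel) (1 / p)"
    unfolding TN_const_def K_def[symmetric] using pqr K0 by (simp add: epow_mult epow_ennreal powr_powr)
  finally show ?thesis by (simp add: S_def)
qed

text \<open>The local functions \<phi>_i are superposed with coefficients a_i. Cells are disjoint,
  so the average over cell i is at most a_i. On a cell of size c the weight 1/s exceeds 1/(4c) and
  the volume is 3 c^(n+1): the cell contributes at least (3/4) a_i \<beta>_i c^n to the pairing,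
  whence the constant 4/3.\<close>

lemma test_function:
  fixes G :: "'a::euclidean_space \<times> real \<Rightarrow> ennreal"
  assumes pqr: "p \<ge> 1" "q \<ge> 1" "r \<ge> 1" and G [measurable]: "G \<in> borel_measurable borel"
    and \<beta>: "\<And>i. \<beta> i \<ge> 0" "\<And>i. \<beta> i = 0 \<or> ennreal (\<beta> i) < local_avg (conj_exp r) (cell i) G"
    and a: "\<And>i. a i \<ge> 0"
  shows "\<exists>F :: 'a \<times> real \<Rightarrow> real. F \<in> borel_measurable borel \<and> (\<forall>z. 0 \<le> F z) \<and>
    TN p q r (\<lambda>z. ennreal (F z)) \<le> ennreal (TN_const TYPE('a) q) * epow (\<integral>\<^sup>+x. epow (\<Sum>i<N. ennreal (a i powr q) * indicator (cell_ball i :: 'a set) x) (p / q) \<partial>lborel) (1 / p) \<and>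
    (\<Sum>i<N. ennreal (a i * \<beta> i) * ennreal (csize TYPE('a) i ^ DIM('a))) \<le> ennreal (4 / 3) * (\<integral>\<^sup>+z\<in>upper_half. ennreal (F z) * G z * ennreal (1 / snd z) \<partial>lborel)"
proof -
  define v where "v i = 3 * csize TYPE('a) i ^ (DIM('a) + 1)" for i
  have v: "v i > 0" "emeasure lborel (cell i :: ('a \<times> real) set) = ennreal (v i)" for i
    by (simp_all add: v_def emeasure_cell)
  have "\<forall>i. \<exists>\<phi>::'a \<times> real \<Rightarrow> real. \<phi> \<in> borel_measurable borel \<and> (\<forall>z. 0 \<le> \<phi> z) \<and> (\<forall>z. z \<notin> cell i \<longrightarrow> \<phi> z = 0) \<and>
     (\<integral>\<^sup>+z\<in>cell i. epow (ennreal (\<phi> z)) r \<partial>lborel) \<le> ennreal (v i) \<and>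
     ennreal (\<beta> i * v i) \<le> (\<integral>\<^sup>+z\<in>cell i. ennreal (\<phi> z) * G z \<partial>lborel)"
    using local_duality[OF cell_sets G v(2,1) pqr(3) \<beta>] by blast
  from choice[OF this] obtain \<phi> :: "nat \<Rightarrow> 'a \<times> real \<Rightarrow> real" where
    \<phi>: "\<forall>i. \<phi> i \<in> borel_measurable borel \<and> (\<forall>z. 0 \<le> \<phi> i z) \<and> (\<forall>z. z \<notin> cell i \<longrightarrow> \<phi> i z = 0) \<and>
     (\<integral>\<^sup>+z\<in>cell i. epow (ennreal (\<phi> i z)) r \<partial>lborel) \<le> ennreal (v i) \<and>
     ennreal (\<beta> i * v i) \<le> (\<integral>\<^sup>+z\<in>cell i. ennreal (\<phi> i z) * G z \<partial>lborel)" by blast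
  have \<phi>m: "\<And>i. \<phi> i \<in> borel_measurable borel" and \<phi>0: "\<And>i z. 0 \<le> \<phi> i z" and \<phi>z: "\<And>i z. z \<notin> cell i \<Longrightarrow> \<phi> i z = 0" and
    \<phi>r: "\<And>i. (\<integral>\<^sup>+z\<in>cell i. epow (ennreal (\<phi> i z)) r \<partial>lborel) \<le> ennreal (v i)" and
    \<phi>G: "\<And>i. ennreal (\<beta> i * v i) \<le> (\<integral>\<^sup>+z\<in>cell i. ennreal (\<phi> i z) * G z \<partial>lborel)"
    using \<phi> by blast+
  note [measurable] = \<phi>m
  define F where "F z = (\<Sum>i<N. a i * \<phi> i z)" for z
  have Fm [measurable]: "F \<in> borel_measurable borel" unfolding F_def by measurable
  have F0: "F z \<ge> 0" for z unfolding F_def using a \<phi>0 by (intro sum_nonneg) auto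
  have Fc: "F z = (if i < N then a i * \<phi> i z else 0)" if "z \<in> cell i" for z i
  proof -
    have "a j * \<phi> j z = (if j = i then a i * \<phi> i z else 0)" for j
      using \<phi>z[of z j] cell_unique[OF that, of j] by auto
    then have "F z = (\<Sum>j<N. if j = i then a i * \<phi> i z else 0)" unfolding F_def by (intro sum.cong) auto
    then show ?thesis by simp
  qed
  define ai where "ai i = (if i < N then a i else 0)" for i
  have ai0: "ai i \<ge> 0" for i using a by (simp add: ai_def)
  have gF: "local_avg (ereal r) (cell i) (\<lambda>z. ennreal (F z)) \<le> ennreal (ai i)" for i
  proof -
    have "(\<integral>\<^sup>+z\<in>cell i. epow (ennreal (F z)) r \<partial>lborel) = (\<integral>\<^sup>+z. ennreal (ai i powr r) * (epow (ennreal (\<phi> i z)) r * indicator (cell i) z) \<partial>lborel)"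
    proof (intro nn_integral_cong)
      fix z :: "'a \<times> real"
      show "epow (ennreal (F z)) r * indicator (cell i) z = ennreal (ai i powr r) * (epow (ennreal (\<phi> i z)) r * indicator (cell i) z)"
      proof (cases "z \<in> cell i")
        case True
        then have "F z = ai i * \<phi> i z" using Fc by (simp add: ai_def)
        then have "F z powr r = ai i powr r * \<phi> i z powr r" using ai0 \<phi>0 by (simp add: powr_mult)
        then show ?thesis using True F0 \<phi>0 by (simp add: epow_ennreal ennreal_mult)
      qed simp
    qed
    also have "\<dots> = ennreal (ai i powr r) * (\<integral>\<^sup>+z\<in>cell i. epow (ennreal (\<phi> i z)) r \<partial>lborel)"
      by (rule nn_integral_cmult) measurable
    also have "\<dots> \<le> ennreal (ai i powr r) * ennreal (v i)" by (intro mult_left_mono \<phi>r) auto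
    finally have "(\<integral>\<^sup>+z\<in>cell i. epow (ennreal (F z)) r \<partial>lborel) / ennreal (v i) \<le> ennreal (ai i powr r)"
      using v by (subst ennreal_divide_le_iff) auto
    then show ?thesis using pqr ai0 v by (simp add: local_avg_def epow_le_iff epow_ennreal)
  qed
  have "TN p q r (\<lambda>z. ennreal (F z)) \<le> ennreal (TN_const TYPE('a) q) * epow (\<integral>\<^sup>+x. epow (\<Sum>i. epow (local_avg (ereal r) (cell i) (\<lambda>z. ennreal (F z))) q * indicator (cell_ball i :: 'a set) x) (p / q) \<partial>lborel) (1 / p)"
    by (intro TN_le_cells pqr) measurable
  also have "\<dots> \<le> ennreal (TN_const TYPE('a) q) * epow (\<integral>\<^sup>+x. epow (\<Sum>i<N. ennreal (a i powr q) * indicator (cell_ball i :: 'a set) x) (p / q) \<partial>lborel) (1 / p)"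
  proof (intro mult_left_mono epow_mono nn_integral_mono)
    fix x :: 'a
    have "(\<Sum>i. epow (local_avg (ereal r) (cell i) (\<lambda>z. ennreal (F z))) q * indicator (cell_ball i) x) \<le> (\<Sum>i. epow (ennreal (ai i)) q * indicator (cell_ball i) x)"
      using pqr by (intro suminf_le mult_right_mono epow_mono gF) auto
    also have "\<dots> = (\<Sum>i<N. ennreal (a i powr q) * indicator (cell_ball i) x)"
      using a pqr by (subst suminf_finite[of "{..<N}"]) (auto simp: ai_def epow_ennreal intro!: sum.cong)
    finally show "(\<Sum>i. epow (local_avg (ereal r) (cell i) (\<lambda>z. ennreal (F z))) q * indicator (cell_ball i) x) \<le> (\<Sum>i<N. ennreal (a i powr q) * indicator (cell_ball i) x)" .
  qed (use pqr in auto)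
  finally have 1: "TN p q r (\<lambda>z. ennreal (F z)) \<le> ennreal (TN_const TYPE('a) q) * epow (\<integral>\<^sup>+x. epow (\<Sum>i<N. ennreal (a i powr q) * indicator (cell_ball i :: 'a set) x) (p / q) \<partial>lborel) (1 / p)" .
  have "(\<Sum>i<N. ennreal (a i * \<beta> i) * ennreal (csize TYPE('a) i ^ DIM('a)))
     \<le> (\<Sum>i<N. ennreal (4 / 3) * (\<integral>\<^sup>+z\<in>cell i. ennreal (F z) * G z * ennreal (1 / snd z) \<partial>lborel))"
  proof (rule sum_mono)
    fix i assume i: "i \<in> {..<N}"
    let ?t = "csize TYPE('a) i"
    have "a i * \<beta> i * ?t ^ DIM('a) = 4 / 3 * (a i / (4 * ?t) * (\<beta> i * v i))"
      by (simp add: v_def)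
    then have "ennreal (a i * \<beta> i) * ennreal (?t ^ DIM('a)) = ennreal (4 / 3) * (ennreal (a i / (4 * ?t)) * ennreal (\<beta> i * v i))"
      using a[of i] \<beta>(1)[of i] v(1)[of i] by (simp add: less_imp_le flip: ennreal_mult)
    also have "\<dots> \<le> ennreal (4 / 3) * (ennreal (a i / (4 * ?t)) * (\<integral>\<^sup>+z\<in>cell i. ennreal (\<phi> i z) * G z \<partial>lborel))"
      by (intro mult_left_mono \<phi>G) auto
    also have "ennreal (a i / (4 * ?t)) * (\<integral>\<^sup>+z\<in>cell i. ennreal (\<phi> i z) * G z \<partial>lborel) = (\<integral>\<^sup>+z. ennreal (a i / (4 * ?t)) * (ennreal (\<phi> i z) * G z * indicator (cell i) z) \<partial>lborel)"
      by (rule nn_integral_cmult[symmetric]) measurable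
    also have "\<dots> \<le> (\<integral>\<^sup>+z\<in>cell i. ennreal (F z) * G z * ennreal (1 / snd z) \<partial>lborel)"
    proof (intro nn_integral_mono)
      fix z :: "'a \<times> real"
      show "ennreal (a i / (4 * ?t)) * (ennreal (\<phi> i z) * G z * indicator (cell i) z) \<le> ennreal (F z) * G z * ennreal (1 / snd z) * indicator (cell i) z"
      proof (cases "z \<in> cell i")
        case True
        then have s: "?t \<le> snd z" "snd z < 4 * ?t" by (auto simp: cell_def)
        have s0: "snd z > 0" using s csize_pos[of "TYPE('a)" i] by linarith
        have "1 / (4 * ?t) \<le> 1 / snd z" using s s0 by (intro divide_left_mono) auto
        then have "(a i * \<phi> i z) * (1 / (4 * ?t)) \<le> (a i * \<phi> i z) * (1 / snd z)" using a \<phi>0 by (intro mult_left_mono) auto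
        then have "a i / (4 * ?t) * \<phi> i z \<le> F z * (1 / snd z)" using Fc[OF True] i by (simp add: mult_ac)
        then have "ennreal (a i / (4 * ?t) * \<phi> i z) \<le> ennreal (F z * (1 / snd z))" by (rule ennreal_leI)
        then have "ennreal (a i / (4 * ?t)) * ennreal (\<phi> i z) \<le> ennreal (F z) * ennreal (1 / snd z)"
          using a[of i] \<phi>0 F0 s0 by (simp only: ennreal_mult''[symmetric] ennreal_mult'[symmetric] divide_nonneg_nonneg)
        from mult_right_mono[OF this, of "G z"] show ?thesis using True by (simp add: mult_ac)
      qed simp
    qed
    finally show "ennreal (a i * \<beta> i) * ennreal (?t ^ DIM('a)) \<le> ennreal (4 / 3) * (\<integral>\<^sup>+z\<in>cell i. ennreal (F z) * G z * ennreal (1 / snd z) \<partial>lborel)"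
      by (simp add: mult_left_mono)
  qed
  also have "\<dots> = ennreal (4 / 3) * (\<integral>\<^sup>+z. (\<Sum>i<N. ennreal (F z) * G z * ennreal (1 / snd z) * indicator (cell i) z) \<partial>lborel)"
    by (subst nn_integral_sum, measurable) (rule sum_distrib_left[symmetric])
  also have "\<dots> \<le> ennreal (4 / 3) * (\<integral>\<^sup>+z\<in>upper_half. ennreal (F z) * G z * ennreal (1 / snd z) \<partial>lborel)"
  proof (intro mult_left_mono nn_integral_mono)
    fix z :: "'a \<times> real"
    have "(\<Sum>i<N. indicator (cell i) z) \<le> (indicator upper_half z :: ennreal)"
    proof (cases "\<exists>i. z \<in> cell i")
      case True
      then obtain i where i: "z \<in> cell i" by blast
      have "(\<Sum>j<N. indicator (cell j) z) = (\<Sum>j<N. if j = i then 1 else (0::ennreal))"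
        using cell_unique[OF i] i by (intro sum.cong refl) (metis indicator_simps)
      also have "\<dots> \<le> 1" by simp
      finally show ?thesis using i cell_subset_upper_half[of i] by (auto simp: indicator_def)
    qed simp
    then have "(ennreal (F z) * G z * ennreal (1 / snd z)) * (\<Sum>i<N. indicator (cell i) z) \<le> (ennreal (F z) * G z * ennreal (1 / snd z)) * indicator upper_half z"
      by (rule mult_left_mono) simp
    then show "(\<Sum>i<N. ennreal (F z) * G z * ennreal (1 / snd z) * indicator (cell i) z) \<le> ennreal (F z) * G z * ennreal (1 / snd z) * indicator upper_half z"
      by (simp add: sum_distrib_left)
  qed simp
  finally show ?thesis using 1 Fm F0 by blast
qed


lemma test_bound:
  fixes G :: "'a::euclidean_space \<times> real \<Rightarrow> ennreal"
  assumes pqr: "p \<ge> 1" "q \<ge> 1" "r \<ge> 1" and G [measurable]: "G \<in> borel_measurable borel"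
    and \<beta>: "\<And>i. \<beta> i \<ge> 0" "\<And>i. \<beta> i = 0 \<or> ennreal (\<beta> i) < local_avg (conj_exp r) (cell i) G"
    and a: "\<And>i. a i \<ge> 0"
    and E: "(\<integral>\<^sup>+x. epow (\<Sum>i<N. ennreal (a i powr q) * indicator (cell_ball i :: 'a set) x) (p / q) \<partial>lborel) \<le> E" and "E < top"
  shows "(\<Sum>i<N. ennreal (a i * \<beta> i) * ennreal (csize TYPE('a) i ^ DIM('a))) \<le> ennreal (4 / 3 * TN_const TYPE('a) q) * epow E (1 / p) * dual_sup p q r G"
proof -
  obtain F :: "'a \<times> real \<Rightarrow> real" where F: "F \<in> borel_measurable borel" "\<forall>z. 0 \<le> F z"
    "TN p q r (\<lambda>z. ennreal (F z)) \<le> ennreal (TN_const TYPE('a) q) * epow (\<integral>\<^sup>+x. epow (\<Sum>i<N. ennreal (a i powr q) * indicator (cell_ball i :: 'a set) x) (p / q) \<partial>lborel) (1 / p)"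
    "(\<Sum>i<N. ennreal (a i * \<beta> i) * ennreal (csize TYPE('a) i ^ DIM('a))) \<le> ennreal (4 / 3) * (\<integral>\<^sup>+z\<in>upper_half. ennreal (F z) * G z * ennreal (1 / snd z) \<partial>lborel)"
    using test_function[OF pqr G, of \<beta> a N, OF \<beta> a] by blast
  obtain e where e: "E = ennreal e" "e \<ge> 0" using \<open>E < top\<close> by (cases E) auto
  have TNe: "TN p q r (\<lambda>z. ennreal (F z)) \<le> ennreal (TN_const TYPE('a) q) * epow E (1 / p)"
    using pqr by (intro order_trans[OF F(3)] mult_left_mono epow_mono E) auto
  have le: "(\<integral>\<^sup>+z\<in>upper_half. ennreal (F z) * G z * ennreal (1 / snd z) \<partial>lborel) \<le> ennreal (TN_const TYPE('a) q * e powr (1 / p)) * dual_sup p q r G"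
  proof (cases "e = 0")
    case False
    then show ?thesis using pqr F TNe e TN_const_pos[of q, where ?'a='a]
      by (intro dual_sup_le) (auto simp: epow_ennreal less_imp_le simp flip: ennreal_mult)
  next
    \<comment> \<open>A norm equal to 0 cannot be normalized. The pairing must vanish here even if
      \<open>dual_sup\<close> is infinite, and the upper duality bound supplies this.\<close>
    case True
    then have "TN p q r (\<lambda>z. ennreal (F z)) = 0" using TNe e by simp
    then have le: "(\<integral>\<^sup>+z\<in>upper_half. ennreal (F z) * G z * ennreal (1 / snd z) \<partial>lborel) \<le> ennreal A * dual_sup p q r G" if "A > 0" for A
      using that pqr F by (intro dual_sup_le) auto
    obtain C where C: "\<And>F G :: 'a \<times> real \<Rightarrow> ennreal. F \<in> borel_measurable lebesgue \<Longrightarrow> G \<in> borel_measurable lebesgue \<Longrightarrow>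
    (\<integral>\<^sup>+z\<in>upper_half. F z * G z * ennreal (1 / snd z) \<partial>lborel) \<le>
      ennreal C * tent_norm (ereal p) (ereal q) (WA (ereal r) F) * tent_norm (conj_exp p) (conj_exp q) (WA (conj_exp r) G)"
      using duality_upper_bound[OF pqr, where ?'a='a] by blast
    have "(\<integral>\<^sup>+z\<in>upper_half. ennreal (F z) * G z * ennreal (1 / snd z) \<partial>lborel) \<le>
      ennreal C * TN p q r (\<lambda>z. ennreal (F z)) * tent_norm (conj_exp p) (conj_exp q) (WA (conj_exp r) G)"
      unfolding TN_def using F G by (intro C borel_measurable_lebesgueI) auto
    then show ?thesis using \<open>TN p q r (\<lambda>z. ennreal (F z)) = 0\<close> by simp
  qed
  have "(\<Sum>i<N. ennreal (a i * \<beta> i) * ennreal (csize TYPE('a) i ^ DIM('a))) \<le> ennreal (4 / 3) * (ennreal (TN_const TYPE('a) q * e powr (1 / p)) * dual_sup p q r G)"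
    by (intro order_trans[OF F(4)] mult_left_mono le) simp
  also have "\<dots> = ennreal (4 / 3 * TN_const TYPE('a) q) * epow E (1 / p) * dual_sup p q r G"
  proof -
    have "ennreal (4 / 3 * TN_const TYPE('a) q) = ennreal (4 / 3) * ennreal (TN_const TYPE('a) q)"
      "ennreal (TN_const TYPE('a) q * e powr (1 / p)) = ennreal (TN_const TYPE('a) q) * ennreal (e powr (1 / p))"
      using TN_const_pos[of q, where ?'a='a] by (intro ennreal_mult; simp add: less_imp_le)+
    moreover have "epow E (1 / p) = ennreal (e powr (1 / p))" using e by (simp add: epow_ennreal)
    ultimately show ?thesis by (simp only: mult_ac)
  qed
  finally show ?thesis .
qed

text \<open>For each grid separately, the discrete duality turns the cells whose enlarged balls fit into
  the grid into a test function.\<close>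

lemma grid_bound:
  assumes p: "p > 1" and q: "q \<ge> 1" and r: "r \<ge> 1"
  shows "\<exists>D>0. \<forall>J. \<forall>G :: 'a::euclidean_space \<times> real \<Rightarrow> ennreal. G \<in> borel_measurable borel \<longrightarrow>
    (\<integral>\<^sup>+x. epow (disc_fun q (\<lambda>i. gcube J (level TYPE('a) i + int k) (corner i))
       (\<lambda>i. if cell_ball i \<subseteq> gcube J (level TYPE('a) i + int k) (corner i :: 'a) then local_avg (conj_exp r) (cell i) G * ennreal (1 / 2) else 0) x) (p / (p - 1)) \<partial>lborel)
     \<le> epow (ennreal D * dual_sup p q r G) (p / (p - 1))"
proof -
  define p' where "p' = p / (p - 1)"
  have p': "p' > 1" using p by (simp add: p'_def field_simps)
  define n where "n = DIM('a)"
  define cc where "cc = chain_const p' q powr (p / q)"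
  \<comment> \<open>The first factor compares a grid cube with the base of the cell; the next is the
    cost of a test function in \<open>test_bound\<close>; the last is the p-th root of the constant
    of the discrete duality.\<close>
  define D where "D = (4 ^ k) ^ n * (4 / 3 * TN_const TYPE('a) q) * cc powr (1 / p)"
  have "chain_const p' q > 0" unfolding chain_const_def by (auto intro!: mult_pos_pos)
  then have cc: "cc > 0" by (simp add: cc_def)
  have D: "D > 0" unfolding D_def using TN_const_pos[of q, where ?'a='a] cc by (intro mult_pos_pos) auto
  have "(\<integral>\<^sup>+x. epow (disc_fun q (\<lambda>i. gcube J (level TYPE('a) i + int k) (corner i))
       (\<lambda>i. if cell_ball i \<subseteq> gcube J (level TYPE('a) i + int k) (corner i :: 'a) then local_avg (conj_exp r) (cell i) G * ennreal (1 / 2) else 0) x) p' \<partial>lborel)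
     \<le> epow (ennreal D * dual_sup p q r G) p'" if G: "G \<in> borel_measurable borel" for J and G :: "'a \<times> real \<Rightarrow> ennreal"
  proof -
    define Q where "Q i = gcube J (level TYPE('a) i + int k) (corner i :: 'a)" for i
    define I where "I = {i. cell_ball i \<subseteq> Q i}"
    define b where "b i = local_avg (conj_exp r) (cell i) G" for i
    define bN where "bN N i = (if i \<in> I then half_trunc (b i) N else 0)" for N i
    define bb where "bb N i = (if i < N then bN N i else 0)" for N i
    have [measurable]: "Q i \<in> sets borel" for i by (simp add: Q_def)
    have Qm: "emeasure lborel (Q i) \<le> ennreal ((4 ^ k) ^ n * csize TYPE('a) i ^ n)" for i
    proof -
      have "pow4 (level TYPE('a) i + int k) ^ n = (4 ^ k) ^ n * csize TYPE('a) i ^ n"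
        by (simp add: pow4_add csize_def power_mult_distrib)
      then show ?thesis using emeasure_gcube[of J "level TYPE('a) i + int k" "corner i :: 'a"] by (simp add: Q_def n_def)
    qed
    have bound: "(\<integral>\<^sup>+x. epow (disc_fun q Q (bb N) x) p' \<partial>lborel) \<le> epow (ennreal D * dual_sup p q r G) p'" for N
    proof -
      define \<beta> where "\<beta> i = enn2real (bN N i)" for i
      have bN: "bN N i = ennreal (\<beta> i)" for i using half_trunc_less_top[of "b i" N] by (simp add: \<beta>_def bN_def less_top)
      have \<beta>: "\<beta> i \<ge> 0" "\<beta> i = 0 \<or> ennreal (\<beta> i) < local_avg (conj_exp r) (cell i) G" for i
        using half_trunc_less[of "b i" N] bN[of i, symmetric] by (auto simp: \<beta>_def bN_def b_def)
      have "\<exists>a V. (\<forall>i. a i \<ge> 0) \<and> V < top \<and>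
        (\<integral>\<^sup>+x. epow (disc_fun q Q (\<lambda>i. if i < N then ennreal (\<beta> i) else 0) x) (p / (p - 1)) \<partial>lborel) \<le> V \<and>
        (\<Sum>i<N. ennreal (a i * \<beta> i) * emeasure lborel (Q i)) = V \<and>
        (\<integral>\<^sup>+x. epow (\<Sum>i<N. ennreal (a i powr q) * indicator (Q i) x) (p / q) \<partial>lborel) \<le> ennreal (chain_const (p / (p - 1)) q powr (p / q)) * V"
      proof (rule discrete_duality[where level = "level TYPE('a)", OF q p])
        show "emeasure lborel (Q i) < top" for i using Qm[of i] by (rule le_less_trans) simp
        show "Q i \<subseteq> Q j \<or> Q i \<inter> Q j = {}" if "level TYPE('a) i \<le> level TYPE('a) j" for i j
          unfolding Q_def using that by (intro gcube_nested) simp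
      qed (use \<beta> in auto)
      then obtain a V where aV: "\<And>i. a i \<ge> 0" "V < top" "(\<integral>\<^sup>+x. epow (disc_fun q Q (bb N) x) p' \<partial>lborel) \<le> V"
        "(\<Sum>i<N. ennreal (a i * \<beta> i) * emeasure lborel (Q i)) = V"
        "(\<integral>\<^sup>+x. epow (\<Sum>i<N. ennreal (a i powr q) * indicator (Q i) x) (p / q) \<partial>lborel) \<le> ennreal cc * V"
        unfolding bb_def bN p'_def cc_def by blast
      \<comment> \<open>The norm estimate replaces cubes by enlarged balls, which is legitimate only
        where the ball lies in the cube, that is, on I. Dropping the other coefficients does not
        change the pairing, since \<beta> vanishes there.\<close>
      define a' where "a' i = (if i \<in> I then a i else 0)" for i
      have a'0: "a' i \<ge> 0" for i using aV(1) by (simp add: a'_def)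
      have a'\<beta>: "a' i * \<beta> i = a i * \<beta> i" for i by (simp add: a'_def \<beta>_def bN_def)
      have "(\<integral>\<^sup>+x. epow (\<Sum>i<N. ennreal (a' i powr q) * indicator (cell_ball i :: 'a set) x) (p / q) \<partial>lborel) \<le> (\<integral>\<^sup>+x. epow (\<Sum>i<N. ennreal (a i powr q) * indicator (Q i) x) (p / q) \<partial>lborel)"
        using p q by (intro nn_integral_mono epow_mono sum_mono) (auto simp: a'_def I_def indicator_def)
      then have E: "(\<integral>\<^sup>+x. epow (\<Sum>i<N. ennreal (a' i powr q) * indicator (cell_ball i :: 'a set) x) (p / q) \<partial>lborel) \<le> ennreal cc * V"
        using aV(5) by (rule order_trans)
      have "(\<Sum>i<N. ennreal (a' i * \<beta> i) * ennreal (csize TYPE('a) i ^ DIM('a))) \<le> ennreal (4 / 3 * TN_const TYPE('a) q) * epow (ennreal cc * V) (1 / p) * dual_sup p q r G"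
        using p aV(2) by (intro test_bound q r G \<beta> a'0 E) (auto simp: ennreal_mult_less_top)
      also have "epow (ennreal cc * V) (1 / p) = ennreal (cc powr (1 / p)) * epow V (1 / p)"
        using cc by (simp add: epow_mult epow_ennreal)
      finally have test: "(\<Sum>i<N. ennreal (a' i * \<beta> i) * ennreal (csize TYPE('a) i ^ DIM('a))) \<le> ennreal (4 / 3 * TN_const TYPE('a) q) * (ennreal (cc powr (1 / p)) * epow V (1 / p)) * dual_sup p q r G" .
      have "V \<le> (\<Sum>i<N. ennreal (a' i * \<beta> i) * ennreal ((4 ^ k) ^ n * csize TYPE('a) i ^ n))"
        unfolding aV(4)[symmetric] a'\<beta> by (intro sum_mono mult_left_mono Qm) auto
      also have "\<dots> = ennreal ((4 ^ k) ^ n) * (\<Sum>i<N. ennreal (a' i * \<beta> i) * ennreal (csize TYPE('a) i ^ DIM('a)))"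
        unfolding sum_distrib_left n_def by (intro sum.cong) (auto simp: ennreal_mult mult_ac)
      also have "\<dots> \<le> ennreal ((4 ^ k) ^ n) * (ennreal (4 / 3 * TN_const TYPE('a) q) * (ennreal (cc powr (1 / p)) * epow V (1 / p)) * dual_sup p q r G)"
        by (intro mult_left_mono test) simp
      also have "\<dots> = ennreal D * epow V (1 / p) * dual_sup p q r G"
      proof -
        have "ennreal D = ennreal ((4 ^ k) ^ n) * ennreal (4 / 3 * TN_const TYPE('a) q) * ennreal (cc powr (1 / p))"
          unfolding D_def using TN_const_pos[of q, where ?'a='a] by (simp only: ennreal_mult[symmetric] less_imp_le mult_nonneg_nonneg powr_ge_zero zero_le_power zero_le_numeral divide_nonneg_nonneg)
        then show ?thesis by (simp only: mult_ac)
      qed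
      finally have "V \<le> epow (ennreal D * dual_sup p q r G) p'"
        unfolding p'_def by (intro ennreal_power_absorb aV(2) p D)
      then show ?thesis using aV(3) by (rule order_trans[rotated])
    qed
    have inc: "incseq (\<lambda>N. bb N i)" for i
      by (auto simp: incseq_def bb_def bN_def half_trunc_mono)
    have SUPb: "(SUP N. bb N i) = (if i \<in> I then b i * ennreal (1 / 2) else 0)" for i
    proof (cases "i \<in> I")
      case True
      then show ?thesis by (simp only: bb_def bN_def if_True SUP_half_trunc_index)
    next
      case False
      then have "bb N i = 0" for N by (simp add: bb_def bN_def)
      then show ?thesis using False by simp
    qed
    have "(\<integral>\<^sup>+x. epow (disc_fun q Q (\<lambda>i. if i \<in> I then b i * ennreal (1 / 2) else 0) x) p' \<partial>lborel)
        = (\<integral>\<^sup>+x. (SUP N. epow (disc_fun q Q (bb N) x) p') \<partial>lborel)"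
      using p' by (simp add: SUPb[symmetric] disc_fun_SUP[OF q inc] epow_SUP)
    also have "\<dots> = (SUP N. \<integral>\<^sup>+x. epow (disc_fun q Q (bb N) x) p' \<partial>lborel)"
    proof (rule nn_integral_monotone_convergence_SUP)
      show "incseq (\<lambda>N x. epow (disc_fun q Q (bb N) x) p')"
        using p' inc by (auto simp: incseq_def le_fun_def intro!: epow_mono disc_fun_mono q)
    qed measurable
    also have "\<dots> \<le> epow (ennreal D * dual_sup p q r G) p'" using bound by (rule SUP_least)
    finally show ?thesis unfolding Q_def[abs_def] I_def b_def mem_Collect_eq .
  qed
  then show ?thesis using D unfolding p'_def by blast
qed

text \<open>Treats both forms of the dual norm for p > 1 at once: for q = 1 it is a nontangential
  maximal norm, for q > 1 an area norm, and \<open>disc_fun\<close> is the cell version of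
  either.\<close>

lemma tent_norm_le_disc:
  assumes p: "p > 1" and q: "q \<ge> 1" and r: "r \<ge> 1"
  shows "\<exists>C>0. \<forall>G :: 'a::euclidean_space \<times> real \<Rightarrow> ennreal. G \<in> borel_measurable borel \<longrightarrow>
    tent_norm (conj_exp p) (conj_exp q) (WA (conj_exp r) G) \<le> ennreal C *
     epow (\<integral>\<^sup>+x. epow (disc_fun q cell_ball (\<lambda>i. local_avg (conj_exp r) (cell i) G) (x :: 'a)) (p / (p - 1)) \<partial>lborel) (1 / (p / (p - 1)))"
proof -
  define p' where "p' = p / (p - 1)"
  have p': "p' > 1" "conj_exp p = ereal p'" using p by (auto simp: p'_def conj_exp_def field_simps)
  have r': "conj_exp r \<ge> 1" using r by (auto simp: conj_exp_def field_simps one_ereal_def)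
  define q' where "q' = q / (q - 1)"
  define K where "K = (if q = 1 then wav_const TYPE('a) else (wav_const TYPE('a) powr q' * (ivol TYPE('a) * \<alpha>2 ^ (DIM('a) + 1))) powr (1 / q'))"
  have wav_const: "wav_const TYPE('a) > 0" using wav_const_ge1[of "TYPE('a)"] by linarith
  have iv: "0 < ivol TYPE('a) * \<alpha>2 ^ (DIM('a) + 1)" using ivol_pos[where ?'a='a] \<alpha>2_pos by (intro mult_pos_pos zero_less_power)
  have "ivol TYPE('a) \<noteq> 0" "\<alpha>2 \<noteq> 0" using ivol_pos[where ?'a='a] \<alpha>2_pos by linarith+
  then have K: "K > 0" using wav_const by (auto simp: K_def)
  have "tent_norm (conj_exp p) (conj_exp q) (WA (conj_exp r) G) \<le> ennreal K *
     epow (\<integral>\<^sup>+x. epow (disc_fun q cell_ball (\<lambda>i. local_avg (conj_exp r) (cell i) G) (x :: 'a)) p' \<partial>lborel) (1 / p')"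
    if G [measurable]: "G \<in> borel_measurable borel" for G :: "'a \<times> real \<Rightarrow> ennreal"
  proof -
    define d where "d x = disc_fun q cell_ball (\<lambda>i. local_avg (conj_exp r) (cell i) G) (x :: 'a)" for x
    have [measurable]: "d \<in> borel_measurable borel" unfolding d_def by measurable
    have scale: "epow (\<integral>\<^sup>+x. epow (ennreal K * d x) p' \<partial>lborel) (1 / p') = ennreal K * epow (\<integral>\<^sup>+x. epow (d x) p' \<partial>lborel) (1 / p')"
    proof -
      have "(\<integral>\<^sup>+x. epow (ennreal K * d x) p' \<partial>lborel) = (\<integral>\<^sup>+x. ennreal (K powr p') * epow (d x) p' \<partial>lborel)"
        using K by (simp add: epow_mult epow_ennreal)
      also have "\<dots> = ennreal (K powr p') * (\<integral>\<^sup>+x. epow (d x) p' \<partial>lborel)"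
        by (rule nn_integral_cmult) measurable
      finally show ?thesis using K p' by (simp add: epow_mult epow_ennreal powr_powr)
    qed
    have "tent_norm (conj_exp p) (conj_exp q) (WA (conj_exp r) G) \<le> epow (\<integral>\<^sup>+x. epow (ennreal K * d x) p' \<partial>lborel) (1 / p')"
    proof (cases "q = 1")
      case True
      then have "tent_norm (conj_exp p) (conj_exp q) (WA (conj_exp r) G) = epow (\<integral>\<^sup>+x. epow (SUP z\<in>cone x. WA (conj_exp r) G z) p' \<partial>lborel) (1 / p')"
        by (simp add: p' conj_exp_def[of 1] tent_norm_nontangential)
      also have "\<dots> \<le> epow (\<integral>\<^sup>+x. epow (ennreal K * d x) p' \<partial>lborel) (1 / p')"
      proof (intro epow_mono nn_integral_mono)
        fix x :: 'a
        show "(SUP z\<in>cone x. WA (conj_exp r) G z) \<le> ennreal K * d x"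
          using SUP_cone_wav_le[OF G r', of x] True by (simp add: K_def d_def disc_fun_def)
      qed (use p' in auto)
      finally show ?thesis .
    next
      case False
      then have q': "q' > 1" "conj_exp q = ereal q'" using q by (auto simp: q'_def conj_exp_def field_simps)
      have "tent_norm (conj_exp p) (conj_exp q) (WA (conj_exp r) G) = epow (\<integral>\<^sup>+x. epow (epow (area q' (WA (conj_exp r) G) x) (1 / q')) p' \<partial>lborel) (1 / p')"
        by (simp add: p' q' tent_norm_real epow_epow)
      also have "\<dots> \<le> epow (\<integral>\<^sup>+x. epow (ennreal K * d x) p' \<partial>lborel) (1 / p')"
      proof (intro epow_mono nn_integral_mono)
        fix x :: 'a
        have "epow (area q' (WA (conj_exp r) G) x) (1 / q') \<le> epow (ennreal (wav_const TYPE('a) powr q' * (ivol TYPE('a) * \<alpha>2 ^ (DIM('a) + 1))) * (\<Sum>i. epow (local_avg (conj_exp r) (cell i) G) q' * indicator (cell_ball i) x)) (1 / q')"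
          using q' by (intro epow_mono area_wav_le G r') auto
        also have "\<dots> = epow (ennreal (wav_const TYPE('a) powr q' * (ivol TYPE('a) * \<alpha>2 ^ (DIM('a) + 1)))) (1 / q') * d x"
          using False by (simp only: epow_mult d_def disc_fun_def q'_def if_False)
        also have "epow (ennreal (wav_const TYPE('a) powr q' * (ivol TYPE('a) * \<alpha>2 ^ (DIM('a) + 1)))) (1 / q') = ennreal K"
          using False iv wav_const by (subst epow_ennreal) (auto simp: K_def less_imp_le)
        finally show "epow (area q' (WA (conj_exp r) G) x) (1 / q') \<le> ennreal K * d x" .
      qed (use p' in auto)
      finally show ?thesis .
    qed
    from this[unfolded scale] show ?thesis unfolding d_def .
  qed
  then show ?thesis using K unfolding p'_def by blast
qed

lemma lower_bound_finite:
  assumes p: "p > 1" and q: "q \<ge> 1" and r: "r \<ge> 1"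
  shows "\<exists>C>0. \<forall>G :: 'a::euclidean_space \<times> real \<Rightarrow> ennreal. G \<in> borel_measurable borel \<longrightarrow>
    tent_norm (conj_exp p) (conj_exp q) (WA (conj_exp r) G) \<le> ennreal C * dual_sup p q r G"
proof -
  define p' where "p' = p / (p - 1)"
  have p': "p' > 1" using p by (simp add: p'_def field_simps)
  \<comment> \<open>So many scales above the cell that the radius of the enlarged ball is at most
    one sixth of the cube size, as \<open>ball_subset_gcube_exists\<close> demands. The offset is
    common to all cells, so their levels still order the cubes.\<close>
  obtain k :: nat where k: "6 * ball_factor TYPE('a) < 4 ^ k" using real_arch_pow[of 4 "6 * ball_factor TYPE('a)"] by auto
  define Q where "Q J i = gcube J (level TYPE('a) i + int k) (corner i :: 'a)" for J i
  obtain D where D: "D > 0" "\<And>J. \<And>G :: 'a \<times> real \<Rightarrow> ennreal. G \<in> borel_measurable borel \<Longrightarrow>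
    (\<integral>\<^sup>+x. epow (disc_fun q (Q J) (\<lambda>i. if cell_ball i \<subseteq> Q J i then local_avg (conj_exp r) (cell i) G * ennreal (1 / 2) else 0) x) p' \<partial>lborel)
     \<le> epow (ennreal D * dual_sup p q r G) p'"
    using grid_bound[OF p q r, where ?'a='a, of k] unfolding Q_def p'_def by blast
  obtain C where C: "C > 0" "\<And>G :: 'a \<times> real \<Rightarrow> ennreal. G \<in> borel_measurable borel \<Longrightarrow>
    tent_norm (conj_exp p) (conj_exp q) (WA (conj_exp r) G) \<le> ennreal C *
     epow (\<integral>\<^sup>+x. epow (disc_fun q cell_ball (\<lambda>i. local_avg (conj_exp r) (cell i) G) (x :: 'a)) p' \<partial>lborel) (1 / p')"
    using tent_norm_le_disc[OF p q r, where ?'a='a] unfolding p'_def by blast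
  define S where "S = Pow (Basis :: 'a set)"
  have S: "finite S" "card S > 0" by (auto simp: S_def card_Pow)
  define m where "m = real (card S)"
  have m: "m > 0" using S by (simp add: m_def)
  have cover: "\<exists>J\<in>S. cell_ball i \<subseteq> Q J i" for i
  proof -
    have "6 * ball_factor TYPE('a) * csize TYPE('a) i \<le> 4 ^ k * csize TYPE('a) i" using k by (intro mult_right_mono) auto
    then have "ball_factor TYPE('a) * csize TYPE('a) i \<le> pow4 (level TYPE('a) i + int k) / 6"
      by (simp add: pow4_add csize_def)
    then show ?thesis unfolding Q_def S_def cell_ball_def using ball_subset_gcube_exists by blast
  qed
  \<comment> \<open>C discretizes the dual norm, 2 undoes the halving of the averages, the powers of
    m = 2^n pay for the summation over the grids, and D is the bound in one grid.\<close>
  define K where "K = C * (2 * m * (m powr p' * m) powr (1 / p') * D)"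
  have K: "K > 0" using C D m by (simp add: K_def)
  have "tent_norm (conj_exp p) (conj_exp q) (WA (conj_exp r) G) \<le> ennreal K * dual_sup p q r G"
    if G: "G \<in> borel_measurable borel" for G :: "'a \<times> real \<Rightarrow> ennreal"
  proof -
    define b where "b i = local_avg (conj_exp r) (cell i) G" for i
    define bJ where "bJ J i = (if cell_ball i \<subseteq> Q J i then b i * ennreal (1 / 2) else 0)" for J i
    define d where "d J = disc_fun q (Q J) (bJ J)" for J
    have [measurable]: "Q J i \<in> sets borel" for J i by (simp add: Q_def)
    have [measurable]: "d J \<in> borel_measurable borel" for J unfolding d_def by measurable
    have dle: "disc_fun q cell_ball b x \<le> ennreal (2 * m) * (\<Sum>J\<in>S. d J x)" for x
      unfolding m_def d_def
    proof (rule disc_fun_le_sum[OF q S(1)])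
      fix i
      obtain J where J: "J \<in> S" "cell_ball i \<subseteq> Q J i" using cover by blast
      have "b i * indicator (cell_ball i) x \<le> b i * indicator (Q J i) x"
        using J by (intro mult_left_mono) (auto simp: indicator_def)
      also have "\<dots> = ennreal 2 * (bJ J i * indicator (Q J i) x)"
      proof -
        have "ennreal 2 * (bJ J i * indicator (Q J i) x) = (2 * (b i * ennreal (1 / 2))) * indicator (Q J i) x"
          using J by (simp only: bJ_def if_True ennreal_numeral mult.assoc)
        then show ?thesis by (simp only: ennreal_half_mult)
      qed
      finally show "\<exists>J\<in>S. b i * indicator (cell_ball i) x \<le> ennreal 2 * (bJ J i * indicator (Q J i) x)" using J by blast
    qed simp
    have "(\<integral>\<^sup>+x. epow (disc_fun q cell_ball b (x :: 'a)) p' \<partial>lborel) \<le> (\<integral>\<^sup>+x. ennreal ((2 * m) powr p' * m powr p') * (\<Sum>J\<in>S. epow (d J x) p') \<partial>lborel)"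
    proof (intro nn_integral_mono)
      fix x :: 'a
      have "epow (disc_fun q cell_ball b x) p' \<le> epow (ennreal (2 * m) * (\<Sum>J\<in>S. d J x)) p'"
        using p' by (intro epow_mono dle) auto
      also have "\<dots> = ennreal ((2 * m) powr p') * epow (\<Sum>J\<in>S. d J x) p'"
        using m by (subst epow_mult, subst epow_ennreal) auto
      also have "\<dots> \<le> ennreal ((2 * m) powr p') * (ennreal (m powr p') * (\<Sum>J\<in>S. epow (d J x) p'))"
        unfolding m_def using p' S by (intro mult_left_mono epow_sum_le) auto
      also have "\<dots> = ennreal ((2 * m) powr p' * m powr p') * (\<Sum>J\<in>S. epow (d J x) p')"
        by (simp only: ennreal_mult[OF powr_ge_zero powr_ge_zero] mult.assoc)
      finally show "epow (disc_fun q cell_ball b x) p' \<le> ennreal ((2 * m) powr p' * m powr p') * (\<Sum>J\<in>S. epow (d J x) p')" .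
    qed
    also have "\<dots> = ennreal ((2 * m) powr p' * m powr p') * (\<integral>\<^sup>+x. (\<Sum>J\<in>S. epow (d J x) p') \<partial>lborel)"
      by (rule nn_integral_cmult) measurable
    also have "(\<integral>\<^sup>+x. (\<Sum>J\<in>S. epow (d J x) p') \<partial>lborel) = (\<Sum>J\<in>S. \<integral>\<^sup>+x. epow (d J x) p' \<partial>lborel)"
      by (rule nn_integral_sum) measurable
    also have "\<dots> \<le> (\<Sum>J\<in>S. epow (ennreal D * dual_sup p q r G) p')"
      unfolding d_def bJ_def b_def by (intro sum_mono D G)
    also have "\<dots> = ennreal m * epow (ennreal D * dual_sup p q r G) p'"
      by (simp add: m_def ennreal_of_nat_eq_real_of_nat)
    finally have "(\<integral>\<^sup>+x. epow (disc_fun q cell_ball b (x :: 'a)) p' \<partial>lborel) \<le> ennreal ((2 * m) powr p' * m powr p') * (ennreal m * epow (ennreal D * dual_sup p q r G) p')"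
      by (simp add: mult_left_mono)
    then have "epow (\<integral>\<^sup>+x. epow (disc_fun q cell_ball b (x :: 'a)) p' \<partial>lborel) (1 / p') \<le> epow (ennreal ((2 * m) powr p' * m powr p') * (ennreal m * epow (ennreal D * dual_sup p q r G) p')) (1 / p')"
      using p' by (intro epow_mono) auto
    also have "\<dots> = epow (ennreal ((2 * m) powr p' * (m powr p' * m))) (1 / p') * (ennreal D * dual_sup p q r G)"
      using p' m by (simp add: epow_mult ennreal_mult mult.assoc)
    also have "epow (ennreal ((2 * m) powr p' * (m powr p' * m))) (1 / p') = ennreal (2 * m * (m powr p' * m) powr (1 / p'))"
      using p' m by (subst epow_ennreal) (auto simp: powr_mult powr_powr)
    finally have "ennreal C * epow (\<integral>\<^sup>+x. epow (disc_fun q cell_ball b (x :: 'a)) p' \<partial>lborel) (1 / p') \<le> ennreal C * (ennreal (2 * m * (m powr p' * m) powr (1 / p')) * (ennreal D * dual_sup p q r G))"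
      by (rule mult_left_mono) simp
    also have "\<dots> = ennreal K * dual_sup p q r G"
      using C D m by (simp add: K_def ennreal_mult mult.assoc)
    finally show ?thesis using C(2)[OF G] unfolding b_def by (rule order_trans[rotated])
  qed
  then show ?thesis using K by blast
qed


section \<open>The endpoint p = 1\<close>

definition kball :: "'a::euclidean_space itself \<Rightarrow> real" where
  "kball T = ubv T * ball_factor T ^ DIM('a)"

lemma kball_pos [simp]: "kball TYPE('a::euclidean_space) > 0"
  by (simp add: kball_def)

lemma emeasure_cell_ball_kball: "emeasure lborel (cell_ball i :: 'a::euclidean_space set) = ennreal (kball TYPE('a) * csize TYPE('a) i ^ DIM('a))"
  by (simp add: emeasure_cell_ball kball_def)

text \<open>With a_i = \<beta>_i^(q'-1) the pairing and the q-th power sum of the coefficients, both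
  weighted by the cell bases, are the same number Z. The enlarged balls that matter lie in B =
  B(c,R), so Hoelder's inequality on B bounds the norm of the test function by a multiple of Z^(1/q)
  |B|^(1/q'), and Z^(1/q) is absorbed.\<close>

lemma Carleson_test:
  fixes G :: "'a::euclidean_space \<times> real \<Rightarrow> ennreal" and c :: 'a
  assumes q: "q > 1" and r: "r \<ge> 1" and G [measurable]: "G \<in> borel_measurable borel" and R: "R > 0"
  defines "q' \<equiv> q / (q - 1)"
  defines "c0 \<equiv> 4 / 3 * TN_const TYPE('a) q * kball TYPE('a) powr (1 / q)"
  shows "(\<Sum>i. epow (if cell_ball i \<subseteq> ball c R then local_avg (conj_exp r) (cell i) G * ennreal (1 / 2) else 0) q' * ennreal (csize TYPE('a) i ^ DIM('a)))
    \<le> ennreal (c0 powr q') * emeasure lborel (ball c R) * epow (dual_sup 1 q r G) q'"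
proof -
  have q': "q' > 1" "(q' - 1) * q = q'" using q by (auto simp: q'_def field_simps)
  define X where "X = dual_sup 1 q r G"
  define m where "m = emeasure lborel (ball c R)"
  have m: "m < top" using R by (simp add: m_def emeasure_ball_ubv)
  define I where "I = {i. cell_ball i \<subseteq> ball c R}"
  define b where "b i = local_avg (conj_exp r) (cell i) G" for i
  define bN where "bN N i = (if i \<in> I then half_trunc (b i) N else 0)" for N i
  define t where "t i = csize TYPE('a) i ^ DIM('a)" for i
  have t: "t i > 0" for i by (simp add: t_def)
  have c0: "c0 > 0" unfolding c0_def using TN_const_pos[of q, where ?'a='a] kball_pos[where ?'a='a]
    by (intro mult_pos_pos) (auto simp: less_imp_neq[symmetric])
  have bound: "(\<Sum>i<N. epow (bN N i) q' * ennreal (t i)) \<le> epow (ennreal c0 * (epow m (1 / q') * X)) q'" for N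
  proof -
    define \<beta> where "\<beta> i = enn2real (bN N i)" for i
    have bN: "bN N i = ennreal (\<beta> i)" for i using half_trunc_less_top[of "b i" N] by (simp add: \<beta>_def bN_def less_top)
    have \<beta>: "\<beta> i \<ge> 0" "\<beta> i = 0 \<or> ennreal (\<beta> i) < local_avg (conj_exp r) (cell i) G" for i
      using half_trunc_less[of "b i" N] bN[of i, symmetric] by (auto simp: \<beta>_def bN_def b_def)
    define Z where "Z = (\<Sum>i<N. epow (bN N i) q' * ennreal (t i))"
    have Z: "Z < top" unfolding Z_def bN using \<beta> by (auto simp: epow_ennreal ennreal_mult_less_top)
    define a where "a i = \<beta> i powr (q' - 1)" for i
    have a: "a i \<ge> 0" "a i * \<beta> i = \<beta> i powr q'" "a i powr q = \<beta> i powr q'" for i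
      using \<beta>(1)[of i] q' by (cases "\<beta> i = 0"; simp add: a_def powr_powr powr_mult_base mult.commute)+
    define S where "S x = (\<Sum>i<N. ennreal (a i powr q) * indicator (cell_ball i :: 'a set) x)" for x
    have [measurable]: "S \<in> borel_measurable borel" unfolding S_def by measurable
    \<comment> \<open>Only cells with enlarged ball inside B(c,R) have a nonzero coefficient.
      Writing the indicator of B(c,R) explicitly gives Hoelder's inequality its second
      factor.\<close>
    have S_supp: "S x = S x * indicator (ball c R) x" for x
    proof (cases "x \<in> ball c R")
      case False
      have "ennreal (a i powr q) * indicator (cell_ball i) x = 0" for i
      proof (cases "i \<in> I")
        case True
        then have "x \<notin> cell_ball i" using False by (auto simp: I_def)
        then show ?thesis by simp
      next
        case False
        then have "\<beta> i = 0" by (simp add: \<beta>_def bN_def)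
        then show ?thesis by (simp add: a)
      qed
      then have "S x = 0" unfolding S_def by (intro sum.neutral ballI)
      then show ?thesis by simp
    qed simp
    have "(\<integral>\<^sup>+x. epow (S x) (1 / q) \<partial>lborel) = (\<integral>\<^sup>+x. epow (S x) (1 / q) * indicator (ball c R) x \<partial>lborel)"
      by (intro nn_integral_cong) (metis S_supp epow_indicator)
    also have "\<dots> \<le> epow (\<integral>\<^sup>+x. epow (epow (S x) (1 / q)) q \<partial>lborel) (1 / q) * epow (\<integral>\<^sup>+x. epow (indicator (ball c R) x) q' \<partial>lborel) (1 / q')"
      unfolding q'_def by (intro nn_Holder q) (auto intro!: borel_measurable_indicator)
    also have "(\<integral>\<^sup>+x. epow (epow (S x) (1 / q)) q \<partial>lborel) = (\<integral>\<^sup>+x. S x \<partial>lborel)" using q by simp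
    also have "(\<integral>\<^sup>+x. S x \<partial>lborel) = (\<Sum>i<N. ennreal (a i powr q) * emeasure lborel (cell_ball i :: 'a set))"
      unfolding S_def by (subst nn_integral_sum) (auto simp: nn_integral_cmult_indicator)
    also have "\<dots> = ennreal (kball TYPE('a)) * Z"
      unfolding Z_def bN sum_distrib_left
    proof (intro sum.cong refl)
      fix i
      have "emeasure lborel (cell_ball i :: 'a set) = ennreal (kball TYPE('a)) * ennreal (t i)"
        unfolding emeasure_cell_ball_kball t_def using kball_pos[where ?'a='a] by (intro ennreal_mult) (auto simp: less_imp_le)
      then show "ennreal (a i powr q) * emeasure lborel (cell_ball i :: 'a set) = ennreal (kball TYPE('a)) * (epow (ennreal (\<beta> i)) q' * ennreal (t i))"
        using \<beta>(1) by (simp add: a epow_ennreal mult_ac)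
    qed
    also have "(\<integral>\<^sup>+x. epow (indicator (ball c R) x) q' \<partial>lborel) = m"
      by (simp add: epow_of_indicator m_def)
    finally have E: "(\<integral>\<^sup>+x. epow (\<Sum>i<N. ennreal (a i powr q) * indicator (cell_ball i :: 'a set) x) (1 / q) \<partial>lborel)
      \<le> epow (ennreal (kball TYPE('a)) * Z) (1 / q) * epow m (1 / q')" unfolding S_def .
    have "Z = (\<Sum>i<N. ennreal (a i * \<beta> i) * ennreal (csize TYPE('a) i ^ DIM('a)))"
      unfolding Z_def bN using \<beta>(1) by (simp add: a epow_ennreal t_def)
    also have "\<dots> \<le> ennreal (4 / 3 * TN_const TYPE('a) q) * epow (epow (ennreal (kball TYPE('a)) * Z) (1 / q) * epow m (1 / q')) (1 / 1) * dual_sup 1 q r G"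
      using q Z m by (intro test_bound r G \<beta> a(1) E) (auto simp: ennreal_mult_less_top)
    also have "\<dots> = ennreal c0 * epow Z (1 / q) * (epow m (1 / q') * X)"
    proof -
      have "ennreal c0 = ennreal (4 / 3 * TN_const TYPE('a) q) * epow (ennreal (kball TYPE('a))) (1 / q)"
        unfolding c0_def epow_ennreal[OF less_imp_le[OF kball_pos]]
        using TN_const_pos[of q, where ?'a='a] by (intro ennreal_mult) (auto simp: less_imp_le)
      then show ?thesis by (simp add: epow_mult X_def) (simp only: mult_ac)
    qed
    finally have "Z \<le> epow (ennreal c0 * (epow m (1 / q') * X)) (q / (q - 1))"
      by (intro ennreal_power_absorb Z q c0)
    then show ?thesis by (simp only: Z_def q'_def)
  qed
  have "(\<Sum>i. epow (if i \<in> I then b i * ennreal (1 / 2) else 0) q' * ennreal (t i))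
      = (\<Sum>i. SUP N. epow (if i < N then bN N i else 0) q' * ennreal (t i))"
  proof (intro suminf_cong)
    fix i
    have "(SUP N. if i < N then bN N i else 0) = (if i \<in> I then b i * ennreal (1 / 2) else 0)"
    proof (cases "i \<in> I")
      case True
      then show ?thesis by (simp only: bN_def if_True SUP_half_trunc_index)
    next
      case False
      then have "(if i < N then bN N i else 0) = 0" for N by (simp add: bN_def)
      then show ?thesis using False by simp
    qed
    then show "epow (if i \<in> I then b i * ennreal (1 / 2) else 0) q' * ennreal (t i) = (SUP N. epow (if i < N then bN N i else 0) q' * ennreal (t i))"
      using q' by (simp add: epow_SUP[symmetric] SUP_mult_right_ennreal[symmetric])
  qed
  also have "\<dots> = (SUP N. \<Sum>i. epow (if i < N then bN N i else 0) q' * ennreal (t i))"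
  proof (rule ennreal_suminf_SUP_eq)
    fix i
    have "incseq (\<lambda>N. if i < N then bN N i else 0)"
      by (auto simp: incseq_def bN_def half_trunc_mono)
    then show "incseq (\<lambda>N. epow (if i < N then bN N i else 0) q' * ennreal (t i))"
      using q' unfolding incseq_def by (intro allI impI mult_right_mono epow_mono) auto
  qed
  also have "\<dots> \<le> epow (ennreal c0 * (epow m (1 / q') * X)) q'"
  proof (rule SUP_least)
    fix N
    have "(\<Sum>i. epow (if i < N then bN N i else 0) q' * ennreal (t i)) = (\<Sum>i<N. epow (bN N i) q' * ennreal (t i))"
      by (subst suminf_finite[of "{..<N}"]) auto
    then show "(\<Sum>i. epow (if i < N then bN N i else 0) q' * ennreal (t i)) \<le> epow (ennreal c0 * (epow m (1 / q') * X)) q'"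
      using bound[of N] by simp
  qed
  also have "\<dots> = ennreal (c0 powr q') * m * epow X q'"
    using c0 q' by (simp add: epow_mult epow_ennreal less_imp_le mult.assoc)
  finally show ?thesis unfolding I_def b_def t_def m_def X_def mem_Collect_eq .
qed

text \<open>The tent over B(c,R) sees only cells whose enlarged balls lie in B(c, \<kappa> R). In
  the constant, \<kappa>^n is the ratio of the two volumes and 2^q' undoes the halving of the
  averages.\<close>

lemma lower_bound_Carleson:
  assumes q: "q > 1" and r: "r \<ge> 1"
  shows "\<exists>C>0. \<forall>G :: 'a::euclidean_space \<times> real \<Rightarrow> ennreal. G \<in> borel_measurable borel \<longrightarrow>
    tent_norm (conj_exp 1) (conj_exp q) (WA (conj_exp r) G) \<le> ennreal C * dual_sup 1 q r G"
proof -
  define q' where "q' = q / (q - 1)"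
  have q': "q' > 1" "conj_exp q = ereal q'" using q by (auto simp: q'_def conj_exp_def field_simps)
  have r': "conj_exp r \<ge> 1" using r by (auto simp: conj_exp_def field_simps one_ereal_def)
  define c0 where "c0 = 4 / 3 * TN_const TYPE('a) q * kball TYPE('a) powr (1 / q)"
  define K where "K = wav_const TYPE('a) powr q' * (ivol TYPE('a) * \<alpha>2)"
  define \<kappa> where "\<kappa> = tent_factor TYPE('a)"
  have \<kappa>: "\<kappa> > 0" unfolding \<kappa>_def tent_factor_def using ball_factor_pos[of "TYPE('a)"] by (intro add_pos_nonneg) (auto simp: less_imp_le)
  have c0: "c0 > 0" unfolding c0_def using TN_const_pos[of q, where ?'a='a] kball_pos[where ?'a='a]
    by (intro mult_pos_pos) (auto simp: less_imp_neq[symmetric])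
  have K: "K > 0" unfolding K_def using ivol_pos[where ?'a='a] wav_const_ge1[of "TYPE('a)"] \<alpha>2_pos
    by (intro mult_pos_pos) auto
  define C where "C = (K * 2 powr q' * c0 powr q' * \<kappa> ^ DIM('a)) powr (1 / q')"
  have Cp: "K * 2 powr q' * c0 powr q' * \<kappa> ^ DIM('a) > 0" using K c0 \<kappa> by (intro mult_pos_pos) auto
  have C: "C > 0" using K c0 \<kappa> by (simp add: C_def)
  have "tent_norm (conj_exp 1) (conj_exp q) (WA (conj_exp r) G) \<le> ennreal C * dual_sup 1 q r G"
    if G: "G \<in> borel_measurable borel" for G :: "'a \<times> real \<Rightarrow> ennreal"
  proof -
    define X where "X = dual_sup 1 q r G"
    have "epow ((\<integral>\<^sup>+z\<in>tent (ball c R). epow (WA (conj_exp r) G z) q' * ennreal (1 / snd z) \<partial>lborel) / emeasure lborel (ball c R)) (1 / q') \<le> ennreal C * X"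
      if R: "R > 0" for c :: 'a and R
    proof -
      define b where "b i = local_avg (conj_exp r) (cell i) G" for i
      define t where "t i = csize TYPE('a) i ^ DIM('a)" for i
      define I where "I = {i. cell_ball i \<subseteq> ball c (\<kappa> * R)}"
      have "(\<integral>\<^sup>+z\<in>tent (ball c R). epow (WA (conj_exp r) G z) q' * ennreal (1 / snd z) \<partial>lborel)
        \<le> ennreal K * (\<Sum>i. epow (b i) q' * of_bool (i \<in> I) * ennreal (t i))"
        using tent_wav_le[OF G r', of q' c R] q' by (simp add: K_def b_def I_def t_def \<kappa>_def)
      also have "(\<Sum>i. epow (b i) q' * of_bool (i \<in> I) * ennreal (t i)) = (\<Sum>i. ennreal (2 powr q') * (epow (if i \<in> I then b i * ennreal (1 / 2) else 0) q' * ennreal (t i)))"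
      proof (intro suminf_cong)
        fix i
        have "epow (b i) q' = epow (2 * (b i * ennreal (1 / 2))) q'" by (simp only: ennreal_half_mult)
        also have "\<dots> = ennreal (2 powr q') * epow (b i * ennreal (1 / 2)) q'"
          using epow_ennreal[of 2 q'] by (subst epow_mult) simp
        finally show "epow (b i) q' * of_bool (i \<in> I) * ennreal (t i) = ennreal (2 powr q') * (epow (if i \<in> I then b i * ennreal (1 / 2) else 0) q' * ennreal (t i))"
          by (cases "i \<in> I") (simp_all only: if_True if_False of_bool_eq mult.assoc mult_1_left mult_zero_left mult_zero_right epow_0)
      qed
      also have "\<dots> = ennreal (2 powr q') * (\<Sum>i. epow (if i \<in> I then b i * ennreal (1 / 2) else 0) q' * ennreal (t i))"
        by (rule ennreal_suminf_cmult)
      also have "ennreal K * \<dots> \<le> ennreal K * (ennreal (2 powr q') * (ennreal (c0 powr q') * emeasure lborel (ball c (\<kappa> * R)) * epow X q'))"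
        using Carleson_test[OF q r G, of "\<kappa> * R" c] \<kappa> R
        unfolding I_def b_def t_def X_def c0_def q'_def mem_Collect_eq by (intro mult_left_mono) auto
      also have "emeasure lborel (ball c (\<kappa> * R)) = ennreal (\<kappa> ^ DIM('a)) * emeasure lborel (ball c R)"
        using \<kappa> R by (simp add: emeasure_ball_ubv power_mult_distrib mult_ac flip: ennreal_mult)
      also have "ennreal K * (ennreal (2 powr q') * (ennreal (c0 powr q') * (ennreal (\<kappa> ^ DIM('a)) * emeasure lborel (ball c R)) * epow X q'))
         = ennreal (K * 2 powr q' * c0 powr q' * \<kappa> ^ DIM('a)) * epow X q' * emeasure lborel (ball c R)"
      proof -
        have "ennreal (K * 2 powr q' * c0 powr q' * \<kappa> ^ DIM('a)) = ennreal K * ennreal (2 powr q') * ennreal (c0 powr q') * ennreal (\<kappa> ^ DIM('a))"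
          using K \<kappa> by (simp only: ennreal_mult[symmetric] less_imp_le mult_nonneg_nonneg powr_ge_zero zero_le_power)
        then show ?thesis by (simp only: mult_ac)
      qed
      finally have le: "(\<integral>\<^sup>+z\<in>tent (ball c R). epow (WA (conj_exp r) G z) q' * ennreal (1 / snd z) \<partial>lborel)
        \<le> ennreal (K * 2 powr q' * c0 powr q' * \<kappa> ^ DIM('a)) * epow X q' * emeasure lborel (ball c R)" .
      have V: "emeasure lborel (ball c R) = ennreal (ubv TYPE('a) * R ^ DIM('a))" "ubv TYPE('a) * R ^ DIM('a) > 0"
        using R by (auto simp: emeasure_ball_ubv)
      have "(\<integral>\<^sup>+z\<in>tent (ball c R). epow (WA (conj_exp r) G z) q' * ennreal (1 / snd z) \<partial>lborel) / emeasure lborel (ball c R)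
         \<le> ennreal (K * 2 powr q' * c0 powr q' * \<kappa> ^ DIM('a)) * epow X q'"
        using le unfolding V(1) ennreal_divide_le_iff[OF V(2)] .
      then have "epow ((\<integral>\<^sup>+z\<in>tent (ball c R). epow (WA (conj_exp r) G z) q' * ennreal (1 / snd z) \<partial>lborel) / emeasure lborel (ball c R)) (1 / q')
        \<le> epow (ennreal (K * 2 powr q' * c0 powr q' * \<kappa> ^ DIM('a)) * epow X q') (1 / q')"
        using q' by (intro epow_mono) auto
      also have "\<dots> = epow (ennreal (K * 2 powr q' * c0 powr q' * \<kappa> ^ DIM('a))) (1 / q') * X"
        using q' by (simp only: epow_mult epow_inv)
      also have "\<dots> = ennreal C * X"
        unfolding C_def using Cp by (subst epow_ennreal) (auto simp: less_imp_le)
      finally show ?thesis .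
    qed
    then show ?thesis
      unfolding X_def q'(2) by (auto simp: conj_exp_def[of 1] tent_norm_Carleson intro!: SUP_least)
  qed
  then show ?thesis using C by blast
qed

text \<open>A test function living on a single cell already detects the average over that cell.
  Since the dual norm is an essential supremum, bounding all cell averages is enough.\<close>

lemma lower_bound_11:
  assumes r: "r \<ge> 1"
  shows "\<exists>C>0. \<forall>G :: 'a::euclidean_space \<times> real \<Rightarrow> ennreal. G \<in> borel_measurable borel \<longrightarrow>
    tent_norm (conj_exp 1) (conj_exp 1) (WA (conj_exp r) G) \<le> ennreal C * dual_sup 1 1 r G"
proof -
  have r': "conj_exp r \<ge> 1" using r by (auto simp: conj_exp_def field_simps one_ereal_def)
  define D where "D = 4 / 3 * TN_const TYPE('a) 1 * kball TYPE('a)"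
  have D: "D > 0" unfolding D_def using TN_const_pos[of 1, where ?'a='a] kball_pos[where ?'a='a] by (intro mult_pos_pos) auto
  define C where "C = wav_const TYPE('a) * (2 * D)"
  have C: "C > 0" unfolding C_def using D wav_const_ge1[of "TYPE('a)"] by (intro mult_pos_pos) auto
  have "tent_norm (conj_exp 1) (conj_exp 1) (WA (conj_exp r) G) \<le> ennreal C * dual_sup 1 1 r G"
    if G: "G \<in> borel_measurable borel" for G :: "'a \<times> real \<Rightarrow> ennreal"
  proof -
    define X where "X = dual_sup 1 1 r G"
    have b: "local_avg (conj_exp r) (cell i) G \<le> ennreal (2 * D) * X" for i
    proof -
      define b where "b = local_avg (conj_exp r) (cell i) G"
      have "half_trunc b N \<le> ennreal D * X" for N
      proof -
        define \<beta> where "\<beta> j = (if j = i then enn2real (half_trunc b N) else 0)" for j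
        define a where "a j = (if j = i then 1 else 0 :: real)" for j
        have bN: "half_trunc b N = ennreal (\<beta> i)" using half_trunc_less_top[of b N] by (simp add: \<beta>_def less_top)
        have \<beta>: "\<beta> j \<ge> 0" "\<beta> j = 0 \<or> ennreal (\<beta> j) < local_avg (conj_exp r) (cell j) G" for j
          using half_trunc_less[of b N] bN[symmetric] by (auto simp: \<beta>_def b_def)
        define t where "t = csize TYPE('a) i ^ DIM('a)"
        have t: "t > 0" by (simp add: t_def)
        have "(\<Sum>j<Suc i. ennreal (a j powr 1) * indicator (cell_ball j :: 'a set) x) = indicator (cell_ball i) x" for x
        proof -
          have "(\<Sum>j<Suc i. ennreal (a j powr 1) * indicator (cell_ball j :: 'a set) x) = (\<Sum>j<Suc i. if j = i then indicator (cell_ball i) x else 0)"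
            by (intro sum.cong) (auto simp: a_def)
          then show ?thesis by simp
        qed
        then have E: "(\<integral>\<^sup>+x. epow (\<Sum>j<Suc i. ennreal (a j powr 1) * indicator (cell_ball j :: 'a set) x) (1 / 1) \<partial>lborel) \<le> ennreal (kball TYPE('a) * t)"
          by (simp add: emeasure_cell_ball_kball t_def)
        have "ennreal (\<beta> i * t) = (\<Sum>j<Suc i. ennreal (a j * \<beta> j) * ennreal (csize TYPE('a) j ^ DIM('a)))"
        proof -
          have "(\<Sum>j<Suc i. ennreal (a j * \<beta> j) * ennreal (csize TYPE('a) j ^ DIM('a))) = (\<Sum>j<Suc i. if j = i then ennreal (\<beta> i * t) else 0)"
            using \<beta> t by (intro sum.cong) (auto simp: a_def t_def ennreal_mult)
          then show ?thesis by simp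
        qed
        also have "\<dots> \<le> ennreal (4 / 3 * TN_const TYPE('a) 1) * epow (ennreal (kball TYPE('a) * t)) (1 / 1) * dual_sup 1 1 r G"
          by (intro test_bound r G \<beta> E) (auto simp: a_def)
        also have "\<dots> = ennreal (D * t) * X"
        proof -
          have "ennreal (D * t) = ennreal (4 / 3 * TN_const TYPE('a) 1) * ennreal (kball TYPE('a) * t)"
            unfolding D_def mult.assoc using TN_const_pos[of 1, where ?'a='a] kball_pos[where ?'a='a] t
            by (subst ennreal_mult[symmetric]) (auto simp: less_imp_le mult.assoc)
          then show ?thesis by (simp add: X_def)
        qed
        finally have "ennreal (\<beta> i) * ennreal t \<le> (ennreal D * X) * ennreal t"
          using \<beta> D t by (simp add: ennreal_mult mult_ac)
        then have "ennreal (\<beta> i) * ennreal t / ennreal t \<le> ennreal D * X"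
          using t by (simp add: ennreal_divide_le_iff)
        then show ?thesis using t by (simp add: bN mult_divide_eq_ennreal)
      qed
      then have "b * ennreal (1 / 2) \<le> ennreal D * X" unfolding SUP_half_trunc[symmetric] by (rule SUP_least)
      then have "2 * (b * ennreal (1 / 2)) \<le> 2 * (ennreal D * X)" by (rule mult_left_mono) simp
      then have "b \<le> 2 * (ennreal D * X)" by (simp only: ennreal_half_mult)
      also have "\<dots> = ennreal (2 * D) * X" using D by (simp add: ennreal_mult mult.assoc)
      finally show ?thesis by (simp add: b_def)
    qed
    have "WA (conj_exp r) G z \<le> ennreal C * X" if "z \<in> upper_half" for z
    proof -
      have "WA (conj_exp r) G z \<le> ennreal (wav_const TYPE('a)) * (SUP i\<in>touch z. local_avg (conj_exp r) (cell i) G)"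
        using that by (intro wav_le_local_avg G r') (simp add: upper_half_def)
      also have "\<dots> \<le> ennreal (wav_const TYPE('a)) * (ennreal (2 * D) * X)"
        by (intro mult_left_mono SUP_least b) simp
      also have "\<dots> = ennreal C * X"
        using D wav_const_ge1[of "TYPE('a)"] by (simp add: C_def ennreal_mult mult.assoc)
      finally show ?thesis .
    qed
    then show ?thesis
      by (simp add: conj_exp_def[of 1] tent_norm_infty esssup_on_le_iff_AE X_def)
  qed
  then show ?thesis using C by blast
qed

theorem duality_lower_bound:
  assumes p: "p \<ge> 1" and q: "q \<ge> 1" and r: "r \<ge> 1"
  shows "\<exists>C>0. \<forall>G :: 'a::euclidean_space \<times> real \<Rightarrow> ennreal. G \<in> borel_measurable borel \<longrightarrow>
    tent_norm (conj_exp p) (conj_exp q) (WA (conj_exp r) G) \<le> ennreal C * dual_sup p q r G"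
proof (cases "p = 1")
  case True
  then show ?thesis using lower_bound_11[OF r, where ?'a='a] lower_bound_Carleson[OF _ r, of q, where ?'a='a] q
    by (cases "q = 1") auto
next
  case False
  then show ?thesis using lower_bound_finite[OF _ q r, of p, where ?'a='a] p by auto
qed

section \<open>A strictly positive weight\<close>

text \<open>Provides a reference element that vanishes nowhere on the half space: its products with
  bounded measurable functions stay in the space, and every element is a measurable multiple of it.
  It is constant on cells, with values small enough along the enumeration.\<close>

lemma positive_weight_exists:
  assumes pqr: "p \<ge> 1" "q \<ge> 1" "r \<ge> 1"
  shows "\<exists>w :: 'a::euclidean_space \<times> real \<Rightarrow> real. w \<in> borel_measurable borel \<and> (\<forall>z\<in>upper_half. w z > 0) \<and> (\<forall>z. z \<notin> upper_half \<longrightarrow> w z = 0) \<and>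
    TN p q r (\<lambda>z. ennreal (w z)) < top"
proof -
  define m where "m i = kball TYPE('a) * csize TYPE('a) i ^ DIM('a)" for i
  have m: "m i > 0" for i by (simp add: m_def)
  \<comment> \<open>The choice a_i^q = 2^(-i) \<epsilon>_i bounds the inner sum at x by twice the
    supremum of \<epsilon>_i over the balls containing x. The power p/q, on whichever side of 1 it
    lies, passes through a supremum, and \<epsilon>_i^(p/q) times the volume of the ball is 2^(-i),
    which is summable.\<close>
  define \<epsilon> where "\<epsilon> i = ((1 / 2) ^ i / m i) powr (q / p)" for i
  have \<epsilon>: "\<epsilon> i > 0" "\<epsilon> i powr (p / q) * m i = (1 / 2) ^ i" for i
    using m[of i] pqr by (auto simp: \<epsilon>_def powr_powr less_imp_neq[symmetric])
  define a where "a i = ((1 / 2) ^ i * \<epsilon> i) powr (1 / q)" for i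
  have a: "a i > 0" "a i powr q = (1 / 2) ^ i * \<epsilon> i" for i
    using \<epsilon>(1)[of i] pqr by (auto simp: a_def powr_powr less_imp_neq[symmetric])
  define Wt where "Wt z = (\<Sum>i. ennreal (a i) * indicator (cell i :: ('a \<times> real) set) z)" for z
  have [measurable]: "Wt \<in> borel_measurable borel" unfolding Wt_def by measurable
  have Wc: "Wt z = ennreal (a i)" if "z \<in> cell i" for z i
  proof -
    have "Wt z = (\<Sum>j\<in>{i}. ennreal (a j) * indicator (cell j) z)"
      unfolding Wt_def using cell_unique[OF that] by (intro suminf_finite) (auto simp: indicator_def)
    then show ?thesis using that by simp
  qed
  define w where "w z = enn2real (Wt z)" for z
  have wm: "w \<in> borel_measurable borel" unfolding w_def by measurable
  have wc: "w z = a i" if "z \<in> cell i" for z i using Wc[OF that] a by (simp add: w_def less_imp_le)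
  have wpos: "w z > 0" if "z \<in> upper_half" for z
  proof -
    from that have "z \<in> (\<Union>i. cell i)" unfolding UN_cell .
    then obtain i where "z \<in> cell i" by blast
    then show ?thesis by (simp only: wc a)
  qed
  have w0: "w z = 0" if "z \<notin> upper_half" for z
  proof -
    have "z \<notin> cell i" for i using that cell_subset_upper_half by auto
    then show ?thesis by (simp add: w_def Wt_def)
  qed
  have gw: "local_avg (ereal r) (cell i) (\<lambda>z. ennreal (w z)) \<le> ennreal (a i)" for i
  proof -
    define v where "v = 3 * csize TYPE('a) i ^ (DIM('a) + 1)"
    have v: "v > 0" "emeasure lborel (cell i :: ('a \<times> real) set) = ennreal v"
      by (simp_all add: v_def emeasure_cell)
    have "(\<integral>\<^sup>+z\<in>cell i. epow (ennreal (w z)) r \<partial>lborel) = (\<integral>\<^sup>+z. ennreal (a i powr r) * indicator (cell i :: ('a \<times> real) set) z \<partial>lborel)"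
      using a by (intro nn_integral_cong) (auto simp: indicator_def wc epow_ennreal less_imp_le)
    also have "\<dots> = ennreal (a i powr r) * ennreal v"
      by (subst nn_integral_cmult_indicator) (auto simp: v)
    finally have "(\<integral>\<^sup>+z\<in>cell i. epow (ennreal (w z)) r \<partial>lborel) / ennreal v \<le> ennreal (a i powr r)"
      using v by (subst ennreal_divide_le_iff) auto
    then show ?thesis using pqr a v by (simp add: local_avg_def epow_le_iff epow_ennreal less_imp_le)
  qed
  have geom: "(\<Sum>i. ennreal ((1 / 2) ^ i)) = ennreal 2"
    by (subst suminf_ennreal2) (auto simp: suminf_geometric summable_geometric)
  have pt: "epow (\<Sum>i. epow (local_avg (ereal r) (cell i) (\<lambda>z. ennreal (w z))) q * indicator (cell_ball i) x) (p / q)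
     \<le> ennreal (2 powr (p / q)) * (\<Sum>i. ennreal (\<epsilon> i powr (p / q)) * indicator (cell_ball i :: 'a set) x)" for x
  proof -
    define U where "U = (SUP i. ennreal (\<epsilon> i) * indicator (cell_ball i :: 'a set) x)"
    have "(\<Sum>i. epow (local_avg (ereal r) (cell i) (\<lambda>z. ennreal (w z))) q * indicator (cell_ball i) x) \<le> (\<Sum>i. ennreal ((1 / 2) ^ i) * U)"
    proof (intro suminf_le)
      fix i
      have "epow (local_avg (ereal r) (cell i) (\<lambda>z. ennreal (w z))) q * indicator (cell_ball i) x \<le> epow (ennreal (a i)) q * indicator (cell_ball i) x"
        using pqr by (intro mult_right_mono epow_mono gw) auto
      also have "\<dots> = ennreal ((1 / 2) ^ i) * (ennreal (\<epsilon> i) * indicator (cell_ball i) x)"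
        using a(1)[of i] a(2)[of i] \<epsilon>(1)[of i] by (simp add: epow_ennreal ennreal_mult less_imp_le mult.assoc)
      also have "\<dots> \<le> ennreal ((1 / 2) ^ i) * U"
        unfolding U_def by (intro mult_left_mono SUP_upper) auto
      finally show "epow (local_avg (ereal r) (cell i) (\<lambda>z. ennreal (w z))) q * indicator (cell_ball i) x \<le> ennreal ((1 / 2) ^ i) * U" .
    qed auto
    also have "\<dots> = ennreal 2 * U" unfolding ennreal_suminf_multc geom ..
    finally have "epow (\<Sum>i. epow (local_avg (ereal r) (cell i) (\<lambda>z. ennreal (w z))) q * indicator (cell_ball i) x) (p / q) \<le> epow (ennreal 2 * U) (p / q)"
      using pqr by (intro epow_mono) auto
    also have "\<dots> = ennreal (2 powr (p / q)) * epow U (p / q)"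
      unfolding epow_mult by (subst epow_ennreal) auto
    also have "epow U (p / q) = (SUP i. epow (ennreal (\<epsilon> i) * indicator (cell_ball i :: 'a set) x) (p / q))"
      unfolding U_def using pqr by (intro epow_SUP) auto
    also have "\<dots> = (SUP i. ennreal (\<epsilon> i powr (p / q)) * indicator (cell_ball i :: 'a set) x)"
      using \<epsilon>(1) by (simp add: epow_mult epow_of_indicator epow_ennreal less_imp_le)
    also have "\<dots> \<le> (\<Sum>i. ennreal (\<epsilon> i powr (p / q)) * indicator (cell_ball i :: 'a set) x)"
    proof (rule SUP_least)
      fix i
      define f where "f j = ennreal (\<epsilon> j powr (p / q)) * indicator (cell_ball j :: 'a set) x" for j
      have "f i \<le> (\<Sum>j. f j)" using sum_le_suminf[of f "{i}"] by simp
      then show "ennreal (\<epsilon> i powr (p / q)) * indicator (cell_ball i :: 'a set) x \<le> (\<Sum>i. ennreal (\<epsilon> i powr (p / q)) * indicator (cell_ball i :: 'a set) x)"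
        by (simp only: f_def)
    qed
    finally show ?thesis by (simp add: mult_left_mono)
  qed
  have "(\<integral>\<^sup>+x. epow (\<Sum>i. epow (local_avg (ereal r) (cell i) (\<lambda>z. ennreal (w z))) q * indicator (cell_ball i :: 'a set) x) (p / q) \<partial>lborel)
     \<le> (\<integral>\<^sup>+x. ennreal (2 powr (p / q)) * (\<Sum>i. ennreal (\<epsilon> i powr (p / q)) * indicator (cell_ball i :: 'a set) x) \<partial>lborel)"
    by (intro nn_integral_mono pt)
  also have "\<dots> = ennreal (2 powr (p / q)) * (\<integral>\<^sup>+x. (\<Sum>i. ennreal (\<epsilon> i powr (p / q)) * indicator (cell_ball i :: 'a set) x) \<partial>lborel)"
    by (rule nn_integral_cmult) measurable
  also have "(\<integral>\<^sup>+x. (\<Sum>i. ennreal (\<epsilon> i powr (p / q)) * indicator (cell_ball i :: 'a set) x) \<partial>lborel) = (\<Sum>i. ennreal (\<epsilon> i powr (p / q)) * emeasure lborel (cell_ball i :: 'a set))"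
    by (subst nn_integral_suminf) (auto simp: nn_integral_cmult_indicator)
  also have "\<dots> = (\<Sum>i. ennreal ((1 / 2) ^ i))"
  proof (intro suminf_cong)
    fix i
    have "ennreal (\<epsilon> i powr (p / q)) * ennreal (m i) = ennreal ((1 / 2) ^ i)"
      using m[of i] by (simp only: ennreal_mult[symmetric] powr_ge_zero less_imp_le \<epsilon>(2))
    then show "ennreal (\<epsilon> i powr (p / q)) * emeasure lborel (cell_ball i :: 'a set) = ennreal ((1 / 2) ^ i)"
      by (simp add: emeasure_cell_ball_kball m_def)
  qed
  also have "ennreal (2 powr (p / q)) * \<dots> < top" unfolding geom by (simp add: ennreal_mult_less_top)
  finally have fin: "(\<integral>\<^sup>+x. epow (\<Sum>i. epow (local_avg (ereal r) (cell i) (\<lambda>z. ennreal (w z))) q * indicator (cell_ball i :: 'a set) x) (p / q) \<partial>lborel) < top" .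
  have "TN p q r (\<lambda>z. ennreal (w z)) < top"
    using wm fin by (intro le_less_trans[OF TN_le_cells[OF pqr]]) (auto simp: ennreal_mult_less_top)
  then show ?thesis using wm wpos w0 by blast
qed

end

section \<open>Densities of finite signed set functions\<close>

text \<open>The supremum is the positive variation of \<nu>; \<open>ennreal\<close> cuts negative
  values to 0. It is superadditive because subsets of disjoint sets can be united. For countable
  subadditivity a subset is split along the partition, and continuity at the empty set disposes of
  the remainder. Radon-Nikodym then applies.\<close>

lemma positive_variation_density:
  fixes \<nu> :: "'a set \<Rightarrow> real"
  assumes sf: "sigma_finite_measure M"
    and add: "\<And>A B. A \<in> sets M \<Longrightarrow> B \<in> sets M \<Longrightarrow> A \<inter> B = {} \<Longrightarrow> \<nu> (A \<union> B) = \<nu> A + \<nu> B"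
    and cont: "\<And>A. range A \<subseteq> sets M \<Longrightarrow> decseq A \<Longrightarrow> (\<Inter>i::nat. A i) = {} \<Longrightarrow> (\<lambda>i. \<nu> (A i)) \<longlonglongrightarrow> 0"
    and null: "\<And>A. A \<in> null_sets M \<Longrightarrow> \<nu> A = 0"
  shows "\<exists>f\<in>borel_measurable M. \<forall>A\<in>sets M. (SUP F\<in>{F\<in>sets M. F \<subseteq> A}. ennreal (\<nu> F)) = (\<integral>\<^sup>+x\<in>A. f x \<partial>M)"
proof -
  interpret sigma_finite_measure M by fact
  define P where "P A = (SUP F\<in>{F\<in>sets M. F \<subseteq> A}. ennreal (\<nu> F))" for A
  have up: "ennreal (\<nu> F) \<le> P A" if "F \<in> sets M" "F \<subseteq> A" for F A
    unfolding P_def using that by (intro SUP_upper) auto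
  have ne: "{F\<in>sets M. F \<subseteq> A} \<noteq> {}" for A by auto
  have sup_add: "P A + P B \<le> P (A \<union> B)" if AB: "A \<in> sets M" "B \<in> sets M" "A \<inter> B = {}" for A B
  proof -
    have "ennreal (\<nu> F) + ennreal (\<nu> F') \<le> P (A \<union> B)"
      if F: "F \<in> sets M" "F \<subseteq> A" and F': "F' \<in> sets M" "F' \<subseteq> B" for F F'
    proof -
      have "\<nu> (F \<union> F') = \<nu> F + \<nu> F'" using F F' AB by (intro add) auto
      moreover have "ennreal (\<nu> (F \<union> F')) \<le> P (A \<union> B)" using F F' by (intro up) auto
      moreover have "ennreal (\<nu> F) \<le> P (A \<union> B)" "ennreal (\<nu> F') \<le> P (A \<union> B)" using F F' by (auto intro!: up)
      ultimately show ?thesis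
        by (cases "\<nu> F \<ge> 0"; cases "\<nu> F' \<ge> 0") (auto simp: ennreal_neg not_le less_imp_le simp flip: ennreal_plus)
    qed
    then have "P A + ennreal (\<nu> F') \<le> P (A \<union> B)" if "F' \<in> sets M" "F' \<subseteq> B" for F'
      unfolding P_def[of A] ennreal_SUP_add_left[OF ne, symmetric] using that by (intro SUP_least) auto
    then show ?thesis
      unfolding P_def[of B] ennreal_SUP_add_right[OF ne] by (intro SUP_least) auto
  qed
  have fin_add: "\<nu> F = (\<Sum>i<n. \<nu> (F \<inter> A i)) + \<nu> (F - (\<Union>i<n. A i))"
    if "F \<in> sets M" "range A \<subseteq> sets M" "disjoint_family A" for F n and A :: "nat \<Rightarrow> 'a set"
  proof (induction n)
    case (Suc n)
    have [measurable]: "A i \<in> sets M" for i using that by auto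
    have "\<nu> (F - (\<Union>i<n. A i)) = \<nu> ((F \<inter> A n) \<union> (F - (\<Union>i<Suc n. A i)))"
    proof (rule arg_cong[where f = \<nu>])
      have "A n \<inter> A i = {}" if "i < n" for i using \<open>disjoint_family A\<close> that by (auto simp: disjoint_family_on_def)
      then show "F - (\<Union>i<n. A i) = (F \<inter> A n) \<union> (F - (\<Union>i<Suc n. A i))"
        by (auto simp: less_Suc_eq)
    qed
    also have "\<dots> = \<nu> (F \<inter> A n) + \<nu> (F - (\<Union>i<Suc n. A i))"
      using that(1) by (intro add) auto
    finally show ?case using Suc by simp
  qed simp
  have ca: "countably_additive (sets M) P"
    unfolding countably_additive_def
  proof (intro allI impI)
    fix A :: "nat \<Rightarrow> 'a set" assume A: "range A \<subseteq> sets M" "disjoint_family A" "(\<Union>i. A i) \<in> sets M"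
    have Am [measurable]: "A i \<in> sets M" for i using A by auto
    have P0: "P {} = 0"
    proof -
      have "{F\<in>sets M. F \<subseteq> {}} = {{}}" by auto
      then show ?thesis unfolding P_def using null[of "{}"] by simp
    qed
    have "(\<Sum>i<n. P (A i)) \<le> P (\<Union>i<n. A i)" for n
    proof (induction n)
      case (Suc n)
      have "(\<Sum>i<Suc n. P (A i)) \<le> P (\<Union>i<n. A i) + P (A n)" using Suc by (simp add: add_right_mono)
      also have "\<dots> \<le> P ((\<Union>i<n. A i) \<union> A n)"
      proof (intro sup_add)
        have "A i \<inter> A n = {}" if "i < n" for i using A(2) that by (auto simp: disjoint_family_on_def)
        then show "(\<Union>i<n. A i) \<inter> A n = {}" by auto
      qed auto
      also have "(\<Union>i<n. A i) \<union> A n = (\<Union>i<Suc n. A i)" by (auto simp: less_Suc_eq)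
      finally show ?case .
    qed (simp add: P0)
    moreover have "P (\<Union>i<n. A i) \<le> P (\<Union>i. A i)" for n
      unfolding P_def by (intro SUP_subset_mono) auto
    ultimately have "(\<Sum>i<n. P (A i)) \<le> P (\<Union>i. A i)" for n by (meson order_trans)
    then have le: "(\<Sum>i. P (A i)) \<le> P (\<Union>i. A i)"
      by (intro suminf_le_const) auto
    have "ennreal (\<nu> F) \<le> (\<Sum>i. P (A i))" if F: "F \<in> sets M" "F \<subseteq> (\<Union>i. A i)" for F
    proof -
      \<comment> \<open>The first n pieces are charged to the variation. The remainder may have
        either sign, hence the absolute value, and tends to 0 by \<open>cont\<close>.\<close>
      have fa: "ennreal (\<nu> F) \<le> (\<Sum>i. P (A i)) + ennreal \<bar>\<nu> (F - (\<Union>i<n. A i))\<bar>" for n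
      proof -
        have "\<nu> F \<le> (\<Sum>i<n. \<bar>max 0 (\<nu> (F \<inter> A i))\<bar>) + \<bar>\<nu> (F - (\<Union>i<n. A i))\<bar>"
          unfolding fin_add[OF F(1) A(1,2), of n] by (intro add_mono sum_mono) auto
        then have "ennreal (\<nu> F) \<le> ennreal ((\<Sum>i<n. \<bar>max 0 (\<nu> (F \<inter> A i))\<bar>) + \<bar>\<nu> (F - (\<Union>i<n. A i))\<bar>)"
          by (rule ennreal_leI)
        also have "\<dots> = (\<Sum>i<n. ennreal \<bar>max 0 (\<nu> (F \<inter> A i))\<bar>) + ennreal \<bar>\<nu> (F - (\<Union>i<n. A i))\<bar>"
          by (subst ennreal_plus) (auto simp: sum_nonneg sum_ennreal)
        also have "(\<Sum>i<n. ennreal \<bar>max 0 (\<nu> (F \<inter> A i))\<bar>) \<le> (\<Sum>i<n. P (A i))"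
        proof (rule sum_mono)
          fix i
          have "ennreal \<bar>max 0 (\<nu> (F \<inter> A i))\<bar> = ennreal (\<nu> (F \<inter> A i))"
            by (auto simp: max_def ennreal_neg)
          also have "\<dots> \<le> P (A i)" using F by (intro up) auto
          finally show "ennreal \<bar>max 0 (\<nu> (F \<inter> A i))\<bar> \<le> P (A i)" .
        qed
        also have "(\<Sum>i<n. P (A i)) \<le> (\<Sum>i. P (A i))" by (intro sum_le_suminf) auto
        finally show ?thesis by (simp add: add_right_mono)
      qed
      have "(\<lambda>n. \<nu> (F - (\<Union>i<n. A i))) \<longlonglongrightarrow> 0"
      proof (rule cont)
        show "decseq (\<lambda>n. F - (\<Union>i<n. A i))" by (auto simp: decseq_def)
        show "(\<Inter>n. F - (\<Union>i<n. A i)) = {}" using F(2) by auto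
      qed (use F in auto)
      then have "(\<lambda>n. (\<Sum>i. P (A i)) + ennreal \<bar>\<nu> (F - (\<Union>i<n. A i))\<bar>) \<longlonglongrightarrow> (\<Sum>i. P (A i)) + ennreal \<bar>0\<bar>"
        by (intro tendsto_add tendsto_const tendsto_ennrealI tendsto_rabs)
      then have "ennreal (\<nu> F) \<le> (\<Sum>i. P (A i)) + ennreal \<bar>0\<bar>"
        using fa by (intro LIMSEQ_le_const) auto
      then show ?thesis by simp
    qed
    then have "P (\<Union>i. A i) \<le> (\<Sum>i. P (A i))"
      unfolding P_def[of "\<Union>i. A i"] by (intro SUP_least) auto
    with le show "(\<Sum>i. P (A i)) = P (\<Union>i. A i)" by (rule antisym)
  qed
  have pos: "positive (sets M) P"
  proof -
    have "{F\<in>sets M. F \<subseteq> {}} = {{}}" by auto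
    then show ?thesis unfolding positive_def P_def using null[of "{}"] by simp
  qed
  define N where "N = measure_of (space M) (sets M) P"
  have setsN: "sets N = sets M" by (simp add: N_def)
  have emN: "emeasure N A = P A" if "A \<in> sets M" for A
    unfolding N_def using that pos ca sets.space_closed sets.sigma_algebra_axioms by (intro emeasure_measure_of_sigma) auto
  have "absolutely_continuous M N"
    unfolding absolutely_continuous_def
  proof
    fix A assume A: "A \<in> null_sets M"
    then have Am: "A \<in> sets M" by auto
    have "\<nu> F = 0" if "F \<in> sets M" "F \<subseteq> A" for F
      using null_sets_subset[OF A that] by (rule null)
    then have "P A \<le> 0" unfolding P_def by (intro SUP_least) auto
    then show "A \<in> null_sets N" using Am emN setsN by (auto simp: null_sets_def)
  qed
  then obtain f where f: "f \<in> borel_measurable M" "density M f = N"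
    using Radon_Nikodym[OF _ setsN] by blast
  have "P A = (\<integral>\<^sup>+x\<in>A. f x \<partial>M)" if "A \<in> sets M" for A
    using emN[OF that] f that by (metis emeasure_density)
  then show ?thesis using f(1) unfolding P_def by blast
qed

text \<open>A Jordan decomposition that avoids Hahn sets: since \<nu>(A - F) = \<nu>(A) - \<nu>(F),
  maximizing \<nu> over subsets of A amounts to maximizing -\<nu> over their complements, up to the
  constant \<nu>(A). The positive and negative variations thus differ by \<nu>(A), and the bound K
  makes both finite.\<close>

lemma signed_density_exists:
  fixes \<nu> :: "'a set \<Rightarrow> real"
  assumes sf: "sigma_finite_measure M"
    and add: "\<And>A B. A \<in> sets M \<Longrightarrow> B \<in> sets M \<Longrightarrow> A \<inter> B = {} \<Longrightarrow> \<nu> (A \<union> B) = \<nu> A + \<nu> B"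
    and cont: "\<And>A. range A \<subseteq> sets M \<Longrightarrow> decseq A \<Longrightarrow> (\<Inter>i::nat. A i) = {} \<Longrightarrow> (\<lambda>i. \<nu> (A i)) \<longlonglongrightarrow> 0"
    and null: "\<And>A. A \<in> null_sets M \<Longrightarrow> \<nu> A = 0"
    and bound: "\<And>A. A \<in> sets M \<Longrightarrow> \<bar>\<nu> A\<bar> \<le> K"
  shows "\<exists>g :: 'a \<Rightarrow> real. integrable M g \<and> (\<forall>A\<in>sets M. \<nu> A = (\<integral>x. g x * indicator A x \<partial>M))"
proof -
  define Pp where "Pp A = (SUP F\<in>{F\<in>sets M. F \<subseteq> A}. ennreal (\<nu> F))" for A
  define Pm where "Pm A = (SUP F\<in>{F\<in>sets M. F \<subseteq> A}. ennreal (- \<nu> F))" for A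
  obtain fp where fp [measurable]: "fp \<in> borel_measurable M" and fpP: "\<And>A. A \<in> sets M \<Longrightarrow> Pp A = (\<integral>\<^sup>+x\<in>A. fp x \<partial>M)"
    using positive_variation_density[of M \<nu>, OF sf add cont null] unfolding Pp_def by blast
  have "\<exists>f\<in>borel_measurable M. \<forall>A\<in>sets M. (SUP F\<in>{F\<in>sets M. F \<subseteq> A}. ennreal (- \<nu> F)) = (\<integral>\<^sup>+x\<in>A. f x \<partial>M)"
  proof (rule positive_variation_density[OF sf])
    fix A assume "range A \<subseteq> sets M" "decseq A" "(\<Inter>i::nat. A i) = {}"
    from tendsto_minus[OF cont[OF this]] show "(\<lambda>i. - \<nu> (A i)) \<longlonglongrightarrow> 0" by simp
  qed (use add null in auto)
  then obtain fm where fm [measurable]: "fm \<in> borel_measurable M" and fmP: "\<And>A. A \<in> sets M \<Longrightarrow> Pm A = (\<integral>\<^sup>+x\<in>A. fm x \<partial>M)"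
    unfolding Pm_def by blast
  have Pfin: "Pp A < top" "Pm A < top" for A
  proof -
    have "Pp A \<le> ennreal K" unfolding Pp_def using bound by (intro SUP_least ennreal_leI) (auto simp: abs_le_iff)
    then show "Pp A < top" by (rule le_less_trans) simp
    have "Pm A \<le> ennreal K" unfolding Pm_def using bound by (intro SUP_least ennreal_leI) (auto simp: abs_le_iff)
    then show "Pm A < top" by (rule le_less_trans) simp
  qed
  have diff: "\<nu> (A - F) = \<nu> A - \<nu> F" if "A \<in> sets M" "F \<in> sets M" "F \<subseteq> A" for A F
  proof -
    have "\<nu> (F \<union> (A - F)) = \<nu> F + \<nu> (A - F)" using that by (intro add) auto
    moreover have "F \<union> (A - F) = A" using that by auto
    ultimately show ?thesis by simp
  qed
  have \<nu>eq: "\<nu> A = enn2real (Pp A) - enn2real (Pm A)" if A: "A \<in> sets M" for A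
  proof -
    have n0: "\<nu> {} = 0" using null[of "{}"] by simp
    have le1: "\<nu> F \<le> \<nu> A + enn2real (Pm A)" if "F \<in> sets M" "F \<subseteq> A" for F
    proof -
      have "ennreal (- \<nu> (A - F)) \<le> Pm A" unfolding Pm_def using A that by (intro SUP_upper) auto
      then have "ennreal (- \<nu> (A - F)) \<le> ennreal (enn2real (Pm A))" using Pfin(2)[of A] by (simp add: less_top)
      then have "- \<nu> (A - F) \<le> enn2real (Pm A)" by (subst (asm) ennreal_le_iff) auto
      then show ?thesis using diff[OF A that] by simp
    qed
    have "Pp A \<le> ennreal (\<nu> A + enn2real (Pm A))"
      unfolding Pp_def by (intro SUP_least ennreal_leI) (auto intro: le1)
    moreover have "0 \<le> \<nu> A + enn2real (Pm A)" using le1[of "{}"] n0 by simp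
    ultimately have 1: "enn2real (Pp A) \<le> \<nu> A + enn2real (Pm A)"
      by (metis enn2real_leI)
    have le2: "- \<nu> F \<le> - \<nu> A + enn2real (Pp A)" if "F \<in> sets M" "F \<subseteq> A" for F
    proof -
      have "ennreal (\<nu> (A - F)) \<le> Pp A" unfolding Pp_def using A that by (intro SUP_upper) auto
      then have "ennreal (\<nu> (A - F)) \<le> ennreal (enn2real (Pp A))" using Pfin(1)[of A] by (simp add: less_top)
      then have "\<nu> (A - F) \<le> enn2real (Pp A)" by (subst (asm) ennreal_le_iff) auto
      then show ?thesis using diff[OF A that] by simp
    qed
    have "Pm A \<le> ennreal (- \<nu> A + enn2real (Pp A))"
      unfolding Pm_def by (intro SUP_least ennreal_leI le2) auto
    moreover have "0 \<le> - \<nu> A + enn2real (Pp A)" using le2[of "{}"] n0 by simp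
    ultimately have "enn2real (Pm A) \<le> - \<nu> A + enn2real (Pp A)"
      by (metis enn2real_leI)
    with 1 show ?thesis by simp
  qed
  have dens: "\<exists>g :: 'a \<Rightarrow> real. integrable M g \<and> (\<forall>A\<in>sets M. (\<integral>x. g x * indicator A x \<partial>M) = enn2real (\<integral>\<^sup>+x\<in>A. f x \<partial>M))"
    if [measurable]: "f \<in> borel_measurable M" and fin: "(\<integral>\<^sup>+x\<in>space M. f x \<partial>M) < top" for f
  proof -
    have "(\<integral>\<^sup>+x\<in>space M. f x \<partial>M) = (\<integral>\<^sup>+x. f x \<partial>M)" by (intro nn_integral_cong) simp
    with fin have fin': "(\<integral>\<^sup>+x. f x \<partial>M) < top" by simp
    then have ae: "AE x in M. f x \<noteq> \<infinity>" by (intro nn_integral_PInf_AE) auto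
    have aeq: "AE x in M. ennreal (enn2real (f x)) = f x" using ae by eventually_elim (simp add: less_top)
    have "(\<integral>\<^sup>+x. ennreal (norm (enn2real (f x))) \<partial>M) = (\<integral>\<^sup>+x. f x \<partial>M)"
      by (rule nn_integral_cong_AE) (use aeq in \<open>eventually_elim, simp\<close>)
    then have int: "integrable M (\<lambda>x. enn2real (f x))" using fin' by (intro integrableI_bounded) auto
    moreover have "(\<integral>x. enn2real (f x) * indicator A x \<partial>M) = enn2real (\<integral>\<^sup>+x\<in>A. f x \<partial>M)" if [measurable]: "A \<in> sets M" for A
    proof -
      have "(\<integral>x. enn2real (f x) * indicator A x \<partial>M) = enn2real (\<integral>\<^sup>+x. ennreal (enn2real (f x) * indicator A x) \<partial>M)"
        by (rule integral_eq_nn_integral) auto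
      also have "(\<integral>\<^sup>+x. ennreal (enn2real (f x) * indicator A x) \<partial>M) = (\<integral>\<^sup>+x\<in>A. f x \<partial>M)"
        by (rule nn_integral_cong_AE) (use aeq in \<open>eventually_elim, auto simp: indicator_def\<close>)
      finally show ?thesis .
    qed
    ultimately show ?thesis by blast
  qed
  obtain gp where gp: "integrable M gp" "\<And>A. A \<in> sets M \<Longrightarrow> (\<integral>x. gp x * indicator A x \<partial>M) = enn2real (Pp A)"
    using dens[OF fp] Pfin(1)[of "space M"] fpP by force
  obtain gm where gm: "integrable M gm" "\<And>A. A \<in> sets M \<Longrightarrow> (\<integral>x. gm x * indicator A x \<partial>M) = enn2real (Pm A)"
    using dens[OF fm] Pfin(2)[of "space M"] fmP by force
  have "\<nu> A = (\<integral>x. (gp x - gm x) * indicator A x \<partial>M)" if A: "A \<in> sets M" for A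
  proof -
    have "(\<integral>x. (gp x - gm x) * indicator A x \<partial>M) = (\<integral>x. gp x * indicator A x - gm x * indicator A x \<partial>M)"
      by (simp add: left_diff_distrib)
    also have "\<dots> = (\<integral>x. gp x * indicator A x \<partial>M) - (\<integral>x. gm x * indicator A x \<partial>M)"
      using gp(1) gm(1) A by (intro Bochner_Integration.integral_diff integrable_real_mult_indicator)
    finally show ?thesis using gp(2) gm(2) A \<nu>eq by simp
  qed
  then show ?thesis using gp(1) gm(1) by (intro exI[of _ "\<lambda>x. gp x - gm x"]) auto
qed

lemma sigma_finite_lebesgue: "sigma_finite_measure (lebesgue :: 'a::euclidean_space measure)"
proof -
  obtain A :: "'a set set" where A: "countable A" "A \<subseteq> sets lborel" "\<Union>A = space lborel" "\<forall>a\<in>A. emeasure lborel a \<noteq> \<infinity>"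
    using lborel.sigma_finite_countable by blast
  have "emeasure lebesgue a = emeasure lborel a" if "a \<in> sets lborel" for a :: "'a set"
    using that by (auto simp: emeasure_completion)
  then show ?thesis using A
    by (intro sigma_finite_measure.intro exI[of _ A]) (auto simp: subset_eq intro: sets_completionI_sets)
qed

section \<open>Duality\<close>

context whitney_params
begin

definition weighted :: "real \<Rightarrow> ('a::euclidean_space \<times> real \<Rightarrow> complex) \<Rightarrow> 'a \<times> real \<Rightarrow> ennreal" where
  "weighted \<beta> f z = ennreal (cmod (f z) * snd z powr (- \<beta>))"

definition pairing_kernel :: "real \<Rightarrow> ('a::euclidean_space \<times> real \<Rightarrow> complex) \<Rightarrow> ('a \<times> real \<Rightarrow> complex) \<Rightarrow> 'a \<times> real \<Rightarrow> complex" where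
  "pairing_kernel \<beta>0 f h z = indicator upper_half z *\<^sub>R (f z * h z * complex_of_real (snd z powr (- \<beta>0 - 1)))"

definition dual_norm :: "real \<Rightarrow> real \<Rightarrow> real \<Rightarrow> ('a::euclidean_space \<times> real \<Rightarrow> ennreal) \<Rightarrow> ennreal" where
  "dual_norm p q r G = tent_norm (conj_exp p) (conj_exp q) (WA (conj_exp r) G)"

lemma wtent_norm_TN: "wtent_norm \<alpha>1 \<alpha>2 (ereal p) (ereal q) (ereal r) \<beta> f = TN p q r (weighted \<beta> f)"
  by (simp add: wtent_norm_def whitney_avg_eq_wav TN_def weighted_def[abs_def] norm_mult)

lemma wtent_norm_dual: "wtent_norm \<alpha>1 \<alpha>2 (conj_exp p) (conj_exp q) (conj_exp r) \<beta> h = dual_norm p q r (weighted \<beta> h)"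
  by (simp add: wtent_norm_def whitney_avg_eq_wav dual_norm_def weighted_def[abs_def] norm_mult)

lemma pairing_eq_integral_kernel: "pairing \<beta>0 f h = (\<integral>z. pairing_kernel \<beta>0 f h z \<partial>lebesgue)"
  by (simp add: pairing_def set_lebesgue_integral_def pairing_kernel_def)

lemma pairing_integrable_iff_kernel: "pairing_integrable \<beta>0 f h \<longleftrightarrow> integrable lebesgue (pairing_kernel \<beta>0 f h)"
  by (simp add: pairing_integrable_def set_integrable_def pairing_kernel_def[abs_def])

lemma lebesgue_measurable_snd [measurable]: "snd \<in> borel_measurable (lebesgue :: ('a::euclidean_space \<times> real) measure)"
  by (intro borel_measurable_lebesgueI) measurable

lemma lebesgue_measurable_powr [measurable]:
  "(\<lambda>z. snd z powr a) \<in> borel_measurable (lebesgue :: ('a::euclidean_space \<times> real) measure)"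
  by (intro borel_measurable_lebesgueI) measurable

lemma lebesgue_upper_half [measurable]: "(upper_half :: ('a::euclidean_space \<times> real) set) \<in> sets lebesgue"
  using upper_half_sets by (auto intro: sets_completionI_sets)

lemma weighted_measurable [measurable]:
  fixes f :: "'a::euclidean_space \<times> real \<Rightarrow> complex"
  assumes f [measurable]: "f \<in> borel_measurable lebesgue"
  shows "weighted \<beta> f \<in> borel_measurable lebesgue"
proof -
  have "(\<lambda>z. cmod (f z)) \<in> borel_measurable lebesgue" by (rule measurable_compose[OF f borel_measurable_norm])
  then show ?thesis unfolding weighted_def[abs_def]
    by (intro measurable_compose[OF _ measurable_ennreal] borel_measurable_times lebesgue_measurable_powr)
qed

lemma pairing_kernel_measurable [measurable]:
  assumes [measurable]: "f \<in> borel_measurable lebesgue" "h \<in> borel_measurable lebesgue"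
  shows "pairing_kernel \<beta>0 f h \<in> borel_measurable lebesgue"
  unfolding pairing_kernel_def[abs_def] by measurable

lemma powr_weights: "s > 0 \<Longrightarrow> s powr (- \<beta>) * s powr (- (\<beta>0 - \<beta>)) * (1 / s) = s powr (- \<beta>0 - 1)" for s :: real
proof -
  assume s: "s > 0"
  have "1 / s = s powr (- 1)" using s by (simp add: powr_minus inverse_eq_divide)
  then have "s powr (- \<beta>) * s powr (- (\<beta>0 - \<beta>)) * (1 / s) = s powr (- \<beta> + - (\<beta>0 - \<beta>) + - 1)"
    by (simp only: powr_add)
  also have "- \<beta> + - (\<beta>0 - \<beta>) + - 1 = - \<beta>0 - 1" by simp
  finally show ?thesis .
qed

text \<open>The powers of t multiply to t^(-\<beta>0 - 1) by \<open>powr_weights\<close>, so for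
  every \<beta> the modulus of the integrand is the product of the two weighted moduli against dy
  dt/t.\<close>

lemma norm_pairing_kernel:
  "ennreal (norm (pairing_kernel \<beta>0 f h z)) = weighted \<beta> f z * weighted (\<beta>0 - \<beta>) h z * ennreal (1 / snd z) * indicator upper_half z"
proof (cases "z \<in> upper_half")
  case True
  then have s: "snd z > 0" by (simp add: upper_half_def)
  have "norm (pairing_kernel \<beta>0 f h z) = cmod (f z) * cmod (h z) * (snd z powr (- \<beta>) * snd z powr (- (\<beta>0 - \<beta>)) * (1 / snd z))"
    unfolding powr_weights[OF s] using True by (simp add: pairing_kernel_def norm_mult)
  also have "\<dots> = (cmod (f z) * snd z powr (- \<beta>)) * (cmod (h z) * snd z powr (- (\<beta>0 - \<beta>))) * (1 / snd z)"
    by (simp only: mult_ac)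
  finally show ?thesis using True s unfolding weighted_def
    by (simp only: ennreal_mult mult_nonneg_nonneg norm_ge_zero powr_ge_zero indicator_simps mult_1_right divide_nonneg_pos zero_le_one)
qed (simp add: pairing_kernel_def)

lemma pairing_kernel_bound:
  assumes pqr: "p \<ge> 1" "q \<ge> 1" "r \<ge> 1"
  shows "\<exists>C>0. \<forall>f h :: 'a::euclidean_space \<times> real \<Rightarrow> complex. f \<in> borel_measurable lebesgue \<longrightarrow> h \<in> borel_measurable lebesgue \<longrightarrow>
    (\<integral>\<^sup>+z. ennreal (norm (pairing_kernel \<beta>0 f h z)) \<partial>lebesgue) \<le> ennreal C * TN p q r (weighted \<beta> f) * dual_norm p q r (weighted (\<beta>0 - \<beta>) h)"
proof -
  obtain C where C: "C > 0" "\<And>F G :: 'a \<times> real \<Rightarrow> ennreal. F \<in> borel_measurable lebesgue \<Longrightarrow> G \<in> borel_measurable lebesgue \<Longrightarrow>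
    (\<integral>\<^sup>+z\<in>upper_half. F z * G z * ennreal (1 / snd z) \<partial>lborel) \<le>
      ennreal C * tent_norm (ereal p) (ereal q) (WA (ereal r) F) * tent_norm (conj_exp p) (conj_exp q) (WA (conj_exp r) G)"
    using duality_upper_bound[OF pqr, where ?'a='a] by blast
  have "(\<integral>\<^sup>+z. ennreal (norm (pairing_kernel \<beta>0 f h z)) \<partial>lebesgue) \<le> ennreal C * TN p q r (weighted \<beta> f) * dual_norm p q r (weighted (\<beta>0 - \<beta>) h)"
    if "f \<in> borel_measurable lebesgue" "h \<in> borel_measurable lebesgue" for f h :: "'a \<times> real \<Rightarrow> complex"
    unfolding nn_integral_completion norm_pairing_kernel[of _ _ _ _ \<beta>] TN_def dual_norm_def using that by (intro C weighted_measurable)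
  then show ?thesis using C(1) by blast
qed

lemma pairing_bound:
  assumes "f \<in> borel_measurable lebesgue" "h \<in> borel_measurable lebesgue" "(\<integral>\<^sup>+z. ennreal (norm (pairing_kernel \<beta>0 f h z)) \<partial>lebesgue) < top"
  shows "integrable lebesgue (pairing_kernel \<beta>0 f h)" "ennreal (cmod (pairing \<beta>0 f h)) \<le> (\<integral>\<^sup>+z. ennreal (norm (pairing_kernel \<beta>0 f h z)) \<partial>lebesgue)"
proof -
  show int: "integrable lebesgue (pairing_kernel \<beta>0 f h)" using assms by (intro integrableI_bounded) auto
  show "ennreal (cmod (pairing \<beta>0 f h)) \<le> (\<integral>\<^sup>+z. ennreal (norm (pairing_kernel \<beta>0 f h z)) \<partial>lebesgue)"
    unfolding pairing_eq_integral_kernel by (rule integral_norm_bound_ennreal[OF int])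
qed

text \<open>The conjugate phase of h makes the integrand of the bilinear pairing nonnegative, and
  t^\<beta> cancels the weight of the norm. Where h vanishes \<open>sgn\<close> is 0, which can only
  lower the norm.\<close>

definition aligned :: "real \<Rightarrow> ('a::euclidean_space \<times> real \<Rightarrow> real) \<Rightarrow> ('a \<times> real \<Rightarrow> complex) \<Rightarrow> 'a \<times> real \<Rightarrow> complex" where
  "aligned \<beta> F h z = complex_of_real (F z * snd z powr \<beta>) * cnj (sgn (h z))"

lemma cnj_sgn_measurable:
  fixes h :: "'b \<Rightarrow> complex"
  assumes h [measurable]: "h \<in> borel_measurable M"
  shows "(\<lambda>z. cnj (sgn (h z))) \<in> borel_measurable M"
proof -
  have "cnj \<in> borel_measurable borel" by (intro borel_measurable_continuous_onI continuous_intros)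
  from measurable_compose[OF h this] have [measurable]: "(\<lambda>z. cnj (h z)) \<in> borel_measurable M" .
  show ?thesis unfolding sgn_div_norm complex_cnj_scaleR by measurable
qed

lemma aligned_measurable [measurable]:
  assumes [measurable]: "F \<in> borel_measurable lebesgue" and h: "h \<in> borel_measurable lebesgue"
  shows "aligned \<beta> F h \<in> borel_measurable lebesgue"
proof -
  note [measurable] = cnj_sgn_measurable[OF h]
  show ?thesis unfolding aligned_def[abs_def] by measurable
qed

lemma cnj_sgn_mult: "cnj (sgn w) * w = complex_of_real (cmod w)"
proof (cases "w = 0")
  case False
  have "cnj (sgn w) * w = cnj w * w / complex_of_real (cmod w)" by (simp add: sgn_eq)
  also have "cnj w * w = complex_of_real (cmod w) * complex_of_real (cmod w)"
    using complex_norm_square[of w] by (simp only: mult.commute[of "cnj w"] power2_eq_square of_real_mult)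
  finally show ?thesis using False by simp
qed simp

lemma weighted_aligned_le:
  assumes "\<And>z. F z \<ge> 0" "z \<in> upper_half"
  shows "weighted \<beta> (aligned \<beta> F h) z \<le> ennreal (F z)"
proof -
  have s: "snd z > 0" using assms(2) by (simp add: upper_half_def)
  have "cmod (aligned \<beta> F h z) * snd z powr (- \<beta>) = F z * cmod (sgn (h z)) * (snd z powr \<beta> * snd z powr (- \<beta>))"
    using assms(1)[of z] by (simp add: aligned_def norm_mult)
  also have "snd z powr \<beta> * snd z powr (- \<beta>) = 1" using s by (simp flip: powr_add)
  also have "F z * cmod (sgn (h z)) * 1 \<le> F z * 1" using assms(1)[of z] by (auto simp: norm_sgn)
  finally show ?thesis unfolding weighted_def by (simp add: ennreal_leI)
qed

lemma TN_aligned_le: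
  assumes "p \<ge> 1" "q \<ge> 1" "r \<ge> 1" and "\<And>z. F z \<ge> 0"
  shows "TN p q r (weighted \<beta> (aligned \<beta> F h)) \<le> TN p q r (\<lambda>z. ennreal (F z))"
  using assms by (intro TN_mono AE_I2 impI weighted_aligned_le)

lemma pairing_aligned:
  fixes h :: "'a::euclidean_space \<times> real \<Rightarrow> complex"
  assumes F [measurable]: "F \<in> borel_measurable lebesgue" and F0: "\<And>z. F z \<ge> 0" and h [measurable]: "h \<in> borel_measurable lebesgue"
    and fin: "(\<integral>\<^sup>+z. ennreal (norm (pairing_kernel \<beta>0 (aligned \<beta> F h) h z)) \<partial>lebesgue) < top"
  shows "ennreal (cmod (pairing \<beta>0 (aligned \<beta> F h) h)) = (\<integral>\<^sup>+z\<in>upper_half. ennreal (F z) * weighted (\<beta>0 - \<beta>) h z * ennreal (1 / snd z) \<partial>lborel)"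
proof -
  define \<phi> where "\<phi> z = indicator upper_half z * (F z * snd z powr \<beta> * cmod (h z) * snd z powr (- \<beta>0 - 1))" for z :: "'a \<times> real"
  have \<phi>0: "\<phi> z \<ge> 0" for z unfolding \<phi>_def using F0 by (intro mult_nonneg_nonneg) auto
  have k\<phi>: "pairing_kernel \<beta>0 (aligned \<beta> F h) h z = complex_of_real (\<phi> z)" for z
  proof -
    have "aligned \<beta> F h z * h z = complex_of_real (F z * snd z powr \<beta>) * complex_of_real (cmod (h z))"
      by (simp only: aligned_def mult.assoc cnj_sgn_mult)
    then show ?thesis by (simp add: pairing_kernel_def \<phi>_def scaleR_conv_of_real mult_ac)
  qed
  have int: "integrable lebesgue (pairing_kernel \<beta>0 (aligned \<beta> F h) h)" using fin by (intro pairing_bound) auto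
  have "integrable lebesgue (\<lambda>z. norm (pairing_kernel \<beta>0 (aligned \<beta> F h) h z))" using int by (rule integrable_norm)
  then have int\<phi>: "integrable lebesgue \<phi>" using \<phi>0 by (simp add: k\<phi>)
  have "pairing \<beta>0 (aligned \<beta> F h) h = complex_of_real (\<integral>z. \<phi> z \<partial>lebesgue)"
    unfolding pairing_eq_integral_kernel k\<phi> by (rule integral_complex_of_real)
  then have "ennreal (cmod (pairing \<beta>0 (aligned \<beta> F h) h)) = ennreal (\<integral>z. \<phi> z \<partial>lebesgue)"
    using \<phi>0 by (simp add: integral_nonneg_AE)
  also have "\<dots> = (\<integral>\<^sup>+z. ennreal (\<phi> z) \<partial>lborel)"
    using nn_integral_eq_integral[OF int\<phi>] \<phi>0 by (simp add: nn_integral_completion)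
  also have "\<dots> = (\<integral>\<^sup>+z\<in>upper_half. ennreal (F z) * weighted (\<beta>0 - \<beta>) h z * ennreal (1 / snd z) \<partial>lborel)"
  proof (intro nn_integral_cong)
    fix z :: "'a \<times> real"
    show "ennreal (\<phi> z) = ennreal (F z) * weighted (\<beta>0 - \<beta>) h z * ennreal (1 / snd z) * indicator upper_half z"
    proof (cases "z \<in> upper_half")
      case True
      then have s: "snd z > 0" by (simp add: upper_half_def)
      have 1: "snd z powr \<beta> * snd z powr (- \<beta>) = 1" using s by (simp flip: powr_add)
      have "\<phi> z = F z * cmod (h z) * (snd z powr \<beta> * (snd z powr (- \<beta>) * snd z powr (- (\<beta>0 - \<beta>)) * (1 / snd z)))"
        unfolding powr_weights[OF s] using True by (simp add: \<phi>_def)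
      also have "\<dots> = F z * cmod (h z) * ((snd z powr \<beta> * snd z powr (- \<beta>)) * snd z powr (- (\<beta>0 - \<beta>)) * (1 / snd z))"
        by (simp only: mult.assoc)
      also have "\<dots> = F z * (cmod (h z) * snd z powr (- (\<beta>0 - \<beta>))) * (1 / snd z)"
        unfolding 1 by (simp only: mult_1_left mult.assoc)
      finally show ?thesis using True s F0[of z] unfolding weighted_def
        by (simp only: ennreal_mult mult_nonneg_nonneg norm_ge_zero powr_ge_zero indicator_simps mult_1_right divide_nonneg_pos zero_le_one)
    qed (simp add: \<phi>_def)
  qed
  finally show ?thesis .
qed

text \<open>Carries the lower bound from Borel to Lebesgue measurable G, since neither side reacts
  to changes on null sets. Finiteness of the left side is not presupposed: the lemma is applied to
  densities of unknown norm.\<close>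

lemma dual_norm_le_dual_sup:
  assumes pqr: "p \<ge> 1" "q \<ge> 1" "r \<ge> 1"
  shows "\<exists>C>0. \<forall>G :: 'a::euclidean_space \<times> real \<Rightarrow> ennreal. G \<in> borel_measurable lebesgue \<longrightarrow>
    dual_norm p q r G \<le> ennreal C * dual_sup p q r G"
proof -
  obtain C where C: "C > 0" "\<And>G :: 'a \<times> real \<Rightarrow> ennreal. G \<in> borel_measurable borel \<Longrightarrow>
    tent_norm (conj_exp p) (conj_exp q) (WA (conj_exp r) G) \<le> ennreal C * dual_sup p q r G"
    using duality_lower_bound[OF pqr, where ?'a='a] by blast
  have "dual_norm p q r G \<le> ennreal C * dual_sup p q r G" if G: "G \<in> borel_measurable lebesgue" for G :: "'a \<times> real \<Rightarrow> ennreal"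
  proof -
    obtain G0 where G0: "G0 \<in> borel_measurable borel" and GG: "AE z in lborel. G z = G0 z"
      using borel_version[OF G] .
    have "(\<integral>\<^sup>+z\<in>upper_half. ennreal (F z) * G0 z * ennreal (1 / snd z) \<partial>lborel) = (\<integral>\<^sup>+z\<in>upper_half. ennreal (F z) * G z * ennreal (1 / snd z) \<partial>lborel)" for F :: "'a \<times> real \<Rightarrow> real"
      by (rule nn_integral_cong_AE) (use GG in \<open>eventually_elim, simp\<close>)
    then have "dual_sup p q r G0 = dual_sup p q r G" by (simp add: dual_sup_def)
    then show ?thesis using C(2)[OF G0] by (simp add: dual_norm_def wav_cong_AE[OF GG])
  qed
  then show ?thesis using C(1) by blast
qed


text \<open>Nothing is claimed about the size of h: it is measurable, and its pairing with every
  element of T converges absolutely. Two features of T carry the argument: it is solid, meaning that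
  measurable functions dominated by an element belong to it, and its norm is order
  continuous.\<close>

lemma representation:
  fixes \<beta> \<beta>0 :: real and L :: "('a::euclidean_space \<times> real \<Rightarrow> complex) \<Rightarrow> complex"
  assumes pqr: "p \<ge> 1" "q \<ge> 1" "r \<ge> 1"
  defines "T \<equiv> {f. f \<in> borel_measurable lebesgue \<and> TN p q r (weighted \<beta> f) < top}"
  assumes L_add: "\<And>f g. f \<in> T \<Longrightarrow> g \<in> T \<Longrightarrow> L (\<lambda>z. f z + g z) = L f + L g"
    and L_mult: "\<And>f a. f \<in> T \<Longrightarrow> L (\<lambda>z. a * f z) = a * L f"
    and L_bound: "\<And>f. f \<in> T \<Longrightarrow> ennreal (cmod (L f)) \<le> ennreal C * TN p q r (weighted \<beta> f)"
  shows "\<exists>h\<in>borel_measurable lebesgue. \<forall>f\<in>T. integrable lebesgue (pairing_kernel \<beta>0 f h) \<and> L f = pairing \<beta>0 f h"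
proof -
  have T_meas: "f \<in> borel_measurable lebesgue" if "f \<in> T" for f using that by (simp add: T_def)
  have dom: "TN p q r (weighted \<beta> g) \<le> ennreal k * TN p q r (weighted \<beta> f)"
    if "f \<in> T" "k > 0" "\<And>z. z \<in> upper_half \<Longrightarrow> cmod (g z) \<le> k * cmod (f z)" for f g k
  proof -
    have "TN p q r (weighted \<beta> g) \<le> TN p q r (\<lambda>z. ennreal k * weighted \<beta> f z)"
    proof (intro TN_mono pqr AE_I2 impI)
      fix z :: "'a \<times> real" assume "z \<in> upper_half"
      then have "cmod (g z) * snd z powr (- \<beta>) \<le> k * cmod (f z) * snd z powr (- \<beta>)"
        using that by (intro mult_right_mono) auto
      then have "ennreal (cmod (g z) * snd z powr (- \<beta>)) \<le> ennreal (k * (cmod (f z) * snd z powr (- \<beta>)))"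
        by (intro ennreal_leI) (simp add: mult.assoc)
      then show "weighted \<beta> g z \<le> ennreal k * weighted \<beta> f z"
        using that(2) by (simp add: weighted_def ennreal_mult)
    qed
    also have "\<dots> = ennreal k * TN p q r (weighted \<beta> f)"
      using that T_meas by (intro TN_scale pqr weighted_measurable)
    finally show ?thesis .
  qed
  have T_dom: "g \<in> T" if "f \<in> T" "k > 0" "g \<in> borel_measurable lebesgue" "\<And>z. z \<in> upper_half \<Longrightarrow> cmod (g z) \<le> k * cmod (f z)" for f g k
  proof -
    have "ennreal k * TN p q r (weighted \<beta> f) < top" using that(1) by (simp add: T_def ennreal_mult_less_top)
    then show ?thesis using le_less_trans[OF dom[OF that(1,2,4)]] that(3) by (simp add: T_def)
  qed
  have TN_lim: "(\<lambda>k. TN p q r (weighted \<beta> (g k))) \<longlonglongrightarrow> 0"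
    if f: "f \<in> T" and g: "\<And>k. g k \<in> borel_measurable lebesgue" and le: "\<And>k z. z \<in> upper_half \<Longrightarrow> cmod (g k z) \<le> cmod (f z)"
      and lim: "AE z in lborel. z \<in> upper_half \<longrightarrow> (\<lambda>k. g k z) \<longlonglongrightarrow> 0" for f and g :: "nat \<Rightarrow> _"
  proof (rule TN_order_continuous[OF pqr])
    show "weighted \<beta> f \<in> borel_measurable lebesgue" "TN p q r (weighted \<beta> f) < top" using f by (auto simp: T_def)
    show "weighted \<beta> (g k) \<in> borel_measurable lebesgue" for k using g by simp
    show "AE z in lborel. z \<in> upper_half \<longrightarrow> weighted \<beta> (g k) z \<le> weighted \<beta> f z" for k
      using le by (intro AE_I2) (auto simp: weighted_def intro!: ennreal_leI mult_right_mono)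
    show "AE z in lborel. z \<in> upper_half \<longrightarrow> (\<lambda>k. weighted \<beta> (g k) z) \<longlonglongrightarrow> 0"
      using lim
    proof (elim eventually_mono, intro impI)
      fix z :: "'a \<times> real" assume "z \<in> upper_half \<longrightarrow> (\<lambda>k. g k z) \<longlonglongrightarrow> 0" "z \<in> upper_half"
      then have "(\<lambda>k. cmod (g k z)) \<longlonglongrightarrow> 0" by (simp add: tendsto_norm_zero_iff)
      then have "(\<lambda>k. cmod (g k z) * snd z powr (- \<beta>)) \<longlonglongrightarrow> 0" by (rule tendsto_mult_left_zero)
      then show "(\<lambda>k. weighted \<beta> (g k) z) \<longlonglongrightarrow> 0" unfolding weighted_def by (subst ennreal_tendsto_0_iff) auto
    qed
  qed
  have L_lim: "(\<lambda>k. L (g k)) \<longlonglongrightarrow> 0"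
    if f: "f \<in> T" and g: "\<And>k. g k \<in> borel_measurable lebesgue" and le: "\<And>k z. z \<in> upper_half \<Longrightarrow> cmod (g k z) \<le> cmod (f z)"
      and lim: "AE z in lborel. z \<in> upper_half \<longrightarrow> (\<lambda>k. g k z) \<longlonglongrightarrow> 0" for f and g :: "nat \<Rightarrow> _"
  proof -
    have gT: "g k \<in> T" for k by (rule T_dom[OF f, of 1]) (use le g in simp_all)
    have "(\<lambda>k. ennreal C * TN p q r (weighted \<beta> (g k))) \<longlonglongrightarrow> ennreal C * 0"
      by (intro ennreal_tendsto_cmult TN_lim[OF f g le lim]) auto
    then have lim0: "(\<lambda>k. ennreal C * TN p q r (weighted \<beta> (g k))) \<longlonglongrightarrow> 0" by simp
    have "(\<lambda>k. ennreal (cmod (L (g k)))) \<longlonglongrightarrow> 0"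
    proof (rule tendsto_sandwich[OF _ _ tendsto_const lim0])
      show "\<forall>\<^sub>F k in sequentially. 0 \<le> ennreal (cmod (L (g k)))" by simp
      show "\<forall>\<^sub>F k in sequentially. ennreal (cmod (L (g k))) \<le> ennreal C * TN p q r (weighted \<beta> (g k))"
        using L_bound[OF gT] by (rule always_eventually[OF allI])
    qed
    then have "(\<lambda>k. cmod (L (g k))) \<longlonglongrightarrow> 0" by (subst (asm) ennreal_tendsto_0_iff) auto
    then show ?thesis by (simp add: tendsto_norm_zero_iff)
  qed
  \<comment> \<open>The constant sequence g is dominated by g itself and tends to 0 almost
    everywhere on the half space, so \<open>L_lim\<close> applies to it.\<close>
  have L_null: "L g = 0" if "g \<in> T" "AE z in lborel. z \<in> upper_half \<longrightarrow> g z = 0" for g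
  proof -
    have "(\<lambda>k::nat. L g) \<longlonglongrightarrow> 0"
      using that T_meas by (intro L_lim[of g]) (auto elim!: eventually_mono)
    then show ?thesis by (simp add: LIMSEQ_const_iff)
  qed
  have L_diff: "L (\<lambda>z. f z - g z) = L f - L g" if "f \<in> T" "g \<in> T" for f g
  proof -
    have "(\<lambda>z. (- 1) * g z) \<in> T" by (rule T_dom[OF that(2), of 1]) (use T_meas[OF that(2)] in simp_all)
    from L_add[OF that(1) this] L_mult[OF that(2), of "- 1"] show ?thesis by simp
  qed
  obtain w :: "'a \<times> real \<Rightarrow> real" where w [measurable]: "w \<in> borel_measurable borel" and w_pos: "\<And>z. z \<in> upper_half \<Longrightarrow> w z > 0"
    and w_0: "\<And>z. z \<notin> upper_half \<Longrightarrow> w z = 0" and w_fin: "TN p q r (\<lambda>z. ennreal (w z)) < top"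
    using positive_weight_exists[OF pqr, where ?'a='a] by blast
  have w0: "w z \<ge> 0" for z using w_pos[of z] w_0[of z] by (cases "z \<in> upper_half") auto
  have wL [measurable]: "w \<in> borel_measurable lebesgue" by (rule borel_measurable_lebesgueI[OF w])
  \<comment> \<open>The factor t^\<beta> compensates the weight of the norm: on the half space the
    weighted modulus of \<open>wf\<close> is w, whose norm is finite.\<close>
  define wf where "wf z = complex_of_real (w z * snd z powr \<beta>)" for z
  have wf_meas [measurable]: "wf \<in> borel_measurable lebesgue"
  proof -
    have "(\<lambda>z. w z * snd z powr \<beta>) \<in> borel_measurable lebesgue"
      by (intro borel_measurable_times wL lebesgue_measurable_powr)
    then show ?thesis unfolding wf_def[abs_def] by measurable
  qed
  have wf_nz: "wf z \<noteq> 0" if "z \<in> upper_half" for z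
    using w_pos[OF that] that by (simp add: wf_def upper_half_def)
  have wf_z: "wf z = 0" if "z \<notin> upper_half" for z using w_0[OF that] by (simp add: wf_def)
  have wf_T: "wf \<in> T"
  proof -
    have "weighted \<beta> wf z \<le> ennreal (w z)" if "z \<in> upper_half" for z
    proof -
      have "cmod (wf z) * snd z powr (- \<beta>) = w z * (snd z powr \<beta> * snd z powr (- \<beta>))"
        using w0 by (simp add: wf_def norm_mult)
      also have "snd z powr \<beta> * snd z powr (- \<beta>) = 1" using that by (simp add: upper_half_def flip: powr_add)
      finally show ?thesis by (simp add: weighted_def)
    qed
    then have "TN p q r (weighted \<beta> wf) \<le> TN p q r (\<lambda>z. ennreal (w z))" by (intro TN_mono pqr AE_I2) auto
    then show ?thesis using w_fin by (auto simp: T_def intro: le_less_trans)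
  qed
  have wu_T: "(\<lambda>z. wf z * u z) \<in> T" if [measurable]: "u \<in> borel_measurable lebesgue" and bd: "\<And>z. cmod (u z) \<le> k" for u k
  proof (rule T_dom[OF wf_T, of "\<bar>k\<bar> + 1"])
    fix z
    have "cmod (u z) \<le> \<bar>k\<bar> + 1" using bd[of z] by linarith
    then have "cmod (wf z) * cmod (u z) \<le> cmod (wf z) * (\<bar>k\<bar> + 1)" by (rule mult_left_mono) simp
    then show "cmod (wf z * u z) \<le> (\<bar>k\<bar> + 1) * cmod (wf z)" by (simp only: norm_mult mult.commute[of _ "cmod (wf z)"])
  qed auto
  \<comment> \<open>Additive by linearity of L, and continuous at the empty set by
    \<open>L_lim\<close> with \<open>wf\<close> as dominating function. The real and imaginary parts
    receive separate densities.\<close>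
  define \<nu> where "\<nu> E = L (\<lambda>z. wf z * indicator E z)" for E
  have ind_T: "(\<lambda>z. wf z * indicator E z) \<in> T" if [measurable]: "E \<in> sets lebesgue" for E
    by (rule wu_T[of _ 1]) (auto simp: indicator_def)
  have \<nu>_add: "\<nu> (A \<union> B) = \<nu> A + \<nu> B" if "A \<in> sets lebesgue" "B \<in> sets lebesgue" "A \<inter> B = {}" for A B
  proof -
    have "(\<lambda>z. wf z * indicator (A \<union> B) z) = (\<lambda>z. wf z * indicator A z + wf z * indicator B z)"
      using that(3) by (auto simp: fun_eq_iff indicator_def)
    then show ?thesis unfolding \<nu>_def using L_add[OF ind_T ind_T, OF that(1,2)] by simp
  qed
  have \<nu>_cont: "(\<lambda>i. \<nu> (A i)) \<longlonglongrightarrow> 0" if A: "range A \<subseteq> sets lebesgue" "decseq A" "(\<Inter>i. A i) = {}" for A :: "nat \<Rightarrow> _"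
    unfolding \<nu>_def
  proof (rule L_lim[OF wf_T])
    have [measurable]: "A i \<in> sets lebesgue" for i using A by auto
    show "(\<lambda>z. wf z * indicator (A k) z) \<in> borel_measurable lebesgue" for k by measurable
    show "cmod (wf z * indicator (A k) z) \<le> cmod (wf z)" for k z by (auto simp: indicator_def)
    show "AE z in lborel. z \<in> upper_half \<longrightarrow> (\<lambda>k. wf z * indicator (A k) z) \<longlonglongrightarrow> 0"
    proof (intro AE_I2 impI tendsto_eventually)
      fix z :: "'a \<times> real"
      obtain i where "z \<notin> A i" using A(3) by auto
      then have "z \<notin> A k" if "k \<ge> i" for k using A(2) that by (auto simp: decseq_def)
      then show "\<forall>\<^sub>F k in sequentially. wf z * indicator (A k) z = 0"
        by (intro eventually_sequentiallyI[of i]) auto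
    qed
  qed
  have \<nu>_null: "\<nu> A = 0" if "A \<in> null_sets lebesgue" for A
    unfolding \<nu>_def
  proof (rule L_null[OF ind_T])
    show "A \<in> sets lebesgue" using that by auto
    have "AE z in lebesgue. z \<notin> A" using that by (rule AE_not_in)
    then show "AE z in lborel. z \<in> upper_half \<longrightarrow> wf z * indicator A z = 0"
      unfolding AE_completion_iff by eventually_elim auto
  qed
  define K where "K = enn2real (ennreal C * TN p q r (weighted \<beta> wf))"
  have \<nu>_bound: "cmod (\<nu> A) \<le> K" if "A \<in> sets lebesgue" for A
  proof -
    have fin: "ennreal C * TN p q r (weighted \<beta> wf) < top" using wf_T by (simp add: T_def ennreal_mult_less_top)
    have "ennreal (cmod (\<nu> A)) \<le> ennreal C * TN p q r (weighted \<beta> (\<lambda>z. wf z * indicator A z))"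
      unfolding \<nu>_def by (intro L_bound ind_T that)
    also have "\<dots> \<le> ennreal C * (ennreal 1 * TN p q r (weighted \<beta> wf))"
      by (intro mult_left_mono dom wf_T) (auto simp: indicator_def)
    finally have "ennreal (cmod (\<nu> A)) \<le> ennreal K" using fin by (simp add: K_def less_top)
    then show ?thesis by (subst (asm) ennreal_le_iff) (auto simp: K_def)
  qed
  obtain g1 :: "'a \<times> real \<Rightarrow> real" where g1: "integrable lebesgue g1" "\<And>A. A \<in> sets lebesgue \<Longrightarrow> Re (\<nu> A) = (\<integral>x. g1 x * indicator A x \<partial>lebesgue)"
  proof -
    have "\<exists>g :: 'a \<times> real \<Rightarrow> real. integrable lebesgue g \<and> (\<forall>A\<in>sets lebesgue. Re (\<nu> A) = (\<integral>x. g x * indicator A x \<partial>lebesgue))"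
    proof (rule signed_density_exists[OF sigma_finite_lebesgue])
      fix A :: "nat \<Rightarrow> ('a \<times> real) set" assume "range A \<subseteq> sets lebesgue" "decseq A" "(\<Inter>i. A i) = {}"
      from tendsto_Re[OF \<nu>_cont[OF this]] show "(\<lambda>i. Re (\<nu> (A i))) \<longlonglongrightarrow> 0" by simp
    next
      fix A :: "('a \<times> real) set" assume "A \<in> sets lebesgue"
      then show "\<bar>Re (\<nu> A)\<bar> \<le> K" using abs_Re_le_cmod[of "\<nu> A"] \<nu>_bound[of A] by linarith
    qed (use \<nu>_add \<nu>_null in auto)
    then show ?thesis using that by blast
  qed
  obtain g2 :: "'a \<times> real \<Rightarrow> real" where g2: "integrable lebesgue g2" "\<And>A. A \<in> sets lebesgue \<Longrightarrow> Im (\<nu> A) = (\<integral>x. g2 x * indicator A x \<partial>lebesgue)"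
  proof -
    have "\<exists>g :: 'a \<times> real \<Rightarrow> real. integrable lebesgue g \<and> (\<forall>A\<in>sets lebesgue. Im (\<nu> A) = (\<integral>x. g x * indicator A x \<partial>lebesgue))"
    proof (rule signed_density_exists[OF sigma_finite_lebesgue])
      fix A :: "nat \<Rightarrow> ('a \<times> real) set" assume "range A \<subseteq> sets lebesgue" "decseq A" "(\<Inter>i. A i) = {}"
      from tendsto_Im[OF \<nu>_cont[OF this]] show "(\<lambda>i. Im (\<nu> (A i))) \<longlonglongrightarrow> 0" by simp
    next
      fix A :: "('a \<times> real) set" assume "A \<in> sets lebesgue"
      then show "\<bar>Im (\<nu> A)\<bar> \<le> K" using abs_Im_le_cmod[of "\<nu> A"] \<nu>_bound[of A] by linarith
    qed (use \<nu>_add \<nu>_null in auto)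
    then show ?thesis using that by blast
  qed
  define g where "g z = complex_of_real (g1 z) + \<i> * complex_of_real (g2 z)" for z
  have g_int: "integrable lebesgue g"
    unfolding g_def[abs_def] using g1(1) g2(1) by (intro Bochner_Integration.integrable_add integrable_mult_right integrable_of_real)
  have g_meas [measurable]: "g \<in> borel_measurable lebesgue" using g_int by (rule borel_measurable_integrable)
  have \<nu>_g: "\<nu> A = (\<integral>z. g z * indicator A z \<partial>lebesgue)" if A: "A \<in> sets lebesgue" for A
  proof -
    have i1: "integrable lebesgue (\<lambda>z. g1 z * indicator A z)" and i2: "integrable lebesgue (\<lambda>z. g2 z * indicator A z)"
      using g1(1) g2(1) A by (auto intro: integrable_real_mult_indicator)
    have "(\<integral>z. g z * indicator A z \<partial>lebesgue) = (\<integral>z. complex_of_real (g1 z * indicator A z) + \<i> * complex_of_real (g2 z * indicator A z) \<partial>lebesgue)"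
      by (intro Bochner_Integration.integral_cong) (auto simp: g_def indicator_def)
    also have "\<dots> = complex_of_real (\<integral>z. g1 z * indicator A z \<partial>lebesgue) + \<i> * complex_of_real (\<integral>z. g2 z * indicator A z \<partial>lebesgue)"
      by (simp only: Bochner_Integration.integral_add[OF integrable_of_real[OF i1] integrable_mult_right[OF integrable_of_real[OF i2]]]
          integral_mult_right_zero integral_complex_of_real)
    also have "\<dots> = \<nu> A" using g1(2)[OF A] g2(2)[OF A] by (simp add: complex_eq_iff)
    finally show ?thesis by simp
  qed
  define gu where "gu z = indicator upper_half z *\<^sub>R g z" for z
  have gu_int: "integrable lebesgue gu"
    unfolding gu_def[abs_def] using g_int by (intro integrable_mult_indicator) auto
  have gu_meas [measurable]: "gu \<in> borel_measurable lebesgue" using gu_int by (rule borel_measurable_integrable)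
  have gu_bd_int: "integrable lebesgue (\<lambda>z. gu z * u z)" if [measurable]: "u \<in> borel_measurable lebesgue" and "\<And>z. cmod (u z) \<le> k" for u k
  proof (rule Bochner_Integration.integrable_bound)
    show "integrable lebesgue (\<lambda>z. k * cmod (gu z))" using gu_int by (intro integrable_mult_right integrable_norm)
    have "0 \<le> k" using that(2) norm_ge_zero order_trans by blast
    show "AE z in lebesgue. cmod (gu z * u z) \<le> norm (k * cmod (gu z))"
    proof (intro AE_I2)
      fix z
      have "cmod (gu z) * cmod (u z) \<le> cmod (gu z) * k" using that(2) by (intro mult_left_mono) auto
      then show "cmod (gu z * u z) \<le> norm (k * cmod (gu z))"
        using \<open>0 \<le> k\<close> by (simp add: norm_mult mult.commute[of "cmod (gu z)"])
    qed
  qed measurable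
  have base: "L (\<lambda>z. wf z * indicator E z) = (\<integral>z. gu z * indicator E z \<partial>lebesgue)" if E: "E \<in> sets lebesgue" for E
  proof -
    have "(\<lambda>z. wf z * indicator E z) = (\<lambda>z. wf z * indicator (E \<inter> upper_half) z)"
      using wf_z by (auto simp: fun_eq_iff indicator_def)
    then have "L (\<lambda>z. wf z * indicator E z) = \<nu> (E \<inter> upper_half)" by (simp add: \<nu>_def)
    also have "\<dots> = (\<integral>z. g z * indicator (E \<inter> upper_half) z \<partial>lebesgue)" using E by (intro \<nu>_g) auto
    also have "\<dots> = (\<integral>z. gu z * indicator E z \<partial>lebesgue)"
      by (intro Bochner_Integration.integral_cong) (auto simp: gu_def indicator_def)
    finally show ?thesis .
  qed
  \<comment> \<open>Linearity of L is available only on T, so the membership of every summand and of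
    the partial sum is checked along the induction.\<close>
  have L_sum: "L (\<lambda>z. wf z * (\<Sum>c\<in>S. c * indicator (A c) z)) = (\<integral>z. gu z * (\<Sum>c\<in>S. c * indicator (A c) z) \<partial>lebesgue)"
    if "finite S" "\<And>c. A c \<in> sets lebesgue" for S and A :: "complex \<Rightarrow> _"
    using that(1)
  proof (induction S)
    case empty
    have "(\<lambda>z. 0) \<in> T" using wu_T[of "\<lambda>_. 0" 0] by simp
    then show ?case using L_null by simp
  next
    case (insert c S)
    have [measurable]: "A c \<in> sets lebesgue" for c by fact
    define s where "s z = (\<Sum>c\<in>S. c * indicator (A c) z)" for z
    have s_meas [measurable]: "s \<in> borel_measurable lebesgue" unfolding s_def by measurable
    have s_bd: "cmod (s z) \<le> (\<Sum>c\<in>S. cmod c)" for z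
      unfolding s_def by (intro order_trans[OF norm_sum] sum_mono) (auto simp: indicator_def)
    have sT: "(\<lambda>z. wf z * s z) \<in> T" by (rule wu_T[OF s_meas s_bd])
    have iT: "(\<lambda>z. wf z * indicator (A c) z) \<in> T" by (rule ind_T) fact
    have cT: "(\<lambda>z. c * (wf z * indicator (A c) z)) \<in> T"
    proof -
      have "(\<lambda>z. wf z * (c * indicator (A c) z)) \<in> T"
        by (rule wu_T[of _ "cmod c"]) (auto simp: indicator_def)
      then show ?thesis by (simp add: mult_ac)
    qed
    have split: "(\<Sum>c\<in>insert c S. c * indicator (A c) z) = c * indicator (A c) z + s z" for z
      unfolding s_def using insert.hyps by (rule sum.insert)
    have fe: "(\<lambda>z. wf z * (\<Sum>c\<in>insert c S. c * indicator (A c) z)) = (\<lambda>z. c * (wf z * indicator (A c) z) + wf z * s z)"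
      unfolding split by (simp only: distrib_left mult.left_commute)
    have "L (\<lambda>z. wf z * (\<Sum>c\<in>insert c S. c * indicator (A c) z)) = c * L (\<lambda>z. wf z * indicator (A c) z) + L (\<lambda>z. wf z * s z)"
      unfolding fe L_add[OF cT sT] L_mult[OF iT] ..
    also have "\<dots> = c * (\<integral>z. gu z * indicator (A c) z \<partial>lebesgue) + (\<integral>z. gu z * s z \<partial>lebesgue)"
      using base[of "A c"] insert.IH by (simp add: s_def)
    also have "\<dots> = (\<integral>z. c * (gu z * indicator (A c) z) + gu z * s z \<partial>lebesgue)"
    proof (subst Bochner_Integration.integral_add)
      show "integrable lebesgue (\<lambda>z. c * (gu z * indicator (A c) z))"
        by (intro integrable_mult_right gu_bd_int[of _ 1]) (auto simp: indicator_def)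
      show "integrable lebesgue (\<lambda>z. gu z * s z)" by (rule gu_bd_int[OF s_meas s_bd])
    qed simp
    also have "\<dots> = (\<integral>z. gu z * (\<Sum>c\<in>insert c S. c * indicator (A c) z) \<partial>lebesgue)"
      unfolding split by (simp only: distrib_left mult.left_commute)
    finally show ?case .
  qed
  have L_simple: "L (\<lambda>z. wf z * u z) = (\<integral>z. gu z * u z \<partial>lebesgue)" if u: "simple_function lebesgue u" for u
  proof -
    define S where "S = range u"
    define A where "A c = u -` {c}" for c
    have fin: "finite S" using simple_functionD(1)[OF u] by (simp add: S_def)
    have m: "A c \<in> sets lebesgue" for c using simple_functionD(2)[OF u, of "{c}"] by (simp add: A_def)
    have eq: "(\<Sum>c\<in>S. c * indicator (A c) z) = u z" for z
    proof -
      have "(\<Sum>c\<in>S. c * indicator (A c) z) = (\<Sum>c\<in>S. if c = u z then c else 0)"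
        by (intro sum.cong) (auto simp: indicator_def A_def)
      also have "\<dots> = u z" using fin by (simp add: S_def)
      finally show ?thesis .
    qed
    show ?thesis using L_sum[OF fin, of A] m by (simp only: eq)
  qed
  have L_bdd: "L (\<lambda>z. wf z * u z) = (\<integral>z. gu z * u z \<partial>lebesgue)"
    if u [measurable]: "u \<in> borel_measurable lebesgue" and bd: "\<And>z. cmod (u z) \<le> k" for u k
  proof -
    have k: "0 \<le> k" using bd norm_ge_zero order_trans by blast
    obtain s where s: "\<And>i. simple_function lebesgue (s i)" "\<And>z. (\<lambda>i. s i z) \<longlonglongrightarrow> u z" "\<And>i z. dist (s i z) 0 \<le> 2 * dist (u z) 0"
      using borel_measurable_implies_sequence_metric[OF u, of 0] by auto
    have sm [measurable]: "s i \<in> borel_measurable lebesgue" for i using s(1) by (rule borel_measurable_simple_function)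
    have sb: "cmod (s i z) \<le> 2 * k" for i z using s(3)[of i z] bd[of z] by simp
    \<comment> \<open>The simple approximants satisfy |s_i| \<le> 2 |u| \<le> 2k, so 3k times
      \<open>wf\<close> dominates all differences.\<close>
    have "(\<lambda>i. L (\<lambda>z. wf z * s i z - wf z * u z)) \<longlonglongrightarrow> 0"
    proof (rule L_lim)
      show "(\<lambda>z. wf z * complex_of_real (3 * k)) \<in> T" using k by (intro wu_T[of _ "3 * k"]) (auto simp: norm_mult)
      show "(\<lambda>z. wf z * s i z - wf z * u z) \<in> borel_measurable lebesgue" for i by measurable
      show "cmod (wf z * s i z - wf z * u z) \<le> cmod (wf z * complex_of_real (3 * k))" for i z
      proof -
        have "cmod (s i z - u z) \<le> 3 * k" using norm_triangle_ineq4[of "s i z" "u z"] sb[of i z] bd[of z] by linarith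
        then have "cmod (wf z) * cmod (s i z - u z) \<le> cmod (wf z) * (3 * k)" by (intro mult_left_mono) auto
        then show ?thesis using k by (simp add: norm_mult flip: right_diff_distrib)
      qed
      show "AE z in lborel. z \<in> upper_half \<longrightarrow> (\<lambda>i. wf z * s i z - wf z * u z) \<longlonglongrightarrow> 0"
      proof (intro AE_I2 impI)
        fix z
        have "(\<lambda>i. wf z * s i z - wf z * u z) \<longlonglongrightarrow> wf z * u z - wf z * u z"
          by (intro tendsto_intros s)
        then show "(\<lambda>i. wf z * s i z - wf z * u z) \<longlonglongrightarrow> 0" by simp
      qed
    qed
    moreover have "L (\<lambda>z. wf z * s i z - wf z * u z) = L (\<lambda>z. wf z * s i z) - L (\<lambda>z. wf z * u z)" for i
      using wu_T[OF sm sb] wu_T[OF u bd] by (intro L_diff)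
    ultimately have "(\<lambda>i. L (\<lambda>z. wf z * s i z) - L (\<lambda>z. wf z * u z)) \<longlonglongrightarrow> 0" by simp
    then have 1: "(\<lambda>i. L (\<lambda>z. wf z * s i z)) \<longlonglongrightarrow> L (\<lambda>z. wf z * u z)" by (simp add: LIM_zero_iff)
    have "(\<lambda>i. \<integral>z. gu z * s i z \<partial>lebesgue) \<longlonglongrightarrow> (\<integral>z. gu z * u z \<partial>lebesgue)"
    proof (rule integral_dominated_convergence[where w = "\<lambda>z. 2 * k * cmod (gu z)"])
      show "integrable lebesgue (\<lambda>z. 2 * k * cmod (gu z))" using gu_int by (intro integrable_mult_right integrable_norm)
      show "AE z in lebesgue. (\<lambda>i. gu z * s i z) \<longlonglongrightarrow> gu z * u z" by (intro AE_I2 tendsto_intros s)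
      show "AE z in lebesgue. norm (gu z * s i z) \<le> 2 * k * cmod (gu z)" for i
      proof (intro AE_I2)
        fix z
        have "cmod (gu z) * cmod (s i z) \<le> cmod (gu z) * (2 * k)" by (intro mult_left_mono sb) simp
        then show "norm (gu z * s i z) \<le> 2 * k * cmod (gu z)" by (simp add: norm_mult mult.commute)
      qed
    qed measurable
    then have "(\<lambda>i. L (\<lambda>z. wf z * s i z)) \<longlonglongrightarrow> (\<integral>z. gu z * u z \<partial>lebesgue)" by (simp add: L_simple s(1))
    with 1 show ?thesis by (rule LIMSEQ_unique)
  qed
  \<comment> \<open>Solved from h wf t^(-\<beta>0 - 1) = g on the half space: then the integrand of
    the pairing of f = wf u with h is gu u.\<close>
  define h where "h z = indicator upper_half z *\<^sub>R (g z / (wf z * complex_of_real (snd z powr (- \<beta>0 - 1))))" for z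
  have h_meas: "h \<in> borel_measurable lebesgue"
  proof -
    have [measurable]: "(\<lambda>z :: 'a \<times> real. complex_of_real (snd z powr (- \<beta>0 - 1))) \<in> borel_measurable lebesgue"
      by (intro measurable_compose[OF lebesgue_measurable_powr]) measurable
    show ?thesis unfolding h_def[abs_def] by measurable
  qed
  have "integrable lebesgue (pairing_kernel \<beta>0 f h) \<and> L f = pairing \<beta>0 f h" if fT: "f \<in> T" for f
  proof -
    have f_meas [measurable]: "f \<in> borel_measurable lebesgue" using fT by (rule T_meas)
    define u where "u z = f z / wf z" for z
    have u_meas [measurable]: "u \<in> borel_measurable lebesgue" unfolding u_def by measurable
    have fu: "f z = wf z * u z" if "z \<in> upper_half" for z using wf_nz[OF that] by (simp add: u_def)
    have pk: "pairing_kernel \<beta>0 f h = (\<lambda>z. gu z * u z)"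
    proof
      fix z
      show "pairing_kernel \<beta>0 f h z = gu z * u z"
      proof (cases "z \<in> upper_half")
        case True
        then have "snd z powr (- \<beta>0 - 1) \<noteq> 0" by (simp add: upper_half_def)
        then show ?thesis using True wf_nz[OF True] by (simp add: pairing_kernel_def gu_def h_def u_def field_simps)
      qed (simp add: pairing_kernel_def gu_def)
    qed
    \<comment> \<open>Setting u to 0 where it exceeds k makes |u_k| increase with k, and at each
      point u_k equals u from some k on.\<close>
    define uk where "uk k z = (if cmod (u z) \<le> real k then u z else 0)" for k :: nat and z
    have uk_meas [measurable]: "uk k \<in> borel_measurable lebesgue" for k unfolding uk_def by measurable
    have uk_bd: "cmod (uk k z) \<le> real k" for k z by (simp add: uk_def)
    have uk_le: "cmod (uk k z) \<le> cmod (u z)" for k z by (simp add: uk_def)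
    have uk_ev: "uk k z = u z" if "k \<ge> nat \<lceil>cmod (u z)\<rceil>" for k z using that by (simp add: uk_def)
    have uk_lim: "(\<lambda>k. uk k z) \<longlonglongrightarrow> u z" for z
      by (rule tendsto_eventually, rule eventually_sequentiallyI[of "nat \<lceil>cmod (u z)\<rceil>"]) (rule uk_ev)
    \<comment> \<open>L is tested on |u_k| with the conjugate phase of \<open>gu\<close>.
      Boundedness of L then bounds the integral of |gu u_k| uniformly in k, and monotone convergence
      makes the pairing with f absolutely convergent.\<close>
    have intk: "(\<integral>\<^sup>+z. ennreal (cmod (gu z) * cmod (uk k z)) \<partial>lebesgue) \<le> ennreal C * TN p q r (weighted \<beta> f)" for k
    proof -
      define v where "v z = complex_of_real (cmod (uk k z)) * cnj (sgn (gu z))" for z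
      have [measurable]: "(\<lambda>z. cnj (sgn (gu z))) \<in> borel_measurable lebesgue"
        by (rule cnj_sgn_measurable[OF gu_meas])
      have v_meas [measurable]: "v \<in> borel_measurable lebesgue" unfolding v_def by measurable
      have v_le: "cmod (v z) \<le> cmod (uk k z)" for z
        by (simp add: v_def norm_mult norm_sgn)
      have v_bd: "cmod (v z) \<le> real k" for z using v_le uk_bd order_trans by blast
      have gv: "gu z * v z = complex_of_real (cmod (gu z) * cmod (uk k z))" for z
      proof -
        have "gu z * v z = (cnj (sgn (gu z)) * gu z) * complex_of_real (cmod (uk k z))" by (simp add: v_def mult_ac)
        then show ?thesis by (simp add: cnj_sgn_mult)
      qed
      have int: "integrable lebesgue (\<lambda>z. cmod (gu z) * cmod (uk k z))"
        using integrable_norm[OF gu_bd_int[OF uk_meas[of k] uk_bd]] by (simp add: norm_mult)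
      have Lv: "L (\<lambda>z. wf z * v z) = complex_of_real (\<integral>z. cmod (gu z) * cmod (uk k z) \<partial>lebesgue)"
        unfolding L_bdd[OF v_meas v_bd] gv by (rule integral_complex_of_real)
      have "(\<integral>\<^sup>+z. ennreal (cmod (gu z) * cmod (uk k z)) \<partial>lebesgue) = ennreal (\<integral>z. cmod (gu z) * cmod (uk k z) \<partial>lebesgue)"
        by (rule nn_integral_eq_integral[OF int]) simp
      also have "\<dots> = ennreal (cmod (L (\<lambda>z. wf z * v z)))" unfolding Lv by (simp add: integral_nonneg_AE)
      also have "\<dots> \<le> ennreal C * TN p q r (weighted \<beta> (\<lambda>z. wf z * v z))"
        by (intro L_bound wu_T[OF v_meas v_bd])
      also have "\<dots> \<le> ennreal C * (ennreal 1 * TN p q r (weighted \<beta> f))"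
      proof (intro mult_left_mono dom fT)
        fix z :: "'a \<times> real" assume z: "z \<in> upper_half"
        have "cmod (wf z) * cmod (v z) \<le> cmod (wf z) * cmod (u z)"
          using order_trans[OF v_le uk_le] by (intro mult_left_mono) auto
        then show "cmod (wf z * v z) \<le> 1 * cmod (f z)" using fu[OF z] by (simp add: norm_mult)
      qed auto
      finally show ?thesis by simp
    qed
    have "(\<integral>\<^sup>+z. ennreal (norm (gu z * u z)) \<partial>lebesgue) \<le> (\<integral>\<^sup>+z. (SUP k. ennreal (cmod (gu z) * cmod (uk k z))) \<partial>lebesgue)"
    proof (intro nn_integral_mono)
      fix z
      show "ennreal (norm (gu z * u z)) \<le> (SUP k. ennreal (cmod (gu z) * cmod (uk k z)))"
        by (rule SUP_upper2[of "nat \<lceil>cmod (u z)\<rceil>"]) (simp_all add: uk_ev norm_mult)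
    qed
    also have "\<dots> = (SUP k. \<integral>\<^sup>+z. ennreal (cmod (gu z) * cmod (uk k z)) \<partial>lebesgue)"
    proof (rule nn_integral_monotone_convergence_SUP)
      show "incseq (\<lambda>k z. ennreal (cmod (gu z) * cmod (uk k z)))"
        unfolding incseq_def le_fun_def
      proof (intro allI impI ennreal_leI mult_left_mono)
        fix k l :: nat and z assume "k \<le> l"
        then show "cmod (uk k z) \<le> cmod (uk l z)" by (simp add: uk_def)
      qed simp
    qed measurable
    also have "\<dots> \<le> ennreal C * TN p q r (weighted \<beta> f)" by (intro SUP_least intk)
    also have "\<dots> < top" using fT by (simp add: T_def ennreal_mult_less_top)
    finally have int: "integrable lebesgue (\<lambda>z. gu z * u z)" by (intro integrableI_bounded) auto
    have "(\<lambda>k. L (\<lambda>z. f z - wf z * uk k z)) \<longlonglongrightarrow> 0"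
    proof (rule L_lim[OF fT])
      show "(\<lambda>z. f z - wf z * uk k z) \<in> borel_measurable lebesgue" for k by measurable
      show "cmod (f z - wf z * uk k z) \<le> cmod (f z)" if "z \<in> upper_half" for k z
        using fu[OF that] by (simp add: uk_def)
      show "AE z in lborel. z \<in> upper_half \<longrightarrow> (\<lambda>k. f z - wf z * uk k z) \<longlonglongrightarrow> 0"
      proof (intro AE_I2 impI)
        fix z :: "'a \<times> real" assume z: "z \<in> upper_half"
        have "(\<lambda>k. f z - wf z * uk k z) \<longlonglongrightarrow> f z - wf z * u z" by (intro tendsto_intros uk_lim)
        then show "(\<lambda>k. f z - wf z * uk k z) \<longlonglongrightarrow> 0" using fu[OF z] by simp
      qed
    qed
    moreover have "L (\<lambda>z. f z - wf z * uk k z) = L f - (\<integral>z. gu z * uk k z \<partial>lebesgue)" for k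
      using L_diff[OF fT wu_T[OF uk_meas uk_bd], of k] L_bdd[OF uk_meas uk_bd, of k] by simp
    ultimately have "(\<lambda>k. L f - (\<integral>z. gu z * uk k z \<partial>lebesgue)) \<longlonglongrightarrow> 0" by simp
    then have "(\<lambda>k. L f - (L f - (\<integral>z. gu z * uk k z \<partial>lebesgue))) \<longlonglongrightarrow> L f - 0" by (intro tendsto_diff tendsto_const)
    then have 1: "(\<lambda>k. \<integral>z. gu z * uk k z \<partial>lebesgue) \<longlonglongrightarrow> L f" by simp
    have "(\<lambda>k. \<integral>z. gu z * uk k z \<partial>lebesgue) \<longlonglongrightarrow> (\<integral>z. gu z * u z \<partial>lebesgue)"
    proof (rule integral_dominated_convergence[where w = "\<lambda>z. cmod (gu z * u z)"])
      show "integrable lebesgue (\<lambda>z. cmod (gu z * u z))" using int by (rule integrable_norm)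
      show "AE z in lebesgue. (\<lambda>k. gu z * uk k z) \<longlonglongrightarrow> gu z * u z" by (intro AE_I2 tendsto_intros uk_lim)
      show "AE z in lebesgue. norm (gu z * uk k z) \<le> cmod (gu z * u z)" for k
        using uk_le by (intro AE_I2) (simp add: norm_mult mult_left_mono)
    qed measurable
    with 1 have "L f = (\<integral>z. gu z * u z \<partial>lebesgue)" by (rule LIMSEQ_unique)
    then show ?thesis using int by (simp add: pairing_eq_integral_kernel pk)
  qed
  then show ?thesis using h_meas by blast
qed

end

theorem theorem5p4:
  fixes p q r \<beta> \<beta>0 \<alpha>1 \<alpha>2 :: real
  assumes "1 \<le> p" "1 \<le> q" "1 \<le> r"
    and "0 < \<alpha>1" "\<alpha>1 < 1 / \<alpha>2" "1 / \<alpha>2 < 1"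
  defines "T \<equiv> (wtent_space \<alpha>1 \<alpha>2 (ereal p) (ereal q) (ereal r) \<beta> :: ('a::euclidean_space \<times> real \<Rightarrow> complex) set)"
    and "nT \<equiv> (wtent_norm \<alpha>1 \<alpha>2 (ereal p) (ereal q) (ereal r) \<beta> :: ('a \<times> real \<Rightarrow> complex) \<Rightarrow> ennreal)"
    and "T' \<equiv> (wtent_space \<alpha>1 \<alpha>2 (conj_exp p) (conj_exp q) (conj_exp r) (\<beta>0 - \<beta>) :: ('a \<times> real \<Rightarrow> complex) set)"
    and "nT' \<equiv> (wtent_norm \<alpha>1 \<alpha>2 (conj_exp p) (conj_exp q) (conj_exp r) (\<beta>0 - \<beta>) :: ('a \<times> real \<Rightarrow> complex) \<Rightarrow> ennreal)"
  shows
    \<comment> \<open>each h in the dual space gives a bounded functional, with norm equivalent to that of h\<close>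
    "(\<exists>c C :: real. 0 < c \<and> 0 < C \<and>
        (\<forall>h\<in>T'. (\<forall>f\<in>T. pairing_integrable \<beta>0 f h \<and>
                          ennreal (cmod (pairing \<beta>0 f h)) \<le> ennreal C * nT' h * nT f)
               \<and> ennreal c * nT' h \<le> (SUP f\<in>{f\<in>T. nT f \<le> 1}. ennreal (cmod (pairing \<beta>0 f h)))))
     \<and>
     \<comment> \<open>every bounded linear functional is of this form, for a unique h (up to a.e. equality)\<close>
     (\<forall>L :: ('a \<times> real \<Rightarrow> complex) \<Rightarrow> complex.
        (\<forall>f\<in>T. \<forall>g\<in>T. L (\<lambda>z. f z + g z) = L f + L g) \<and>
        (\<forall>f\<in>T. \<forall>a. L (\<lambda>z. a * f z) = a * L f) \<and>
        (\<exists>C :: real. \<forall>f\<in>T. ennreal (cmod (L f)) \<le> ennreal C * nT f)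
        \<longrightarrow>
        (\<exists>h\<in>T'. (\<forall>f\<in>T. L f = pairing \<beta>0 f h) \<and>
           (\<forall>h2\<in>T'. (\<forall>f\<in>T. L f = pairing \<beta>0 f h2) \<longrightarrow>
              (AE z in lebesgue. z \<in> upper_half \<longrightarrow> h2 z = h z))))"
proof -
  interpret whitney_params \<alpha>1 \<alpha>2
    using assms(4-6) by unfold_locales
  note pqr = assms(1-3)
  have nT: "nT f = TN p q r (weighted \<beta> f)" for f
    unfolding nT_def by (rule wtent_norm_TN)
  have nT': "nT' h = dual_norm p q r (weighted (\<beta>0 - \<beta>) h)" for h
    unfolding nT'_def by (rule wtent_norm_dual)
  have T: "f \<in> T \<longleftrightarrow> f \<in> borel_measurable lebesgue \<and> TN p q r (weighted \<beta> f) < top" for f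
    unfolding T_def wtent_space_def by (simp add: wtent_norm_TN)
  have T': "h \<in> T' \<longleftrightarrow> h \<in> borel_measurable lebesgue \<and> dual_norm p q r (weighted (\<beta>0 - \<beta>) h) < top" for h
    unfolding T'_def wtent_space_def by (simp add: wtent_norm_dual)
  obtain C1 where C1: "C1 > 0" "\<And>f h :: 'a \<times> real \<Rightarrow> complex. f \<in> borel_measurable lebesgue \<Longrightarrow> h \<in> borel_measurable lebesgue \<Longrightarrow>
    (\<integral>\<^sup>+z. ennreal (norm (pairing_kernel \<beta>0 f h z)) \<partial>lebesgue) \<le> ennreal C1 * TN p q r (weighted \<beta> f) * dual_norm p q r (weighted (\<beta>0 - \<beta>) h)"
    using pairing_kernel_bound[OF pqr, where ?'a='a, of \<beta>0 \<beta>] by blast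
  obtain C2 where C2: "C2 > 0" "\<And>G :: 'a \<times> real \<Rightarrow> ennreal. G \<in> borel_measurable lebesgue \<Longrightarrow> dual_norm p q r G \<le> ennreal C2 * dual_sup p q r G"
    using dual_norm_le_dual_sup[OF pqr, where ?'a='a] by blast
  have fin: "(\<integral>\<^sup>+z. ennreal (norm (pairing_kernel \<beta>0 f h z)) \<partial>lebesgue) < top" if "f \<in> T" "h \<in> T'" for f h
  proof (rule le_less_trans)
    show "(\<integral>\<^sup>+z. ennreal (norm (pairing_kernel \<beta>0 f h z)) \<partial>lebesgue) \<le> ennreal C1 * TN p q r (weighted \<beta> f) * dual_norm p q r (weighted (\<beta>0 - \<beta>) h)"
      using that by (intro C1) (auto simp: T T')
    show "ennreal C1 * TN p q r (weighted \<beta> f) * dual_norm p q r (weighted (\<beta>0 - \<beta>) h) < top"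
      using that by (auto simp: T T' ennreal_mult_less_top)
  qed
  have aligned_T: "aligned \<beta> F h \<in> T" "TN p q r (weighted \<beta> (aligned \<beta> F h)) \<le> TN p q r (\<lambda>z. ennreal (F z))"
    if "F \<in> borel_measurable borel" "\<And>z. 0 \<le> F z" "TN p q r (\<lambda>z. ennreal (F z)) < top" "h \<in> borel_measurable lebesgue"
    for F :: "'a \<times> real \<Rightarrow> real" and h
  proof -
    show le: "TN p q r (weighted \<beta> (aligned \<beta> F h)) \<le> TN p q r (\<lambda>z. ennreal (F z))"
      by (intro TN_aligned_le pqr that)
    have "aligned \<beta> F h \<in> borel_measurable lebesgue"
      by (intro aligned_measurable borel_measurable_lebesgueI that)
    then show "aligned \<beta> F h \<in> T" using le_less_trans[OF le that(3)] by (simp add: T)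
  qed
  have bounded: "pairing_integrable \<beta>0 f h \<and> ennreal (cmod (pairing \<beta>0 f h)) \<le> ennreal C1 * nT' h * nT f"
    if f: "f \<in> T" and h: "h \<in> T'" for f h
  proof -
    have m: "f \<in> borel_measurable lebesgue" "h \<in> borel_measurable lebesgue" using f h by (auto simp: T T')
    note b = pairing_bound[OF m fin[OF f h]]
    have "ennreal (cmod (pairing \<beta>0 f h)) \<le> ennreal C1 * nT f * nT' h"
      unfolding nT nT' using b(2) C1(2)[OF m] by (rule order_trans)
    then show ?thesis using b(1) by (simp add: pairing_integrable_iff_kernel mult_ac)
  qed
  \<comment> \<open>\<open>dual_sup\<close> knows nonnegative test functions only; giving F the
    conjugate phase of h turns each of its integrals into the modulus of a pairing without raising
    the norm.\<close>
  have lower: "ennreal (1 / C2) * nT' h \<le> (SUP f\<in>{f\<in>T. nT f \<le> 1}. ennreal (cmod (pairing \<beta>0 f h)))" if h: "h \<in> T'" for h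
  proof -
    have hm: "h \<in> borel_measurable lebesgue" using h by (simp add: T')
    have "ennreal (1 / C2) * nT' h \<le> ennreal (1 / C2) * (ennreal C2 * dual_sup p q r (weighted (\<beta>0 - \<beta>) h))"
      unfolding nT' by (intro mult_left_mono C2 weighted_measurable hm) simp
    also have "\<dots> = dual_sup p q r (weighted (\<beta>0 - \<beta>) h)"
      using C2(1) by (simp add: mult.assoc[symmetric] flip: ennreal_mult)
    also have "\<dots> \<le> (SUP f\<in>{f\<in>T. nT f \<le> 1}. ennreal (cmod (pairing \<beta>0 f h)))"
      unfolding dual_sup_def
    proof (rule SUP_least)
      fix F :: "'a \<times> real \<Rightarrow> real"
      assume "F \<in> {F. F \<in> borel_measurable borel \<and> (\<forall>z. 0 \<le> F z) \<and> TN p q r (\<lambda>z. ennreal (F z)) \<le> 1}"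
      then have F: "F \<in> borel_measurable borel" "\<And>z. 0 \<le> F z" "TN p q r (\<lambda>z. ennreal (F z)) \<le> 1" by auto
      have F': "TN p q r (\<lambda>z. ennreal (F z)) < top" using F(3) by (rule le_less_trans) simp
      note al = aligned_T[OF F(1,2) F' hm]
      have "(\<integral>\<^sup>+z\<in>upper_half. ennreal (F z) * weighted (\<beta>0 - \<beta>) h z * ennreal (1 / snd z) \<partial>lborel) = ennreal (cmod (pairing \<beta>0 (aligned \<beta> F h) h))"
        by (rule pairing_aligned[symmetric, OF borel_measurable_lebesgueI[OF F(1)] F(2) hm fin[OF al(1) h]])
      also have "\<dots> \<le> (SUP f\<in>{f\<in>T. nT f \<le> 1}. ennreal (cmod (pairing \<beta>0 f h)))"
        using al order_trans[OF al(2) F(3)] by (intro SUP_upper) (auto simp: nT)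
      finally show "(\<integral>\<^sup>+z\<in>upper_half. ennreal (F z) * weighted (\<beta>0 - \<beta>) h z * ennreal (1 / snd z) \<partial>lborel) \<le> (SUP f\<in>{f\<in>T. nT f \<le> 1}. ennreal (cmod (pairing \<beta>0 f h)))" .
    qed
    finally show ?thesis .
  qed
  have unique: "AE z in lebesgue. z \<in> upper_half \<longrightarrow> h2 z = h z"
    if h: "h \<in> T'" and h2: "h2 \<in> T'" and eq: "\<And>f. f \<in> T \<Longrightarrow> pairing \<beta>0 f h = pairing \<beta>0 f h2" for h h2
  proof -
    have hm [measurable]: "h \<in> borel_measurable lebesgue" "h2 \<in> borel_measurable lebesgue" using h h2 by (auto simp: T')
    define d where "d z = h z - h2 z" for z
    have dm [measurable]: "d \<in> borel_measurable lebesgue" unfolding d_def by measurable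
    obtain w :: "'a \<times> real \<Rightarrow> real" where w: "w \<in> borel_measurable borel" "\<And>z. z \<in> upper_half \<Longrightarrow> w z > 0"
      "\<And>z. z \<notin> upper_half \<Longrightarrow> w z = 0" "TN p q r (\<lambda>z. ennreal (w z)) < top"
      using positive_weight_exists[OF pqr, where ?'a='a] by blast
    have w0: "0 \<le> w z" for z using w(2)[of z] w(3)[of z] by (cases "z \<in> upper_half") auto
    have wm [measurable]: "w \<in> borel_measurable lebesgue" by (rule borel_measurable_lebesgueI[OF w(1)])
    \<comment> \<open>Aligning the positive weight with the difference d makes the pairing the
      integral of |d| against a strictly positive density on the half space. Its vanishing forces d
      = 0 almost everywhere there.\<close>
    define f where "f = aligned \<beta> w d"
    have fT: "f \<in> T" unfolding f_def by (rule aligned_T(1)[OF w(1) w0 w(4) dm])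
    have pd: "pairing_kernel \<beta>0 f d = (\<lambda>z. pairing_kernel \<beta>0 f h z - pairing_kernel \<beta>0 f h2 z)"
      by (simp add: fun_eq_iff pairing_kernel_def d_def algebra_simps)
    have fm: "f \<in> borel_measurable lebesgue" using fT by (simp add: T)
    have i: "integrable lebesgue (pairing_kernel \<beta>0 f h)" "integrable lebesgue (pairing_kernel \<beta>0 f h2)"
      using pairing_bound(1)[OF fm _ fin[OF fT]] hm h h2 by auto
    have "pairing \<beta>0 f d = pairing \<beta>0 f h - pairing \<beta>0 f h2"
      unfolding pairing_eq_integral_kernel pd using i by (rule Bochner_Integration.integral_diff)
    then have zero: "pairing \<beta>0 f d = 0" using eq[OF fT] by simp
    have "integrable lebesgue (pairing_kernel \<beta>0 f d)" unfolding pd using i by (rule Bochner_Integration.integrable_diff)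
    then have "(\<integral>\<^sup>+z. ennreal (norm (pairing_kernel \<beta>0 f d z)) \<partial>lebesgue) < top" by (simp add: integrable_iff_bounded)
    from pairing_aligned[OF wm w0 dm this[unfolded f_def]]
    have "(\<integral>\<^sup>+z\<in>upper_half. ennreal (w z) * weighted (\<beta>0 - \<beta>) d z * ennreal (1 / snd z) \<partial>lebesgue) = 0"
      using zero by (simp add: f_def nn_integral_completion)
    moreover have "(\<lambda>z. ennreal (w z) * weighted (\<beta>0 - \<beta>) d z * ennreal (1 / snd z) * indicator upper_half z) \<in> borel_measurable lebesgue"
      by (intro borel_measurable_times_ennreal weighted_measurable dm borel_measurable_indicator lebesgue_upper_half) measurable
    ultimately have "AE z in lebesgue. ennreal (w z) * weighted (\<beta>0 - \<beta>) d z * ennreal (1 / snd z) * indicator upper_half z = 0"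
      by (subst (asm) nn_integral_0_iff_AE)
    then show ?thesis
    proof (elim eventually_mono, intro impI)
      fix z :: "'a \<times> real"
      assume 0: "ennreal (w z) * weighted (\<beta>0 - \<beta>) d z * ennreal (1 / snd z) * indicator upper_half z = 0" and z: "z \<in> upper_half"
      have s: "snd z > 0" using z by (simp add: upper_half_def)
      have "ennreal (w z) \<noteq> 0" using w(2)[OF z] by (simp add: ennreal_eq_0_iff)
      moreover have "ennreal (1 / snd z) \<noteq> 0" using s by (simp add: ennreal_eq_0_iff not_le)
      ultimately have "weighted (\<beta>0 - \<beta>) d z = 0" using 0 z by simp
      then have "cmod (d z) * snd z powr (- (\<beta>0 - \<beta>)) \<le> 0" by (simp only: weighted_def ennreal_eq_0_iff)
      moreover have "snd z powr (- (\<beta>0 - \<beta>)) > 0" using s by simp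
      ultimately have "cmod (d z) \<le> 0" by (simp only: mult_le_0_iff) auto
      then show "h2 z = h z" by (simp add: d_def)
    qed
  qed
  have represent: "\<exists>h\<in>T'. \<forall>f\<in>T. L f = pairing \<beta>0 f h"
    if add: "\<And>f g. f \<in> T \<Longrightarrow> g \<in> T \<Longrightarrow> L (\<lambda>z. f z + g z) = L f + L g"
      and mult: "\<And>f a. f \<in> T \<Longrightarrow> L (\<lambda>z. a * f z) = a * L f"
      and bd: "\<And>f. f \<in> T \<Longrightarrow> ennreal (cmod (L f)) \<le> ennreal C * nT f"
    for L :: "('a \<times> real \<Rightarrow> complex) \<Rightarrow> complex" and C
  proof -
    have T_eq: "T = {f. f \<in> borel_measurable lebesgue \<and> TN p q r (weighted \<beta> f) < top}" using T by auto
    have "\<exists>h\<in>borel_measurable lebesgue. \<forall>f\<in>T. integrable lebesgue (pairing_kernel \<beta>0 f h) \<and> L f = pairing \<beta>0 f h"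
      unfolding T_eq
    proof (rule representation[OF pqr])
      show "ennreal (cmod (L f)) \<le> ennreal C * TN p q r (weighted \<beta> f)" if "f \<in> {f. f \<in> borel_measurable lebesgue \<and> TN p q r (weighted \<beta> f) < top}" for f
        using bd[of f] that unfolding T_eq nT .
    qed (use add mult in \<open>simp_all only: T_eq\<close>)
    then obtain h where hm: "h \<in> borel_measurable lebesgue" and h: "\<And>f. f \<in> T \<Longrightarrow> integrable lebesgue (pairing_kernel \<beta>0 f h)" "\<And>f. f \<in> T \<Longrightarrow> L f = pairing \<beta>0 f h"
      by blast
    \<comment> \<open>Here h enters the dual space: the bound on L controls every aligned test,
      hence \<open>dual_sup\<close>, and the lower bound, valid for merely measurable functions,
      converts this into a finite dual norm.\<close>
    have "dual_sup p q r (weighted (\<beta>0 - \<beta>) h) \<le> ennreal C"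
      unfolding dual_sup_def
    proof (rule SUP_least)
      fix F :: "'a \<times> real \<Rightarrow> real"
      assume "F \<in> {F. F \<in> borel_measurable borel \<and> (\<forall>z. 0 \<le> F z) \<and> TN p q r (\<lambda>z. ennreal (F z)) \<le> 1}"
      then have F: "F \<in> borel_measurable borel" "\<And>z. 0 \<le> F z" "TN p q r (\<lambda>z. ennreal (F z)) \<le> 1" by auto
      have F': "TN p q r (\<lambda>z. ennreal (F z)) < top" using F(3) by (rule le_less_trans) simp
      note al = aligned_T[OF F(1,2) F' hm]
      have fin': "(\<integral>\<^sup>+z. ennreal (norm (pairing_kernel \<beta>0 (aligned \<beta> F h) h z)) \<partial>lebesgue) < top"
        using h(1)[OF al(1)] by (simp add: integrable_iff_bounded)
      have "(\<integral>\<^sup>+z\<in>upper_half. ennreal (F z) * weighted (\<beta>0 - \<beta>) h z * ennreal (1 / snd z) \<partial>lborel) = ennreal (cmod (L (aligned \<beta> F h)))"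
        unfolding h(2)[OF al(1)]
        by (rule pairing_aligned[symmetric, OF borel_measurable_lebesgueI[OF F(1)] F(2) hm fin'])
      also have "\<dots> \<le> ennreal C * nT (aligned \<beta> F h)" by (rule bd[OF al(1)])
      also have "\<dots> \<le> ennreal C * 1" unfolding nT by (intro mult_left_mono order_trans[OF al(2) F(3)]) simp
      finally show "(\<integral>\<^sup>+z\<in>upper_half. ennreal (F z) * weighted (\<beta>0 - \<beta>) h z * ennreal (1 / snd z) \<partial>lborel) \<le> ennreal C" by simp
    qed
    then have "ennreal C2 * dual_sup p q r (weighted (\<beta>0 - \<beta>) h) \<le> ennreal C2 * ennreal C" by (rule mult_left_mono) simp
    with C2(2)[OF weighted_measurable[OF hm]] have "dual_norm p q r (weighted (\<beta>0 - \<beta>) h) \<le> ennreal C2 * ennreal C" by (rule order_trans)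
    also have "\<dots> < top" by (simp add: ennreal_mult_less_top)
    finally have "h \<in> T'" using hm by (simp add: T')
    then show ?thesis using h(2) by blast
  qed
  show ?thesis
  proof (intro conjI allI impI)
    show "\<exists>c C :: real. 0 < c \<and> 0 < C \<and>
        (\<forall>h\<in>T'. (\<forall>f\<in>T. pairing_integrable \<beta>0 f h \<and>
                          ennreal (cmod (pairing \<beta>0 f h)) \<le> ennreal C * nT' h * nT f)
               \<and> ennreal c * nT' h \<le> (SUP f\<in>{f\<in>T. nT f \<le> 1}. ennreal (cmod (pairing \<beta>0 f h))))"
      using C1(1) C2(1) bounded lower by (intro exI[of _ "1 / C2"] exI[of _ C1] conjI ballI) auto
  next
    fix L :: "('a \<times> real \<Rightarrow> complex) \<Rightarrow> complex"
    assume L: "(\<forall>f\<in>T. \<forall>g\<in>T. L (\<lambda>z. f z + g z) = L f + L g) \<and>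
        (\<forall>f\<in>T. \<forall>a. L (\<lambda>z. a * f z) = a * L f) \<and>
        (\<exists>C :: real. \<forall>f\<in>T. ennreal (cmod (L f)) \<le> ennreal C * nT f)"
    then obtain C where C: "\<And>f. f \<in> T \<Longrightarrow> ennreal (cmod (L f)) \<le> ennreal C * nT f" by blast
    have "\<exists>h\<in>T'. \<forall>f\<in>T. L f = pairing \<beta>0 f h"
      by (rule represent[of L C]) (use L C in blast)+
    then obtain h where h: "h \<in> T'" "\<forall>f\<in>T. L f = pairing \<beta>0 f h" by blast
    have "AE z in lebesgue. z \<in> upper_half \<longrightarrow> h2 z = h z" if "h2 \<in> T'" "\<forall>f\<in>T. L f = pairing \<beta>0 f h2" for h2
      using h that by (intro unique) auto
    then show "\<exists>h\<in>T'. (\<forall>f\<in>T. L f = pairing \<beta>0 f h) \<and>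
           (\<forall>h2\<in>T'. (\<forall>f\<in>T. L f = pairing \<beta>0 f h2) \<longrightarrow>
              (AE z in lebesgue. z \<in> upper_half \<longrightarrow> h2 z = h z))"
      using h by blast
  qed
qed

end
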